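(* Let $R$ be a commutative noetherian ring, let $\mathsf T$ be an $R$-linear compactly generated triangulated category with a finite generating sequence $\mathcal G$, and assume that $\mathsf T$ is $\mathcal G$-quasiapproximable. Assume that $\mathrm{Hom}_{\mathsf T}(G,G')$ is a finitely generated $R$-module for all $G,G'\in\bigcup_{n\in\mathbb Z}\mathcal G^n$. Let $\mathcal Y|_{\mathsf T^b_c}:\mathsf T^b_c\to\mathrm{Hom}([\mathsf T^c]^{\mathrm{op}},\mathrm{Mod}(R))$ be the functor taking $F\in\mathsf T^b_c$ to $\mathrm{Hom}_{\mathsf T}(-,F)|_{\mathsf T^c}$. Then: (1) the essential image of $\mathcal Y|_{\mathsf T^b_c}$ consists exactly of the $\mathcal G$-finite $\mathsf T^c$-cohomological functors; (2) $\mathcal Y|_{\mathsf T^b_c}$ is fully faithful.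
   Context: Conventions. $\Sigma$ is the shift; compactly generated triangulated categories have small coproducts; $\mathsf T^c$ is the full subcategory of compact objects. $\mathsf A\star\mathsf C$ is the full subcategory of objects $B$ in a triangle $A\to B\to C\to\Sigma A$, $A\in\mathsf A$, $C\in\mathsf C$. $\mathsf A^\perp=\{t:\mathrm{Hom}(a,t)=0\ \forall a\in\mathsf A\}$, ${}^\perp\mathsf A=\{t:\mathrm{Hom}(t,a)=0\ \forall a\in\mathsf A\}$. For a class $U$ of objects: $\mathrm{smd}$ = closure under summands; $\mathrm{coprod}(U)$ = closure under finite direct sums and extensions; $\mathrm{Coprod}_1(U)$ = closure under small coproducts, $\mathrm{Coprod}_{n+1}(U)=\mathrm{Coprod}_1(U)\star\mathrm{Coprod}_n(U)$. An orthogonal metric on $\mathsf T$ is a sequence $\mathcal R=\{\mathcal R_n\}_{n\in\mathbb Z}$ of strictly full subcategories containing $0$ with $\mathcal R_n\star\mathcal R_n\subseteq\mathcal R_n$, $\Sigma^{-1}\mathcal R_{n+1}\cup\mathcal R_{n+1}\cup\Sigma\mathcal R_{n+1}\subseteq\mathcal R_n$ and ${}^\perp(\mathcal R_n^\perp)=\mathcal R_n$ for all $n$. A generating sequence is a sequence $\mathcal G=\{\mathcal G^i\}_{i\in\mathbb Z}$ of full subcategories of $\mathsf T^c$ such that $\mathrm{smd}(\mathrm{coprod}(\bigcup_i\mathcal G^i))=\mathsf T^c$ and $\Sigma^{-1}\mathcal G^n\cup\mathcal G^n\cup\Sigma\mathcal G^n\subseteq\mathcal G^{[n-1,n+1]}$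 for all $n$, where $\mathcal G^{[i,j]}=\mathrm{smd}(\mathrm{coprod}(\bigcup_{i\le n\le j}\mathcal G^n))$. It is finite if each $\mathcal G^i$ has only finitely many objects. Put $\mathcal M^{\mathcal G}_n=\mathcal G^{(-\infty,-n]}=\mathrm{smd}(\mathrm{coprod}(\bigcup_{m\le -n}\mathcal G^m))$, $\mathcal R^{\mathcal G}_n={}^\perp((\mathcal M^{\mathcal G}_n)^\perp)$ (orthogonals in $\mathsf T$), and $\overline{\mathcal G}^{[i,j]}_m=\mathrm{smd}(\mathrm{Coprod}_m(\bigcup_{i\le n\le j}\mathcal G^n))$. The closure of the compacts with respect to an orthogonal metric $\mathcal R$ is $\bigcap_{n\in\mathbb Z}(\mathsf T^c\star\mathcal R_n)$. Let $\overline{\mathsf T^c}$ be the closure with respect to $\mathcal R^{\mathcal G}$, and $\mathsf T^b_c=\overline{\mathsf T^c}\cap\bigcup_{n\in\mathbb Z}(\mathcal M^{\mathcal G}_n)^\perp$ (orthogonals in $\mathsf T$). $\mathsf T$ is $\mathcal G$-quasiapproximable if there are an orthogonal metric $\mathcal R$ and an integer $A>0$ such that: (0) $\mathcal M^{\mathcal G}_i\subseteq\bigcup_{|n|\le A}\Sigma^n\mathcal M^{\mathcal G}_{i+1}$ for all $i$; (1) $\mathcal M^{\mathcal G}_{i+A}\subseteq\mathcal R_i$ for all $i$; (2) $\mathrm{Hom}_{\mathsf T}(\mathcal G^n,\mathcal R_i)=0$ whenever $n+i\ge A$; (3) writing $\mathsf C$ for the closure of the compacts with respect to $\mathcal R$,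 for all $i\in\mathbb Z$ every $F\in\mathcal R_i\cap\mathsf C$ admits a triangle $E\to F\to D\to\Sigma E$ with $D\in\mathcal R_{i+1}\cap\mathsf C$ and $E\in\overline{\mathcal G}^{[-A-i,A-i]}_A$. A $\mathsf T^c$-cohomological functor is an ($R$-linear) functor $H:[\mathsf T^c]^{\mathrm{op}}\to\mathrm{Mod}(R)$ taking triangles to long exact sequences. It is $\mathcal G$-finite if $H(F)$ is a finitely generated $R$-module for all $F\in\mathsf T^c$ and $H(\mathcal G^i)=0$ for all $|i|\gg0$. *)

theory Defs
  imports "HOL-Algebra.Ring_Divisibility" "HOL-Algebra.Module"
begin

unbundle cardinal_syntax

section \<open>Smallness\<close>

text \<open>
  Sizes are measured by an uncountable regular cardinal \<open>\<kappa>\<close>; a set is small if it has fewer than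
  \<open>\<kappa>\<close> elements. The sets belonging to a Grothendieck universe are the special case in which
  \<open>\<kappa>\<close> is in addition a strong limit; this is not required, so that \<open>\<kappa>\<close> can already be found inside HOL.
  Every small set is in bijection with a subset of the type \<open>'u\<close> underlying \<open>\<kappa>\<close>, which is why small
  index sets are taken to be of type \<open>'u set\<close>.
\<close>

definition regular_uncountable :: "'u rel \<Rightarrow> bool" where
  "regular_uncountable \<kappa> \<longleftrightarrow> Card_order \<kappa> \<and> regularCard \<kappa> \<and> natLeq <o \<kappa>"

definition small :: "'u rel \<Rightarrow> 'a set \<Rightarrow> bool" where
  "small \<kappa> A \<longleftrightarrow> |A| <o \<kappa>"


section \<open>Linear categories\<close>

text \<open>
  Parallel arrows are added by \<open>arr_add\<close>; \<open>arr_zero C X Y\<close> is the zero arrow from \<open>X\<close> to \<open>Y\<close>, and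
  \<open>arr_scale C r f\<close> is the action of the scalar \<open>r\<close>. Composition is in applicative order.
\<close>

record ('o, 'm, 'r) lin_category =
  obj :: "'o set"
  arr :: "'m set"
  src :: "'m \<Rightarrow> 'o"
  tgt :: "'m \<Rightarrow> 'o"
  ide :: "'o \<Rightarrow> 'm"
  comp :: "'m \<Rightarrow> 'm \<Rightarrow> 'm"  (infixl \<open>\<cdot>\<index>\<close> 70)
  arr_add :: "'m \<Rightarrow> 'm \<Rightarrow> 'm"
  arr_zero :: "'o \<Rightarrow> 'o \<Rightarrow> 'm"
  arr_scale :: "'r \<Rightarrow> 'm \<Rightarrow> 'm"

definition Hom :: "('o, 'm, 'r, 'e) lin_category_scheme \<Rightarrow> 'o \<Rightarrow> 'o \<Rightarrow> 'm set" where
  "Hom C X Y = {f \<in> arr C. src C f = X \<and> tgt C f = Y}"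

definition Hom_mod ::
    "('o, 'm, 'r, 'e) lin_category_scheme \<Rightarrow> 'o \<Rightarrow> 'o \<Rightarrow> ('r, 'm) module" where
  "Hom_mod C X Y =
     \<lparr>carrier = Hom C X Y, mult = (\<lambda>_ _. undefined), one = undefined,
      zero = arr_zero C X Y, add = arr_add C, smult = arr_scale C\<rparr>"

locale R_linear_category =
  fixes R :: "('r, 'a) ring_scheme" and C :: "('o, 'm, 'r, 'e) lin_category_scheme" (structure)
  assumes src_tgt: "f \<in> arr C \<Longrightarrow> src C f \<in> obj C \<and> tgt C f \<in> obj C"
    and ide: "X \<in> obj C \<Longrightarrow> ide C X \<in> Hom C X X"
    and comp_closed: "\<lbrakk>f \<in> Hom C X Y; g \<in> Hom C Y Z\<rbrakk> \<Longrightarrow> g \<cdot> f \<in> Hom C X Z"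
    and comp_assoc:
      "\<lbrakk>f \<in> Hom C W X; g \<in> Hom C X Y; h \<in> Hom C Y Z\<rbrakk> \<Longrightarrow> (h \<cdot> g) \<cdot> f = h \<cdot> (g \<cdot> f)"
    and comp_ide: "f \<in> Hom C X Y \<Longrightarrow> f \<cdot> ide C X = f \<and> ide C Y \<cdot> f = f"
    and Hom_module: "\<lbrakk>X \<in> obj C; Y \<in> obj C\<rbrakk> \<Longrightarrow> module R (Hom_mod C X Y)"
    and comp_add_right:
      "\<lbrakk>f \<in> Hom C X Y; f' \<in> Hom C X Y; g \<in> Hom C Y Z\<rbrakk> \<Longrightarrow>
        g \<cdot> arr_add C f f' = arr_add C (g \<cdot> f) (g \<cdot> f')"
    and comp_add_left:
      "\<lbrakk>f \<in> Hom C X Y; g \<in> Hom C Y Z; g' \<in> Hom C Y Z\<rbrakk> \<Longrightarrow>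
        arr_add C g g' \<cdot> f = arr_add C (g \<cdot> f) (g' \<cdot> f)"
    and comp_scale_right:
      "\<lbrakk>r \<in> carrier R; f \<in> Hom C X Y; g \<in> Hom C Y Z\<rbrakk> \<Longrightarrow>
        g \<cdot> arr_scale C r f = arr_scale C r (g \<cdot> f)"
    and comp_scale_left:
      "\<lbrakk>r \<in> carrier R; f \<in> Hom C X Y; g \<in> Hom C Y Z\<rbrakk> \<Longrightarrow>
        arr_scale C r g \<cdot> f = arr_scale C r (g \<cdot> f)"

definition iso_arr :: "('o, 'm, 'r, 'e) lin_category_scheme \<Rightarrow> 'm \<Rightarrow> 'o \<Rightarrow> 'o \<Rightarrow> bool" where
  "iso_arr C f X Y \<longleftrightarrow> f \<in> Hom C X Y \<and>
     (\<exists>g \<in> Hom C Y X. g \<cdot>\<^bsub>C\<^esub> f = ide C X \<and> f \<cdot>\<^bsub>C\<^esub> g = ide C Y)"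

definition isomorphic :: "('o, 'm, 'r, 'e) lin_category_scheme \<Rightarrow> 'o \<Rightarrow> 'o \<Rightarrow> bool" where
  "isomorphic C X Y \<longleftrightarrow> (\<exists>f. iso_arr C f X Y)"

definition is_zero :: "('o, 'm, 'r, 'e) lin_category_scheme \<Rightarrow> 'o \<Rightarrow> bool" where
  "is_zero C Z \<longleftrightarrow> Z \<in> obj C \<and> ide C Z = arr_zero C Z Z"

definition is_direct_sum ::
    "('o, 'm, 'r, 'e) lin_category_scheme \<Rightarrow> 'o \<Rightarrow> 'o \<Rightarrow> 'o \<Rightarrow> bool" where
  "is_direct_sum C X Y S \<longleftrightarrow>
     (\<exists>i \<in> Hom C X S. \<exists>j \<in> Hom C Y S. \<exists>p \<in> Hom C S X. \<exists>q \<in> Hom C S Y.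
        p \<cdot>\<^bsub>C\<^esub> i = ide C X \<and> q \<cdot>\<^bsub>C\<^esub> j = ide C Y \<and>
        q \<cdot>\<^bsub>C\<^esub> i = arr_zero C X Y \<and> p \<cdot>\<^bsub>C\<^esub> j = arr_zero C Y X \<and>
        arr_add C (i \<cdot>\<^bsub>C\<^esub> p) (j \<cdot>\<^bsub>C\<^esub> q) = ide C S)"

definition is_coproduct ::
    "('o, 'm, 'r, 'e) lin_category_scheme \<Rightarrow> 'i set \<Rightarrow> ('i \<Rightarrow> 'o) \<Rightarrow> 'o \<Rightarrow> ('i \<Rightarrow> 'm) \<Rightarrow> bool" where
  "is_coproduct C I X S \<iota> \<longleftrightarrow> S \<in> obj C \<and> (\<forall>i\<in>I. \<iota> i \<in> Hom C (X i) S) \<and>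
     (\<forall>Y \<in> obj C. \<forall>f. (\<forall>i\<in>I. f i \<in> Hom C (X i) Y) \<longrightarrow>
        (\<exists>!h. h \<in> Hom C S Y \<and> (\<forall>i\<in>I. h \<cdot>\<^bsub>C\<^esub> \<iota> i = f i)))"

text \<open>\<open>c\<close> is compact if the canonical map from the direct sum of the \<open>Hom(c, X\<^sub>i)\<close>, realised as the
  families of finite support, to \<open>Hom(c, \<Coprod> X\<^sub>i)\<close> is bijective for all small families.\<close>

definition compacts :: "'u rel \<Rightarrow> ('o, 'm, 'r, 'e) lin_category_scheme \<Rightarrow> 'o set" where
  "compacts \<kappa> C = {c \<in> obj C.
     \<forall>(I::'u set) X S \<iota>. small \<kappa> I \<and> (\<forall>i\<in>I. X i \<in> obj C) \<and> is_coproduct C I X S \<iota> \<longrightarrow>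
       bij_betw
         (\<lambda>\<phi>. finsum (Hom_mod C c S) (\<lambda>i. \<iota> i \<cdot>\<^bsub>C\<^esub> \<phi> i) {i \<in> I. \<phi> i \<noteq> arr_zero C c (X i)})
         {\<phi> \<in> (\<Pi>\<^sub>E i\<in>I. Hom C c (X i)). finite {i \<in> I. \<phi> i \<noteq> arr_zero C c (X i)}}
         (Hom C c S)}"

definition has_small_coproducts :: "'u rel \<Rightarrow> ('o, 'm, 'r, 'e) lin_category_scheme \<Rightarrow> bool" where
  "has_small_coproducts \<kappa> C \<longleftrightarrow>
     (\<forall>(I::'u set) X. small \<kappa> I \<and> (\<forall>i\<in>I. X i \<in> obj C) \<longrightarrow> (\<exists>S \<iota>. is_coproduct C I X S \<iota>))"


section \<open>Triangulated categories\<close>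

text \<open>The shift is an automorphism with action \<open>susp\<close> on objects and \<open>susp_arr\<close> on arrows. A triangle
  \<open>X \<rightarrow> Y \<rightarrow> Z \<rightarrow> \<Sigma>X\<close> is given by its three arrows.\<close>

record ('o, 'm, 'r) tri_category = "('o, 'm, 'r) lin_category" +
  susp :: "'o \<Rightarrow> 'o"
  susp_arr :: "'m \<Rightarrow> 'm"
  triangles :: "('m \<times> 'm \<times> 'm) set"

definition candidate_triangle ::
    "('o, 'm, 'r, 'e) tri_category_scheme \<Rightarrow> 'o \<Rightarrow> 'o \<Rightarrow> 'o \<Rightarrow> 'm \<Rightarrow> 'm \<Rightarrow> 'm \<Rightarrow> bool" where
  "candidate_triangle T X Y Z f g h \<longleftrightarrow>
     f \<in> Hom T X Y \<and> g \<in> Hom T Y Z \<and> h \<in> Hom T Z (susp T X)"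

definition triangle ::
    "('o, 'm, 'r, 'e) tri_category_scheme \<Rightarrow> 'o \<Rightarrow> 'o \<Rightarrow> 'o \<Rightarrow> 'm \<Rightarrow> 'm \<Rightarrow> 'm \<Rightarrow> bool" where
  "triangle T X Y Z f g h \<longleftrightarrow> candidate_triangle T X Y Z f g h \<and> (f, g, h) \<in> triangles T"

locale R_linear_triangulated_category = R_linear_category R T
  for R :: "('r, 'a) ring_scheme" and T :: "('o, 'm, 'r, 'e) tri_category_scheme" (structure) +
  assumes zero_object: "\<exists>Z. is_zero T Z"
    and direct_sums: "\<lbrakk>X \<in> obj T; Y \<in> obj T\<rbrakk> \<Longrightarrow> \<exists>S. is_direct_sum T X Y S"
    and susp_bij: "bij_betw (susp T) (obj T) (obj T)"
    and susp_arr_bij: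
      "\<lbrakk>X \<in> obj T; Y \<in> obj T\<rbrakk> \<Longrightarrow>
        bij_betw (susp_arr T) (Hom T X Y) (Hom T (susp T X) (susp T Y))"
    and susp_ide: "X \<in> obj T \<Longrightarrow> susp_arr T (ide T X) = ide T (susp T X)"
    and susp_comp:
      "\<lbrakk>f \<in> Hom T X Y; g \<in> Hom T Y Z\<rbrakk> \<Longrightarrow> susp_arr T (g \<cdot> f) = susp_arr T g \<cdot> susp_arr T f"
    and susp_add:
      "\<lbrakk>f \<in> Hom T X Y; g \<in> Hom T X Y\<rbrakk> \<Longrightarrow>
        susp_arr T (arr_add T f g) = arr_add T (susp_arr T f) (susp_arr T g)"
    and susp_scale:
      "\<lbrakk>r \<in> carrier R; f \<in> Hom T X Y\<rbrakk> \<Longrightarrow>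
        susp_arr T (arr_scale T r f) = arr_scale T r (susp_arr T f)"
    and triangle_iso:
      "\<lbrakk>triangle T X Y Z f g h; candidate_triangle T X' Y' Z' f' g' h';
        iso_arr T a X X'; iso_arr T b Y Y'; iso_arr T c Z Z';
        f' \<cdot> a = b \<cdot> f; g' \<cdot> b = c \<cdot> g; h' \<cdot> c = susp_arr T a \<cdot> h\<rbrakk> \<Longrightarrow>
        triangle T X' Y' Z' f' g' h'"
    and triangle_ide:
      "\<lbrakk>X \<in> obj T; is_zero T Z\<rbrakk> \<Longrightarrow>
        triangle T X X Z (ide T X) (arr_zero T X Z) (arr_zero T Z (susp T X))"
    and triangle_exists: "f \<in> Hom T X Y \<Longrightarrow> \<exists>Z g h. triangle T X Y Z f g h"
    and triangle_rotate:
      "candidate_triangle T X Y Z f g h \<Longrightarrow>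
        triangle T X Y Z f g h \<longleftrightarrow>
        triangle T Y Z (susp T X) g h (\<ominus>\<^bsub>Hom_mod T (susp T X) (susp T Y)\<^esub> susp_arr T f)"
    and triangle_map:
      "\<lbrakk>triangle T X Y Z f g h; triangle T X' Y' Z' f' g' h';
        a \<in> Hom T X X'; b \<in> Hom T Y Y'; f' \<cdot> a = b \<cdot> f\<rbrakk> \<Longrightarrow>
        \<exists>c \<in> Hom T Z Z'. g' \<cdot> b = c \<cdot> g \<and> h' \<cdot> c = susp_arr T a \<cdot> h"
    and octahedral:
      "\<lbrakk>triangle T X Y Z' f f' f''; triangle T Y Z X' g g' g'';
        triangle T X Z Y' (g \<cdot> f) k' k''\<rbrakk> \<Longrightarrow>
        \<exists>u v. triangle T Z' Y' X' u v (susp_arr T f' \<cdot> g'') \<and>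
              u \<cdot> f' = k' \<cdot> g \<and> k'' \<cdot> u = f'' \<and> v \<cdot> k' = g' \<and> g'' \<cdot> v = susp_arr T f \<cdot> k''"

definition shift :: "('o, 'm, 'r, 'e) tri_category_scheme \<Rightarrow> int \<Rightarrow> 'o \<Rightarrow> 'o" where
  "shift T n X = (if n \<ge> 0 then (susp T ^^ nat n) X
                  else (inv_into (obj T) (susp T) ^^ nat (- n)) X)"

definition shift_arr :: "('o, 'm, 'r, 'e) tri_category_scheme \<Rightarrow> int \<Rightarrow> 'm \<Rightarrow> 'm" where
  "shift_arr T n f = (if n \<ge> 0 then (susp_arr T ^^ nat n) f
                      else (inv_into (arr T) (susp_arr T) ^^ nat (- n)) f)"

text \<open>Arrows out of compact objects are required to form small sets; this is implied by local smallness
  of the category.\<close>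

definition compactly_generated :: "'u rel \<Rightarrow> ('o, 'm, 'r, 'e) tri_category_scheme \<Rightarrow> bool" where
  "compactly_generated \<kappa> T \<longleftrightarrow>
     has_small_coproducts \<kappa> T \<and>
     (\<forall>c \<in> compacts \<kappa> T. \<forall>X \<in> obj T. small \<kappa> (Hom T c X)) \<and>
     (\<exists>S \<subseteq> compacts \<kappa> T. small \<kappa> S \<and>
        (\<forall>X \<in> obj T. (\<forall>s\<in>S. \<forall>n. Hom T (shift T n s) X = {arr_zero T (shift T n s) X}) \<longrightarrow>
           is_zero T X))"


section \<open>Classes of objects\<close>

text \<open>Full subcategories are identified with their sets of objects.\<close>

definition strictly_full :: "('o, 'm, 'r, 'e) lin_category_scheme \<Rightarrow> 'o set \<Rightarrow> bool" where
  "strictly_full C U \<longleftrightarrow> U \<subseteq> obj C \<and> (\<forall>X\<in>U. \<forall>Y. isomorphic C X Y \<longrightarrow> Y \<in> U)"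

definition right_orth :: "('o, 'm, 'r, 'e) lin_category_scheme \<Rightarrow> 'o set \<Rightarrow> 'o set" where
  "right_orth C U = {t \<in> obj C. \<forall>u\<in>U. Hom C u t = {arr_zero C u t}}"

definition left_orth :: "('o, 'm, 'r, 'e) lin_category_scheme \<Rightarrow> 'o set \<Rightarrow> 'o set" where
  "left_orth C U = {t \<in> obj C. \<forall>u\<in>U. Hom C t u = {arr_zero C t u}}"

definition extensions ::
    "('o, 'm, 'r, 'e) tri_category_scheme \<Rightarrow> 'o set \<Rightarrow> 'o set \<Rightarrow> 'o set" where
  "extensions T U V = {B. \<exists>A\<in>U. \<exists>C\<in>V. \<exists>f g h. triangle T A B C f g h}"

definition smd :: "('o, 'm, 'r, 'e) lin_category_scheme \<Rightarrow> 'o set \<Rightarrow> 'o set" where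
  "smd C U = {X \<in> obj C. \<exists>Y \<in> obj C. \<exists>S \<in> U. is_direct_sum C X Y S}"

text \<open>The empty direct sum is included, so that \<open>coprod T U\<close> always contains the zero objects.\<close>

inductive_set coprod :: "('o, 'm, 'r, 'e) tri_category_scheme \<Rightarrow> 'o set \<Rightarrow> 'o set"
  for T :: "('o, 'm, 'r, 'e) tri_category_scheme" and U :: "'o set" where
  base: "X \<in> U \<Longrightarrow> X \<in> coprod T U"
| zero: "is_zero T Z \<Longrightarrow> Z \<in> coprod T U"
| sum: "\<lbrakk>X \<in> coprod T U; Y \<in> coprod T U; is_direct_sum T X Y S\<rbrakk> \<Longrightarrow> S \<in> coprod T U"
| ext: "\<lbrakk>A \<in> coprod T U; C \<in> coprod T U; triangle T A B C f g h\<rbrakk> \<Longrightarrow> B \<in> coprod T U"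

text \<open>A small coproduct of small coproducts is again one, so a single step closes \<open>U\<close> under small
  coproducts.\<close>

definition Coprod1 :: "'u rel \<Rightarrow> ('o, 'm, 'r, 'e) lin_category_scheme \<Rightarrow> 'o set \<Rightarrow> 'o set" where
  "Coprod1 \<kappa> C U =
     {S. \<exists>(I::'u set) X \<iota>. small \<kappa> I \<and> (\<forall>i\<in>I. X i \<in> U) \<and> is_coproduct C I X S \<iota>}"

text \<open>The stages are indexed from \<open>1\<close>; the value at \<open>0\<close> is not used.\<close>

fun Coprod ::
    "'u rel \<Rightarrow> ('o, 'm, 'r, 'e) tri_category_scheme \<Rightarrow> nat \<Rightarrow> 'o set \<Rightarrow> 'o set" where
  "Coprod \<kappa> T 0 U = {Z. is_zero T Z}"
| "Coprod \<kappa> T (Suc 0) U = Coprod1 \<kappa> T U"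
| "Coprod \<kappa> T (Suc (Suc n)) U = extensions T (Coprod1 \<kappa> T U) (Coprod \<kappa> T (Suc n) U)"


section \<open>Metrics and generating sequences\<close>

definition orthogonal_metric ::
    "('o, 'm, 'r, 'e) tri_category_scheme \<Rightarrow> (int \<Rightarrow> 'o set) \<Rightarrow> bool" where
  "orthogonal_metric T \<R> \<longleftrightarrow>
     (\<forall>n. strictly_full T (\<R> n) \<and> {Z. is_zero T Z} \<subseteq> \<R> n \<and>
          extensions T (\<R> n) (\<R> n) \<subseteq> \<R> n \<and>
          shift T (-1) ` \<R> (n + 1) \<union> \<R> (n + 1) \<union> shift T 1 ` \<R> (n + 1) \<subseteq> \<R> n \<and>
          left_orth T (right_orth T (\<R> n)) = \<R> n)"

text \<open>The closure of the compacts with respect to \<open>\<R>\<close>.\<close>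

definition compact_closure ::
    "'u rel \<Rightarrow> ('o, 'm, 'r, 'e) tri_category_scheme \<Rightarrow> (int \<Rightarrow> 'o set) \<Rightarrow> 'o set" where
  "compact_closure \<kappa> T \<R> = (\<Inter>n. extensions T (compacts \<kappa> T) (\<R> n))"

text \<open>The class \<open>\<G>\<^sup>J\<close> for an interval \<open>J\<close> of integers, bounded or not.\<close>

definition gen_on ::
    "('o, 'm, 'r, 'e) tri_category_scheme \<Rightarrow> (int \<Rightarrow> 'o set) \<Rightarrow> int set \<Rightarrow> 'o set" where
  "gen_on T \<G> J = smd T (coprod T (\<Union>n\<in>J. \<G> n))"

definition generating_sequence ::
    "'u rel \<Rightarrow> ('o, 'm, 'r, 'e) tri_category_scheme \<Rightarrow> (int \<Rightarrow> 'o set) \<Rightarrow> bool" where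
  "generating_sequence \<kappa> T \<G> \<longleftrightarrow>
     (\<forall>n. \<G> n \<subseteq> compacts \<kappa> T) \<and> gen_on T \<G> UNIV = compacts \<kappa> T \<and>
     (\<forall>n. shift T (-1) ` \<G> n \<union> \<G> n \<union> shift T 1 ` \<G> n \<subseteq> gen_on T \<G> {n - 1..n + 1})"

definition gen_M ::
    "('o, 'm, 'r, 'e) tri_category_scheme \<Rightarrow> (int \<Rightarrow> 'o set) \<Rightarrow> int \<Rightarrow> 'o set" where
  "gen_M T \<G> n = gen_on T \<G> {..- n}"

definition gen_R ::
    "('o, 'm, 'r, 'e) tri_category_scheme \<Rightarrow> (int \<Rightarrow> 'o set) \<Rightarrow> int \<Rightarrow> 'o set" where
  "gen_R T \<G> n = left_orth T (right_orth T (gen_M T \<G> n))"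

definition gen_bar ::
    "'u rel \<Rightarrow> ('o, 'm, 'r, 'e) tri_category_scheme \<Rightarrow> (int \<Rightarrow> 'o set) \<Rightarrow> nat \<Rightarrow> int set \<Rightarrow> 'o set" where
  "gen_bar \<kappa> T \<G> m J = smd T (Coprod \<kappa> T m (\<Union>n\<in>J. \<G> n))"

text \<open>The category \<open>\<T>\<^sup>b\<^sub>c\<close>.\<close>

definition bounded_closure ::
    "'u rel \<Rightarrow> ('o, 'm, 'r, 'e) tri_category_scheme \<Rightarrow> (int \<Rightarrow> 'o set) \<Rightarrow> 'o set" where
  "bounded_closure \<kappa> T \<G> =
     compact_closure \<kappa> T (gen_R T \<G>) \<inter> (\<Union>n. right_orth T (gen_M T \<G> n))"

definition quasiapproximable ::
    "'u rel \<Rightarrow> ('o, 'm, 'r, 'e) tri_category_scheme \<Rightarrow> (int \<Rightarrow> 'o set) \<Rightarrow> bool" where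
  "quasiapproximable \<kappa> T \<G> \<longleftrightarrow>
     (\<exists>\<R> A. orthogonal_metric T \<R> \<and> A > 0 \<and>
        (\<forall>i. gen_M T \<G> i \<subseteq> (\<Union>n \<in> {- int A..int A}. shift T n ` gen_M T \<G> (i + 1))) \<and>
        (\<forall>i. gen_M T \<G> (i + int A) \<subseteq> \<R> i) \<and>
        (\<forall>n i. n + i \<ge> int A \<longrightarrow> (\<forall>X \<in> \<G> n. \<forall>Y \<in> \<R> i. Hom T X Y = {arr_zero T X Y})) \<and>
        (\<forall>i. \<forall>F \<in> \<R> i \<inter> compact_closure \<kappa> T \<R>.
           \<exists>E D f g h. triangle T E F D f g h \<and>
             D \<in> \<R> (i + 1) \<inter> compact_closure \<kappa> T \<R> \<and>
             E \<in> gen_bar \<kappa> T \<G> A {- int A - i..int A - i}))"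


section \<open>Functors to modules\<close>

definition linear_maps ::
    "('r, 'a) ring_scheme \<Rightarrow> ('r, 'x) module \<Rightarrow> ('r, 'y) module \<Rightarrow> ('x \<Rightarrow> 'y) set" where
  "linear_maps R M N =
     {h \<in> carrier M \<rightarrow> carrier N.
        (\<forall>x \<in> carrier M. \<forall>y \<in> carrier M. h (x \<oplus>\<^bsub>M\<^esub> y) = h x \<oplus>\<^bsub>N\<^esub> h y) \<and>
        (\<forall>r \<in> carrier R. \<forall>x \<in> carrier M. h (r \<odot>\<^bsub>M\<^esub> x) = r \<odot>\<^bsub>N\<^esub> h x)}"

definition exact_at :: "('r, 'x) module \<Rightarrow> ('x \<Rightarrow> 'x) \<Rightarrow> ('r, 'x) module \<Rightarrow> ('x \<Rightarrow> 'x) \<Rightarrow>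
    ('r, 'x) module \<Rightarrow> bool" where
  "exact_at K f L g M \<longleftrightarrow> f ` carrier K = {x \<in> carrier L. g x = \<zero>\<^bsub>M\<^esub>}"

definition finitely_generated :: "('r, 'a) ring_scheme \<Rightarrow> ('r, 'x) module \<Rightarrow> bool" where
  "finitely_generated R M \<longleftrightarrow>
     (\<exists>B \<subseteq> carrier M. finite B \<and> (\<forall>N. submodule N R M \<and> B \<subseteq> N \<longrightarrow> N = carrier M))"

record ('o, 'm, 'r, 'x) mod_functor =
  on_obj :: "'o \<Rightarrow> ('r, 'x) module"
  on_arr :: "'m \<Rightarrow> 'x \<Rightarrow> 'x"

text \<open>Contravariant \<open>R\<close>-linear functors to \<open>Mod(R)\<close> from the full subcategory with objects \<open>U\<close>. The
  values of the record outside this subcategory are irrelevant.\<close>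

locale linear_functor =
  fixes R :: "('r, 'a) ring_scheme"
    and C :: "('o, 'm, 'r, 'e) lin_category_scheme" (structure)
    and U :: "'o set"
    and H :: "('o, 'm, 'r, 'x) mod_functor"
  assumes obj_module: "X \<in> U \<Longrightarrow> module R (on_obj H X)"
    and arr_linear:
      "\<lbrakk>X \<in> U; Y \<in> U; f \<in> Hom C X Y\<rbrakk> \<Longrightarrow>
        on_arr H f \<in> linear_maps R (on_obj H Y) (on_obj H X)"
    and ide: "\<lbrakk>X \<in> U; x \<in> carrier (on_obj H X)\<rbrakk> \<Longrightarrow> on_arr H (ide C X) x = x"
    and comp:
      "\<lbrakk>X \<in> U; Y \<in> U; Z \<in> U; f \<in> Hom C X Y; g \<in> Hom C Y Z; x \<in> carrier (on_obj H Z)\<rbrakk> \<Longrightarrow>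
        on_arr H (g \<cdot> f) x = on_arr H f (on_arr H g x)"
    and add:
      "\<lbrakk>X \<in> U; Y \<in> U; f \<in> Hom C X Y; g \<in> Hom C X Y; x \<in> carrier (on_obj H Y)\<rbrakk> \<Longrightarrow>
        on_arr H (arr_add C f g) x = on_arr H f x \<oplus>\<^bsub>on_obj H X\<^esub> on_arr H g x"
    and scale:
      "\<lbrakk>X \<in> U; Y \<in> U; r \<in> carrier R; f \<in> Hom C X Y; x \<in> carrier (on_obj H Y)\<rbrakk> \<Longrightarrow>
        on_arr H (arr_scale C r f) x = r \<odot>\<^bsub>on_obj H X\<^esub> on_arr H f x"

text \<open>
  A triangle \<open>X \<rightarrow> Y \<rightarrow> Z \<rightarrow> \<Sigma>X\<close> of objects of \<open>U\<close>, with arrows \<open>f, g, h\<close>, is sent to the sequence of all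
  \<open>\<dots> \<rightarrow> H(\<Sigma>\<^sup>n\<^sup>+\<^sup>1X) \<rightarrow> H(\<Sigma>\<^sup>nZ) \<rightarrow> H(\<Sigma>\<^sup>nY) \<rightarrow> H(\<Sigma>\<^sup>nX) \<rightarrow> H(\<Sigma>\<^sup>n\<^sup>-\<^sup>1Z) \<rightarrow> \<dots>\<close>
\<close>

definition cohomological_functor ::
    "('r, 'a) ring_scheme \<Rightarrow> ('o, 'm, 'r, 'e) tri_category_scheme \<Rightarrow> 'o set \<Rightarrow>
     ('o, 'm, 'r, 'x) mod_functor \<Rightarrow> bool" where
  "cohomological_functor R T U H \<longleftrightarrow> linear_functor R T U H \<and>
     (\<forall>X\<in>U. \<forall>Y\<in>U. \<forall>Z\<in>U. \<forall>f g h. triangle T X Y Z f g h \<longrightarrow>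
       (\<forall>n. exact_at (on_obj H (shift T (n + 1) X)) (on_arr H (shift_arr T n h))
                      (on_obj H (shift T n Z)) (on_arr H (shift_arr T n g))
                      (on_obj H (shift T n Y)) \<and>
            exact_at (on_obj H (shift T n Z)) (on_arr H (shift_arr T n g))
                      (on_obj H (shift T n Y)) (on_arr H (shift_arr T n f))
                      (on_obj H (shift T n X)) \<and>
            exact_at (on_obj H (shift T n Y)) (on_arr H (shift_arr T n f))
                      (on_obj H (shift T n X)) (on_arr H (shift_arr T (n - 1) h))
                      (on_obj H (shift T (n - 1) Z))))"

definition G_finite ::
    "('r, 'a) ring_scheme \<Rightarrow> 'u rel \<Rightarrow> ('o, 'm, 'r, 'e) tri_category_scheme \<Rightarrow>
     (int \<Rightarrow> 'o set) \<Rightarrow> ('o, 'm, 'r, 'x) mod_functor \<Rightarrow> bool" where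
  "G_finite R \<kappa> T \<G> H \<longleftrightarrow>
     (\<forall>F \<in> compacts \<kappa> T. finitely_generated R (on_obj H F)) \<and>
     (\<exists>N. \<forall>i. \<bar>i\<bar> \<ge> N \<longrightarrow> (\<forall>X \<in> \<G> i. carrier (on_obj H X) = {\<zero>\<^bsub>on_obj H X\<^esub>}))"

text \<open>Natural transformations between functors on the full subcategory with objects \<open>U\<close>. They are
  extensional, so that equality of functions is equality of natural transformations. The two functors may
  take values in modules over different types.\<close>

definition nat_transformations ::
    "('r, 'a) ring_scheme \<Rightarrow> ('o, 'm, 'r, 'e) lin_category_scheme \<Rightarrow> 'o set \<Rightarrow>
     ('o, 'm, 'r, 'x) mod_functor \<Rightarrow> ('o, 'm, 'r, 'y) mod_functor \<Rightarrow> ('o \<Rightarrow> 'x \<Rightarrow> 'y) set" where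
  "nat_transformations R C U H K =
     {\<alpha> \<in> (\<Pi>\<^sub>E X\<in>U. linear_maps R (on_obj H X) (on_obj K X) \<inter> extensional (carrier (on_obj H X))).
        \<forall>X\<in>U. \<forall>Y\<in>U. \<forall>f \<in> Hom C X Y. \<forall>y \<in> carrier (on_obj H Y).
          \<alpha> X (on_arr H f y) = on_arr K f (\<alpha> Y y)}"

definition nat_isomorphic ::
    "('r, 'a) ring_scheme \<Rightarrow> ('o, 'm, 'r, 'e) lin_category_scheme \<Rightarrow> 'o set \<Rightarrow>
     ('o, 'm, 'r, 'x) mod_functor \<Rightarrow> ('o, 'm, 'r, 'y) mod_functor \<Rightarrow> bool" where
  "nat_isomorphic R C U H K \<longleftrightarrow>
     (\<exists>\<alpha> \<in> nat_transformations R C U H K.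
        \<forall>X\<in>U. bij_betw (\<alpha> X) (carrier (on_obj H X)) (carrier (on_obj K X)))"

text \<open>The restricted Yoneda functor \<open>F \<mapsto> Hom(-, F)\<close>, on objects and on arrows.\<close>

definition yoneda ::
    "('o, 'm, 'r, 'e) lin_category_scheme \<Rightarrow> 'o \<Rightarrow> ('o, 'm, 'r, 'm) mod_functor" where
  "yoneda C F = \<lparr>on_obj = (\<lambda>X. Hom_mod C X F), on_arr = (\<lambda>f g. g \<cdot>\<^bsub>C\<^esub> f)\<rparr>"

definition yoneda_arr ::
    "('o, 'm, 'r, 'e) lin_category_scheme \<Rightarrow> 'o set \<Rightarrow> 'm \<Rightarrow> 'o \<Rightarrow> 'm \<Rightarrow> 'm" where
  "yoneda_arr C U f = (\<lambda>X\<in>U. \<lambda>g \<in> Hom C X (src C f). f \<cdot>\<^bsub>C\<^esub> g)"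

text \<open>The functor \<open>F \<mapsto> Hom(-, F)|\<^sub>U\<close> is considered on the full subcategory with objects \<open>V\<close>. Its essential
  image is described among functors with values in modules over an arbitrary type \<open>'x\<close>.\<close>

definition yoneda_essential_image ::
    "('r, 'a) ring_scheme \<Rightarrow> ('o, 'm, 'r, 'e) lin_category_scheme \<Rightarrow> 'o set \<Rightarrow> 'o set \<Rightarrow>
     ('o, 'm, 'r, 'x) mod_functor set" where
  "yoneda_essential_image R C U V =
     {H. linear_functor R C U H \<and> (\<exists>F\<in>V. nat_isomorphic R C U (yoneda C F) H)}"

definition yoneda_fully_faithful ::
    "('r, 'a) ring_scheme \<Rightarrow> ('o, 'm, 'r, 'e) lin_category_scheme \<Rightarrow> 'o set \<Rightarrow> 'o set \<Rightarrow> bool" where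
  "yoneda_fully_faithful R C U V \<longleftrightarrow>
     (\<forall>F\<in>V. \<forall>F'\<in>V. bij_betw (yoneda_arr C U) (Hom C F F')
        (nat_transformations R C U (yoneda C F) (yoneda C F')))"

end

theory Submission
  imports Defs
begin

text \<open>
  Since \<open>R\<close> is noetherian, all modules \<open>Hom(P, K)\<close> between compact objects are finitely generated. Hence a
  finite cohomological functor \<open>H\<close> is computed by a tower of compact objects \<open>L\<^sub>k\<close> with compatible elements of
  \<open>H(L\<^sub>k)\<close>, built one window of the generating sequence at a time: elements of \<open>H\<close> are hit, and arrows that are
  killed by \<open>H\<close> become zero, after a bounded number of steps. The hocolim \<open>F\<close> of the tower represents \<open>H\<close> on
  the compact objects.

  The main point is that \<open>F\<close> lies in the closure of the compacts. Quasiapproximability yields a single class of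
  compact objects, obtained by a bounded number of extensions from small coproducts of generators of bounded degree,
  through which one can test all arrows into \<open>F\<close> up to a given degree; as the bounds on the tower pass to this class,
  one finds on one compact object two arrows whose difference has a cone approximating \<open>F \<oplus> \<Sigma>F\<close>, better and
  better as the degree varies. So \<open>F \<oplus> \<Sigma>F\<close>, and then also \<open>F \<oplus> \<Sigma>\<^sup>nF\<close> for odd \<open>n\<close> of either sign, is in
  the closure. Some shift of \<open>F\<close> lies arbitrarily deep in the metric by condition (0), so that \<open>F\<close> itself is in the
  closure.

  Conversely, an object of the closure is a compact one up to an object deep in the metric, which has no arrows to a given
  bounded object. This gives the finiteness of \<open>Hom(-, F)\<close> and lets natural transformations on the compact objects
  extend uniquely.
\<close>

section \<open>Finitely generated modules over a noetherian ring\<close>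

text \<open>Nothing in the construction of the tower bounds the cones of its transition maps in the
  metric, and condition (3) of quasiapproximability speaks only of objects already in a closure. It
  is therefore applied to compact objects alone. The order of choices makes this work: first a class
  of possible approximants \<open>E\<close>, then a stage of the tower that is good for the whole
  class, then a compact object \<open>X\<close> through which a later stage maps to
  \<open>F\<close>, and only then \<open>E\<close> itself, as the approximant of \<open>X\<close>.
  With bounds depending on the single object, the stage would depend on \<open>E\<close> and the
  choice would be circular.

  The two arrows \<open>i\<close> and \<open>e\<close> from \<open>E\<close> to \<open>X\<close>
  behave, in a chosen range of degrees, like the identity and an idempotent with image
  \<open>Hom(-, F)\<close>. As \<open>i\<close> is invertible on arrows only in that range, the
  idempotent cannot be split directly. The cone of \<open>i - e\<close> sees both the kernel and the
  cokernel of \<open>1 - e\<close>, and each of them is a copy of \<open>Hom(-, F)\<close>; this is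
  where the extra summand \<open>\<Sigma>F\<close> comes from.\<close>

definition fg_submodule :: "('r, 'a) ring_scheme \<Rightarrow> ('r, 'x) module \<Rightarrow> 'x set \<Rightarrow> bool" where
  "fg_submodule R M N \<longleftrightarrow>
     (\<exists>B \<subseteq> N. finite B \<and> (\<forall>N'. submodule N' R M \<and> B \<subseteq> N' \<longrightarrow> N \<subseteq> N'))"

lemma linear_maps_zero:
  assumes "module R M" "module R N" "h \<in> linear_maps R M N"
  shows "h \<zero>\<^bsub>M\<^esub> = \<zero>\<^bsub>N\<^esub>"
proof -
  interpret M: module R M by fact
  interpret N: module R N by fact
  have c: "h \<zero>\<^bsub>M\<^esub> \<in> carrier N" using assms(3) by (auto simp: linear_maps_def)
  have "h (\<zero>\<^bsub>M\<^esub> \<oplus>\<^bsub>M\<^esub> \<zero>\<^bsub>M\<^esub>) = h \<zero>\<^bsub>M\<^esub> \<oplus>\<^bsub>N\<^esub> h \<zero>\<^bsub>M\<^esub>"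
    using assms(3) M.zero_closed unfolding linear_maps_def by blast
  then show ?thesis using c by (metis M.M.l_zero M.zero_closed N.M.add.l_cancel_one')
qed

lemma linear_maps_minus:
  assumes "module R M" "module R N" "h \<in> linear_maps R M N" "x \<in> carrier M"
  shows "h (\<ominus>\<^bsub>M\<^esub> x) = \<ominus>\<^bsub>N\<^esub> h x"
proof -
  interpret M: module R M by fact
  interpret N: module R N by fact
  have c: "h x \<in> carrier N" "h (\<ominus>\<^bsub>M\<^esub> x) \<in> carrier N"
    using assms(3,4) by (auto simp: linear_maps_def)
  have "h (\<ominus>\<^bsub>M\<^esub> x) \<oplus>\<^bsub>N\<^esub> h x = h (\<ominus>\<^bsub>M\<^esub> x \<oplus>\<^bsub>M\<^esub> x)"
    using assms(3,4) unfolding linear_maps_def by auto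
  also have "\<dots> = \<zero>\<^bsub>N\<^esub>"
    using linear_maps_zero[OF assms(1,2,3)] assms(4) by (simp add: M.M.l_neg)
  finally show ?thesis using c by (metis N.M.minus_equality)
qed

lemma vimage_submodule:
  assumes "module R M" "module R N" "h \<in> linear_maps R M N" "submodule K R N"
  shows "submodule {x \<in> carrier M. h x \<in> K} R M"
proof -
  interpret M: module R M by fact
  interpret N: module R N by fact
  note K = N.submoduleE[OF assms(4)]
  have z: "\<zero>\<^bsub>N\<^esub> \<in> K" using K(2,3,5) by (metis N.M.r_neg K(1) ex_in_conv subsetD)
  show ?thesis
    using assms(3) K z linear_maps_minus[OF assms(1-3)] linear_maps_zero[OF assms(1-3)]
    by (intro M.submoduleI) (auto simp: linear_maps_def)
qed

lemma image_submodule: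
  assumes "module R M" "module R N" "h \<in> linear_maps R M N" "submodule K R M"
  shows "submodule (h ` K) R N"
proof -
  interpret M: module R M by fact
  interpret N: module R N by fact
  note K = M.submoduleE[OF assms(4)]
  have z: "\<zero>\<^bsub>M\<^esub> \<in> K" using K(2,3,5) by (metis M.M.r_neg K(1) ex_in_conv subsetD)
  show ?thesis
  proof (rule N.submoduleI)
    show "h ` K \<subseteq> carrier N" using assms(3) K(1) by (auto simp: linear_maps_def)
    show "\<zero>\<^bsub>N\<^esub> \<in> h ` K" using linear_maps_zero[OF assms(1-3)] z by (metis imageI)
  next
    fix a assume "a \<in> h ` K"
    then obtain x where x: "x \<in> K" "a = h x" by auto
    then have "\<ominus>\<^bsub>N\<^esub> a = h (\<ominus>\<^bsub>M\<^esub> x)" using linear_maps_minus[OF assms(1-3)] K(1) by auto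
    then show "\<ominus>\<^bsub>N\<^esub> a \<in> h ` K" using x K(3) by auto
  next
    fix a b assume "a \<in> h ` K" "b \<in> h ` K"
    then obtain x y where x: "x \<in> K" "a = h x" "y \<in> K" "b = h y" by auto
    then have "a \<oplus>\<^bsub>N\<^esub> b = h (x \<oplus>\<^bsub>M\<^esub> y)" using assms(3) K(1) by (simp add: linear_maps_def subset_iff)
    then show "a \<oplus>\<^bsub>N\<^esub> b \<in> h ` K" using x K(5) by auto
  next
    fix r a assume r: "r \<in> carrier R" and "a \<in> h ` K"
    then obtain x where x: "x \<in> K" "a = h x" by auto
    then have "r \<odot>\<^bsub>N\<^esub> a = h (r \<odot>\<^bsub>M\<^esub> x)" using assms(3) K(1) r by (simp add: linear_maps_def subset_iff)
    then show "r \<odot>\<^bsub>N\<^esub> a \<in> h ` K" using x r K(4) by auto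
  qed
qed

lemma zero_submodule:
  assumes "module R M"
  shows "submodule {\<zero>\<^bsub>M\<^esub>} R M"
proof -
  interpret M: module R M by fact
  show ?thesis by (intro M.submoduleI) auto
qed

lemma Int_submodule:
  assumes "module R M" "submodule K R M" "submodule L R M"
  shows "submodule (K \<inter> L) R M"
proof -
  interpret M: module R M by fact
  note K = M.submoduleE[OF assms(2)] and L = M.submoduleE[OF assms(3)]
  have z: "\<zero>\<^bsub>M\<^esub> \<in> K" using K(2,3,5) by (metis M.M.r_neg K(1) ex_in_conv subsetD)
  have z': "\<zero>\<^bsub>M\<^esub> \<in> L" using L(2,3,5) by (metis M.M.r_neg L(1) ex_in_conv subsetD)
  show ?thesis using K L z z' by (intro M.submoduleI) auto
qed

lemma submodule_zero_mem:
  assumes "module R M" "submodule K R M"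
  shows "\<zero>\<^bsub>M\<^esub> \<in> K"
proof -
  interpret M: module R M by fact
  note K = M.submoduleE[OF assms(2)]
  show ?thesis using K(2,3,5) by (metis M.M.r_neg K(1) ex_in_conv subsetD)
qed

definition span :: "('r, 'a) ring_scheme \<Rightarrow> ('r, 'x) module \<Rightarrow> 'x set \<Rightarrow> 'x set" where
  "span R M B = \<Inter>{N. submodule N R M \<and> B \<subseteq> N}"

lemma span_submodule:
  assumes "module R M" "B \<subseteq> carrier M"
  shows "submodule (span R M B) R M"
proof -
  interpret M: module R M by fact
  have c: "carrier M \<in> {N. submodule N R M \<and> B \<subseteq> N}" using assms(2) M.carrier_is_submodule by auto
  show ?thesis
  proof (rule M.submoduleI)
    show "span R M B \<subseteq> carrier M" using c unfolding span_def by blast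
    show "\<zero>\<^bsub>M\<^esub> \<in> span R M B" using submodule_zero_mem[OF assms(1)] unfolding span_def by blast
  qed (auto simp: span_def dest: M.submoduleE(3,4,5))
qed

lemma submodule_adjoin:
  assumes M: "module R M" and K: "submodule K R M" and b: "b \<in> carrier M"
  shows "submodule {r \<odot>\<^bsub>M\<^esub> b \<oplus>\<^bsub>M\<^esub> m | r m. r \<in> carrier R \<and> m \<in> K} R M" (is "submodule ?S R M")
proof -
  interpret M: module R M by fact
  note E = M.submoduleE[OF K]
  show ?thesis
  proof (rule M.submoduleI)
    show "?S \<subseteq> carrier M" using E(1) b by auto
    have "\<zero>\<^bsub>M\<^esub> = \<zero>\<^bsub>R\<^esub> \<odot>\<^bsub>M\<^esub> b \<oplus>\<^bsub>M\<^esub> \<zero>\<^bsub>M\<^esub>" using b by simp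
    then show "\<zero>\<^bsub>M\<^esub> \<in> ?S" using submodule_zero_mem[OF M K] by blast
  next
    fix a assume "a \<in> ?S"
    then obtain r m where rm: "r \<in> carrier R" "m \<in> K" "a = r \<odot>\<^bsub>M\<^esub> b \<oplus>\<^bsub>M\<^esub> m" by auto
    then have m: "m \<in> carrier M" using E(1) by auto
    have "\<ominus>\<^bsub>M\<^esub> a = (\<ominus>\<^bsub>R\<^esub> r) \<odot>\<^bsub>M\<^esub> b \<oplus>\<^bsub>M\<^esub> \<ominus>\<^bsub>M\<^esub> m"
      using rm m b by (simp add: M.smult_l_minus M.M.minus_add)
    then show "\<ominus>\<^bsub>M\<^esub> a \<in> ?S" using rm E(3) by blast
  next
    fix a a' assume "a \<in> ?S" "a' \<in> ?S"
    then obtain r m r' m' where rm: "r \<in> carrier R" "m \<in> K" "a = r \<odot>\<^bsub>M\<^esub> b \<oplus>\<^bsub>M\<^esub> m"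
      "r' \<in> carrier R" "m' \<in> K" "a' = r' \<odot>\<^bsub>M\<^esub> b \<oplus>\<^bsub>M\<^esub> m'" by auto
    then have m: "m \<in> carrier M" "m' \<in> carrier M" using E(1) by auto
    have "a \<oplus>\<^bsub>M\<^esub> a' = (r \<oplus>\<^bsub>R\<^esub> r') \<odot>\<^bsub>M\<^esub> b \<oplus>\<^bsub>M\<^esub> (m \<oplus>\<^bsub>M\<^esub> m')"
      using rm m b by (simp add: M.smult_l_distr M.M.a_ac)
    then show "a \<oplus>\<^bsub>M\<^esub> a' \<in> ?S" using rm E(5) by blast
  next
    fix s a assume s: "s \<in> carrier R" and "a \<in> ?S"
    then obtain r m where rm: "r \<in> carrier R" "m \<in> K" "a = r \<odot>\<^bsub>M\<^esub> b \<oplus>\<^bsub>M\<^esub> m" by auto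
    then have m: "m \<in> carrier M" using E(1) by auto
    have "s \<odot>\<^bsub>M\<^esub> a = (s \<otimes>\<^bsub>R\<^esub> r) \<odot>\<^bsub>M\<^esub> b \<oplus>\<^bsub>M\<^esub> s \<odot>\<^bsub>M\<^esub> m"
      using rm m b s by (simp add: M.smult_r_distr M.smult_assoc1)
    then show "s \<odot>\<^bsub>M\<^esub> a \<in> ?S" using rm s E(4) by blast
  qed
qed

text \<open>Induction on the generators; one generator at a time is handled by the ideal of its possible
  coefficients.\<close>

lemma noetherian_fg_submodule_span:
  assumes R: "cring R" "noetherian_ring R" and M: "module R M"
    and B: "finite B" "B \<subseteq> carrier M" and N: "submodule N R M" "N \<subseteq> span R M B"
  shows "fg_submodule R M N"
  using B N
proof (induction B arbitrary: N rule: finite_induct)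
  case empty
  have "span R M {} \<subseteq> {\<zero>\<^bsub>M\<^esub>}" using zero_submodule[OF M] unfolding span_def by blast
  then have "N \<subseteq> {\<zero>\<^bsub>M\<^esub>}" using empty by auto
  then show ?case using submodule_zero_mem[OF M] unfolding fg_submodule_def by blast
next
  case (insert b B)
  interpret M: module R M by fact
  interpret S: noetherian_ring R by fact
  define K where "K = span R M B"
  have Ks: "submodule K R M" using span_submodule[OF M] insert.prems unfolding K_def by auto
  have b: "b \<in> carrier M" using insert.prems by auto
  note E = M.submoduleE[OF Ks]
  define J where "J N' = {r \<in> carrier R. \<exists>m\<in>K. r \<odot>\<^bsub>M\<^esub> b \<oplus>\<^bsub>M\<^esub> m \<in> N'}" for N'
  have ideal_J: "ideal (J N') R" if N': "submodule N' R M" for N'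
  proof -
    note F = M.submoduleE[OF N']
    show ?thesis
    proof (rule idealI)
      show "ring R" by (rule M.R.ring_axioms)
      have "a \<oplus>\<^bsub>R\<^esub> a' \<in> J N'" if aJ: "a \<in> J N'" "a' \<in> J N'" for a a'
      proof -
        obtain m m' where m: "m \<in> K" "a \<odot>\<^bsub>M\<^esub> b \<oplus>\<^bsub>M\<^esub> m \<in> N'" "m' \<in> K" "a' \<odot>\<^bsub>M\<^esub> b \<oplus>\<^bsub>M\<^esub> m' \<in> N'"
          "a \<in> carrier R" "a' \<in> carrier R"
          using aJ unfolding J_def by blast
        have mc: "m \<in> carrier M" "m' \<in> carrier M" using m E(1) by auto
        have "(a \<oplus>\<^bsub>R\<^esub> a') \<odot>\<^bsub>M\<^esub> b \<oplus>\<^bsub>M\<^esub> (m \<oplus>\<^bsub>M\<^esub> m') = (a \<odot>\<^bsub>M\<^esub> b \<oplus>\<^bsub>M\<^esub> m) \<oplus>\<^bsub>M\<^esub> (a' \<odot>\<^bsub>M\<^esub> b \<oplus>\<^bsub>M\<^esub> m')"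
          using m mc b by (simp add: M.smult_l_distr M.M.a_ac)
        then have "(a \<oplus>\<^bsub>R\<^esub> a') \<odot>\<^bsub>M\<^esub> b \<oplus>\<^bsub>M\<^esub> (m \<oplus>\<^bsub>M\<^esub> m') \<in> N'" using F(5) m by auto
        then show ?thesis using m E(5) unfolding J_def by blast
      qed
      moreover have "x \<otimes>\<^bsub>R\<^esub> a \<in> J N'" if aJ: "a \<in> J N'" "x \<in> carrier R" for a x
      proof -
        obtain m where m: "m \<in> K" "a \<odot>\<^bsub>M\<^esub> b \<oplus>\<^bsub>M\<^esub> m \<in> N'" "a \<in> carrier R"
          using aJ unfolding J_def by blast
        have mc: "m \<in> carrier M" using m E(1) by auto
        have "(x \<otimes>\<^bsub>R\<^esub> a) \<odot>\<^bsub>M\<^esub> b \<oplus>\<^bsub>M\<^esub> x \<odot>\<^bsub>M\<^esub> m = x \<odot>\<^bsub>M\<^esub> (a \<odot>\<^bsub>M\<^esub> b \<oplus>\<^bsub>M\<^esub> m)"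
          using m mc b aJ by (simp add: M.smult_r_distr M.smult_assoc1)
        then have "(x \<otimes>\<^bsub>R\<^esub> a) \<odot>\<^bsub>M\<^esub> b \<oplus>\<^bsub>M\<^esub> x \<odot>\<^bsub>M\<^esub> m \<in> N'" using F(4) m aJ by auto
        then show ?thesis using m aJ E(4) unfolding J_def by blast
      qed
      moreover have "a \<otimes>\<^bsub>R\<^esub> x \<in> J N'" if aJ: "a \<in> J N'" "x \<in> carrier R" for a x
      proof -
        have "a \<in> carrier R" using aJ unfolding J_def by auto
        then have "a \<otimes>\<^bsub>R\<^esub> x = x \<otimes>\<^bsub>R\<^esub> a" using aJ(2) by (rule M.R.m_comm)
        then show ?thesis using calculation(2) aJ by simp
      qed
      moreover have "\<zero>\<^bsub>R\<^esub> \<in> J N'"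
        using submodule_zero_mem[OF M Ks] submodule_zero_mem[OF M N'] b unfolding J_def
        by (auto intro!: bexI[of _ "\<zero>\<^bsub>M\<^esub>"])
      moreover have "\<ominus>\<^bsub>R\<^esub> a \<in> J N'" if "a \<in> J N'" for a
      proof -
        have "\<ominus>\<^bsub>R\<^esub> \<one>\<^bsub>R\<^esub> \<otimes>\<^bsub>R\<^esub> a \<in> J N'" using that calculation(2) by auto
        then show ?thesis using that by (auto simp: J_def M.R.l_minus)
      qed
      moreover have "J N' \<subseteq> carrier R" unfolding J_def by auto
      ultimately show "subgroup (J N') (add_monoid R)"
        and "\<And>a x. a \<in> J N' \<Longrightarrow> x \<in> carrier R \<Longrightarrow> x \<otimes>\<^bsub>R\<^esub> a \<in> J N'"
        and "\<And>a x. a \<in> J N' \<Longrightarrow> x \<in> carrier R \<Longrightarrow> a \<otimes>\<^bsub>R\<^esub> x \<in> J N'"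
        by (auto intro!: subgroup.intro simp: a_inv_def[symmetric])
    qed
  qed
  obtain A where A: "A \<subseteq> carrier R" "finite A" "J N = Idl\<^bsub>R\<^esub> A"
    using S.finetely_gen[OF ideal_J[OF insert.prems(2)]] by auto
  have AJ: "A \<subseteq> J N" using A M.R.genideal_self by auto
  then have "\<forall>a\<in>A. \<exists>m\<in>K. a \<odot>\<^bsub>M\<^esub> b \<oplus>\<^bsub>M\<^esub> m \<in> N" unfolding J_def by auto
  then obtain m where m: "\<And>a. a \<in> A \<Longrightarrow> m a \<in> K \<and> a \<odot>\<^bsub>M\<^esub> b \<oplus>\<^bsub>M\<^esub> m a \<in> N" by metis
  have "fg_submodule R M (N \<inter> K)"
    using insert.IH[OF _ Int_submodule[OF M insert.prems(2) Ks]] insert.prems unfolding K_def by auto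
  then obtain C where C: "C \<subseteq> N \<inter> K" "finite C"
    "\<And>N'. submodule N' R M \<Longrightarrow> C \<subseteq> N' \<Longrightarrow> N \<inter> K \<subseteq> N'" unfolding fg_submodule_def by metis
  \<comment> \<open>As in the basis theorem: generators of \<open>N \<inter> K\<close>, together
    with one member of \<open>N\<close> for each generator of the coefficient ideal.\<close>
  define D where "D = C \<union> (\<lambda>a. a \<odot>\<^bsub>M\<^esub> b \<oplus>\<^bsub>M\<^esub> m a) ` A"
  have "N \<subseteq> N'" if N': "submodule N' R M" "D \<subseteq> N'" for N'
  proof
    fix n assume n: "n \<in> N"
    \<comment> \<open>Intersecting with \<open>N\<close> yields a \<open>k'\<close> for which the
      difference \<open>k - k'\<close> lies in \<open>N\<close> as well as in \<open>K\<close>,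
      where the induction hypothesis applies.\<close>
    define N2 where "N2 = N' \<inter> N"
    have N2: "submodule N2 R M" using Int_submodule[OF M N'(1) insert.prems(2)] unfolding N2_def .
    have "A \<subseteq> J N2" using m N'(2) A(1) unfolding J_def N2_def D_def by blast
    then have "J N \<subseteq> J N2" using A(3) M.R.genideal_minimal[OF ideal_J[OF N2]] by auto
    have "span R M (insert b B) \<subseteq> {r \<odot>\<^bsub>M\<^esub> b \<oplus>\<^bsub>M\<^esub> m | r m. r \<in> carrier R \<and> m \<in> K}"
    proof -
      have "b = \<one>\<^bsub>R\<^esub> \<odot>\<^bsub>M\<^esub> b \<oplus>\<^bsub>M\<^esub> \<zero>\<^bsub>M\<^esub>" using b by simp
      moreover have "x = \<zero>\<^bsub>R\<^esub> \<odot>\<^bsub>M\<^esub> b \<oplus>\<^bsub>M\<^esub> x" if "x \<in> B" for x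
        using that b insert.prems by auto
      moreover have "B \<subseteq> K" unfolding K_def span_def by auto
      ultimately have "insert b B \<subseteq> {r \<odot>\<^bsub>M\<^esub> b \<oplus>\<^bsub>M\<^esub> m | r m. r \<in> carrier R \<and> m \<in> K}"
        using submodule_zero_mem[OF M Ks] by blast
      then show ?thesis using submodule_adjoin[OF M Ks b] unfolding span_def by blast
    qed
    then obtain r k where rk: "r \<in> carrier R" "k \<in> K" "n = r \<odot>\<^bsub>M\<^esub> b \<oplus>\<^bsub>M\<^esub> k"
      using n insert.prems(3) by blast
    then have "r \<in> J N" using n unfolding J_def by auto
    then obtain k' where k': "k' \<in> K" "r \<odot>\<^bsub>M\<^esub> b \<oplus>\<^bsub>M\<^esub> k' \<in> N2"
      using \<open>J N \<subseteq> J N2\<close> unfolding J_def by auto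
    have kc: "k \<in> carrier M" "k' \<in> carrier M" using rk k' E(1) by auto
    note F = M.submoduleE[OF insert.prems(2)]
    have eq: "n \<oplus>\<^bsub>M\<^esub> \<ominus>\<^bsub>M\<^esub> (r \<odot>\<^bsub>M\<^esub> b \<oplus>\<^bsub>M\<^esub> k') = k \<oplus>\<^bsub>M\<^esub> \<ominus>\<^bsub>M\<^esub> k'"
      using rk kc b by (simp add: M.M.minus_add M.M.a_ac M.M.r_neg1 M.M.r_neg)
    have "n \<oplus>\<^bsub>M\<^esub> \<ominus>\<^bsub>M\<^esub> (r \<odot>\<^bsub>M\<^esub> b \<oplus>\<^bsub>M\<^esub> k') \<in> N" using n k' F(3,5) unfolding N2_def by auto
    moreover have "k \<oplus>\<^bsub>M\<^esub> \<ominus>\<^bsub>M\<^esub> k' \<in> K" using rk k' E(3,5) by auto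
    ultimately have "n \<oplus>\<^bsub>M\<^esub> \<ominus>\<^bsub>M\<^esub> (r \<odot>\<^bsub>M\<^esub> b \<oplus>\<^bsub>M\<^esub> k') \<in> N'"
      using C(3)[OF N'(1)] N'(2) eq unfolding D_def by auto
    then have "(n \<oplus>\<^bsub>M\<^esub> \<ominus>\<^bsub>M\<^esub> (r \<odot>\<^bsub>M\<^esub> b \<oplus>\<^bsub>M\<^esub> k')) \<oplus>\<^bsub>M\<^esub> (r \<odot>\<^bsub>M\<^esub> b \<oplus>\<^bsub>M\<^esub> k') \<in> N'"
      using k' M.submoduleE(5)[OF N'(1)] unfolding N2_def by auto
    moreover have "(n \<oplus>\<^bsub>M\<^esub> \<ominus>\<^bsub>M\<^esub> (r \<odot>\<^bsub>M\<^esub> b \<oplus>\<^bsub>M\<^esub> k')) \<oplus>\<^bsub>M\<^esub> (r \<odot>\<^bsub>M\<^esub> b \<oplus>\<^bsub>M\<^esub> k') = n"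
      using n F(1) rk kc b by (simp add: M.M.a_assoc M.M.l_neg subsetD)
    ultimately show "n \<in> N'" by simp
  qed
  moreover have "D \<subseteq> N" "finite D" using C m A unfolding D_def by auto
  ultimately show ?case unfolding fg_submodule_def by blast
qed

text \<open>Finite generation of \<open>N\<close> is expressed inside \<open>M\<close>, so that
  \<open>N\<close> never has to be made into a module of its own.\<close>

lemma noetherian_fg_submodule:
  assumes R: "cring R" "noetherian_ring R" and M: "module R M" "finitely_generated R M"
    and N: "submodule N R M"
  shows "fg_submodule R M N"
proof -
  obtain B where B: "B \<subseteq> carrier M" "finite B" "\<And>N. submodule N R M \<Longrightarrow> B \<subseteq> N \<Longrightarrow> N = carrier M"
    using M(2) unfolding finitely_generated_def by blast
  have "N \<subseteq> carrier M" using module.submoduleE(1)[OF M(1) N] .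
  moreover have "span R M B = carrier M" using B(3)[OF span_submodule[OF M(1) B(1)]] by (auto simp: span_def)
  ultimately show ?thesis using noetherian_fg_submodule_span[OF R M(1) B(2,1) N] by simp
qed

text \<open>Noetherianity enters through the image of \<open>L\<close> in \<open>M\<close>: lifts of
  its generators, together with the images of generators of \<open>K\<close>, generate
  \<open>L\<close>.\<close>

lemma finitely_generated_middle:
  assumes R: "cring R" "noetherian_ring R" and M: "module R K" "module R L" "module R M"
    and f: "f \<in> linear_maps R K L" and g: "g \<in> linear_maps R L M" and ex: "exact_at K f L g M"
    and fg: "finitely_generated R K" "finitely_generated R M"
  shows "finitely_generated R L"
proof -
  interpret L: module R L by fact
  have S: "submodule (g ` carrier L) R M"
    using image_submodule[OF M(2,3) g L.carrier_is_submodule] .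
  obtain C where C: "C \<subseteq> g ` carrier L" "finite C"
    "\<And>N. submodule N R M \<Longrightarrow> C \<subseteq> N \<Longrightarrow> g ` carrier L \<subseteq> N"
    using noetherian_fg_submodule[OF R M(3) fg(2) S] unfolding fg_submodule_def by metis
  obtain D where D: "D \<subseteq> carrier L" "finite D" "C = g ` D"
    using C(1,2) by (metis finite_subset_image)
  obtain B where B: "B \<subseteq> carrier K" "finite B" "\<And>N. submodule N R K \<Longrightarrow> B \<subseteq> N \<Longrightarrow> N = carrier K"
    using fg(1) unfolding finitely_generated_def by blast
  have fL: "f x \<in> carrier L" if "x \<in> carrier K" for x using f that by (auto simp: linear_maps_def)
  have "N = carrier L" if N: "submodule N R L" "f ` B \<union> D \<subseteq> N" for N
  proof
    show "N \<subseteq> carrier L" using L.submoduleE(1)[OF N(1)] .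
    show "carrier L \<subseteq> N"
    proof
      fix x assume x: "x \<in> carrier L"
      have "g ` carrier L \<subseteq> g ` N" using C(3)[OF image_submodule[OF M(2,3) g N(1)]] D(3) N(2) by blast
      then obtain n where n: "n \<in> N" "g x = g n" using x by auto
      have nc: "n \<in> carrier L" using n L.submoduleE(1)[OF N(1)] by auto
      have "g (x \<oplus>\<^bsub>L\<^esub> \<ominus>\<^bsub>L\<^esub> n) = \<zero>\<^bsub>M\<^esub>"
      proof -
        interpret MM: module R M by fact
        have "g (x \<oplus>\<^bsub>L\<^esub> \<ominus>\<^bsub>L\<^esub> n) = g x \<oplus>\<^bsub>M\<^esub> \<ominus>\<^bsub>M\<^esub> g n"
          using g x nc linear_maps_minus[OF M(2,3) g nc] by (auto simp: linear_maps_def)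
        moreover have "g n \<in> carrier M" using g nc by (auto simp: linear_maps_def)
        ultimately show ?thesis using n by (simp add: MM.M.r_neg)
      qed
      then obtain k where k: "k \<in> carrier K" "x \<oplus>\<^bsub>L\<^esub> \<ominus>\<^bsub>L\<^esub> n = f k"
        using ex x nc unfolding exact_at_def by (metis (mono_tags, lifting) L.M.add.inv_closed L.M.add.m_closed imageE mem_Collect_eq)
      have "{x \<in> carrier K. f x \<in> N} = carrier K"
        using B(3)[OF vimage_submodule[OF M(1,2) f N(1)]] B(1) N(2) by auto
      then have "f k \<in> N" using k by auto
      then have "f k \<oplus>\<^bsub>L\<^esub> n \<in> N" using n L.submoduleE(5)[OF N(1)] by auto
      moreover have "f k \<oplus>\<^bsub>L\<^esub> n = x"
        unfolding k(2)[symmetric] using x nc by (simp add: L.M.a_assoc L.M.l_neg)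
      ultimately show "x \<in> N" by simp
    qed
  qed
  moreover have "f ` B \<union> D \<subseteq> carrier L" "finite (f ` B \<union> D)" using B D fL by auto
  ultimately show ?thesis unfolding finitely_generated_def by blast
qed

lemma finitely_generated_surj:
  assumes M: "module R M" "module R N" and h: "h \<in> linear_maps R M N"
    and s: "h ` carrier M = carrier N" and fg: "finitely_generated R M"
  shows "finitely_generated R N"
proof -
  obtain B where B: "B \<subseteq> carrier M" "finite B" "\<And>N. submodule N R M \<Longrightarrow> B \<subseteq> N \<Longrightarrow> N = carrier M"
    using fg unfolding finitely_generated_def by blast
  have "K = carrier N" if K: "submodule K R N" "h ` B \<subseteq> K" for K
  proof -
    have "{x \<in> carrier M. h x \<in> K} = carrier M"
      using B(3)[OF vimage_submodule[OF M h K(1)]] B(1) K(2) by auto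
    then have "h ` carrier M \<subseteq> K" by blast
    then show ?thesis using s module.submoduleE(1)[OF M(2) K(1)] by auto
  qed
  moreover have "h ` B \<subseteq> carrier N" using B s by auto
  ultimately show ?thesis using B unfolding finitely_generated_def by blast
qed

section \<open>Linear categories\<close>

context R_linear_category
begin

abbreviation add (infixl \<open>\<boxplus>\<close> 65) where "f \<boxplus> g \<equiv> arr_add C f g"
abbreviation zer where "zer X Y \<equiv> arr_zero C X Y"
text \<open>The negative in \<open>Hom_mod\<close>, with the two objects read off from the arrow so
  that they need not be carried along.\<close>

definition neg where "neg f = \<ominus>\<^bsub>Hom_mod C (src C f) (tgt C f)\<^esub> f"
definition sub (infixl \<open>\<boxminus>\<close> 65) where "f \<boxminus> g = f \<boxplus> neg g"

lemma Hom_mod_simps [simp]: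
  "carrier (Hom_mod C X Y) = Hom C X Y" "zero (Hom_mod C X Y) = zer X Y"
  "f \<oplus>\<^bsub>Hom_mod C X Y\<^esub> g = f \<boxplus> g" "r \<odot>\<^bsub>Hom_mod C X Y\<^esub> f = arr_scale C r f"
  by (simp_all add: Hom_mod_def)

lemma Hom_obj: "f \<in> Hom C X Y \<Longrightarrow> X \<in> obj C \<and> Y \<in> obj C"
  using src_tgt by (auto simp: Hom_def)

lemma HomD: "f \<in> Hom C X Y \<Longrightarrow> f \<in> arr C \<and> src C f = X \<and> tgt C f = Y"
  by (simp add: Hom_def)

lemma arr_Hom: "f \<in> arr C \<Longrightarrow> f \<in> Hom C (src C f) (tgt C f)"
  by (simp add: Hom_def)

lemma neg_eq: "f \<in> Hom C X Y \<Longrightarrow> \<ominus>\<^bsub>Hom_mod C X Y\<^esub> f = neg f"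
  by (auto simp: neg_def Hom_def)

lemma zer_Hom: "X \<in> obj C \<Longrightarrow> Y \<in> obj C \<Longrightarrow> zer X Y \<in> Hom C X Y"
  using module.axioms(2)[OF Hom_module, THEN abelian_group.axioms(1), THEN abelian_monoid.zero_closed]
  by fastforce

context
  fixes X Y
  assumes XY: "X \<in> obj C" "Y \<in> obj C"
begin

interpretation M: module R "Hom_mod C X Y" using XY by (rule Hom_module)

lemma add_Hom': "f \<in> Hom C X Y \<Longrightarrow> g \<in> Hom C X Y \<Longrightarrow> f \<boxplus> g \<in> Hom C X Y"
  using M.M.a_closed[of f g] by simp
lemma scale_Hom': "f \<in> Hom C X Y \<Longrightarrow> r \<in> carrier R \<Longrightarrow> arr_scale C r f \<in> Hom C X Y"
  using M.smult_closed[of r f] by simp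
lemma neg_Hom': "f \<in> Hom C X Y \<Longrightarrow> neg f \<in> Hom C X Y"
  using M.M.a_inv_closed[of f] by (simp add: neg_eq)
lemma add_assoc': "f \<in> Hom C X Y \<Longrightarrow> g \<in> Hom C X Y \<Longrightarrow> h \<in> Hom C X Y \<Longrightarrow> f \<boxplus> g \<boxplus> h = f \<boxplus> (g \<boxplus> h)"
  using M.M.a_assoc[of f g h] by simp
lemma add_comm': "f \<in> Hom C X Y \<Longrightarrow> g \<in> Hom C X Y \<Longrightarrow> f \<boxplus> g = g \<boxplus> f"
  using M.M.a_comm[of f g] by simp
lemma add_zer': "f \<in> Hom C X Y \<Longrightarrow> f \<boxplus> zer X Y = f \<and> zer X Y \<boxplus> f = f"
  using M.M.l_zero[of f] M.M.r_zero[of f] by simp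
lemma add_neg': "f \<in> Hom C X Y \<Longrightarrow> f \<boxplus> neg f = zer X Y \<and> neg f \<boxplus> f = zer X Y"
  using M.M.l_neg[of f] M.M.r_neg[of f] by (simp add: neg_eq)
lemma neg_unique': "f \<in> Hom C X Y \<Longrightarrow> g \<in> Hom C X Y \<Longrightarrow> f \<boxplus> g = zer X Y \<Longrightarrow> f = neg g"
  using M.M.minus_equality[of f g] by (simp add: neg_eq)
lemma add_eq_zer_imp': "f \<in> Hom C X Y \<Longrightarrow> g \<in> Hom C X Y \<Longrightarrow> f \<boxplus> g = f \<Longrightarrow> g = zer X Y"
  using M.M.add.l_cancel_one[of f g] by simp
lemma neg_neg': "f \<in> Hom C X Y \<Longrightarrow> neg (neg f) = f"
  using M.M.minus_minus[of f] by (simp add: neg_eq neg_Hom')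
lemma sub_eq_zer_iff': "f \<in> Hom C X Y \<Longrightarrow> g \<in> Hom C X Y \<Longrightarrow> f \<boxminus> g = zer X Y \<longleftrightarrow> f = g"
  using neg_unique'[of f "neg g"] neg_neg'[of g] neg_Hom'[of g] add_neg'[of g] by (auto simp: sub_def)
lemma sub_add': "f \<in> Hom C X Y \<Longrightarrow> g \<in> Hom C X Y \<Longrightarrow> (f \<boxminus> g) \<boxplus> g = f"
  using M.M.a_assoc[of f "neg g" g] by (simp add: sub_def neg_Hom' add_neg' add_zer')
lemma add_sub': "f \<in> Hom C X Y \<Longrightarrow> g \<in> Hom C X Y \<Longrightarrow> (f \<boxplus> g) \<boxminus> g = f"
  using M.M.a_assoc[of f g "neg g"] by (simp add: sub_def neg_Hom' add_neg' add_zer')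
end

lemma add_Hom: "f \<in> Hom C X Y \<Longrightarrow> g \<in> Hom C X Y \<Longrightarrow> f \<boxplus> g \<in> Hom C X Y"
  using add_Hom' Hom_obj by blast
lemma scale_Hom: "f \<in> Hom C X Y \<Longrightarrow> r \<in> carrier R \<Longrightarrow> arr_scale C r f \<in> Hom C X Y"
  using scale_Hom' Hom_obj by blast
lemma neg_Hom: "f \<in> Hom C X Y \<Longrightarrow> neg f \<in> Hom C X Y"
  using neg_Hom' Hom_obj by blast
lemma sub_Hom: "f \<in> Hom C X Y \<Longrightarrow> g \<in> Hom C X Y \<Longrightarrow> f \<boxminus> g \<in> Hom C X Y"
  unfolding sub_def by (intro add_Hom neg_Hom)
lemma add_assoc: "f \<in> Hom C X Y \<Longrightarrow> g \<in> Hom C X Y \<Longrightarrow> h \<in> Hom C X Y \<Longrightarrow> f \<boxplus> g \<boxplus> h = f \<boxplus> (g \<boxplus> h)"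
  using add_assoc' Hom_obj by blast
lemma add_comm: "f \<in> Hom C X Y \<Longrightarrow> g \<in> Hom C X Y \<Longrightarrow> f \<boxplus> g = g \<boxplus> f"
  using add_comm' Hom_obj by blast
lemma add_zer: "f \<in> Hom C X Y \<Longrightarrow> f \<boxplus> zer X Y = f" "f \<in> Hom C X Y \<Longrightarrow> zer X Y \<boxplus> f = f"
  using add_zer' Hom_obj by blast+
lemma add_neg: "f \<in> Hom C X Y \<Longrightarrow> f \<boxplus> neg f = zer X Y" "f \<in> Hom C X Y \<Longrightarrow> neg f \<boxplus> f = zer X Y"
  using add_neg' Hom_obj by blast+
lemma neg_unique: "f \<in> Hom C X Y \<Longrightarrow> g \<in> Hom C X Y \<Longrightarrow> f \<boxplus> g = zer X Y \<Longrightarrow> f = neg g"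
  using neg_unique' Hom_obj by blast
lemma sub_eq_zer_iff: "f \<in> Hom C X Y \<Longrightarrow> g \<in> Hom C X Y \<Longrightarrow> f \<boxminus> g = zer X Y \<longleftrightarrow> f = g"
  using sub_eq_zer_iff' Hom_obj by blast
lemma neg_neg: "f \<in> Hom C X Y \<Longrightarrow> neg (neg f) = f"
  using neg_neg' Hom_obj by blast
lemma sub_add: "f \<in> Hom C X Y \<Longrightarrow> g \<in> Hom C X Y \<Longrightarrow> (f \<boxminus> g) \<boxplus> g = f"
  using sub_add' Hom_obj by blast
lemma add_sub: "f \<in> Hom C X Y \<Longrightarrow> g \<in> Hom C X Y \<Longrightarrow> (f \<boxplus> g) \<boxminus> g = f"
  using add_sub' Hom_obj by blast
lemma add_eq_zer_imp: "f \<in> Hom C X Y \<Longrightarrow> g \<in> Hom C X Y \<Longrightarrow> f \<boxplus> g = f \<Longrightarrow> g = zer X Y"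
  using add_eq_zer_imp' Hom_obj by blast

lemma neg_zer: "X \<in> obj C \<Longrightarrow> Y \<in> obj C \<Longrightarrow> neg (zer X Y) = zer X Y"
  by (metis add_zer(1) neg_unique zer_Hom)

lemma neg_eq_zer: "f \<in> Hom C X Y \<Longrightarrow> neg f = zer X Y \<Longrightarrow> f = zer X Y"
  by (metis Hom_obj neg_neg neg_zer)

lemma sub_zer: "f \<in> Hom C X Y \<Longrightarrow> f \<boxminus> zer X Y = f"
  by (metis Hom_obj add_zer(1) neg_zer sub_def)

lemma comp_zer_right: 
  assumes "X \<in> obj C" "g \<in> Hom C Y Z"
  shows "g \<cdot> zer X Y = zer X Z"
proof -
  have z: "zer X Y \<in> Hom C X Y" using assms Hom_obj zer_Hom by blast
  have "g \<cdot> zer X Y \<boxplus> g \<cdot> zer X Y = g \<cdot> zer X Y"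
    by (metis z add_zer(1) assms(2) comp_add_right)
  then show ?thesis using add_eq_zer_imp z assms(2) comp_closed by blast
qed

lemma comp_zer_left: 
  assumes "Z \<in> obj C" "f \<in> Hom C X Y"
  shows "zer Y Z \<cdot> f = zer X Z"
proof -
  have z: "zer Y Z \<in> Hom C Y Z" using assms Hom_obj zer_Hom by blast
  have "zer Y Z \<cdot> f \<boxplus> zer Y Z \<cdot> f = zer Y Z \<cdot> f"
    by (metis z add_zer(1) assms(2) comp_add_left)
  then show ?thesis using add_eq_zer_imp z assms(2) comp_closed by blast
qed

lemma comp_neg_right:
  assumes f: "f \<in> Hom C X Y" and g: "g \<in> Hom C Y Z"
  shows "g \<cdot> neg f = neg (g \<cdot> f)"
proof (rule neg_unique)
  show "g \<cdot> neg f \<in> Hom C X Z" "g \<cdot> f \<in> Hom C X Z"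
    using comp_closed[OF neg_Hom[OF f] g] comp_closed[OF f g] .
  have "g \<cdot> neg f \<boxplus> g \<cdot> f = g \<cdot> (neg f \<boxplus> f)" using comp_add_right[OF neg_Hom[OF f] f g] by simp
  then show "g \<cdot> neg f \<boxplus> g \<cdot> f = zer X Z" using add_neg(2)[OF f] comp_zer_right[OF _ g] Hom_obj[OF f] by simp
qed

lemma comp_neg_left:
  assumes f: "f \<in> Hom C X Y" and g: "g \<in> Hom C Y Z"
  shows "neg g \<cdot> f = neg (g \<cdot> f)"
proof (rule neg_unique)
  show "neg g \<cdot> f \<in> Hom C X Z" "g \<cdot> f \<in> Hom C X Z"
    using comp_closed[OF f neg_Hom[OF g]] comp_closed[OF f g] .
  have "neg g \<cdot> f \<boxplus> g \<cdot> f = (neg g \<boxplus> g) \<cdot> f" using comp_add_left[OF f neg_Hom[OF g] g] by simp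
  then show "neg g \<cdot> f \<boxplus> g \<cdot> f = zer X Z" using add_neg(2)[OF g] comp_zer_left[OF _ f] Hom_obj[OF g] by simp
qed

lemma comp_sub_right:
  "f \<in> Hom C X Y \<Longrightarrow> f' \<in> Hom C X Y \<Longrightarrow> g \<in> Hom C Y Z \<Longrightarrow> g \<cdot> (f \<boxminus> f') = g \<cdot> f \<boxminus> g \<cdot> f'"
  unfolding sub_def by (simp add: comp_neg_right[symmetric] comp_add_right neg_Hom)
lemma comp_sub_left:
  "f \<in> Hom C X Y \<Longrightarrow> g \<in> Hom C Y Z \<Longrightarrow> g' \<in> Hom C Y Z \<Longrightarrow> (g \<boxminus> g') \<cdot> f = g \<cdot> f \<boxminus> g' \<cdot> f"
  unfolding sub_def by (simp add: comp_neg_left[symmetric] comp_add_left neg_Hom)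

section \<open>Vanishing Hom groups and retracts\<close>

definition hz where "hz X Y \<longleftrightarrow> Hom C X Y = {zer X Y}"

text \<open>The zero arrow has to be a member of \<open>Hom C X Y\<close>, which forces both ends to
  be objects.\<close>

lemma hz_obj: "hz X Y \<Longrightarrow> X \<in> obj C \<and> Y \<in> obj C"
  unfolding hz_def using Hom_obj by blast
lemma hzI: "X \<in> obj C \<Longrightarrow> Y \<in> obj C \<Longrightarrow> (\<And>f. f \<in> Hom C X Y \<Longrightarrow> f = zer X Y) \<Longrightarrow> hz X Y"
  unfolding hz_def using zer_Hom by blast
lemma hzD: "hz X Y \<Longrightarrow> f \<in> Hom C X Y \<Longrightarrow> f = zer X Y"
  unfolding hz_def by blast

lemma right_orth_iff: "t \<in> right_orth C U \<longleftrightarrow> t \<in> obj C \<and> (\<forall>u\<in>U. hz u t)"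
  unfolding right_orth_def hz_def by blast
lemma left_orth_iff: "t \<in> left_orth C U \<longleftrightarrow> t \<in> obj C \<and> (\<forall>u\<in>U. hz t u)"
  unfolding left_orth_def hz_def by blast

lemma is_zeroD:
  assumes "is_zero C Z" "X \<in> obj C"
  shows "hz Z X" "hz X Z"
proof -
  have Z: "Z \<in> obj C" "ide C Z = zer Z Z" using assms by (auto simp: is_zero_def)
  show "hz Z X" using Z assms(2)
    by (intro hzI) (metis comp_ide comp_zer_right Hom_obj)+
  show "hz X Z" using Z assms(2)
    by (intro hzI) (metis comp_ide comp_zer_left Hom_obj)+
qed

text \<open>A summand through its inclusion and projection only; compactness, orthogonality and the
  bounds on towers are all inherited along such a pair.\<close>

definition retract where
  "retract X S \<longleftrightarrow> (\<exists>i\<in>Hom C X S. \<exists>p\<in>Hom C S X. p \<cdot> i = ide C X)"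

lemma retract_obj: "retract X S \<Longrightarrow> X \<in> obj C \<and> S \<in> obj C"
  unfolding retract_def using Hom_obj by blast

lemma retract_trans:
  assumes "retract X Y" "retract Y Z"
  shows "retract X Z"
proof -
  obtain i p where 1: "i \<in> Hom C X Y" "p \<in> Hom C Y X" "p \<cdot> i = ide C X"
    using assms(1) unfolding retract_def by blast
  obtain j q where 2: "j \<in> Hom C Y Z" "q \<in> Hom C Z Y" "q \<cdot> j = ide C Y"
    using assms(2) unfolding retract_def by blast
  have "(p \<cdot> q) \<cdot> (j \<cdot> i) = p \<cdot> ((q \<cdot> j) \<cdot> i)"
    using comp_assoc[OF comp_closed[OF 1(1) 2(1)] 2(2) 1(2)] comp_assoc[OF 1(1) 2(1) 2(2)] by simp
  also have "\<dots> = ide C X" using 1 2(3) comp_ide by simp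
  finally show ?thesis using 1 2 comp_closed unfolding retract_def by blast
qed

lemma hz_retract_left:
  assumes "retract X S" "hz S Y"
  shows "hz X Y"
proof -
  obtain i p where 1: "i \<in> Hom C X S" "p \<in> Hom C S X" "p \<cdot> i = ide C X"
    using assms(1) unfolding retract_def by blast
  show ?thesis
  proof (rule hzI)
    show "X \<in> obj C" "Y \<in> obj C" using assms hz_obj retract_obj by blast+
    fix f assume f: "f \<in> Hom C X Y"
    have "f = (f \<cdot> p) \<cdot> i" using comp_assoc[OF 1(1,2) f] 1(3) comp_ide[OF f] by simp
    also have "f \<cdot> p = zer S Y" using assms(2) hzD f 1 comp_closed by blast
    finally show "f = zer X Y" using 1 f comp_zer_left Hom_obj by metis
  qed
qed

lemma direct_sum_retract:
  assumes "is_direct_sum C X Y S"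
  shows "retract X S" "retract Y S"
  using assms unfolding is_direct_sum_def retract_def by blast+

lemma direct_sum_hz:
  assumes "is_direct_sum C X Y S" 
  shows "hz X P \<Longrightarrow> hz Y P \<Longrightarrow> hz S P" and "hz P X \<Longrightarrow> hz P Y \<Longrightarrow> hz P S"
proof -
  obtain i j p q where 1: "i \<in> Hom C X S" "j \<in> Hom C Y S" "p \<in> Hom C S X" "q \<in> Hom C S Y"
    "i \<cdot> p \<boxplus> j \<cdot> q = ide C S" using assms unfolding is_direct_sum_def by blast
  have S: "S \<in> obj C" using 1 Hom_obj by blast
  have ip: "i \<cdot> p \<in> Hom C S S" "j \<cdot> q \<in> Hom C S S" using 1 comp_closed by blast+
  show "hz S P" if h: "hz X P" "hz Y P"
  proof (rule hzI[OF S])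
    show P: "P \<in> obj C" using h hz_obj by blast
    fix f assume f: "f \<in> Hom C S P"
    have "f = f \<cdot> (i \<cdot> p \<boxplus> j \<cdot> q)" using 1 f comp_ide by simp
    also have "\<dots> = (f \<cdot> i) \<cdot> p \<boxplus> (f \<cdot> j) \<cdot> q" 
      using comp_add_right[OF ip f] comp_assoc[OF 1(3,1) f] comp_assoc[OF 1(4,2) f] by simp
    also have "f \<cdot> i = zer X P" using h hzD f 1 comp_closed by blast
    also have "f \<cdot> j = zer Y P" using h hzD f 1 comp_closed by blast
    finally show "f = zer S P" using comp_zer_left 1 P S add_zer zer_Hom by metis
  qed
  show "hz P S" if h: "hz P X" "hz P Y"
  proof (rule hzI[OF _ S])
    show P: "P \<in> obj C" using h hz_obj by blast
    fix f assume f: "f \<in> Hom C P S"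
    have "f = (i \<cdot> p \<boxplus> j \<cdot> q) \<cdot> f" using 1 f comp_ide by simp
    also have "\<dots> = i \<cdot> (p \<cdot> f) \<boxplus> j \<cdot> (q \<cdot> f)" 
      using comp_add_left[OF f ip] comp_assoc[OF f 1(3,1)] comp_assoc[OF f 1(4,2)] by simp
    also have "p \<cdot> f = zer P X" using h hzD f 1 comp_closed by blast
    also have "q \<cdot> f = zer P Y" using h hzD f 1 comp_closed by blast
    finally show "f = zer P S" using comp_zer_right 1 P S add_zer zer_Hom by metis
  qed
qed

lemma smd_retract: "X \<in> smd C U \<Longrightarrow> \<exists>S\<in>U. retract X S"
  unfolding smd_def using direct_sum_retract by blast

lemma direct_sum_zero:
  assumes "X \<in> obj C" "is_zero C Z"
  shows "is_direct_sum C X Z X"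
proof -
  have Z: "Z \<in> obj C" "ide C Z = zer Z Z" using assms by (auto simp: is_zero_def)
  note z = zer_Hom[OF assms(1) Z(1)] zer_Hom[OF Z(1) assms(1)] and I = ide[OF assms(1)]
  have "zer X Z \<cdot> zer Z X = ide C Z" using comp_zer_left[OF Z(1) z(2)] Z(2) by simp
  moreover have "zer Z X \<cdot> zer X Z = zer X X" using comp_zer_left[OF assms(1) z(1)] .
  ultimately show ?thesis unfolding is_direct_sum_def
    using I z comp_ide[OF I] comp_ide[OF z(1)] comp_ide[OF z(2)] add_zer(1)[OF I]
    by (intro bexI[of _ "ide C X"] bexI[of _ "zer Z X"] bexI[of _ "zer X Z"]) auto
qed

lemma coproduct_eq:
  assumes "is_coproduct C I X S \<iota>" "h \<in> Hom C S Y" "h' \<in> Hom C S Y" "\<And>i. i \<in> I \<Longrightarrow> h \<cdot> \<iota> i = h' \<cdot> \<iota> i"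
  shows "h = h'"
proof -
  have Y: "Y \<in> obj C" using assms Hom_obj by blast
  have "\<forall>i\<in>I. h \<cdot> \<iota> i \<in> Hom C (X i) Y" using assms comp_closed unfolding is_coproduct_def by blast
  then have "\<exists>!k. k \<in> Hom C S Y \<and> (\<forall>i\<in>I. k \<cdot> \<iota> i = h \<cdot> \<iota> i)"
    using assms(1) Y unfolding is_coproduct_def by (auto dest!: bspec[of _ _ Y] spec[of _ "\<lambda>i. h \<cdot> \<iota> i"])
  then show ?thesis using assms by metis
qed

lemma coproduct_ex:
  assumes "is_coproduct C I X S \<iota>" "Y \<in> obj C" "\<And>i. i \<in> I \<Longrightarrow> f i \<in> Hom C (X i) Y"
  shows "\<exists>h\<in>Hom C S Y. \<forall>i\<in>I. h \<cdot> \<iota> i = f i"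
  using assms unfolding is_coproduct_def by metis

lemma coproduct_Hom: "is_coproduct C I X S \<iota> \<Longrightarrow> i \<in> I \<Longrightarrow> \<iota> i \<in> Hom C (X i) S"
  and coproduct_obj: "is_coproduct C I X S \<iota> \<Longrightarrow> S \<in> obj C"
  by (auto simp: is_coproduct_def)

end

section \<open>Triangulated categories\<close>

text \<open>The common form of \<open>shift\<close> and \<open>shift_arr\<close>, so that the group
  law of integral powers of a bijection is proved once for both.\<close>

definition zpow :: "('b \<Rightarrow> 'b) \<Rightarrow> 'b set \<Rightarrow> int \<Rightarrow> 'b \<Rightarrow> 'b" where
  "zpow f A n x = (if n \<ge> 0 then (f ^^ nat n) x else (inv_into A f ^^ nat (- n)) x)"

context
  fixes f :: "'b \<Rightarrow> 'b" and A
  assumes bij: "bij_betw f A A"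
begin

lemma zpow_0 [simp]: "zpow f A 0 x = x"
  by (simp add: zpow_def)

lemma zpow_mem: "x \<in> A \<Longrightarrow> zpow f A n x \<in> A"
proof -
  have "(f ^^ k) x \<in> A" if "x \<in> A" for k using bij that by (induction k) (auto dest: bij_betwE)
  moreover have "(inv_into A f ^^ k) x \<in> A" if "x \<in> A" for k
    using bij_betw_inv_into[OF bij] that by (induction k) (auto dest: bij_betwE)
  ultimately show "x \<in> A \<Longrightarrow> zpow f A n x \<in> A" by (simp add: zpow_def)
qed

lemma zpow_succ: "x \<in> A \<Longrightarrow> zpow f A (n + 1) x = f (zpow f A n x)"
proof (cases "n \<ge> 0")
  case True
  then have "nat (n + 1) = Suc (nat n)" by simp
  then show ?thesis using True by (simp add: zpow_def)
next
  case False
  assume x: "x \<in> A"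
  define k where "k = nat (- n - 1)"
  have k: "nat (- n) = Suc k" "n + 1 = - int k" using False by (auto simp: k_def)
  have "(inv_into A f ^^ k) x \<in> A" 
    using bij_betw_inv_into[OF bij] x by (induction k) (auto dest: bij_betwE)
  then have "f (inv_into A f ((inv_into A f ^^ k) x)) = (inv_into A f ^^ k) x"
    using bij by (simp add: bij_betw_inv_into_right)
  then have 1: "f (zpow f A n x) = (inv_into A f ^^ k) x" using False k(1) by (simp add: zpow_def)
  show ?thesis
  proof (cases "k = 0")
    case True then show ?thesis using 1 k by (simp add: zpow_def)
  next
    case False then show ?thesis using 1 k by (simp add: zpow_def)
  qed
qed

lemma zpow_inj: "x \<in> A \<Longrightarrow> y \<in> A \<Longrightarrow> f x = f y \<Longrightarrow> x = y"
  using bij by (auto simp: bij_betw_def inj_on_def)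

lemma zpow_add: "x \<in> A \<Longrightarrow> zpow f A (m + n) x = zpow f A m (zpow f A n x)"
proof (induction m rule: int_induct[where k = 0])
  case base then show ?case by simp
next
  case (step1 i)
  have "zpow f A (i + n + 1) x = f (zpow f A (i + n) x)" using step1 by (intro zpow_succ)
  also have "\<dots> = zpow f A (i + 1) (zpow f A n x)" using step1 zpow_succ[OF zpow_mem] by simp
  finally show ?case by (simp add: algebra_simps)
next
  case (step2 i)
  have "f (zpow f A (i - 1 + n) x) = zpow f A (i - 1 + n + 1) x" using zpow_succ[OF step2(3), of "i - 1 + n"] by (simp add: algebra_simps)
  also have "\<dots> = zpow f A (i - 1 + 1) (zpow f A n x)" using step2 by simp
  also have "\<dots> = f (zpow f A (i - 1) (zpow f A n x))" using zpow_succ[OF zpow_mem] step2 by blast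
  finally show ?case using zpow_inj zpow_mem step2 by blast
qed

end

lemma shift_zpow: "shift T n X = zpow (susp T) (obj T) n X"
  and shift_arr_zpow: "shift_arr T n f = zpow (susp_arr T) (arr T) n f"
  by (auto simp: shift_def shift_arr_def zpow_def)

context R_linear_triangulated_category
begin

notation add (infixl \<open>\<boxplus>\<close> 65)
notation sub (infixl \<open>\<boxminus>\<close> 65)

section \<open>Additivity and iteration of the suspension\<close>

lemma susp_obj: "X \<in> obj T \<Longrightarrow> susp T X \<in> obj T"
  using susp_bij bij_betwE by blast

lemma susp_inj_obj: "X \<in> obj T \<Longrightarrow> Y \<in> obj T \<Longrightarrow> susp T X = susp T Y \<Longrightarrow> X = Y"
  using susp_bij by (auto simp: bij_betw_def inj_on_def)

lemma desusp_obj: "X \<in> obj T \<Longrightarrow> \<exists>Y\<in>obj T. susp T Y = X"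
  using susp_bij unfolding bij_betw_def by (metis imageE)

lemma susp_Hom: "f \<in> Hom T X Y \<Longrightarrow> susp_arr T f \<in> Hom T (susp T X) (susp T Y)"
  using susp_arr_bij Hom_obj bij_betwE by blast

lemma desusp_Hom:
  "X \<in> obj T \<Longrightarrow> Y \<in> obj T \<Longrightarrow> g \<in> Hom T (susp T X) (susp T Y) \<Longrightarrow> \<exists>f\<in>Hom T X Y. susp_arr T f = g"
  using susp_arr_bij[of X Y] unfolding bij_betw_def by (metis imageE)

lemma susp_inj: "f \<in> Hom T X Y \<Longrightarrow> g \<in> Hom T X Y \<Longrightarrow> susp_arr T f = susp_arr T g \<Longrightarrow> f = g"
  using susp_arr_bij[of X Y] Hom_obj unfolding bij_betw_def inj_on_def by blast

lemma susp_zer: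
  assumes "X \<in> obj T" "Y \<in> obj T"
  shows "susp_arr T (zer X Y) = zer (susp T X) (susp T Y)"
proof -
  note z = zer_Hom[OF assms]
  have "susp_arr T (zer X Y) \<boxplus> susp_arr T (zer X Y) = susp_arr T (zer X Y)"
    using susp_add[OF z z] add_zer(1)[OF z] by simp
  then show ?thesis using add_eq_zer_imp[OF susp_Hom[OF z] susp_Hom[OF z]] by simp
qed

lemma susp_neg:
  assumes f: "f \<in> Hom T X Y"
  shows "susp_arr T (neg f) = neg (susp_arr T f)"
proof (rule neg_unique)
  show "susp_arr T (neg f) \<in> Hom T (susp T X) (susp T Y)" "susp_arr T f \<in> Hom T (susp T X) (susp T Y)"
    using susp_Hom[OF neg_Hom[OF f]] susp_Hom[OF f] .
  show "susp_arr T (neg f) \<boxplus> susp_arr T f = zer (susp T X) (susp T Y)"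
    using susp_add[OF neg_Hom[OF f] f] add_neg(2)[OF f] susp_zer Hom_obj[OF f] by simp
qed

lemma susp_sub: "f \<in> Hom T X Y \<Longrightarrow> g \<in> Hom T X Y \<Longrightarrow> susp_arr T (f \<boxminus> g) = susp_arr T f \<boxminus> susp_arr T g"
  unfolding sub_def using susp_add susp_neg neg_Hom by metis

lemma susp_eq_zer: "f \<in> Hom T X Y \<Longrightarrow> susp_arr T f = zer (susp T X) (susp T Y) \<Longrightarrow> f = zer X Y"
  using susp_inj susp_zer zer_Hom Hom_obj by metis

text \<open>The axioms give bijectivity only between the groups \<open>Hom T X Y\<close>; source and
  target are recovered from injectivity on objects. This makes the \<open>inv_into\<close> in
  \<open>shift_arr\<close> a genuine inverse.\<close>

lemma susp_arr_bij_arr: "bij_betw (susp_arr T) (arr T) (arr T)"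
  unfolding bij_betw_def
proof
  show "inj_on (susp_arr T) (arr T)"
  proof (rule inj_onI)
    fix f g assume fg: "f \<in> arr T" "g \<in> arr T" "susp_arr T f = susp_arr T g"
    note F = susp_Hom[OF arr_Hom[OF fg(1)]] and G = susp_Hom[OF arr_Hom[OF fg(2)]]
    have "susp T (src T f) = susp T (src T g)" "susp T (tgt T f) = susp T (tgt T g)"
      using HomD[OF F] HomD[OF G] fg(3) by auto
    then have "src T f = src T g" "tgt T f = tgt T g" using susp_inj_obj src_tgt fg(1,2) by blast+
    then show "f = g" using susp_inj arr_Hom fg by metis
  qed
  have "g \<in> susp_arr T ` arr T" if g: "g \<in> arr T" for g
  proof -
    obtain X Y where "X \<in> obj T" "susp T X = src T g" "Y \<in> obj T" "susp T Y = tgt T g"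
      using desusp_obj src_tgt[OF g] by metis
    then obtain f where "f \<in> Hom T X Y" "susp_arr T f = g" using desusp_Hom arr_Hom[OF g] by metis
    then show ?thesis using HomD by blast
  qed
  moreover have "susp_arr T f \<in> arr T" if "f \<in> arr T" for f
    using HomD susp_Hom arr_Hom that by metis
  ultimately show "susp_arr T ` arr T = arr T" by blast
qed

abbreviation sh where "sh \<equiv> shift T"
abbreviation sha where "sha \<equiv> shift_arr T"

lemma shift_0 [simp]: "sh 0 X = X" "sha 0 f = f"
  by (simp_all add: shift_def shift_arr_def)
lemma shift_1 [simp]: "sh 1 X = susp T X" "sha 1 f = susp_arr T f"
  by (simp_all add: shift_def shift_arr_def)
lemma shift_obj: "X \<in> obj T \<Longrightarrow> sh n X \<in> obj T"
  unfolding shift_zpow by (rule zpow_mem[OF susp_bij])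
lemma shift_succ: "X \<in> obj T \<Longrightarrow> sh (n + 1) X = susp T (sh n X)"
  unfolding shift_zpow by (rule zpow_succ[OF susp_bij])
lemma shift_add: "X \<in> obj T \<Longrightarrow> sh (m + n) X = sh m (sh n X)"
  unfolding shift_zpow by (rule zpow_add[OF susp_bij])
lemma shift_inverse: "X \<in> obj T \<Longrightarrow> sh (- n) (sh n X) = X" "X \<in> obj T \<Longrightarrow> sh n (sh (- n) X) = X"
  using shift_add[of X "- n" n] shift_add[of X n "- n"] by simp_all
lemma shift_arr_succ: "f \<in> arr T \<Longrightarrow> sha (n + 1) f = susp_arr T (sha n f)"
  unfolding shift_arr_zpow by (rule zpow_succ[OF susp_arr_bij_arr])
lemma shift_arr_add: "f \<in> arr T \<Longrightarrow> sha (m + n) f = sha m (sha n f)"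
  unfolding shift_arr_zpow by (rule zpow_add[OF susp_arr_bij_arr])
lemma shift_arr_inverse: "f \<in> arr T \<Longrightarrow> sha (- n) (sha n f) = f" "f \<in> arr T \<Longrightarrow> sha n (sha (- n) f) = f"
  using shift_arr_add[of f "- n" n] shift_arr_add[of f n "- n"] by simp_all
lemma shift_arr_mem: "f \<in> arr T \<Longrightarrow> sha n f \<in> arr T"
  unfolding shift_arr_zpow by (rule zpow_mem[OF susp_arr_bij_arr])

lemma shift_Hom:
  assumes f: "f \<in> Hom T X Y"
  shows "sha n f \<in> Hom T (sh n X) (sh n Y)"
proof (induction n rule: int_induct[where k = 0])
  case base then show ?case using f by simp
next
  case (step1 i)
  then show ?case using susp_Hom[OF step1(2)] shift_succ shift_arr_succ Hom_obj[OF f] HomD[OF f] by simp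
next
  case (step2 i)
  have XY: "X \<in> obj T" "Y \<in> obj T" "f \<in> arr T" using Hom_obj[OF f] HomD[OF f] by auto
  have "sh i X = susp T (sh (i - 1) X)" "sh i Y = susp T (sh (i - 1) Y)"
    using shift_succ[of _ "i - 1"] XY by simp_all
  moreover have e: "sha i f = susp_arr T (sha (i - 1) f)" using shift_arr_succ[of f "i - 1"] XY by simp
  ultimately obtain g where g: "g \<in> Hom T (sh (i - 1) X) (sh (i - 1) Y)" "susp_arr T g = sha i f"
    using desusp_Hom[OF shift_obj[OF XY(1)] shift_obj[OF XY(2)]] step2(2) by metis
  then have "g = sha (i - 1) f"
    using zpow_inj[OF susp_arr_bij_arr] e HomD shift_arr_mem[OF XY(3)] by metis
  then show ?case using g by simp
qed

text \<open>Upwards both families are determined by suspension, downwards by its faithfulness. All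
  functoriality statements for \<open>shift_arr\<close> reduce to this.\<close>

lemma shift_preserves:
  assumes "\<And>n. a n \<in> Hom T (sh n X) (sh n Y)" "\<And>n. b n \<in> Hom T (sh n X) (sh n Y)" "X \<in> obj T" "Y \<in> obj T"
    and "a 0 = b 0" "\<And>n. a (n + 1) = susp_arr T (a n)" "\<And>n. b (n + 1) = susp_arr T (b n)"
  shows "a n = b n"
proof (induction n rule: int_induct[where k = 0])
  case base then show ?case using assms by simp
next
  case (step1 i) then show ?case using assms by simp
next
  case (step2 i)
  have "susp_arr T (a (i - 1)) = susp_arr T (b (i - 1))" using assms(6,7)[of "i - 1"] step2 by simp
  then show ?case using susp_inj[OF assms(1,2)] by blast
qed

lemma shift_comp:
  assumes f: "f \<in> Hom T X Y" and g: "g \<in> Hom T Y Z"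
  shows "sha n (g \<cdot> f) = sha n g \<cdot> sha n f"
proof (rule shift_preserves[where a = "\<lambda>n. sha n (g \<cdot> f)" and b = "\<lambda>n. sha n g \<cdot> sha n f"])
  fix n
  show "sha (n + 1) (g \<cdot> f) = susp_arr T (sha n (g \<cdot> f))"
    using shift_arr_succ HomD[OF comp_closed[OF f g]] by simp
  show "sha (n + 1) g \<cdot> sha (n + 1) f = susp_arr T (sha n g \<cdot> sha n f)"
    using shift_arr_succ HomD[OF f] HomD[OF g] susp_comp[OF shift_Hom[OF f] shift_Hom[OF g]] by simp
  show "sha n (g \<cdot> f) \<in> Hom T (sh n X) (sh n Z)" using shift_Hom[OF comp_closed[OF f g]] .
  show "sha n g \<cdot> sha n f \<in> Hom T (sh n X) (sh n Z)" using comp_closed[OF shift_Hom[OF f] shift_Hom[OF g]] .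
qed (use Hom_obj[OF f] Hom_obj[OF g] in auto)

lemma shift_arr_plus:
  assumes f: "f \<in> Hom T X Y" and g: "g \<in> Hom T X Y"
  shows "sha n (f \<boxplus> g) = sha n f \<boxplus> sha n g"
proof (rule shift_preserves[where a = "\<lambda>n. sha n (f \<boxplus> g)" and b = "\<lambda>n. sha n f \<boxplus> sha n g"])
  fix n
  show "sha (n + 1) (f \<boxplus> g) = susp_arr T (sha n (f \<boxplus> g))"
    using shift_arr_succ HomD[OF add_Hom[OF f g]] by simp
  show "sha (n + 1) f \<boxplus> sha (n + 1) g = susp_arr T (sha n f \<boxplus> sha n g)"
    using shift_arr_succ HomD[OF f] HomD[OF g] susp_add[OF shift_Hom[OF f] shift_Hom[OF g]] by simp
  show "sha n (f \<boxplus> g) \<in> Hom T (sh n X) (sh n Y)" using shift_Hom[OF add_Hom[OF f g]] .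
  show "sha n f \<boxplus> sha n g \<in> Hom T (sh n X) (sh n Y)" using add_Hom[OF shift_Hom[OF f] shift_Hom[OF g]] .
qed (use Hom_obj[OF f] Hom_obj[OF g] in auto)

lemma shift_ide:
  assumes X: "X \<in> obj T"
  shows "sha n (ide T X) = ide T (sh n X)"
proof (rule shift_preserves[where a = "\<lambda>n. sha n (ide T X)" and b = "\<lambda>n. ide T (sh n X)"])
  fix n
  show "sha (n + 1) (ide T X) = susp_arr T (sha n (ide T X))"
    using shift_arr_succ HomD[OF ide[OF X]] by simp
  show "ide T (sh (n + 1) X) = susp_arr T (ide T (sh n X))"
    using shift_succ[OF X] susp_ide[OF shift_obj[OF X]] by simp
  show "sha n (ide T X) \<in> Hom T (sh n X) (sh n X)" using shift_Hom[OF ide[OF X]] .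
  show "ide T (sh n X) \<in> Hom T (sh n X) (sh n X)" using ide[OF shift_obj[OF X]] .
qed (use X in auto)

lemma shift_zer:
  assumes "X \<in> obj T" "Y \<in> obj T"
  shows "sha n (zer X Y) = zer (sh n X) (sh n Y)"
proof -
  note z = zer_Hom[OF assms]
  have "sha n (zer X Y) \<boxplus> sha n (zer X Y) = sha n (zer X Y)"
    using shift_arr_plus[OF z z] add_zer(1)[OF z] by simp
  then show ?thesis using add_eq_zer_imp[OF shift_Hom[OF z] shift_Hom[OF z]] by simp
qed

lemma unshift_Hom:
  assumes "g \<in> Hom T (sh n X) (sh n Y)" "X \<in> obj T" "Y \<in> obj T"
  shows "\<exists>f\<in>Hom T X Y. sha n f = g"
  using shift_Hom[OF assms(1), of "- n"] shift_inverse assms shift_arr_inverse(2) HomD[OF assms(1)] by metis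

lemma shift_inj: "f \<in> Hom T X Y \<Longrightarrow> g \<in> Hom T X Y \<Longrightarrow> sha n f = sha n g \<Longrightarrow> f = g"
  using shift_arr_inverse(1) HomD by metis

lemma hz_shift_iff:
  assumes "X \<in> obj T" "Y \<in> obj T"
  shows "hz (sh n X) (sh n Y) \<longleftrightarrow> hz X Y"
proof
  assume h: "hz (sh n X) (sh n Y)"
  show "hz X Y" using assms shift_inj[OF _ zer_Hom[OF assms]] hzD[OF h shift_Hom] shift_zer[OF assms] by (intro hzI) auto
next
  assume h: "hz X Y"
  show "hz (sh n X) (sh n Y)"
    using assms unshift_Hom[OF _ assms] hzD[OF h] shift_zer[OF assms] shift_obj by (intro hzI) metis+
qed

lemma hz_shift_left: 
  assumes "X \<in> obj T" "Y \<in> obj T" shows "hz (sh n X) Y \<longleftrightarrow> hz X (sh (- n) Y)"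
  using hz_shift_iff[OF assms(1) shift_obj[OF assms(2)], of n "- n"] shift_inverse assms by simp

lemma retract_shift:
  assumes "retract X S"
  shows "retract (sh n X) (sh n S)"
proof -
  obtain i p where 1: "i \<in> Hom T X S" "p \<in> Hom T S X" "p \<cdot> i = ide T X"
    using assms(1) unfolding retract_def by blast
  have "sha n p \<cdot> sha n i = ide T (sh n X)"
    using shift_comp[OF 1(1,2)] 1(3) shift_ide retract_obj[OF assms] by metis
  then show ?thesis using 1 shift_Hom unfolding retract_def by blast
qed

subsection \<open>Exactness\<close>

lemma triangle_Hom:
  assumes "triangle T X Y Z f g h"
  shows "f \<in> Hom T X Y" "g \<in> Hom T Y Z" "h \<in> Hom T Z (susp T X)"
  using assms by (auto simp: triangle_def candidate_triangle_def)

lemma triangle_obj: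
  assumes "triangle T X Y Z f g h"
  shows "X \<in> obj T" "Y \<in> obj T" "Z \<in> obj T"
  using triangle_Hom[OF assms] Hom_obj by blast+

lemma rotate_iff:
  assumes "f \<in> Hom T X Y" "g \<in> Hom T Y Z" "h \<in> Hom T Z (susp T X)"
  shows "triangle T X Y Z f g h \<longleftrightarrow> triangle T Y Z (susp T X) g h (neg (susp_arr T f))"
  using triangle_rotate[of X Y Z f g h] neg_eq[OF susp_Hom[OF assms(1)]] assms
  by (simp add: candidate_triangle_def)

lemma rotate: "triangle T X Y Z f g h \<Longrightarrow> triangle T Y Z (susp T X) g h (neg (susp_arr T f))"
  by (simp add: rotate_iff[symmetric] triangle_Hom)

lemma triangle_zero1:
  assumes t: "triangle T X Y Z f g h"
  shows "g \<cdot> f = zer X Z"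
proof -
  obtain O' where O': "is_zero T O'" using zero_object by blast
  note XYZ = triangle_obj[OF t] and F = triangle_Hom[OF t]
  have t0: "triangle T X X O' (ide T X) (zer X O') (zer O' (susp T X))"
    using triangle_ide[OF XYZ(1) O'] .
  obtain c where c: "c \<in> Hom T O' Z" "g \<cdot> f = c \<cdot> zer X O'"
    using triangle_map[OF t0 t ide[OF XYZ(1)] F(1)] by blast
  then show ?thesis using comp_zer_right XYZ(1) by simp
qed

lemma triangle_zero2: "triangle T X Y Z f g h \<Longrightarrow> h \<cdot> g = zer Y (susp T X)"
  using triangle_zero1 rotate by blast

lemma triangle_zero3:
  assumes t: "triangle T X Y Z f g h"
  shows "susp_arr T f \<cdot> h = zer Z (susp T Y)"
proof -
  note F = triangle_Hom[OF t]
  have "neg (susp_arr T f) \<cdot> h = zer Z (susp T Y)" using triangle_zero2[OF rotate[OF t]] by simp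
  then have "neg (susp_arr T f \<cdot> h) = zer Z (susp T Y)" using comp_neg_left[OF F(3) susp_Hom[OF F(1)]] by simp
  then show ?thesis using neg_eq_zer comp_closed[OF F(3) susp_Hom[OF F(1)]] by blast
qed

text \<open>The fill-in axiom produces the third arrow of a map of triangles, whereas an arrow into
  the first vertex is wanted. Both triangles are therefore rotated, the third vertices become
  suspensions, and the result is desuspended; the two signs cancel.\<close>

lemma exact_cov:
  assumes t: "triangle T X Y Z f g h" and x: "x \<in> Hom T P Y" and gx: "g \<cdot> x = zer P Z"
  shows "\<exists>x'\<in>Hom T P X. f \<cdot> x' = x"
proof -
  obtain O' where O': "is_zero T O'" using zero_object by blast
  note XYZ = triangle_obj[OF t] and F = triangle_Hom[OF t]
  have P: "P \<in> obj T" "O' \<in> obj T" using Hom_obj[OF x] O' by (auto simp: is_zero_def)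
  note t0 = rotate[OF triangle_ide[OF P(1) O']]
  have "g \<cdot> x = zer O' Z \<cdot> zer P O'"
    using gx comp_zer_left[OF XYZ(3) zer_Hom[OF P]] by simp
  then obtain c where c: "c \<in> Hom T (susp T P) (susp T X)"
    "neg (susp_arr T f) \<cdot> c = susp_arr T x \<cdot> neg (susp_arr T (ide T P))"
    using triangle_map[OF t0 rotate[OF t] x zer_Hom[OF P(2) XYZ(3)]] by metis
  obtain x' where x': "x' \<in> Hom T P X" "susp_arr T x' = c"
    using desusp_Hom[OF P(1) XYZ(1) c(1)] by blast
  have "neg (susp_arr T (f \<cdot> x')) = neg (susp_arr T f) \<cdot> c"
    using comp_neg_left[OF c(1) susp_Hom[OF F(1)]] x' susp_comp[OF x'(1) F(1)] by simp
  also have "\<dots> = neg (susp_arr T x)"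
    using c(2) comp_neg_right[OF ide[OF susp_obj[OF P(1)]] susp_Hom[OF x]] susp_ide[OF P(1)]
      comp_ide[OF susp_Hom[OF x]] by simp
  finally have "susp_arr T (f \<cdot> x') = susp_arr T x"
    using neg_neg susp_Hom[OF x] susp_Hom[OF comp_closed[OF x'(1) F(1)]] by metis
  then show ?thesis using x' susp_inj[OF comp_closed[OF x'(1) F(1)] x] by blast
qed

lemma exact_cov2:
  assumes t: "triangle T X Y Z f g h" and x: "x \<in> Hom T P Z" and hx: "h \<cdot> x = zer P (susp T X)"
  shows "\<exists>x'\<in>Hom T P Y. g \<cdot> x' = x"
  using exact_cov[OF rotate[OF t] x hx] .

lemma exact_cov3:
  assumes t: "triangle T X Y Z f g h" and x: "x \<in> Hom T P (susp T X)"
    and fx: "susp_arr T f \<cdot> x = zer P (susp T Y)"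
  shows "\<exists>x'\<in>Hom T P Z. h \<cdot> x' = x"
proof -
  note F = triangle_Hom[OF t]
  have "neg (susp_arr T f) \<cdot> x = zer P (susp T Y)"
    using comp_neg_left[OF x susp_Hom[OF F(1)]] fx neg_zer Hom_obj[OF x] Hom_obj[OF susp_Hom[OF F(1)]] by simp
  then show ?thesis using exact_cov2[OF rotate[OF t] x] by blast
qed

text \<open>Exactness at the first term, with the arrow from
  \<open>\<Sigma>\<^sup>-\<^sup>1Z\<close> to \<open>X\<close> replaced by its suspension
  \<open>h\<close>.\<close>

lemma exact_cov0:
  assumes t: "triangle T X Y Z f g h" and x: "x \<in> Hom T P X" and fx: "f \<cdot> x = zer P Y"
  shows "\<exists>x'\<in>Hom T (susp T P) Z. h \<cdot> x' = susp_arr T x"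
proof (rule exact_cov3[OF t susp_Hom[OF x]])
  show "susp_arr T f \<cdot> susp_arr T x = zer (susp T P) (susp T Y)"
    using susp_comp[OF x triangle_Hom(1)[OF t]] fx susp_zer Hom_obj[OF x] triangle_obj[OF t] by simp
qed

lemma triangle_zero_left:
  assumes "is_zero T O'" and P: "P \<in> obj T"
  shows "triangle T O' P P (zer O' P) (ide T P) (zer P (susp T O'))"
proof -
  have O': "O' \<in> obj T" "ide T O' = zer O' O'" using assms(1) by (auto simp: is_zero_def)
  have SO: "is_zero T (susp T O')"
    using O' susp_ide[OF O'(1)] susp_zer[OF O'(1) O'(1)] susp_obj[OF O'(1)] by (simp add: is_zero_def)
  have "triangle T P P (susp T O') (ide T P) (zer P (susp T O')) (neg (susp_arr T (zer O' P)))"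
    using triangle_ide[OF P SO] susp_zer[OF O'(1) P] neg_zer susp_obj[OF P] susp_obj[OF O'(1)] by simp
  then show ?thesis
    using rotate_iff[OF zer_Hom[OF O'(1) P] ide[OF P] zer_Hom[OF P susp_obj[OF O'(1)]]] by simp
qed

text \<open>Here the fill-in axiom maps the given triangle directly to the one on
  \<open>0 \<rightarrow> P \<rightarrow> P\<close>, and no sign appears.\<close>

lemma exact_contra:
  assumes t: "triangle T X Y Z f g h" and x: "x \<in> Hom T Y P" and xf: "x \<cdot> f = zer X P"
  shows "\<exists>x'\<in>Hom T Z P. x' \<cdot> g = x"
proof -
  obtain O' where O': "is_zero T O'" using zero_object by blast
  note XYZ = triangle_obj[OF t] and F = triangle_Hom[OF t]
  have P: "P \<in> obj T" "O' \<in> obj T" using Hom_obj[OF x] O' by (auto simp: is_zero_def)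
  note t0 = triangle_zero_left[OF O' P(1)]
  have "zer O' P \<cdot> zer X O' = x \<cdot> f"
    using xf comp_zer_left[OF P(1) zer_Hom[OF XYZ(1) P(2)]] by simp
  then obtain c where c: "c \<in> Hom T Z P" "ide T P \<cdot> x = c \<cdot> g"
    using triangle_map[OF t t0 zer_Hom[OF XYZ(1) P(2)] x] by blast
  then show ?thesis using comp_ide[OF x] by auto
qed

lemma exact_contra2:
  assumes t: "triangle T X Y Z f g h" and x: "x \<in> Hom T Z P" and xg: "x \<cdot> g = zer Y P"
  shows "\<exists>x'\<in>Hom T (susp T X) P. x' \<cdot> h = x"
  using exact_contra[OF rotate[OF t] x xg] .

lemma exact_contra3:
  assumes t: "triangle T X Y Z f g h" and x: "x \<in> Hom T (susp T X) P" and xh: "x \<cdot> h = zer Z P"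
  shows "\<exists>x'\<in>Hom T (susp T Y) P. x' \<cdot> susp_arr T f = x"
proof -
  note F = triangle_Hom[OF t]
  obtain y where y: "y \<in> Hom T (susp T Y) P" "y \<cdot> neg (susp_arr T f) = x"
    using exact_contra2[OF rotate[OF t] x xh] by blast
  have "neg y \<cdot> susp_arr T f = y \<cdot> neg (susp_arr T f)"
    using comp_neg_left[OF susp_Hom[OF F(1)] y(1)] comp_neg_right[OF susp_Hom[OF F(1)] y(1)] by simp
  then show ?thesis using y neg_Hom[OF y(1)] by auto
qed

text \<open>The obstruction to extending \<open>x\<close> along \<open>f\<close> is the composite of
  \<open>\<Sigma>x\<close> with \<open>h\<close>. In the main applications it vanishes because
  \<open>Z\<close> has no arrows to the suspended target.\<close>

lemma exact_contra0:
  assumes t: "triangle T X Y Z f g h" and x: "x \<in> Hom T X P" and xh: "susp_arr T x \<cdot> h = zer Z (susp T P)"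
  shows "\<exists>x'\<in>Hom T Y P. x' \<cdot> f = x"
proof -
  note F = triangle_Hom[OF t] and XYZ = triangle_obj[OF t]
  obtain y where y: "y \<in> Hom T (susp T Y) (susp T P)" "y \<cdot> susp_arr T f = susp_arr T x"
    using exact_contra3[OF t susp_Hom[OF x] xh] by blast
  obtain x' where x': "x' \<in> Hom T Y P" "susp_arr T x' = y"
    using desusp_Hom[OF XYZ(2) _ y(1)] Hom_obj[OF x] by blast
  have "susp_arr T (x' \<cdot> f) = susp_arr T x" using susp_comp[OF F(1) x'(1)] x' y by simp
  then show ?thesis using x' susp_inj[OF comp_closed[OF F(1) x'(1)] x] by blast
qed

lemma ext_hz_cov:
  assumes t: "triangle T X Y Z f g h" and "hz P X" "hz P Z"
  shows "hz P Y"
proof (rule hzI)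
  show "P \<in> obj T" "Y \<in> obj T" using assms(2) hz_obj triangle_obj[OF t] by blast+
  fix x assume x: "x \<in> Hom T P Y"
  have "g \<cdot> x = zer P Z" using hzD[OF assms(3) comp_closed[OF x triangle_Hom(2)[OF t]]] .
  then obtain x' where "x' \<in> Hom T P X" "f \<cdot> x' = x" using exact_cov[OF t x] by blast
  then show "x = zer P Y" using hzD[OF assms(2)] comp_zer_right[OF \<open>P \<in> obj T\<close> triangle_Hom(1)[OF t]] by metis
qed

lemma ext_hz_contra:
  assumes t: "triangle T X Y Z f g h" and "hz X P" "hz Z P"
  shows "hz Y P"
proof (rule hzI)
  show "P \<in> obj T" "Y \<in> obj T" using assms(2) hz_obj triangle_obj[OF t] by blast+
  fix x assume x: "x \<in> Hom T Y P"
  have "x \<cdot> f = zer X P" using hzD[OF assms(2) comp_closed[OF triangle_Hom(1)[OF t] x]] .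
  then obtain x' where "x' \<in> Hom T Z P" "x' \<cdot> g = x" using exact_contra[OF t x] by blast
  then show "x = zer Y P" using hzD[OF assms(3)] comp_zer_left[OF \<open>P \<in> obj T\<close> triangle_Hom(2)[OF t]] by metis
qed

text \<open>The three rotations of a triangle compose to the shift with all signs changed; two of the signs can
  be absorbed by the automorphism \<open>-1\<close> of the middle term.\<close>

lemma triangle_susp_iff:
  assumes "f \<in> Hom T X Y" "g \<in> Hom T Y Z" "h \<in> Hom T Z (susp T X)"
  shows "triangle T X Y Z f g h \<longleftrightarrow>
    triangle T (susp T X) (susp T Y) (susp T Z) (susp_arr T f) (susp_arr T g) (neg (susp_arr T h))"
proof -
  note S = susp_Hom[OF assms(1)] susp_Hom[OF assms(2)] susp_Hom[OF assms(3)]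
  note N = neg_Hom[OF S(1)] neg_Hom[OF S(2)] neg_Hom[OF S(3)]
  have 1: "triangle T X Y Z f g h \<longleftrightarrow> triangle T (susp T X) (susp T Y) (susp T Z)
    (neg (susp_arr T f)) (neg (susp_arr T g)) (neg (susp_arr T h))"
    using rotate_iff[OF assms] rotate_iff[OF assms(2,3) N(1)] rotate_iff[OF assms(3) N(1,2)] by simp
  have o: "susp T X \<in> obj T" "susp T Y \<in> obj T" "susp T Z \<in> obj T"
    using Hom_obj[OF S(1)] Hom_obj[OF S(2)] by auto
  note I = ide[OF o(1)] ide[OF o(2)] ide[OF o(3)]
  have i: "iso_arr T (ide T A) A A" if "A \<in> obj T" for A
    unfolding iso_arr_def using ide[OF that] comp_ide[OF ide[OF that]] by auto
  have "neg (ide T (susp T Y)) \<cdot> neg (ide T (susp T Y)) = ide T (susp T Y)"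
    using comp_neg_left[OF neg_Hom[OF I(2)] I(2)] comp_neg_right[OF I(2) I(2)] comp_ide[OF I(2)]
      neg_neg[OF I(2)] comp_ide[OF neg_Hom[OF I(2)]] by simp
  then have n: "iso_arr T (neg (ide T (susp T Y))) (susp T Y) (susp T Y)"
    unfolding iso_arr_def using neg_Hom[OF I(2)] by auto
  have a1: "neg (ide T (susp T Y)) \<cdot> susp_arr T f = neg (susp_arr T f)"
    using comp_neg_left[OF S(1) I(2)] comp_ide[OF S(1)] by simp
  have a2: "neg (ide T (susp T Y)) \<cdot> neg (susp_arr T f) = susp_arr T f"
    using comp_neg_left[OF N(1) I(2)] comp_ide[OF N(1)] neg_neg[OF S(1)] by simp
  have a3: "susp_arr T g \<cdot> neg (ide T (susp T Y)) = neg (susp_arr T g)"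
    using comp_neg_right[OF I(2) S(2)] comp_ide[OF S(2)] by simp
  have a4: "neg (susp_arr T g) \<cdot> neg (ide T (susp T Y)) = susp_arr T g"
    using comp_neg_right[OF I(2) N(2)] comp_ide[OF N(2)] neg_neg[OF S(2)] by simp
  have c: "candidate_triangle T (susp T X) (susp T Y) (susp T Z) (susp_arr T f) (susp_arr T g) (neg (susp_arr T h))"
    "candidate_triangle T (susp T X) (susp T Y) (susp T Z) (neg (susp_arr T f)) (neg (susp_arr T g)) (neg (susp_arr T h))"
    using S N by (auto simp: candidate_triangle_def)
  note J = comp_ide[OF S(1)] comp_ide[OF S(2)] comp_ide[OF N(1)] comp_ide[OF N(2)] comp_ide[OF N(3)] susp_ide[OF o(1)]
  have "triangle T (susp T X) (susp T Y) (susp T Z) (susp_arr T f) (susp_arr T g) (neg (susp_arr T h))"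
    if t: "triangle T (susp T X) (susp T Y) (susp T Z) (neg (susp_arr T f)) (neg (susp_arr T g)) (neg (susp_arr T h))"
    using J a2 a3 by (intro triangle_iso[OF t c(1) i[OF o(1)] n i[OF o(3)]]) simp_all
  moreover have "triangle T (susp T X) (susp T Y) (susp T Z) (neg (susp_arr T f)) (neg (susp_arr T g)) (neg (susp_arr T h))"
    if t: "triangle T (susp T X) (susp T Y) (susp T Z) (susp_arr T f) (susp_arr T g) (neg (susp_arr T h))"
    using J a1 a4 by (intro triangle_iso[OF t c(2) i[OF o(1)] n i[OF o(3)]]) simp_all
  ultimately show ?thesis using 1 by blast
qed

text \<open>The third arrow is left unspecified; this hides the sign that each suspension
  introduces.\<close>

lemma triangle_shift:
  assumes t: "triangle T X Y Z f g h"
  shows "\<exists>h. triangle T (sh n X) (sh n Y) (sh n Z) (sha n f) (sha n g) h"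
proof (induction n rule: int_induct[where k = 0])
  case base then show ?case using t by auto
next
  case (step1 i)
  note F = triangle_Hom[OF t]
  obtain h where h: "triangle T (sh i X) (sh i Y) (sh i Z) (sha i f) (sha i g) h" using step1 by blast
  then show ?case using triangle_susp_iff[OF triangle_Hom[OF h]] shift_succ triangle_obj[OF t] shift_arr_succ HomD[OF F(1)] HomD[OF F(2)]
    by auto
next
  case (step2 i)
  note F = triangle_Hom[OF t] and o = triangle_obj[OF t]
  have s: "sh i W = susp T (sh (i - 1) W)" if "W \<in> obj T" for W using shift_succ[OF that, of "i - 1"] by simp
  have sa: "sha i k = susp_arr T (sha (i - 1) k)" if "k \<in> arr T" for k using shift_arr_succ[OF that, of "i - 1"] by simp
  obtain h where h: "triangle T (susp T (sh (i - 1) X)) (susp T (sh (i - 1) Y)) (susp T (sh (i - 1) Z))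
      (susp_arr T (sha (i - 1) f)) (susp_arr T (sha (i - 1) g)) h"
    using step2 s o sa HomD[OF F(1)] HomD[OF F(2)] by auto
  obtain h' where h': "h' \<in> Hom T (sh (i - 1) Z) (susp T (sh (i - 1) X))" "susp_arr T h' = h"
    using desusp_Hom[OF shift_obj[OF o(3)] susp_obj[OF shift_obj[OF o(1)]] triangle_Hom(3)[OF h]] by blast
  have "neg (susp_arr T (neg h')) = h" using susp_neg[OF h'(1)] neg_neg[OF susp_Hom[OF h'(1)]] h' by simp
  then have "triangle T (sh (i - 1) X) (sh (i - 1) Y) (sh (i - 1) Z) (sha (i - 1) f) (sha (i - 1) g) (neg h')"
    using triangle_susp_iff[OF shift_Hom[OF F(1)] shift_Hom[OF F(2)] neg_Hom[OF h'(1)]] h by simp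
  then show ?case by blast
qed

lemma extensions_shift: "B \<in> extensions T U V \<Longrightarrow> sh n B \<in> extensions T (sh n ` U) (sh n ` V)"
  unfolding extensions_def using triangle_shift by blast

section \<open>Associativity of extensions and split triangles\<close>

lemma triangle_fiber:
  assumes g: "g \<in> Hom T Y Z"
  shows "\<exists>X f h. triangle T X Y Z f g h"
proof -
  obtain W h k where t: "triangle T Y Z W g h k" using triangle_exists[OF g] by blast
  obtain X where X: "X \<in> obj T" "susp T X = W" using desusp_obj triangle_obj[OF t] by blast
  obtain f where f: "f \<in> Hom T X Y" "susp_arr T f = k"
    using desusp_Hom[OF X(1) triangle_obj(1)[OF t]] triangle_Hom(3)[OF t] X(2) by blast
  have "triangle T X Y Z (neg f) g h"
    using t rotate_iff[OF neg_Hom[OF f(1)] g] triangle_Hom(2)[OF t] susp_neg[OF f(1)] f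
      neg_neg[OF susp_Hom[OF f(1)]] X(2) by simp
  then show ?thesis by blast
qed

text \<open>The octahedral axiom for the composite
  \<open>A \<rightarrow> B' \<rightarrow> B\<close>.\<close>

lemma extensions_assoc1:
  assumes "B \<in> extensions T (extensions T U V) W"
  shows "B \<in> extensions T U (extensions T V W)"
proof -
  obtain B' C f g h where t: "B' \<in> extensions T U V" "C \<in> W" "triangle T B' B C f g h"
    using assms unfolding extensions_def by blast
  obtain A D f' g' h' where t': "A \<in> U" "D \<in> V" "triangle T A B' D f' g' h'"
    using t(1) unfolding extensions_def by blast
  obtain Y k' k'' where Y: "triangle T A B Y (f \<cdot> f') k' k''"
    using triangle_exists comp_closed[OF triangle_Hom(1)[OF t'(3)] triangle_Hom(1)[OF t(3)]] by blast
  obtain u v where "triangle T D Y C u v (susp_arr T g' \<cdot> h)" using octahedral[OF t'(3) t(3) Y] by blast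
  then have "Y \<in> extensions T V W" using t t' unfolding extensions_def by blast
  then show ?thesis using Y t'(1) unfolding extensions_def by blast
qed

text \<open>The octahedral axiom for the composite \<open>B \<rightarrow> D \<rightarrow> C\<close>
  of second arrows. It applies after rotation, so the triangle it yields is suspended and has to be
  shifted back.\<close>

lemma extensions_assoc2:
  assumes "B \<in> extensions T U (extensions T V W)"
  shows "B \<in> extensions T (extensions T U V) W"
proof -
  obtain A D f g h where t: "A \<in> U" "D \<in> extensions T V W" "triangle T A B D f g h"
    using assms unfolding extensions_def by blast
  obtain V' C f' g' h' where t': "V' \<in> V" "C \<in> W" "triangle T V' D C f' g' h'"
    using t(2) unfolding extensions_def by blast
  obtain Y k k' where Y: "triangle T Y B C k (g' \<cdot> g) k'"
    using triangle_fiber[OF comp_closed[OF triangle_Hom(2)[OF t(3)] triangle_Hom(2)[OF t'(3)]]] by blast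
  obtain u v w where "triangle T (susp T A) (susp T Y) (susp T V') u v w"
    using octahedral[OF rotate[OF t(3)] rotate[OF t'(3)] rotate[OF Y]] by blast
  then have "\<exists>f g h. triangle T A Y V' f g h"
    using triangle_shift[of _ _ _ _ _ _ "- 1"] triangle_obj[OF t(3)] triangle_obj[OF t'(3)] triangle_obj[OF Y]
      shift_inverse(1)[of _ 1] by fastforce
  then have "Y \<in> extensions T U V" using t t' unfolding extensions_def by blast
  then show ?thesis using Y t'(2) unfolding extensions_def by blast
qed

lemma extensionsI: "triangle T A B D f g h \<Longrightarrow> A \<in> U \<Longrightarrow> D \<in> V \<Longrightarrow> B \<in> extensions T U V"
  unfolding extensions_def by blast

lemma extensions_mono: "U \<subseteq> U' \<Longrightarrow> V \<subseteq> V' \<Longrightarrow> extensions T U V \<subseteq> extensions T U' V'"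
  unfolding extensions_def by blast

lemma extensions_obj: "B \<in> extensions T U V \<Longrightarrow> B \<in> obj T"
  unfolding extensions_def using triangle_obj by blast

lemma smd_self:
  assumes "X \<in> U" "X \<in> obj T"
  shows "X \<in> smd T U"
proof -
  obtain O' where O': "is_zero T O'" using zero_object by blast
  then show ?thesis using direct_sum_zero[OF assms(2) O'] assms unfolding smd_def is_zero_def by blast
qed

text \<open>With \<open>g = 0\<close> the identity of \<open>Y\<close> lifts along
  \<open>f\<close>.\<close>

lemma split_retract:
  assumes t: "triangle T X Y Z f g h" and g: "g = zer Y Z"
  shows "retract Y X"
proof -
  have Y: "Y \<in> obj T" using triangle_obj[OF t] by blast
  have "g \<cdot> ide T Y = zer Y Z" using comp_ide triangle_Hom[OF t] g by blast
  then obtain s where "s \<in> Hom T Y X" "f \<cdot> s = ide T Y" using exact_cov[OF t ide[OF Y]] by blast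
  then show ?thesis using triangle_Hom[OF t] unfolding retract_def by blast
qed

lemma split_retract2:
  assumes t: "triangle T X Y Z f g h" and f: "f = zer X Y"
  shows "retract Y Z"
proof -
  have Y: "Y \<in> obj T" using triangle_obj[OF t] by blast
  have "ide T Y \<cdot> f = zer X Y" using comp_ide triangle_Hom[OF t] f by blast
  then obtain s where "s \<in> Hom T Z Y" "s \<cdot> g = ide T Y" using exact_contra[OF t ide[OF Y]] by blast
  then show ?thesis using triangle_Hom[OF t] unfolding retract_def by blast
qed

end

section \<open>Coproducts and compact objects\<close>

text \<open>Makes sequences into small families: the index sets in
  \<open>has_small_coproducts\<close> and \<open>compacts\<close> are sets over
  \<open>'u\<close>.\<close>

lemma countable_small_range:
  fixes \<kappa> :: "'u rel"
  assumes "regular_uncountable \<kappa>"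
  shows "\<exists>e::nat \<Rightarrow> 'u. inj e \<and> small \<kappa> (range e)"
proof -
  have k: "Card_order \<kappa>" "natLeq <o \<kappa>" using assms by (auto simp: regular_uncountable_def)
  have "|UNIV :: nat set| \<le>o |UNIV :: 'u set|"
    using ordLeq_transitive[OF ordIso_ordLeq_trans[OF card_of_nat ordLess_imp_ordLeq[OF k(2)]]
      ordIso_ordLeq_trans[OF ordIso_symmetric[OF card_of_Field_ordIso[OF k(1)]] card_of_mono1[OF subset_UNIV]]] .
  then have "\<exists>e :: nat \<Rightarrow> 'u. inj_on e UNIV \<and> e ` UNIV \<subseteq> UNIV" by (simp only: card_of_ordLeq)
  then obtain e :: "nat \<Rightarrow> 'u" where e: "inj e" by (elim exE conjE)
  have "|range e| =o |UNIV :: nat set|"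
    using e by (metis card_of_ordIso inj_on_imp_bij_betw ordIso_symmetric)
  then have "small \<kappa> (range e)"
    unfolding small_def using ordIso_ordLess_trans[OF ordIso_transitive[OF _ card_of_nat] k(2)] by blast
  then show ?thesis using e by blast
qed

context R_linear_triangulated_category
begin

text \<open>The arrows into a coproduct that are finite sums of arrows through single summands. By
  \<open>compact_fsums\<close> and \<open>compactI\<close> they stand in for the bijection in the
  definition of \<open>compacts\<close>, and being inductively generated they are easily composed
  and added.\<close>

inductive_set fsums for c I X S \<iota> where
  zero: "zer c S \<in> fsums c I X S \<iota>"
| step: "x \<in> fsums c I X S \<iota> \<Longrightarrow> i \<in> I \<Longrightarrow> \<phi> \<in> Hom T c (X i) \<Longrightarrow> (\<iota> i \<cdot> \<phi>) \<boxplus> x \<in> fsums c I X S \<iota>"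

lemma coproduct_summand_obj: "is_coproduct T I X S \<iota> \<Longrightarrow> i \<in> I \<Longrightarrow> X i \<in> obj T"
  by (drule (1) coproduct_Hom) (simp add: Hom_obj)

lemma coproduct_proj:
  assumes "is_coproduct T I X S \<iota>"
  shows "\<exists>r\<in>Hom T S S. \<forall>i\<in>I. r \<cdot> \<iota> i = (if i \<in> J then \<iota> i else zer (X i) S)"
  using coproduct_Hom[OF assms] zer_Hom coproduct_summand_obj[OF assms] coproduct_obj[OF assms]
  by (intro coproduct_ex[OF assms]) auto

lemma coproduct_pr:
  assumes "is_coproduct T I X S \<iota>" "k \<in> I"
  shows "\<exists>p\<in>Hom T S (X k). \<forall>i\<in>I. p \<cdot> \<iota> i = (if i = k then ide T (X k) else zer (X i) (X k))"
  using zer_Hom coproduct_summand_obj[OF assms(1)] ide assms(2)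
  by (intro coproduct_ex[OF assms(1)]) auto

lemma fsums_Hom:
  assumes "is_coproduct T I X S \<iota>" "c \<in> obj T" "x \<in> fsums c I X S \<iota>"
  shows "x \<in> Hom T c S"
  using assms(3)
proof induction
  case zero then show ?case using zer_Hom[OF assms(2) coproduct_obj[OF assms(1)]] .
next
  case (step x i \<phi>)
  then show ?case using add_Hom[OF comp_closed[OF step(3) coproduct_Hom[OF assms(1) step(2)]]] by blast
qed

lemma fsums_add:
  assumes "is_coproduct T I X S \<iota>" "c \<in> obj T" "x \<in> fsums c I X S \<iota>" and y: "y \<in> fsums c I X S \<iota>"
  shows "x \<boxplus> y \<in> fsums c I X S \<iota>"
  using assms(3)
proof induction
  case zero then show ?case using add_zer(2) fsums_Hom[OF assms(1,2)] y by simp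
next
  case (step x i \<phi>)
  have "(\<iota> i \<cdot> \<phi> \<boxplus> x) \<boxplus> y = \<iota> i \<cdot> \<phi> \<boxplus> (x \<boxplus> y)"
    using add_assoc comp_closed[OF step(3) coproduct_Hom[OF assms(1) step(2)]] fsums_Hom[OF assms(1,2)] step y by blast
  then show ?case using fsums.step step by metis
qed

lemma fsums_precomp:
  assumes "is_coproduct T I X S \<iota>" "x \<in> fsums c I X S \<iota>" "w \<in> Hom T c' c"
  shows "x \<cdot> w \<in> fsums c' I X S \<iota>"
  using assms(2)
proof induction
  case zero then show ?case using comp_zer_left[OF _ assms(3)] coproduct_obj[OF assms(1)] fsums.zero by simp
next
  case (step x i \<phi>)
  note i = coproduct_Hom[OF assms(1) step(2)]
  have "(\<iota> i \<cdot> \<phi> \<boxplus> x) \<cdot> w = \<iota> i \<cdot> (\<phi> \<cdot> w) \<boxplus> x \<cdot> w"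
    using comp_add_left[OF assms(3) comp_closed[OF step(3) i] fsums_Hom[OF assms(1) _ step(1)]]
      comp_assoc[OF assms(3) step(3) i] Hom_obj[OF assms(3)] by simp
  then show ?case using fsums.step step comp_closed[OF assms(3)] by metis
qed

lemma fsums_cong:
  assumes "x \<in> fsums c I X S \<iota>" "\<And>i. i \<in> I \<Longrightarrow> X i = X' i \<and> \<iota> i = \<iota>' i"
  shows "x \<in> fsums c I X' S \<iota>'"
  using assms(1)
proof induction
  case zero then show ?case by (rule fsums.zero)
next
  case (step x i \<phi>) then show ?case using fsums.step[of x c I X' S \<iota>' i \<phi>] assms(2) by simp
qed

text \<open>Stated through the endomorphisms \<open>r\<close> that keep the coordinates in
  \<open>J'\<close> and erase the others: finite support means that such an \<open>r\<close> fixes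
  \<open>x\<close> once \<open>J'\<close> is large.\<close>

lemma fsums_support:
  assumes cp: "is_coproduct T I X S \<iota>" and c: "c \<in> obj T" and "x \<in> fsums c I X S \<iota>"
  shows "\<exists>J\<subseteq>I. finite J \<and> (\<forall>J' r. J \<subseteq> J' \<and> r \<in> Hom T S S \<and> (\<forall>i\<in>I. r \<cdot> \<iota> i = (if i \<in> J' then \<iota> i else zer (X i) S)) \<longrightarrow> r \<cdot> x = x)"
  using assms(3)
proof induction
  case zero then show ?case using comp_zer_right[OF c] by (intro exI[of _ "{}"]) auto
next
  case (step x i \<phi>)
  note i = coproduct_Hom[OF cp step(2)]
  obtain J where J: "J \<subseteq> I" "finite J" "\<And>J' r. J \<subseteq> J' \<Longrightarrow> r \<in> Hom T S S \<Longrightarrow>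
    \<forall>i\<in>I. r \<cdot> \<iota> i = (if i \<in> J' then \<iota> i else zer (X i) S) \<Longrightarrow> r \<cdot> x = x" using step(4) by blast
  have "r \<cdot> (\<iota> i \<cdot> \<phi> \<boxplus> x) = \<iota> i \<cdot> \<phi> \<boxplus> x" if r: "insert i J \<subseteq> J'" "r \<in> Hom T S S"
    "\<forall>i\<in>I. r \<cdot> \<iota> i = (if i \<in> J' then \<iota> i else zer (X i) S)" for J' r
  proof -
    have "r \<cdot> (\<iota> i \<cdot> \<phi> \<boxplus> x) = (r \<cdot> \<iota> i) \<cdot> \<phi> \<boxplus> r \<cdot> x"
      using comp_add_right[OF comp_closed[OF step(3) i] fsums_Hom[OF cp c step(1)] r(2)] comp_assoc[OF step(3) i r(2)] by simp
    then show ?thesis using J(3)[OF _ r(2,3)] r step(2) by simp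
  qed
  then show ?case using J(1,2) step(2) by (intro exI[of _ "insert i J"]) auto
qed

lemma proj_insert:
  assumes cp: "is_coproduct T I X S \<iota>" and k: "k \<in> I" "k \<notin> J"
    and r: "r \<in> Hom T S S" "\<And>i. i \<in> I \<Longrightarrow> r \<cdot> \<iota> i = (if i \<in> insert k J then \<iota> i else zer (X i) S)"
    and p: "p \<in> Hom T S (X k)" "\<And>i. i \<in> I \<Longrightarrow> p \<cdot> \<iota> i = (if i = k then ide T (X k) else zer (X i) (X k))"
    and r': "r' \<in> Hom T S S" "\<And>i. i \<in> I \<Longrightarrow> r' \<cdot> \<iota> i = (if i \<in> J then \<iota> i else zer (X i) S)"
  shows "r = \<iota> k \<cdot> p \<boxplus> r'"
proof (rule coproduct_eq[OF cp r(1)])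
  note ik = coproduct_Hom[OF cp k(1)]
  show "\<iota> k \<cdot> p \<boxplus> r' \<in> Hom T S S" using add_Hom[OF comp_closed[OF p(1) ik] r'(1)] .
  fix i assume i: "i \<in> I"
  note ii = coproduct_Hom[OF cp i]
  have eq: "(\<iota> k \<cdot> p \<boxplus> r') \<cdot> \<iota> i = \<iota> k \<cdot> (p \<cdot> \<iota> i) \<boxplus> r' \<cdot> \<iota> i"
    using comp_add_left[OF ii comp_closed[OF p(1) ik] r'(1)] comp_assoc[OF ii p(1) ik] by simp
  show "r \<cdot> \<iota> i = (\<iota> k \<cdot> p \<boxplus> r') \<cdot> \<iota> i"
  proof (cases "i = k")
    case True
    then show ?thesis using eq r(2)[OF i] p(2)[OF i] r'(2)[OF i] k comp_ide[OF ik] add_zer(1)[OF ik] by simp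
  next
    case False
    have "\<iota> k \<cdot> zer (X i) (X k) = zer (X i) S" using comp_zer_right[OF _ ik] coproduct_summand_obj[OF cp i] by simp
    moreover have "zer (X i) S \<boxplus> r' \<cdot> \<iota> i = r' \<cdot> \<iota> i" using add_zer(2)[OF comp_closed[OF ii r'(1)]] .
    ultimately show ?thesis using eq r(2)[OF i] p(2)[OF i] r'(2)[OF i] False by simp
  qed
qed

lemma proj_fsums:
  assumes cp: "is_coproduct T I X S \<iota>" and x: "x \<in> Hom T c S" and "finite J"
  shows "J \<subseteq> I \<Longrightarrow> r \<in> Hom T S S \<Longrightarrow> (\<And>i. i \<in> I \<Longrightarrow> r \<cdot> \<iota> i = (if i \<in> J then \<iota> i else zer (X i) S)) \<Longrightarrow>
    r \<cdot> x \<in> fsums c I X S \<iota>"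
  using assms(3)
proof (induction J arbitrary: r rule: finite_induct)
  case empty
  have "r = zer S S"
  proof (rule coproduct_eq[OF cp empty(2)])
    show "zer S S \<in> Hom T S S" using zer_Hom coproduct_obj[OF cp] by blast
    fix i assume i: "i \<in> I"
    show "r \<cdot> \<iota> i = zer S S \<cdot> \<iota> i"
      using empty(3)[OF i] comp_zer_left[OF coproduct_obj[OF cp] coproduct_Hom[OF cp i]] by simp
  qed
  then show ?case using comp_zer_left[OF coproduct_obj[OF cp] x] fsums.zero by simp
next
  case (insert k J)
  have k: "k \<in> I" using insert by blast
  note ik = coproduct_Hom[OF cp k]
  obtain p where p: "p \<in> Hom T S (X k)" "\<And>i. i \<in> I \<Longrightarrow> p \<cdot> \<iota> i = (if i = k then ide T (X k) else zer (X i) (X k))"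
    using coproduct_pr[OF cp k] by blast
  obtain r' where r': "r' \<in> Hom T S S" "\<And>i. i \<in> I \<Longrightarrow> r' \<cdot> \<iota> i = (if i \<in> J then \<iota> i else zer (X i) S)"
    using coproduct_proj[OF cp, of J] by blast
  have "r \<cdot> x = \<iota> k \<cdot> (p \<cdot> x) \<boxplus> r' \<cdot> x"
    using proj_insert[OF cp k insert(2) insert(5,6) p r'] comp_add_left[OF x comp_closed[OF p(1) ik] r'(1)]
      comp_assoc[OF x p(1) ik] by simp
  then show ?case using fsums.step[OF insert.IH[OF _ r'] k comp_closed[OF x p(1)]] insert(4) by simp
qed

lemma proj_zero:
  assumes cp: "is_coproduct T I X S \<iota>" and x: "x \<in> Hom T c S" and "finite J"
    and z: "\<And>k p. k \<in> I \<Longrightarrow> p \<in> Hom T S (X k) \<Longrightarrow>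
      (\<And>i. i \<in> I \<Longrightarrow> p \<cdot> \<iota> i = (if i = k then ide T (X k) else zer (X i) (X k))) \<Longrightarrow> p \<cdot> x = zer c (X k)"
  shows "J \<subseteq> I \<Longrightarrow> r \<in> Hom T S S \<Longrightarrow> (\<And>i. i \<in> I \<Longrightarrow> r \<cdot> \<iota> i = (if i \<in> J then \<iota> i else zer (X i) S)) \<Longrightarrow>
    r \<cdot> x = zer c S"
  using assms(3)
proof (induction J arbitrary: r rule: finite_induct)
  case empty
  have "r = zer S S"
  proof (rule coproduct_eq[OF cp empty(2)])
    show "zer S S \<in> Hom T S S" using zer_Hom coproduct_obj[OF cp] by blast
    fix i assume i: "i \<in> I"
    show "r \<cdot> \<iota> i = zer S S \<cdot> \<iota> i"
      using empty(3)[OF i] comp_zer_left[OF coproduct_obj[OF cp] coproduct_Hom[OF cp i]] by simp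
  qed
  then show ?case using comp_zer_left[OF coproduct_obj[OF cp] x] by simp
next
  case (insert k J)
  have k: "k \<in> I" using insert by blast
  note ik = coproduct_Hom[OF cp k]
  obtain p where p: "p \<in> Hom T S (X k)" "\<And>i. i \<in> I \<Longrightarrow> p \<cdot> \<iota> i = (if i = k then ide T (X k) else zer (X i) (X k))"
    using coproduct_pr[OF cp k] by blast
  obtain r' where r': "r' \<in> Hom T S S" "\<And>i. i \<in> I \<Longrightarrow> r' \<cdot> \<iota> i = (if i \<in> J then \<iota> i else zer (X i) S)"
    using coproduct_proj[OF cp, of J] by blast
  have "r \<cdot> x = \<iota> k \<cdot> (p \<cdot> x) \<boxplus> r' \<cdot> x"
    using proj_insert[OF cp k insert(2) insert(5,6) p r'] comp_add_left[OF x comp_closed[OF p(1) ik] r'(1)]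
      comp_assoc[OF x p(1) ik] by simp
  also have "r' \<cdot> x = zer c S" using insert.IH[OF _ r'] insert(4) by blast
  also have "p \<cdot> x = zer c (X k)" using z[OF k p] .
  also have "\<iota> k \<cdot> zer c (X k) = zer c S" using comp_zer_right[OF _ ik] Hom_obj[OF x] by simp
  finally show ?case using add_zer(1) zer_Hom Hom_obj[OF x] by simp
qed

text \<open>On arrows of finite support the coordinate projections are jointly faithful, which fails
  for general arrows into a coproduct.\<close>

lemma fsums_eq_zer:
  assumes cp: "is_coproduct T I X S \<iota>" and c: "c \<in> obj T" and x: "x \<in> fsums c I X S \<iota>"
    and z: "\<And>k p. k \<in> I \<Longrightarrow> p \<in> Hom T S (X k) \<Longrightarrow>
      (\<And>i. i \<in> I \<Longrightarrow> p \<cdot> \<iota> i = (if i = k then ide T (X k) else zer (X i) (X k))) \<Longrightarrow> p \<cdot> x = zer c (X k)"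
  shows "x = zer c S"
proof -
  obtain J where J: "J \<subseteq> I" "finite J" "\<And>r. r \<in> Hom T S S \<Longrightarrow>
    \<forall>i\<in>I. r \<cdot> \<iota> i = (if i \<in> J then \<iota> i else zer (X i) S) \<Longrightarrow> r \<cdot> x = x"
    using fsums_support[OF cp c x] by blast
  obtain r where r: "r \<in> Hom T S S" "\<forall>i\<in>I. r \<cdot> \<iota> i = (if i \<in> J then \<iota> i else zer (X i) S)"
    using coproduct_proj[OF cp, of J] by blast
  have "r \<cdot> x = zer c S"
    by (rule proj_zero[OF cp fsums_Hom[OF cp c x] J(2) z J(1) r(1)]) (use r(2) in auto)
  then show ?thesis using J(3)[OF r] by simp
qed

lemma finsum_fsums:
  assumes cp: "is_coproduct T I X S \<iota>" and c: "c \<in> obj T" and "finite J"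
  shows "J \<subseteq> I \<Longrightarrow> (\<And>i. i \<in> J \<Longrightarrow> \<phi> i \<in> Hom T c (X i)) \<Longrightarrow>
    finsum (Hom_mod T c S) (\<lambda>i. \<iota> i \<cdot> \<phi> i) J \<in> fsums c I X S \<iota>"
  using assms(3)
proof (induction J rule: finite_induct)
  interpret M: module R "Hom_mod T c S" using Hom_module c coproduct_obj[OF cp] by blast
  {
    case empty
    then show ?case using fsums.zero by simp
  next
    case (insert k J)
    have ip: "\<iota> i \<cdot> \<phi> i \<in> Hom T c S" if "i \<in> insert k J" for i
      using comp_closed[OF insert(5)[OF that] coproduct_Hom[OF cp]] insert(4) that by blast
    have "finsum (Hom_mod T c S) (\<lambda>i. \<iota> i \<cdot> \<phi> i) (insert k J) = \<iota> k \<cdot> \<phi> k \<boxplus> finsum (Hom_mod T c S) (\<lambda>i. \<iota> i \<cdot> \<phi> i) J"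
      using M.M.finsum_insert[OF insert(1,2), of "\<lambda>i. \<iota> i \<cdot> \<phi> i"] ip by (simp add: Pi_iff)
    then show ?case using fsums.step[OF insert.IH, of k "\<phi> k"] insert(4,5) by simp
  }
qed

lemma compact_obj: "c \<in> compacts \<kappa> T \<Longrightarrow> c \<in> obj T"
  by (simp add: compacts_def)

lemma compact_fsums:
  fixes I :: "'u set" and \<kappa> :: "'u rel"
  assumes "c \<in> compacts \<kappa> T" "small \<kappa> I" and cp: "is_coproduct T I X S \<iota>" and x: "x \<in> Hom T c S"
  shows "x \<in> fsums c I X S \<iota>"
proof -
  have "\<forall>i\<in>I. X i \<in> obj T" using coproduct_summand_obj[OF cp] by blast
  then have "bij_betw
         (\<lambda>\<phi>. finsum (Hom_mod T c S) (\<lambda>i. \<iota> i \<cdot> \<phi> i) {i \<in> I. \<phi> i \<noteq> arr_zero T c (X i)})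
         {\<phi> \<in> (\<Pi>\<^sub>E i\<in>I. Hom T c (X i)). finite {i \<in> I. \<phi> i \<noteq> arr_zero T c (X i)}}
         (Hom T c S)"
    using assms(1,2) cp unfolding compacts_def by blast
  then obtain \<phi> where \<phi>: "\<phi> \<in> (\<Pi>\<^sub>E i\<in>I. Hom T c (X i))" "finite {i \<in> I. \<phi> i \<noteq> arr_zero T c (X i)}"
    "x = finsum (Hom_mod T c S) (\<lambda>i. \<iota> i \<cdot> \<phi> i) {i \<in> I. \<phi> i \<noteq> arr_zero T c (X i)}"
    using x unfolding bij_betw_def by blast
  show ?thesis unfolding \<phi>(3) using \<phi>(1) by (intro finsum_fsums[OF cp compact_obj[OF assms(1)] \<phi>(2)]) auto
qed

lemma fsums_finsum:
  assumes cp: "is_coproduct T I X S \<iota>" and c: "c \<in> obj T" and "x \<in> fsums c I X S \<iota>"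
  shows "\<exists>\<phi> J. J \<subseteq> I \<and> finite J \<and> (\<forall>i\<in>I. \<phi> i \<in> Hom T c (X i)) \<and> (\<forall>i\<in>I - J. \<phi> i = zer c (X i)) \<and>
    x = finsum (Hom_mod T c S) (\<lambda>i. \<iota> i \<cdot> \<phi> i) J"
  using assms(3)
proof induction
  interpret M: module R "Hom_mod T c S" using Hom_module c coproduct_obj[OF cp] by blast
  {
    case zero
    show ?case using zer_Hom[OF c] coproduct_summand_obj[OF cp]
      by (intro exI[of _ "\<lambda>i. zer c (X i)"] exI[of _ "{}"]) simp
  next
    case (step x k \<theta>)
    then obtain \<phi> J where J: "J \<subseteq> I" "finite J" "\<forall>i\<in>I. \<phi> i \<in> Hom T c (X i)" "\<forall>i\<in>I - J. \<phi> i = zer c (X i)"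
      "x = finsum (Hom_mod T c S) (\<lambda>i. \<iota> i \<cdot> \<phi> i) J" by blast
    \<comment> \<open>The index \<open>k\<close> may already occur in the sum, so the new term is
      added to the old component.\<close>
    define \<phi>' where "\<phi>' = \<phi>(k := \<theta> \<boxplus> \<phi> k)"
    have ip: "\<iota> i \<cdot> \<phi> i \<in> Hom T c S" if "i \<in> I" for i using that J(3) comp_closed coproduct_Hom[OF cp] by blast
    have pk: "\<phi> k \<in> Hom T c (X k)" using J(3) step(2) by blast
    note ik = coproduct_Hom[OF cp step(2)]
    have "x = finsum (Hom_mod T c S) (\<lambda>i. \<iota> i \<cdot> \<phi> i) (insert k (J - {k}))"
    proof (cases "k \<in> J")
      case True then show ?thesis using J(5) by (simp add: insert_absorb)
    next
      case False
      have "\<iota> k \<cdot> \<phi> k = zer c S" using False J(4) step(2) comp_zer_right[OF c ik] by simp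
      moreover have "finsum (Hom_mod T c S) (\<lambda>i. \<iota> i \<cdot> \<phi> i) (insert k J) = \<iota> k \<cdot> \<phi> k \<boxplus> x"
        using M.M.finsum_insert[OF J(2) False, of "\<lambda>i. \<iota> i \<cdot> \<phi> i"] ip J(1,5) step(2) by (simp add: Pi_iff subset_iff)
      ultimately show ?thesis using False add_zer(2)[OF fsums_Hom[OF cp c step(1)]] by simp
    qed
    also have "\<dots> = \<iota> k \<cdot> \<phi> k \<boxplus> finsum (Hom_mod T c S) (\<lambda>i. \<iota> i \<cdot> \<phi> i) (J - {k})"
      using M.M.finsum_insert[of "J - {k}" k "\<lambda>i. \<iota> i \<cdot> \<phi> i"] ip J(1,2) step(2) by (simp add: Pi_iff subset_iff)
    finally have 1: "x = \<iota> k \<cdot> \<phi> k \<boxplus> finsum (Hom_mod T c S) (\<lambda>i. \<iota> i \<cdot> \<phi> i) (J - {k})" .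
    have s: "finsum (Hom_mod T c S) (\<lambda>i. \<iota> i \<cdot> \<phi> i) (J - {k}) = finsum (Hom_mod T c S) (\<lambda>i. \<iota> i \<cdot> \<phi>' i) (J - {k})"
      using ip J(1) by (intro M.M.finsum_cong') (auto simp: \<phi>'_def subset_iff split: if_splits)
    have h: "finsum (Hom_mod T c S) (\<lambda>i. \<iota> i \<cdot> \<phi> i) (J - {k}) \<in> Hom T c S"
      using M.M.finsum_closed[of "\<lambda>i. \<iota> i \<cdot> \<phi> i" "J - {k}"] ip J(1) by (auto simp: Pi_iff)
    have kk: "\<iota> k \<cdot> \<phi>' k = \<iota> k \<cdot> \<theta> \<boxplus> \<iota> k \<cdot> \<phi> k"
      using comp_add_right[OF step(3) pk ik] by (simp add: \<phi>'_def)
    have kk': "\<iota> k \<cdot> \<phi>' k \<in> Hom T c S" using kk add_Hom[OF comp_closed[OF step(3) ik] comp_closed[OF pk ik]] by simp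
    have "\<iota> k \<cdot> \<theta> \<boxplus> x = \<iota> k \<cdot> \<phi>' k \<boxplus> finsum (Hom_mod T c S) (\<lambda>i. \<iota> i \<cdot> \<phi>' i) (J - {k})"
      using 1 kk s add_assoc[OF comp_closed[OF step(3) ik] comp_closed[OF pk ik] h] by simp
    also have "\<dots> = finsum (Hom_mod T c S) (\<lambda>i. \<iota> i \<cdot> \<phi>' i) (insert k (J - {k}))"
    proof -
      have "\<iota> i \<cdot> \<phi>' i \<in> Hom T c S" if "i \<in> J - {k}" for i using that ip J(1) by (auto simp: \<phi>'_def)
      then show ?thesis
        using M.M.finsum_insert[of "J - {k}" k "\<lambda>i. \<iota> i \<cdot> \<phi>' i"] kk' J(2) by (simp add: Pi_iff)
    qed
    finally have "\<iota> k \<cdot> \<theta> \<boxplus> x = finsum (Hom_mod T c S) (\<lambda>i. \<iota> i \<cdot> \<phi>' i) (insert k (J - {k}))" .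
    moreover have "\<forall>i\<in>I. \<phi>' i \<in> Hom T c (X i)" using J(3) add_Hom[OF step(3) pk] by (simp add: \<phi>'_def)
    moreover have "\<forall>i\<in>I - insert k (J - {k}). \<phi>' i = zer c (X i)" using J(4) by (simp add: \<phi>'_def)
    ultimately show ?case using J(1,2) step(2) by (intro exI[of _ \<phi>'] exI[of _ "insert k (J - {k})"]) auto
  }
qed

lemma pr_finsum:
  assumes cp: "is_coproduct T I X S \<iota>" and c: "c \<in> obj T" and k: "k \<in> I"
    and p: "p \<in> Hom T S (X k)" "\<And>i. i \<in> I \<Longrightarrow> p \<cdot> \<iota> i = (if i = k then ide T (X k) else zer (X i) (X k))"
    and "finite J"
  shows "J \<subseteq> I \<Longrightarrow> (\<And>i. i \<in> I \<Longrightarrow> \<phi> i \<in> Hom T c (X i)) \<Longrightarrow>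
    p \<cdot> finsum (Hom_mod T c S) (\<lambda>i. \<iota> i \<cdot> \<phi> i) J = (if k \<in> J then \<phi> k else zer c (X k))"
  using assms(6)
proof (induction J rule: finite_induct)
  interpret M: module R "Hom_mod T c S" using Hom_module c coproduct_obj[OF cp] by blast
  {
    case empty
    then show ?case using comp_zer_right[OF c p(1)] by simp
  next
    case (insert l J)
    have l: "l \<in> I" using insert by blast
    note il = coproduct_Hom[OF cp l]
    have ip: "\<iota> i \<cdot> \<phi> i \<in> Hom T c S" if "i \<in> I" for i using that insert(5) comp_closed coproduct_Hom[OF cp] by blast
    have h: "finsum (Hom_mod T c S) (\<lambda>i. \<iota> i \<cdot> \<phi> i) J \<in> Hom T c S"
      using M.M.finsum_closed[of "\<lambda>i. \<iota> i \<cdot> \<phi> i" J] ip insert(4) by (auto simp: Pi_iff)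
    have "finsum (Hom_mod T c S) (\<lambda>i. \<iota> i \<cdot> \<phi> i) (insert l J) = \<iota> l \<cdot> \<phi> l \<boxplus> finsum (Hom_mod T c S) (\<lambda>i. \<iota> i \<cdot> \<phi> i) J"
      using M.M.finsum_insert[OF insert(1,2), of "\<lambda>i. \<iota> i \<cdot> \<phi> i"] insert(4) ip by (simp add: Pi_iff subset_iff)
    then have 1: "p \<cdot> finsum (Hom_mod T c S) (\<lambda>i. \<iota> i \<cdot> \<phi> i) (insert l J)
      = (p \<cdot> \<iota> l) \<cdot> \<phi> l \<boxplus> p \<cdot> finsum (Hom_mod T c S) (\<lambda>i. \<iota> i \<cdot> \<phi> i) J"
      using comp_add_right[OF ip[OF l] h p(1)] comp_assoc[OF insert(5)[OF l] il p(1)] by simp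
    have 2: "p \<cdot> finsum (Hom_mod T c S) (\<lambda>i. \<iota> i \<cdot> \<phi> i) J = (if k \<in> J then \<phi> k else zer c (X k))"
      using insert by blast
    show ?case
    proof (cases "l = k")
      case True
      then show ?thesis using 1 2 p(2)[OF l] insert(2) comp_ide[OF insert(5)[OF l]] add_zer(1)[OF insert(5)[OF l]] by simp
    next
      case False
      have "zer (X l) (X k) \<cdot> \<phi> l = zer c (X k)"
        using comp_zer_left[OF coproduct_summand_obj[OF cp k] insert(5)[OF l]] .
      then show ?thesis using 1 2 p(2)[OF l] False add_zer(2)[OF insert(5)[OF k]]
          add_zer(2)[OF zer_Hom[OF c coproduct_summand_obj[OF cp k]]] by simp
    qed
  }
qed

text \<open>Injectivity of the canonical map is automatic, since the coordinate projections recover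
  the family; only surjectivity has to be supplied.\<close>

lemma compactI:
  fixes \<kappa> :: "'u rel"
  assumes c: "c \<in> obj T"
    and f: "\<And>(I::'u set) X S \<iota> x. small \<kappa> I \<Longrightarrow> is_coproduct T I X S \<iota> \<Longrightarrow> x \<in> Hom T c S \<Longrightarrow> x \<in> fsums c I X S \<iota>"
  shows "c \<in> compacts \<kappa> T"
  unfolding compacts_def mem_Collect_eq
proof (intro conjI allI impI c, elim conjE)
  fix I :: "'u set" and X S \<iota>
  assume sm: "small \<kappa> I" and cp: "is_coproduct T I X S \<iota>"
  interpret M: module R "Hom_mod T c S" using Hom_module c coproduct_obj[OF cp] by blast
  define sp where "sp \<phi> = {i \<in> I. \<phi> i \<noteq> arr_zero T c (X i)}" for \<phi>
  define D where "D = {\<phi> \<in> (\<Pi>\<^sub>E i\<in>I. Hom T c (X i)). finite (sp \<phi>)}"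
  define V where "V \<phi> = finsum (Hom_mod T c S) (\<lambda>i. \<iota> i \<cdot> \<phi> i) (sp \<phi>)" for \<phi>
  have V: "V \<phi> = finsum (Hom_mod T c S) (\<lambda>i. \<iota> i \<cdot> \<phi> i) J"
    if J: "J \<subseteq> I" "finite J" "\<And>i. i \<in> I \<Longrightarrow> \<phi> i \<in> Hom T c (X i)" "\<And>i. i \<in> I - J \<Longrightarrow> \<phi> i = zer c (X i)" for \<phi> J
  proof -
    have "sp \<phi> \<subseteq> J" using J(4) unfolding sp_def by blast
    moreover have "\<iota> i \<cdot> \<phi> i = zer c S" if "i \<in> J - sp \<phi>" for i
      using that J(1) comp_zer_right[OF c] coproduct_Hom[OF cp] unfolding sp_def by auto
    moreover have "\<iota> i \<cdot> \<phi> i \<in> Hom T c S" if "i \<in> J" for i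
      using that J(1,3) comp_closed coproduct_Hom[OF cp] by blast
    ultimately show ?thesis unfolding V_def using J(2)
      by (intro M.M.add.finprod_mono_neutral_cong_left) auto
  qed
  have "inj_on V D"
  proof (rule inj_onI)
    fix \<phi> \<phi>' assume h: "\<phi> \<in> D" "\<phi>' \<in> D" "V \<phi> = V \<phi>'"
    show "\<phi> = \<phi>'"
    proof (rule PiE_ext[of _ I "\<lambda>i. Hom T c (X i)"])
      show "\<phi> \<in> (\<Pi>\<^sub>E i\<in>I. Hom T c (X i))" "\<phi>' \<in> (\<Pi>\<^sub>E i\<in>I. Hom T c (X i))" using h by (auto simp: D_def)
      fix k assume k: "k \<in> I"
      obtain p where p: "p \<in> Hom T S (X k)" "\<And>i. i \<in> I \<Longrightarrow> p \<cdot> \<iota> i = (if i = k then ide T (X k) else zer (X i) (X k))"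
        using coproduct_pr[OF cp k] by blast
      have "p \<cdot> V \<psi> = \<psi> k" if "\<psi> \<in> D" for \<psi>
      proof -
        have "p \<cdot> V \<psi> = (if k \<in> sp \<psi> then \<psi> k else zer c (X k))"
          unfolding V_def using that by (intro pr_finsum[OF cp c k p]) (auto simp: D_def sp_def)
        then show ?thesis using k by (auto simp: sp_def)
      qed
      then show "\<phi> k = \<phi>' k" using h by metis
    qed
  qed
  moreover have "V ` D = Hom T c S"
  proof
    show "V ` D \<subseteq> Hom T c S"
    proof
      fix x assume "x \<in> V ` D"
      then obtain \<phi> where \<phi>: "\<phi> \<in> D" "x = V \<phi>" by blast
      have "V \<phi> \<in> fsums c I X S \<iota>" unfolding V_def using \<phi>(1)
        by (intro finsum_fsums[OF cp c]) (auto simp: D_def sp_def)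
      then show "x \<in> Hom T c S" using fsums_Hom[OF cp c] \<phi>(2) by simp
    qed
    show "Hom T c S \<subseteq> V ` D"
    proof
      fix x assume "x \<in> Hom T c S"
      then obtain \<phi> J where J: "J \<subseteq> I" "finite J" "\<forall>i\<in>I. \<phi> i \<in> Hom T c (X i)" "\<forall>i\<in>I - J. \<phi> i = zer c (X i)"
        "x = finsum (Hom_mod T c S) (\<lambda>i. \<iota> i \<cdot> \<phi> i) J"
        using fsums_finsum[OF cp c f[OF sm cp]] by blast
      define \<phi>' where "\<phi>' = restrict \<phi> I"
      have "V \<phi>' = finsum (Hom_mod T c S) (\<lambda>i. \<iota> i \<cdot> \<phi>' i) J"
        using J by (intro V) (auto simp: \<phi>'_def)
      also have "\<dots> = x"
      proof -
        have "\<iota> i \<cdot> \<phi> i \<in> Hom T c S" if "i \<in> I" for i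
          using comp_closed[OF J(3)[rule_format, OF that] coproduct_Hom[OF cp that]] .
        then show ?thesis unfolding J(5)
          using J(1) by (intro M.M.finsum_cong') (auto simp: \<phi>'_def subset_iff)
      qed
      finally have "V \<phi>' = x" .
      moreover have "sp \<phi>' \<subseteq> J" using J(4) by (auto simp: sp_def \<phi>'_def)
      then have "\<phi>' \<in> D" using J(2,3) finite_subset by (auto simp: D_def \<phi>'_def)
      ultimately show "x \<in> V ` D" by blast
    qed
  qed
  ultimately have "bij_betw V D (Hom T c S)" by (simp add: bij_betw_def)
  then show "bij_betw (\<lambda>\<phi>. finsum (Hom_mod T c S) (\<lambda>i. \<iota> i \<cdot> \<phi> i) {i \<in> I. \<phi> i \<noteq> zer c (X i)})
         {\<phi> \<in> (\<Pi>\<^sub>E i\<in>I. Hom T c (X i)). finite {i \<in> I. \<phi> i \<noteq> zer c (X i)}} (Hom T c S)"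
    unfolding V_def D_def sp_def .
qed

section \<open>Closure properties of the compact objects\<close>

lemma compact_retract:
  fixes \<kappa> :: "'u rel"
  assumes "k \<in> compacts \<kappa> T" "retract c k"
  shows "c \<in> compacts \<kappa> T"
proof (rule compactI)
  show "c \<in> obj T" using retract_obj assms(2) by blast
  obtain i p where ip: "i \<in> Hom T c k" "p \<in> Hom T k c" "p \<cdot> i = ide T c"
    using assms(2) unfolding retract_def by blast
  fix I :: "'u set" and X S \<iota> x assume h: "small \<kappa> I" "is_coproduct T I X S \<iota>" "x \<in> Hom T c S"
  have "x = (x \<cdot> p) \<cdot> i" using comp_assoc[OF ip(1,2) h(3)] ip(3) comp_ide[OF h(3)] by simp
  then show "x \<in> fsums c I X S \<iota>"
    using fsums_precomp[OF h(2) compact_fsums[OF assms(1) h(1,2) comp_closed[OF ip(2) h(3)]] ip(1)] by simp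
qed

text \<open>The restriction of \<open>x\<close> to \<open>A\<close> has finite support, so a finite
  truncation \<open>r \<cdot> x\<close> agrees with \<open>x\<close> on \<open>A\<close>. The
  difference factors through \<open>C\<close>, where compactness applies again.\<close>

lemma compact_ext:
  fixes \<kappa> :: "'u rel"
  assumes t: "triangle T A B C f g h" and "A \<in> compacts \<kappa> T" "C \<in> compacts \<kappa> T"
  shows "B \<in> compacts \<kappa> T"
proof (rule compactI)
  show B: "B \<in> obj T" using triangle_obj[OF t] by blast
  fix I :: "'u set" and X S \<iota> x assume sm: "small \<kappa> I" and cp: "is_coproduct T I X S \<iota>" and x: "x \<in> Hom T B S"
  note F = triangle_Hom[OF t]
  note xf = comp_closed[OF F(1) x]
  obtain J where J: "J \<subseteq> I" "finite J" "\<And>r. r \<in> Hom T S S \<Longrightarrow>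
    \<forall>i\<in>I. r \<cdot> \<iota> i = (if i \<in> J then \<iota> i else zer (X i) S) \<Longrightarrow> r \<cdot> (x \<cdot> f) = x \<cdot> f"
    using fsums_support[OF cp _ compact_fsums[OF assms(2) sm cp xf]] triangle_obj[OF t] by blast
  obtain r where r: "r \<in> Hom T S S" "\<forall>i\<in>I. r \<cdot> \<iota> i = (if i \<in> J then \<iota> i else zer (X i) S)"
    using coproduct_proj[OF cp, of J] by blast
  have 1: "r \<cdot> x \<in> fsums B I X S \<iota>" using proj_fsums[OF cp x J(2,1) r(1)] r(2) by blast
  note rx = comp_closed[OF x r(1)]
  have "(x \<boxminus> r \<cdot> x) \<cdot> f = zer A S"
    using comp_sub_left[OF F(1) x rx] comp_assoc[OF F(1) x r(1)] J(3)[OF r] sub_eq_zer_iff[OF xf xf] by simp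
  then obtain z where z: "z \<in> Hom T C S" "z \<cdot> g = x \<boxminus> r \<cdot> x" using exact_contra[OF t sub_Hom[OF x rx]] by blast
  have "z \<cdot> g \<in> fsums B I X S \<iota>" using fsums_precomp[OF cp compact_fsums[OF assms(3) sm cp z(1)] F(2)] .
  then have "z \<cdot> g \<boxplus> r \<cdot> x \<in> fsums B I X S \<iota>" using fsums_add[OF cp B _ 1] by blast
  then show "x \<in> fsums B I X S \<iota>" using z(2) sub_add[OF x rx] by simp
qed

lemma compact_direct_sum:
  fixes \<kappa> :: "'u rel"
  assumes "is_direct_sum T X' Y S'" "X' \<in> compacts \<kappa> T" "Y \<in> compacts \<kappa> T"
  shows "S' \<in> compacts \<kappa> T"
proof (rule compactI)
  obtain i j p q where 1: "i \<in> Hom T X' S'" "j \<in> Hom T Y S'" "p \<in> Hom T S' X'" "q \<in> Hom T S' Y"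
    "i \<cdot> p \<boxplus> j \<cdot> q = ide T S'" using assms unfolding is_direct_sum_def by blast
  show S': "S' \<in> obj T" using 1 Hom_obj by blast
  fix I :: "'u set" and X S \<iota> x assume sm: "small \<kappa> I" and cp: "is_coproduct T I X S \<iota>" and x: "x \<in> Hom T S' S"
  have "x = x \<cdot> (i \<cdot> p \<boxplus> j \<cdot> q)" using 1 comp_ide[OF x] by simp
  also have "\<dots> = (x \<cdot> i) \<cdot> p \<boxplus> (x \<cdot> j) \<cdot> q"
    using comp_add_right[OF comp_closed[OF 1(3,1)] comp_closed[OF 1(4,2)] x] comp_assoc[OF 1(3,1) x]
      comp_assoc[OF 1(4,2) x] by simp
  finally show "x \<in> fsums S' I X S \<iota>"
    using fsums_add[OF cp S' fsums_precomp[OF cp compact_fsums[OF assms(2) sm cp comp_closed[OF 1(1) x]] 1(3)]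
        fsums_precomp[OF cp compact_fsums[OF assms(3) sm cp comp_closed[OF 1(2) x]] 1(4)]] by simp
qed

lemma compact_zero:
  fixes \<kappa> :: "'u rel"
  assumes "is_zero T Z"
  shows "Z \<in> compacts \<kappa> T"
proof (rule compactI)
  show Z: "Z \<in> obj T" using assms by (simp add: is_zero_def)
  fix I :: "'u set" and X S \<iota> x assume "small \<kappa> I" and cp: "is_coproduct T I X S \<iota>" and x: "x \<in> Hom T Z S"
  have "x = zer Z S" using is_zeroD(1)[OF assms] hzD x coproduct_obj[OF cp] by blast
  then show "x \<in> fsums Z I X S \<iota>" using fsums.zero by simp
qed

lemma shift_coproduct:
  assumes cp: "is_coproduct T I X S \<iota>"
  shows "is_coproduct T I (\<lambda>i. sh n (X i)) (sh n S) (\<lambda>i. sha n (\<iota> i))"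
  unfolding is_coproduct_def
proof (intro conjI ballI allI impI)
  have S: "S \<in> obj T" using coproduct_obj[OF cp] .
  show "sh n S \<in> obj T" using shift_obj[OF S] .
  show "sha n (\<iota> i) \<in> Hom T (sh n (X i)) (sh n S)" if "i \<in> I" for i using shift_Hom[OF coproduct_Hom[OF cp that]] .
  fix Y f assume Y: "Y \<in> obj T" and f: "\<forall>i\<in>I. f i \<in> Hom T (sh n (X i)) Y"
  have "sha (- n) (f i) \<in> Hom T (X i) (sh (- n) Y)" if "i \<in> I" for i
    using shift_Hom[of "f i" _ _ "- n"] f that shift_inverse(1) coproduct_summand_obj[OF cp] by metis
  then obtain h where h: "h \<in> Hom T S (sh (- n) Y)" "\<forall>i\<in>I. h \<cdot> \<iota> i = sha (- n) (f i)"
    using coproduct_ex[OF cp shift_obj[OF Y], of "\<lambda>i. sha (- n) (f i)"] by blast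
  show "\<exists>!h. h \<in> Hom T (sh n S) Y \<and> (\<forall>i\<in>I. h \<cdot> sha n (\<iota> i) = f i)"
  proof (rule ex1I[of _ "sha n h"])
    have "sha n h \<cdot> sha n (\<iota> i) = f i" if "i \<in> I" for i
      using shift_comp[OF coproduct_Hom[OF cp that] h(1), of n] h(2) that shift_arr_inverse(2)[of "f i" n] f HomD by metis
    moreover have "sha n h \<in> Hom T (sh n S) Y" using shift_Hom[OF h(1), of n] shift_inverse(2)[OF Y] by simp
    ultimately show "sha n h \<in> Hom T (sh n S) Y \<and> (\<forall>i\<in>I. sha n h \<cdot> sha n (\<iota> i) = f i)" by blast
    fix k assume k: "k \<in> Hom T (sh n S) Y \<and> (\<forall>i\<in>I. k \<cdot> sha n (\<iota> i) = f i)"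
    have kk: "sha (- n) k \<in> Hom T S (sh (- n) Y)" using shift_Hom[of k _ _ "- n"] k shift_inverse(1)[OF S] by metis
    have "sha (- n) k = h"
    proof (rule coproduct_eq[OF cp kk h(1)])
      fix i assume i: "i \<in> I"
      note ii = coproduct_Hom[OF cp i]
      have "sha (- n) (k \<cdot> sha n (\<iota> i)) = sha (- n) k \<cdot> sha (- n) (sha n (\<iota> i))"
        using shift_comp[OF shift_Hom[OF ii]] k by blast
      then show "sha (- n) k \<cdot> \<iota> i = h \<cdot> \<iota> i"
        using k i h(2) shift_arr_inverse(1) HomD[OF ii] by simp
    qed
    then show "k = sha n h" using shift_arr_inverse(2) k HomD by metis
  qed
qed

lemma fsums_shift:
  assumes cp: "is_coproduct T I X S \<iota>" and c: "c \<in> obj T" and "x \<in> fsums c I X S \<iota>"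
  shows "sha n x \<in> fsums (sh n c) I (\<lambda>i. sh n (X i)) (sh n S) (\<lambda>i. sha n (\<iota> i))"
  using assms(3)
proof induction
  case zero then show ?case using shift_zer[OF c coproduct_obj[OF cp]] fsums.zero by simp
next
  case (step x i \<phi>)
  note ii = coproduct_Hom[OF cp step(2)]
  have "sha n (\<iota> i \<cdot> \<phi> \<boxplus> x) = sha n (\<iota> i) \<cdot> sha n \<phi> \<boxplus> sha n x"
    using shift_arr_plus[OF comp_closed[OF step(3) ii] fsums_Hom[OF cp c step(1)]] shift_comp[OF step(3) ii] by simp
  then show ?case using fsums.step[OF step(4) step(2) shift_Hom[OF step(3)]] by simp
qed

lemma compact_shift:
  fixes \<kappa> :: "'u rel"
  assumes c: "c \<in> compacts \<kappa> T"
  shows "sh n c \<in> compacts \<kappa> T"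
proof (rule compactI)
  note co = compact_obj[OF c]
  show "sh n c \<in> obj T" using shift_obj[OF co] .
  fix I :: "'u set" and X S \<iota> x assume sm: "small \<kappa> I" and cp: "is_coproduct T I X S \<iota>" and x: "x \<in> Hom T (sh n c) S"
  note S = coproduct_obj[OF cp]
  have y: "sha (- n) x \<in> Hom T c (sh (- n) S)" using shift_Hom[OF x, of "- n"] shift_inverse(1)[OF co] by simp
  note cp' = shift_coproduct[OF cp, of "- n"]
  have "sha n (sha (- n) x) \<in> fsums (sh n c) I (\<lambda>i. sh n (sh (- n) (X i))) (sh n (sh (- n) S)) (\<lambda>i. sha n (sha (- n) (\<iota> i)))"
    using fsums_shift[OF cp' co compact_fsums[OF c sm cp' y]] .
  then have "x \<in> fsums (sh n c) I (\<lambda>i. sh n (sh (- n) (X i))) S (\<lambda>i. sha n (sha (- n) (\<iota> i)))"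
    using shift_arr_inverse(2) HomD[OF x] shift_inverse(2)[OF S] by simp
  then show "x \<in> fsums (sh n c) I X S \<iota>"
    by (rule fsums_cong) (use shift_arr_inverse(2) HomD[OF coproduct_Hom[OF cp]] shift_inverse(2) coproduct_summand_obj[OF cp] in auto)
qed

text \<open>The compactness property is carried along the injection into \<open>'u\<close> together
  with the coproduct, as the definition of \<open>compacts\<close> speaks only of index sets over
  \<open>'u\<close>.\<close>

lemma nat_coproduct:
  fixes \<kappa> :: "'u rel"
  assumes "regular_uncountable \<kappa>" "has_small_coproducts \<kappa> T" and X: "\<And>n::nat. X n \<in> obj T"
  shows "\<exists>S \<iota>. is_coproduct T UNIV X S \<iota> \<and>
    (\<forall>c\<in>compacts \<kappa> T. \<forall>x\<in>Hom T c S. x \<in> fsums c UNIV X S \<iota>)"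
proof -
  obtain e :: "nat \<Rightarrow> 'u" where e: "inj e" "small \<kappa> (range e)" using countable_small_range[OF assms(1)] by blast
  define X' where "X' u = X (inv_into UNIV e u)" for u
  have Xe: "X' (e n) = X n" for n using e(1) by (simp add: X'_def)
  obtain S \<iota>' where cp: "is_coproduct T (range e) X' S \<iota>'"
    using assms(2)[unfolded has_small_coproducts_def, rule_format, of "range e" X'] e(2) X
    by (auto simp: X'_def)
  define \<iota> where "\<iota> n = \<iota>' (e n)" for n
  have cp': "is_coproduct T UNIV X S \<iota>"
    unfolding is_coproduct_def
  proof (intro conjI ballI allI impI)
    show "S \<in> obj T" using coproduct_obj[OF cp] .
    show "\<iota> n \<in> Hom T (X n) S" for n using coproduct_Hom[OF cp, of "e n"] Xe by (simp add: \<iota>_def)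
    fix Y f assume Y: "Y \<in> obj T" and f: "\<forall>i\<in>UNIV. f i \<in> Hom T (X i) Y"
    obtain h where h: "h \<in> Hom T S Y" "\<forall>i\<in>range e. h \<cdot> \<iota>' i = f (inv_into UNIV e i)"
      using coproduct_ex[OF cp Y, of "\<lambda>u. f (inv_into UNIV e u)"] f X'_def by auto
    show "\<exists>!h. h \<in> Hom T S Y \<and> (\<forall>i\<in>UNIV. h \<cdot> \<iota> i = f i)"
    proof (rule ex1I[of _ h])
      show "h \<in> Hom T S Y \<and> (\<forall>i\<in>UNIV. h \<cdot> \<iota> i = f i)" using h e(1) by (simp add: \<iota>_def)
      fix k assume k: "k \<in> Hom T S Y \<and> (\<forall>i\<in>UNIV. k \<cdot> \<iota> i = f i)"
      have "k \<cdot> \<iota>' i = h \<cdot> \<iota>' i" if "i \<in> range e" for i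
        using k h(2) that e(1) by (auto simp: \<iota>_def)
      then show "k = h" using coproduct_eq[OF cp _ h(1)] k by blast
    qed
  qed
  have "x \<in> fsums c UNIV X S \<iota>" if "x \<in> fsums c (range e) X' S \<iota>'" for c x
    using that
  proof induction
    case zero then show ?case by (rule fsums.zero)
  next
    case (step x i \<phi>)
    then obtain n where "i = e n" by blast
    then show ?case using fsums.step[OF step(4), of n \<phi>] step(3) Xe by (simp add: \<iota>_def)
  qed
  then show ?thesis using cp' compact_fsums[OF _ e(2) cp] by blast
qed

end

section \<open>Homotopy colimits\<close>

context R_linear_triangulated_category
begin

fun trans where
  "trans L \<tau> i 0 = ide T (L i)"
| "trans L \<tau> i (Suc n) = \<tau> (i + n) \<cdot> trans L \<tau> i n"

context
  fixes L :: "nat \<Rightarrow> 'o" and \<tau>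
  assumes L: "\<And>k. \<tau> k \<in> Hom T (L k) (L (Suc k))"
begin

lemma seq_obj: "L k \<in> obj T"
  using Hom_obj[OF L] by blast

lemma trans_Hom: "trans L \<tau> i n \<in> Hom T (L i) (L (i + n))"
proof (induction n)
  case 0 then show ?case using ide[OF seq_obj] by simp
next
  case (Suc n) then show ?case using comp_closed[OF Suc L] by simp
qed

lemma trans_add: "trans L \<tau> (i + n) m \<cdot> trans L \<tau> i n = trans L \<tau> i (n + m)"
proof (induction m)
  case 0 then show ?case using comp_ide[OF trans_Hom] by simp
next
  case (Suc m)
  have "\<tau> (i + n + m) \<in> Hom T (L (i + n + m)) (L (Suc (i + n + m)))" using L .
  then have "(\<tau> (i + n + m) \<cdot> trans L \<tau> (i + n) m) \<cdot> trans L \<tau> i n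
    = \<tau> (i + n + m) \<cdot> (trans L \<tau> (i + n) m \<cdot> trans L \<tau> i n)"
    using comp_assoc[OF trans_Hom trans_Hom] by blast
  then show ?case using Suc by (simp add: add.assoc)
qed

lemma trans_Suc_left: "trans L \<tau> (Suc i) m \<cdot> \<tau> i = trans L \<tau> i (Suc m)"
  using trans_add[of i 1 m] comp_ide[OF L] by simp

lemma cocone_trans:
  assumes u: "\<And>k. u k \<in> Hom T (L k) F" "\<And>k. u (Suc k) \<cdot> \<tau> k = u k"
  shows "u (i + n) \<cdot> trans L \<tau> i n = u i"
proof (induction n)
  case 0 then show ?case using comp_ide[OF u(1)] by simp
next
  case (Suc n)
  have "u (Suc (i + n)) \<cdot> (\<tau> (i + n) \<cdot> trans L \<tau> i n) = (u (Suc (i + n)) \<cdot> \<tau> (i + n)) \<cdot> trans L \<tau> i n"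
    using comp_assoc[OF trans_Hom L u(1)] by simp
  then show ?case using Suc u(2) by simp
qed

end

text \<open>The last clause describes the arrows out of \<open>F\<close> that vanish on all \<open>L k\<close>, in the case that the
  relevant derived limit is zero.\<close>

definition hocolim where
  "hocolim \<kappa> L \<tau> F u \<longleftrightarrow>
     (\<forall>k. u k \<in> Hom T (L k) F \<and> u (Suc k) \<cdot> \<tau> k = u k) \<and>
     (\<forall>P\<in>compacts \<kappa> T. \<forall>x\<in>Hom T P F. \<exists>k. \<exists>g\<in>Hom T P (L k). u k \<cdot> g = x) \<and>
     (\<forall>P\<in>compacts \<kappa> T. \<forall>k. \<forall>g\<in>Hom T P (L k). u k \<cdot> g = zer P F \<longrightarrow>
        (\<exists>n. trans L \<tau> k n \<cdot> g = zer P (L (k + n)))) \<and>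
     (\<forall>t f. (\<forall>k. f k \<in> Hom T (L k) t \<and> f (Suc k) \<cdot> \<tau> k = f k) \<longrightarrow> (\<exists>h\<in>Hom T F t. \<forall>k. h \<cdot> u k = f k)) \<and>
     (\<forall>t\<in>obj T. (\<forall>\<phi>. (\<forall>k. \<phi> k \<in> Hom T (susp T (L k)) t) \<longrightarrow>
          (\<exists>\<psi>. \<forall>k. \<psi> k \<in> Hom T (susp T (L k)) t \<and> \<phi> k = \<psi> k \<boxminus> \<psi> (Suc k) \<cdot> susp_arr T (\<tau> k))) \<longrightarrow>
        (\<forall>f\<in>Hom T F t. (\<forall>k. f \<cdot> u k = zer (L k) t) \<longrightarrow> f = zer F t))"

text \<open>Only finitely many indices occur in a finite sum; this bounds the number of steps after
  which an arrow into a homotopy colimit dies.\<close>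

lemma fsums_pr_eventually:
  fixes X :: "nat \<Rightarrow> 'o"
  assumes cp: "is_coproduct T UNIV X S \<iota>" and c: "c \<in> obj T" and "x \<in> fsums c UNIV X S \<iota>"
    and p: "\<And>k. p k \<in> Hom T S (X k)"
      "\<And>k i. p k \<cdot> \<iota> i = (if i = k then ide T (X k) else zer (X i) (X k))"
  shows "\<exists>n0. \<forall>n\<ge>n0. p n \<cdot> x = zer c (X n)"
  using assms(3)
proof induction
  case zero then show ?case using comp_zer_right[OF c p(1)] by blast
next
  case (step x i \<phi>)
  then obtain n0 where n0: "\<forall>n\<ge>n0. p n \<cdot> x = zer c (X n)" by blast
  note ii = coproduct_Hom[OF cp step(2)]
  have "p n \<cdot> (\<iota> i \<cdot> \<phi> \<boxplus> x) = zer c (X n)" if n: "n \<ge> max n0 (Suc i)" for n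
  proof -
    have o: "X n \<in> obj T" using p(1) Hom_obj by blast
    have "p n \<cdot> (\<iota> i \<cdot> \<phi> \<boxplus> x) = (p n \<cdot> \<iota> i) \<cdot> \<phi> \<boxplus> p n \<cdot> x"
      using comp_add_right[OF comp_closed[OF step(3) ii] fsums_Hom[OF cp c step(1)] p(1)] comp_assoc[OF step(3) ii p(1)] by simp
    also have "\<dots> = zer c (X n) \<boxplus> zer c (X n)"
      using n n0 p(2)[of n i] comp_zer_left[OF o step(3)] by auto
    finally show ?thesis using add_zer(1)[OF zer_Hom[OF c o]] by simp
  qed
  then show ?case by blast
qed

lemma hocolim_exists:
  fixes \<kappa> :: "'u rel" and L :: "nat \<Rightarrow> 'o"
  assumes "regular_uncountable \<kappa>" "has_small_coproducts \<kappa> T"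
    and \<tau>: "\<And>k. \<tau> k \<in> Hom T (L k) (L (Suc k))"
  shows "\<exists>F u. hocolim \<kappa> L \<tau> F u"
proof -
  note Lo = seq_obj[where \<tau> = \<tau>, OF \<tau>]
  obtain S \<iota> where cp: "is_coproduct T UNIV L S \<iota>"
    and cf: "\<And>c x. c \<in> compacts \<kappa> T \<Longrightarrow> x \<in> Hom T c S \<Longrightarrow> x \<in> fsums c UNIV L S \<iota>"
    using nat_coproduct[where X = L, OF assms(1,2) Lo] by blast
  note S = coproduct_obj[OF cp] and \<iota> = coproduct_Hom[OF cp UNIV_I]
  obtain s where s: "s \<in> Hom T S S" "\<And>k. s \<cdot> \<iota> k = \<iota> (Suc k) \<cdot> \<tau> k"
    using coproduct_ex[OF cp S, of "\<lambda>k. \<iota> (Suc k) \<cdot> \<tau> k"] comp_closed[OF \<tau> \<iota>] by blast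
  define d where "d = ide T S \<boxminus> s"
  have d: "d \<in> Hom T S S" unfolding d_def using sub_Hom[OF ide[OF S] s(1)] .
  obtain F c b where t: "triangle T S S F d c b" using triangle_exists[OF d] by blast
  note C = triangle_Hom[OF t] and F = triangle_obj(3)[OF t]
  define u where "u k = c \<cdot> \<iota> k" for k
  have u: "u k \<in> Hom T (L k) F" for k unfolding u_def using comp_closed[OF \<iota> C(2)] .
  have d_comp: "x \<cdot> d = x \<boxminus> x \<cdot> s" if "x \<in> Hom T S Y" for x Y
    unfolding d_def using comp_sub_right[OF ide[OF S] s(1) that] comp_ide[OF that] by simp
  have "c \<boxminus> c \<cdot> s = zer S F" using triangle_zero1[OF t] d_comp[OF C(2)] by simp
  then have cs: "c = c \<cdot> s" using sub_eq_zer_iff[OF C(2) comp_closed[OF s(1) C(2)]] by simp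
  have u\<tau>: "u (Suc k) \<cdot> \<tau> k = u k" for k
  proof -
    have "u (Suc k) \<cdot> \<tau> k = c \<cdot> (s \<cdot> \<iota> k)" unfolding u_def s(2) using comp_assoc[OF \<tau> \<iota> C(2)] .
    also have "\<dots> = (c \<cdot> s) \<cdot> \<iota> k" using comp_assoc[OF \<iota> s(1) C(2)] by simp
    finally show ?thesis using cs by (simp add: u_def)
  qed
  note tr = trans_Hom[where \<tau> = \<tau>, OF \<tau>] and ut = cocone_trans[where \<tau> = \<tau>, OF \<tau>, OF u u\<tau>]
  have "\<exists>q\<in>Hom T S (L n). \<forall>k. q \<cdot> \<iota> k = (if k \<le> n then trans L \<tau> k (n - k) else zer (L k) (L n))" for n
  proof -
    have "trans L \<tau> k (n - k) \<in> Hom T (L k) (L n)" if "k \<le> n" for k using tr[of k "n - k"] that by simp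
    then show ?thesis
      using coproduct_ex[OF cp Lo, of "\<lambda>k. if k \<le> n then trans L \<tau> k (n - k) else zer (L k) (L n)" n] zer_Hom[OF Lo Lo] by simp
  qed
  then obtain q where q: "\<And>n. q n \<in> Hom T S (L n)"
    "\<And>n k. q n \<cdot> \<iota> k = (if k \<le> n then trans L \<tau> k (n - k) else zer (L k) (L n))" by metis
  define p where "p n = q n \<cdot> d" for n
  have p: "p n \<in> Hom T S (L n)" for n unfolding p_def using comp_closed[OF d q(1)] .
  have p\<iota>: "p n \<cdot> \<iota> k = (if k = n then ide T (L n) else zer (L k) (L n))" for n k
  proof -
    have "p n \<cdot> \<iota> k = q n \<cdot> \<iota> k \<boxminus> (q n \<cdot> s) \<cdot> \<iota> k"
      unfolding p_def d_comp[OF q(1)] using comp_sub_left[OF \<iota> q(1) comp_closed[OF s(1) q(1)]] .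
    also have "(q n \<cdot> s) \<cdot> \<iota> k = (q n \<cdot> \<iota> (Suc k)) \<cdot> \<tau> k"
      using comp_assoc[OF \<iota> s(1) q(1)] comp_assoc[OF \<tau> \<iota> q(1)] s(2) by simp
    finally have pe: "p n \<cdot> \<iota> k = q n \<cdot> \<iota> k \<boxminus> (q n \<cdot> \<iota> (Suc k)) \<cdot> \<tau> k" .
    consider "k < n" | "k = n" | "k > n" by linarith
    then show ?thesis
    proof cases
      case 1
      have "trans L \<tau> (Suc k) (n - Suc k) \<cdot> \<tau> k = trans L \<tau> k (n - k)"
        using trans_Suc_left[where \<tau> = \<tau>, OF \<tau>, of k "n - Suc k"] 1 by (simp add: Suc_diff_Suc)
      moreover have "trans L \<tau> k (n - k) \<in> Hom T (L k) (L n)" using tr[of k "n - k"] 1 by simp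
      ultimately show ?thesis using pe 1 q(2)[of n k] q(2)[of n "Suc k"] sub_eq_zer_iff by simp
    next
      case 2
      then show ?thesis using pe q(2)[of n k] q(2)[of n "Suc k"]
          comp_zer_left[OF Lo \<tau>] sub_zer[OF ide[OF Lo]] by simp
    next
      case 3
      then show ?thesis using pe q(2)[of n k] q(2)[of n "Suc k"]
          comp_zer_left[OF Lo \<tau>] sub_zer[OF zer_Hom[OF Lo Lo]] by simp
    qed
  qed
  \<comment> \<open>Since every coordinate projection factors through \<open>d\<close>, an arrow of
    finite support killed by \<open>d\<close> is zero. So \<open>b \<cdot> x\<close> vanishes for
    compact \<open>P\<close>, and \<open>x\<close> comes from the coproduct.\<close>
  have lift: "\<exists>k. \<exists>g\<in>Hom T P (L k). u k \<cdot> g = x" if P: "P \<in> compacts \<kappa> T" and x: "x \<in> Hom T P F" for P x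
  proof -
    note Po = compact_obj[OF P]
    have Po': "sh (- 1) P \<in> obj T" "susp T (sh (- 1) P) = P"
      using shift_obj[OF Po] shift_succ[OF Po, of "- 1"] by simp_all
    have bx: "b \<cdot> x \<in> Hom T (susp T (sh (- 1) P)) (susp T S)" using comp_closed[OF x C(3)] Po' by simp
    obtain y where y: "y \<in> Hom T (sh (- 1) P) S" "susp_arr T y = b \<cdot> x"
      using desusp_Hom[OF Po'(1) S bx] by blast
    have "susp_arr T (d \<cdot> y) = zer (susp T (sh (- 1) P)) (susp T S)"
      using susp_comp[OF y(1) d] y(2) comp_assoc[OF x C(3) susp_Hom[OF d]] triangle_zero3[OF t]
        comp_zer_left[OF susp_obj[OF S] x] Po'(2) by simp
    then have dy: "d \<cdot> y = zer (sh (- 1) P) S" using susp_eq_zer[OF comp_closed[OF y(1) d]] by blast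
    have "y = zer (sh (- 1) P) S"
    proof (rule fsums_eq_zer[OF cp Po'(1) cf[OF compact_shift[OF P] y(1)]])
      fix k p' assume p': "p' \<in> Hom T S (L k)" "\<And>i. i \<in> UNIV \<Longrightarrow> p' \<cdot> \<iota> i = (if i = k then ide T (L k) else zer (L i) (L k))"
      have "p' = p k" using coproduct_eq[OF cp p'(1) p] p'(2) p\<iota> by simp
      then show "p' \<cdot> y = zer (sh (- 1) P) (L k)"
        unfolding p_def using comp_assoc[OF y(1) d q(1)] dy comp_zer_right[OF Po'(1) q(1)] by simp
    qed
    then have "b \<cdot> x = zer P (susp T S)" using y(2) susp_zer[OF Po'(1) S] Po'(2) by simp
    then obtain x' where x': "x' \<in> Hom T P S" "c \<cdot> x' = x" using exact_cov2[OF t x] by blast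
    have "\<exists>k. \<exists>g\<in>Hom T P (L k). u k \<cdot> g = c \<cdot> x'" using cf[OF P x'(1)]
    proof induction
      case zero
      then show ?case using comp_zer_right[OF Po u] comp_zer_right[OF Po C(2)] zer_Hom[OF Po Lo] by metis
    next
      case (step x i \<phi>)
      then obtain k g where g: "g \<in> Hom T P (L k)" "u k \<cdot> g = c \<cdot> x" by blast
      define m where "m = max i k"
      define G where "G = trans L \<tau> i (m - i) \<cdot> \<phi> \<boxplus> trans L \<tau> k (m - k) \<cdot> g"
      have t1: "trans L \<tau> i (m - i) \<in> Hom T (L i) (L m)" "trans L \<tau> k (m - k) \<in> Hom T (L k) (L m)"
        using tr[of i "m - i"] tr[of k "m - k"] by (simp_all add: m_def)
      have t2: "u m \<cdot> trans L \<tau> i (m - i) = u i" "u m \<cdot> trans L \<tau> k (m - k) = u k"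
        using ut[of i "m - i"] ut[of k "m - k"] by (simp_all add: m_def)
      have "u m \<cdot> G = (u m \<cdot> trans L \<tau> i (m - i)) \<cdot> \<phi> \<boxplus> (u m \<cdot> trans L \<tau> k (m - k)) \<cdot> g"
        unfolding G_def using comp_add_right[OF comp_closed[OF step(3) t1(1)] comp_closed[OF g(1) t1(2)] u]
          comp_assoc[OF step(3) t1(1) u] comp_assoc[OF g(1) t1(2) u] by simp
      also have "\<dots> = c \<cdot> (\<iota> i \<cdot> \<phi> \<boxplus> x)"
        using t2 g(2) comp_add_right[OF comp_closed[OF step(3) \<iota>] fsums_Hom[OF cp Po step(1)] C(2)]
          comp_assoc[OF step(3) \<iota> C(2)] by (simp add: u_def)
      finally show ?case using add_Hom[OF comp_closed[OF step(3) t1(1)] comp_closed[OF g(1) t1(2)]] G_def by metis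
    qed
    then show ?thesis using x' by simp
  qed
  \<comment> \<open>The image of \<open>g\<close> in stage \<open>k + n\<close> is the coordinate of
    index \<open>k + n\<close> of an arrow \<open>x\<close> with
    \<open>d \<cdot> x = \<iota> k \<cdot> g\<close>, hence zero for large \<open>n\<close>.\<close>
  have die: "\<exists>n. trans L \<tau> k n \<cdot> g = zer P (L (k + n))"
    if P: "P \<in> compacts \<kappa> T" and g: "g \<in> Hom T P (L k)" and z: "u k \<cdot> g = zer P F" for P k g
  proof -
    note Po = compact_obj[OF P]
    have "c \<cdot> (\<iota> k \<cdot> g) = zer P F" using z comp_assoc[OF g \<iota> C(2)] by (simp add: u_def)
    then obtain x where x: "x \<in> Hom T P S" "d \<cdot> x = \<iota> k \<cdot> g" using exact_cov[OF t comp_closed[OF g \<iota>]] by blast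
    obtain n0 where n0: "\<And>n. n \<ge> n0 \<Longrightarrow> p n \<cdot> x = zer P (L n)"
      using fsums_pr_eventually[OF cp Po cf[OF P x(1)] p p\<iota>] by blast
    have "trans L \<tau> k n0 \<cdot> g = (q (k + n0) \<cdot> \<iota> k) \<cdot> g" using q(2)[of "k + n0" k] by simp
    also have "\<dots> = p (k + n0) \<cdot> x"
      unfolding p_def using comp_assoc[OF g \<iota> q(1)] comp_assoc[OF x(1) d q(1)] x(2) by simp
    finally show ?thesis using n0 by auto
  qed
  have weak: "\<exists>h\<in>Hom T F t'. \<forall>k. h \<cdot> u k = f k"
    if f: "\<And>k. f k \<in> Hom T (L k) t'" "\<And>k. f (Suc k) \<cdot> \<tau> k = f k" for t' f
  proof -
    have t': "t' \<in> obj T" using f(1) Hom_obj by blast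
    obtain \<phi> where \<phi>: "\<phi> \<in> Hom T S t'" "\<And>k. \<phi> \<cdot> \<iota> k = f k" using coproduct_ex[OF cp t', of f] f(1) by blast
    have "\<phi> \<cdot> s = \<phi>"
    proof (rule coproduct_eq[OF cp comp_closed[OF s(1) \<phi>(1)] \<phi>(1)])
      fix k
      show "(\<phi> \<cdot> s) \<cdot> \<iota> k = \<phi> \<cdot> \<iota> k"
        using comp_assoc[OF \<iota> s(1) \<phi>(1)] comp_assoc[OF \<tau> \<iota> \<phi>(1)] s(2) \<phi>(2) f(2) by simp
    qed
    then have "\<phi> \<cdot> d = zer S t'" using d_comp[OF \<phi>(1)] sub_eq_zer_iff[OF \<phi>(1) \<phi>(1)] by simp
    then obtain h where h: "h \<in> Hom T F t'" "h \<cdot> c = \<phi>" using exact_contra[OF t \<phi>(1)] by blast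
    have "h \<cdot> u k = f k" for k using comp_assoc[OF \<iota> C(2) h(1)] h(2) \<phi>(2) by (simp add: u_def)
    then show ?thesis using h by blast
  qed
  \<comment> \<open>Such an \<open>f\<close> factors through \<open>b\<close>; solving the
    telescoping equations writes the factor as \<open>\<Psi>\<close> after the suspension of
    \<open>d\<close>, and that suspension composes with \<open>b\<close> to zero.\<close>
  have van: "f = zer F t'" if t': "t' \<in> obj T" and f: "f \<in> Hom T F t'" "\<And>k. f \<cdot> u k = zer (L k) t'"
    and tele: "\<And>\<phi>. (\<forall>k. \<phi> k \<in> Hom T (susp T (L k)) t') \<Longrightarrow>
          \<exists>\<psi>. \<forall>k. \<psi> k \<in> Hom T (susp T (L k)) t' \<and> \<phi> k = \<psi> k \<boxminus> \<psi> (Suc k) \<cdot> susp_arr T (\<tau> k)" for t' f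
  proof -
    note fc = comp_closed[OF C(2) f(1)]
    have "f \<cdot> c = zer S t'"
    proof (rule coproduct_eq[OF cp fc zer_Hom[OF S t']])
      fix k show "(f \<cdot> c) \<cdot> \<iota> k = zer S t' \<cdot> \<iota> k"
        using comp_assoc[OF \<iota> C(2) f(1)] f(2)[of k] comp_zer_left[OF t' \<iota>] by (simp add: u_def)
    qed
    then obtain f' where f': "f' \<in> Hom T (susp T S) t'" "f' \<cdot> b = f" using exact_contra2[OF t f(1)] by blast
    have cp1: "is_coproduct T UNIV (\<lambda>k. susp T (L k)) (susp T S) (\<lambda>k. susp_arr T (\<iota> k))"
      using shift_coproduct[OF cp, of 1] by simp
    note S\<iota> = susp_Hom[OF \<iota>]
    obtain \<psi> where \<psi>: "\<And>k. \<psi> k \<in> Hom T (susp T (L k)) t'"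
      "\<And>k. f' \<cdot> susp_arr T (\<iota> k) = \<psi> k \<boxminus> \<psi> (Suc k) \<cdot> susp_arr T (\<tau> k)"
      using tele[of "\<lambda>k. f' \<cdot> susp_arr T (\<iota> k)"] comp_closed[OF S\<iota> f'(1)] by blast
    obtain \<Psi> where \<Psi>: "\<Psi> \<in> Hom T (susp T S) t'" "\<And>k. \<Psi> \<cdot> susp_arr T (\<iota> k) = \<psi> k"
      using coproduct_ex[OF cp1 t', of \<psi>] \<psi>(1) by blast
    note Sd = susp_Hom[OF d]
    have "\<Psi> \<cdot> susp_arr T d = f'"
    proof (rule coproduct_eq[OF cp1 comp_closed[OF Sd \<Psi>(1)] f'(1)])
      fix k
      have "d \<cdot> \<iota> k = \<iota> k \<boxminus> \<iota> (Suc k) \<cdot> \<tau> k"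
        unfolding d_def using comp_sub_left[OF \<iota> ide[OF S] s(1)] comp_ide[OF \<iota>] s(2) by simp
      then have "susp_arr T d \<cdot> susp_arr T (\<iota> k) = susp_arr T (\<iota> k) \<boxminus> susp_arr T (\<iota> (Suc k)) \<cdot> susp_arr T (\<tau> k)"
        by (simp only: susp_comp[OF \<iota> d, symmetric] susp_sub[OF \<iota> comp_closed[OF \<tau> \<iota>]] susp_comp[OF \<tau> \<iota>])
      then have "\<Psi> \<cdot> (susp_arr T d \<cdot> susp_arr T (\<iota> k)) = \<psi> k \<boxminus> \<psi> (Suc k) \<cdot> susp_arr T (\<tau> k)"
        using comp_sub_right[OF S\<iota> comp_closed[OF susp_Hom[OF \<tau>] S\<iota>] \<Psi>(1)] \<Psi>(2)
          comp_assoc[OF susp_Hom[OF \<tau>] S\<iota> \<Psi>(1)] by simp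
      then show "(\<Psi> \<cdot> susp_arr T d) \<cdot> susp_arr T (\<iota> k) = f' \<cdot> susp_arr T (\<iota> k)"
        using comp_assoc[OF S\<iota> Sd \<Psi>(1)] \<psi>(2) by simp
    qed
    then have "f = \<Psi> \<cdot> (susp_arr T d \<cdot> b)" using f'(2) comp_assoc[OF C(3) Sd \<Psi>(1)] by simp
    then show ?thesis using triangle_zero3[OF t] comp_zer_right[OF F \<Psi>(1)] by simp
  qed
  have "hocolim \<kappa> L \<tau> F u" unfolding hocolim_def
    apply (intro conjI allI impI ballI)
    using u u\<tau> lift die apply (blast, blast, blast, blast)
    using weak apply blast
    using van by blast
  then show ?thesis by blast
qed

lemma hocolim_cocone:
  assumes "hocolim \<kappa> L \<tau> F u"
  shows "u k \<in> Hom T (L k) F" "u (Suc k) \<cdot> \<tau> k = u k"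
  using assms[unfolded hocolim_def, THEN conjunct1] by blast+

lemma hocolim_lift:
  assumes "hocolim \<kappa> L \<tau> F u" "P \<in> compacts \<kappa> T" "x \<in> Hom T P F"
  shows "\<exists>k. \<exists>g\<in>Hom T P (L k). u k \<cdot> g = x"
  using assms(1)[unfolded hocolim_def, THEN conjunct2, THEN conjunct1] assms(2,3) by blast

lemma hocolim_die:
  assumes "hocolim \<kappa> L \<tau> F u" "P \<in> compacts \<kappa> T" "g \<in> Hom T P (L k)" "u k \<cdot> g = zer P F"
  shows "\<exists>n. trans L \<tau> k n \<cdot> g = zer P (L (k + n))"
  using assms(1)[unfolded hocolim_def, THEN conjunct2, THEN conjunct2, THEN conjunct1] assms(2-4) by blast

lemma hocolim_weak:
  assumes "hocolim \<kappa> L \<tau> F u" "\<And>k. f k \<in> Hom T (L k) t" "\<And>k. f (Suc k) \<cdot> \<tau> k = f k"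
  shows "\<exists>h\<in>Hom T F t. \<forall>k. h \<cdot> u k = f k"
  using assms(1)[unfolded hocolim_def, THEN conjunct2, THEN conjunct2, THEN conjunct2, THEN conjunct1,
      THEN spec, THEN spec, of f t] assms(2,3) by blast

lemma hocolim_vanish:
  assumes "hocolim \<kappa> L \<tau> F u" "f \<in> Hom T F t" "\<And>k. f \<cdot> u k = zer (L k) t"
    and "\<And>\<phi>. (\<And>k. \<phi> k \<in> Hom T (susp T (L k)) t) \<Longrightarrow>
      \<exists>\<psi>. \<forall>k. \<psi> k \<in> Hom T (susp T (L k)) t \<and> \<phi> k = \<psi> k \<boxminus> \<psi> (Suc k) \<cdot> susp_arr T (\<tau> k)"
  shows "f = zer F t"
  using assms(1)[unfolded hocolim_def, THEN conjunct2, THEN conjunct2, THEN conjunct2, THEN conjunct2,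
      THEN bspec, of t, THEN mp, THEN bspec, of f] assms(2-4) Hom_obj[OF assms(2)] by simp

text \<open>The derived limit vanishes because its terms do; the suspended objects are what it is
  formed from.\<close>

lemma hocolim_orth:
  assumes h: "hocolim \<kappa> L \<tau> F u" and F: "F \<in> obj T" and t: "\<And>k. hz (L k) t" "\<And>k. hz (susp T (L k)) t"
    and \<tau>: "\<And>k. \<tau> k \<in> Hom T (L k) (L (Suc k))"
  shows "hz F t"
proof (rule hzI[OF F])
  show to: "t \<in> obj T" using t(1) hz_obj by blast
  fix f assume f: "f \<in> Hom T F t"
  show "f = zer F t"
  proof (rule hocolim_vanish[OF h f])
    show "f \<cdot> u k = zer (L k) t" for k using hzD[OF t(1) comp_closed[OF hocolim_cocone(1)[OF h] f]] .
    fix \<phi> assume p: "\<And>k. \<phi> k \<in> Hom T (susp T (L k)) t"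
    have "zer (susp T (L k)) t \<in> Hom T (susp T (L k)) t \<and>
      \<phi> k = zer (susp T (L k)) t \<boxminus> zer (susp T (L (Suc k))) t \<cdot> susp_arr T (\<tau> k)" for k
    proof -
      have o: "susp T (L k) \<in> obj T" using t(2) hz_obj by blast
      note z = zer_Hom[OF o to]
      then show ?thesis using hzD[OF t(2) p] comp_zer_left[OF to susp_Hom[OF \<tau>]] sub_zer[OF z] by simp
    qed
    then show "\<exists>\<psi>. \<forall>k. \<psi> k \<in> Hom T (susp T (L k)) t \<and> \<phi> k = \<psi> k \<boxminus> \<psi> (Suc k) \<cdot> susp_arr T (\<tau> k)"
      by (intro exI[of _ "\<lambda>k. zer (susp T (L k)) t"]) blast
  qed
qed

section \<open>Representable functors are cohomological\<close>

lemma yoneda_simps [simp]: "on_obj (yoneda T F) X = Hom_mod T X F" "on_arr (yoneda T F) f g = g \<cdot> f"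
  by (simp_all add: yoneda_def)

lemma yoneda_linear:
  assumes "U \<subseteq> obj T" "F \<in> obj T"
  shows "linear_functor R T U (yoneda T F)"
proof (rule linear_functor.intro)
  fix X assume X: "X \<in> U"
  show "module R (on_obj (yoneda T F) X)" using Hom_module X assms by auto
  fix x assume "x \<in> carrier (on_obj (yoneda T F) X)"
  then show "on_arr (yoneda T F) (ide T X) x = x" using comp_ide by simp
next
  fix X Y f assume f: "f \<in> Hom T X Y"
  show "on_arr (yoneda T F) f \<in> linear_maps R (on_obj (yoneda T F) Y) (on_obj (yoneda T F) X)"
    unfolding linear_maps_def using comp_closed[OF f] comp_add_left[OF f] comp_scale_left[OF _ f] by auto
next
  fix X Y Z f g x assume "f \<in> Hom T X Y" "g \<in> Hom T Y Z" "x \<in> carrier (on_obj (yoneda T F) Z)"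
  then show "on_arr (yoneda T F) (g \<cdot> f) x = on_arr (yoneda T F) f (on_arr (yoneda T F) g x)"
    using comp_assoc by simp
next
  fix X Y f g x assume "f \<in> Hom T X Y" "g \<in> Hom T X Y" "x \<in> carrier (on_obj (yoneda T F) Y)"
  then show "on_arr (yoneda T F) (f \<boxplus> g) x = on_arr (yoneda T F) f x \<oplus>\<^bsub>on_obj (yoneda T F) X\<^esub> on_arr (yoneda T F) g x"
    using comp_add_right by simp
next
  fix X Y r f x assume "r \<in> carrier R" "f \<in> Hom T X Y" "x \<in> carrier (on_obj (yoneda T F) Y)"
  then show "on_arr (yoneda T F) (arr_scale T r f) x = r \<odot>\<^bsub>on_obj (yoneda T F) X\<^esub> on_arr (yoneda T F) f x"
    using comp_scale_right by simp
qed

text \<open>The exactness of the shifted sequence against \<open>F\<close> is the exactness of the original sequence against a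
  shift of \<open>F\<close>; in this way no signs occur.\<close>

lemma yoneda_cohomological:
  assumes "U \<subseteq> obj T" "F \<in> obj T"
  shows "cohomological_functor R T U (yoneda T F)"
  unfolding cohomological_functor_def
proof (intro conjI ballI allI impI)
  show "linear_functor R T U (yoneda T F)" using yoneda_linear[OF assms] .
  fix X Y Z f g h n assume t: "triangle T X Y Z f g h"
  note H = triangle_Hom[OF t] and XYZ = triangle_obj[OF t]
  define F' where "F' = sh (- n) F"
  have F': "F' \<in> obj T" "sh n F' = F" using assms(2) shift_obj shift_inverse(2) unfolding F'_def by auto
  have ex: "exact_at (on_obj (yoneda T F) (sh n C)) (on_arr (yoneda T F) (sha n b))
                     (on_obj (yoneda T F) (sh n B)) (on_arr (yoneda T F) (sha n a)) (on_obj (yoneda T F) (sh n A))"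
    if ab: "a \<in> Hom T A B" "b \<in> Hom T B C" "b \<cdot> a = zer A C"
      and e: "\<And>x. x \<in> Hom T B F' \<Longrightarrow> x \<cdot> a = zer A F' \<Longrightarrow> \<exists>x'\<in>Hom T C F'. x' \<cdot> b = x" for A B C a b
  proof -
    have o: "A \<in> obj T" "B \<in> obj T" "C \<in> obj T" using Hom_obj[OF ab(1)] Hom_obj[OF ab(2)] by auto
    have z: "sha n b \<cdot> sha n a = zer (sh n A) (sh n C)"
      using shift_comp[OF ab(1,2)] ab(3) shift_zer[OF o(1,3)] by simp
    note a = shift_Hom[OF ab(1), of n] and b = shift_Hom[OF ab(2), of n]
    have 1: "(x \<cdot> sha n b) \<cdot> sha n a = zer (sh n A) F \<and> x \<cdot> sha n b \<in> Hom T (sh n B) F" if "x \<in> Hom T (sh n C) F" for x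
      using comp_assoc[OF a b that] z comp_zer_right[OF shift_obj[OF o(1)] that] comp_closed[OF b that] by simp
    have 2: "\<exists>x'\<in>Hom T (sh n C) F. x' \<cdot> sha n b = x" if x: "x \<in> Hom T (sh n B) F" "x \<cdot> sha n a = zer (sh n A) F" for x
    proof -
      obtain y where y: "y \<in> Hom T B F'" "sha n y = x" using unshift_Hom[OF _ o(2) F'(1)] x(1) F'(2) by auto
      have "sha n (y \<cdot> a) = sha n (zer A F')" using shift_comp[OF ab(1) y(1)] y(2) x(2) shift_zer[OF o(1) F'(1)] F'(2) by simp
      then have "y \<cdot> a = zer A F'" using shift_inj[OF comp_closed[OF ab(1) y(1)] zer_Hom[OF o(1) F'(1)]] by blast
      then obtain y' where y': "y' \<in> Hom T C F'" "y' \<cdot> b = y" using e[OF y(1)] by blast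
      then have "sha n y' \<cdot> sha n b = x" using shift_comp[OF ab(2) y'(1)] y(2) by simp
      then show ?thesis using shift_Hom[OF y'(1), of n] F'(2) by auto
    qed
    show ?thesis unfolding exact_at_def using 1 2 by auto
  qed
  have s: "sh (n + 1) X = sh n (susp T X)" using shift_add[OF XYZ(1), of n 1] by simp
  show "exact_at (on_obj (yoneda T F) (sh (n + 1) X)) (on_arr (yoneda T F) (sha n h))
                 (on_obj (yoneda T F) (sh n Z)) (on_arr (yoneda T F) (sha n g)) (on_obj (yoneda T F) (sh n Y))"
    unfolding s using ex[OF H(2,3) triangle_zero2[OF t]] exact_contra2[OF t] by blast
  show "exact_at (on_obj (yoneda T F) (sh n Z)) (on_arr (yoneda T F) (sha n g))
                 (on_obj (yoneda T F) (sh n Y)) (on_arr (yoneda T F) (sha n f)) (on_obj (yoneda T F) (sh n X))"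
    using ex[OF H(1,2) triangle_zero1[OF t]] exact_contra[OF t] by blast
  define h' where "h' = sha (- 1) h"
  have X1: "sh (- 1) (susp T X) = X" using shift_inverse(1)[OF XYZ(1), of 1] by simp
  have h': "h' \<in> Hom T (sh (- 1) Z) X" unfolding h'_def using shift_Hom[OF H(3), of "- 1"] X1 by simp
  have sh': "susp_arr T h' = h" "susp T (sh (- 1) Z) = Z"
    unfolding h'_def using shift_arr_inverse(2)[of h 1] HomD[OF H(3)] shift_inverse(2)[OF XYZ(3), of 1] by simp_all
  have "susp_arr T (f \<cdot> h') = zer (susp T (sh (- 1) Z)) (susp T Y)"
    using susp_comp[OF h' H(1)] sh' triangle_zero3[OF t] by simp
  then have z: "f \<cdot> h' = zer (sh (- 1) Z) Y" using susp_eq_zer[OF comp_closed[OF h' H(1)]] by blast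
  have e0: "\<exists>x'\<in>Hom T Y F'. x' \<cdot> f = x" if x: "x \<in> Hom T X F'" "x \<cdot> h' = zer (sh (- 1) Z) F'" for x
  proof -
    have "susp_arr T x \<cdot> h = zer Z (susp T F')"
      using susp_comp[OF h' x(1)] x(2) sh' susp_zer[OF shift_obj[OF XYZ(3)] F'(1), of "- 1"] by simp
    then show ?thesis using exact_contra0[OF t x(1)] by blast
  qed
  have s': "sh (n - 1) Z = sh n (sh (- 1) Z)" "sha (n - 1) h = sha n h'"
    unfolding h'_def using shift_add[OF XYZ(3), of n "- 1"] shift_arr_add[of h n "- 1"] HomD[OF H(3)] by simp_all
  show "exact_at (on_obj (yoneda T F) (sh n Y)) (on_arr (yoneda T F) (sha n f))
                 (on_obj (yoneda T F) (sh n X)) (on_arr (yoneda T F) (sha (n - 1) h)) (on_obj (yoneda T F) (sh (n - 1) Z))"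
    unfolding s' using ex[OF h' H(1) z] e0 by blast
qed

end

section \<open>Towers over a cohomological functor\<close>

text \<open>The class \<open>U\<close> stays a parameter: the given functor lives on the compact
  objects, while \<open>Hom(-, F)\<close> is later taken on all objects, where infinite coproducts
  can be tested as well.\<close>

locale cohomological = R_linear_triangulated_category R T
  for R :: "('r, 'a) ring_scheme" and T :: "('o, 'm, 'r, 'e) tri_category_scheme" (structure) +
  fixes U :: "'o set" and H :: "('o, 'm, 'r, 'x) mod_functor"
  assumes coh: "cohomological_functor R T U H"
    and U_obj: "U \<subseteq> obj T" and U_shift: "X \<in> U \<Longrightarrow> sh n X \<in> U"
begin

abbreviation HH where "HH X \<equiv> carrier (on_obj H X)"
abbreviation Hz where "Hz X \<equiv> \<zero>\<^bsub>on_obj H X\<^esub>"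

lemma lin: "linear_functor R T U H"
  using coh by (simp add: cohomological_functor_def)

lemma H_module: "X \<in> U \<Longrightarrow> module R (on_obj H X)"
  using linear_functor.obj_module[OF lin] .

lemma H_linear: "X \<in> U \<Longrightarrow> Y \<in> U \<Longrightarrow> f \<in> Hom T X Y \<Longrightarrow> on_arr H f \<in> linear_maps R (on_obj H Y) (on_obj H X)"
  using linear_functor.arr_linear[OF lin] .

lemma H_mem: "X \<in> U \<Longrightarrow> Y \<in> U \<Longrightarrow> f \<in> Hom T X Y \<Longrightarrow> x \<in> HH Y \<Longrightarrow> on_arr H f x \<in> HH X"
  using H_linear[of X Y f] by (auto simp: linear_maps_def)

lemma H_ide: "X \<in> U \<Longrightarrow> x \<in> HH X \<Longrightarrow> on_arr H (ide T X) x = x"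
  using linear_functor.ide[OF lin] .

lemma H_comp: "X \<in> U \<Longrightarrow> Y \<in> U \<Longrightarrow> Z \<in> U \<Longrightarrow> f \<in> Hom T X Y \<Longrightarrow> g \<in> Hom T Y Z \<Longrightarrow> x \<in> HH Z \<Longrightarrow>
    on_arr H (g \<cdot> f) x = on_arr H f (on_arr H g x)"
  using linear_functor.comp[OF lin] .

lemma H_add: "X \<in> U \<Longrightarrow> Y \<in> U \<Longrightarrow> f \<in> Hom T X Y \<Longrightarrow> g \<in> Hom T X Y \<Longrightarrow> x \<in> HH Y \<Longrightarrow>
    on_arr H (f \<boxplus> g) x = on_arr H f x \<oplus>\<^bsub>on_obj H X\<^esub> on_arr H g x"
  using linear_functor.add[OF lin] .

lemma H_plus: "X \<in> U \<Longrightarrow> Y \<in> U \<Longrightarrow> f \<in> Hom T X Y \<Longrightarrow> x \<in> HH Y \<Longrightarrow> x' \<in> HH Y \<Longrightarrow>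
    on_arr H f (x \<oplus>\<^bsub>on_obj H Y\<^esub> x') = on_arr H f x \<oplus>\<^bsub>on_obj H X\<^esub> on_arr H f x'"
  using H_linear[of X Y f] by (auto simp: linear_maps_def)

lemma H_zero: "X \<in> U \<Longrightarrow> Y \<in> U \<Longrightarrow> f \<in> Hom T X Y \<Longrightarrow> on_arr H f (Hz Y) = Hz X"
  using linear_maps_zero[OF H_module H_module H_linear] by blast

lemma H_minus: "X \<in> U \<Longrightarrow> Y \<in> U \<Longrightarrow> f \<in> Hom T X Y \<Longrightarrow> x \<in> HH Y \<Longrightarrow>
    on_arr H f (\<ominus>\<^bsub>on_obj H Y\<^esub> x) = \<ominus>\<^bsub>on_obj H X\<^esub> on_arr H f x"
  using linear_maps_minus[OF H_module H_module H_linear] by blast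

lemma H_zer:
  assumes "X \<in> U" "Y \<in> U" "x \<in> HH Y"
  shows "on_arr H (zer X Y) x = Hz X"
proof -
  interpret M: module R "on_obj H X" using H_module assms by blast
  have o: "X \<in> obj T" "Y \<in> obj T" using assms U_obj by auto
  note z = zer_Hom[OF o]
  have "on_arr H (zer X Y) x \<oplus>\<^bsub>on_obj H X\<^esub> on_arr H (zer X Y) x = on_arr H (zer X Y) x"
    using H_add[OF assms(1,2) z z assms(3)] add_zer(1)[OF z] by simp
  then show ?thesis using H_mem[OF assms(1,2) z assms(3)] by simp
qed

lemma H_neg:
  assumes "X \<in> U" "Y \<in> U" "f \<in> Hom T X Y" "x \<in> HH Y"
  shows "on_arr H (neg f) x = \<ominus>\<^bsub>on_obj H X\<^esub> on_arr H f x"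
proof -
  interpret M: module R "on_obj H X" using H_module assms by blast
  note n = neg_Hom[OF assms(3)]
  have "on_arr H (neg f) x \<oplus>\<^bsub>on_obj H X\<^esub> on_arr H f x = Hz X"
    using H_add[OF assms(1,2) n assms(3,4)] add_neg(2)[OF assms(3)] H_zer[OF assms(1,2,4)] by simp
  then show ?thesis
    using M.M.minus_equality H_mem[OF assms(1,2) n assms(4)] H_mem[OF assms(1,2,3,4)] by metis
qed

lemma H_sub_zero:
  assumes "X \<in> U" "Y \<in> U" "f \<in> Hom T X Y" "g \<in> Hom T X Y" "x \<in> HH Y" "on_arr H f x = on_arr H g x"
  shows "on_arr H (f \<boxminus> g) x = Hz X"
proof -
  interpret M: module R "on_obj H X" using H_module assms by blast
  show ?thesis unfolding sub_def
    using H_add[OF assms(1,2,3) neg_Hom[OF assms(4)] assms(5)] H_neg[OF assms(1,2,4,5)] assms(6)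
      M.M.r_neg H_mem[OF assms(1,2,4,5)] by simp
qed

lemma H_exact:
  assumes "triangle T X Y Z f g h" "X \<in> U" "Y \<in> U" "Z \<in> U"
  shows "on_arr H (sha n h) ` HH (sh (n + 1) X) = {x \<in> HH (sh n Z). on_arr H (sha n g) x = Hz (sh n Y)}"
    and "on_arr H (sha n g) ` HH (sh n Z) = {x \<in> HH (sh n Y). on_arr H (sha n f) x = Hz (sh n X)}"
    and "on_arr H (sha n f) ` HH (sh n Y) = {x \<in> HH (sh n X). on_arr H (sha (n - 1) h) x = Hz (sh (n - 1) Z)}"
  using coh[unfolded cohomological_functor_def exact_at_def, THEN conjunct2, THEN bspec, OF assms(2),
      THEN bspec, OF assms(3), THEN bspec, OF assms(4), THEN spec, THEN spec, THEN spec, THEN mp, OF assms(1),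
      THEN spec, of n] by blast+

lemma H_zero_object:
  assumes "is_zero T Z" "Z \<in> U" "x \<in> HH Z"
  shows "x = Hz Z"
  using H_ide[OF assms(2,3)] H_zer[OF assms(2,2,3)] assms(1) by (simp add: is_zero_def)

end

lemma (in R_linear_triangulated_category) yoneda_on_arr: "on_arr (yoneda T F) f = (\<lambda>g. g \<cdot> f)"
  by (simp add: yoneda_def)

lemma (in R_linear_triangulated_category) yoneda_interpret:
  assumes "F \<in> obj T" "U \<subseteq> obj T" "\<And>X n. X \<in> U \<Longrightarrow> sh n X \<in> U"
  shows "cohomological R T U (yoneda T F)"
  using yoneda_cohomological[OF assms(2,1)] assms(2,3) R_linear_triangulated_category_axioms
  by (simp add: cohomological_def cohomological_axioms_def)

text \<open>By the Yoneda lemma, \<open>y k\<close> is a natural transformation from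
  \<open>Hom(-, L k)\<close> to \<open>H\<close>, and \<open>y_\<tau>\<close> says that these form a
  cocone over the tower.\<close>

locale tower = cohomological R T U H
  for R :: "('r, 'a) ring_scheme" and T :: "('o, 'm, 'r, 'e) tri_category_scheme" (structure)
    and U :: "'o set" and H :: "('o, 'm, 'r, 'x) mod_functor" +
  fixes L :: "nat \<Rightarrow> 'o" and \<tau> :: "nat \<Rightarrow> 'm" and y :: "nat \<Rightarrow> 'x"
  assumes L_U: "L k \<in> U" and \<tau>: "\<tau> k \<in> Hom T (L k) (L (Suc k))"
    and y: "y k \<in> carrier (on_obj H (L k))" and y_\<tau>: "on_arr H (\<tau> k) (y (Suc k)) = y k"
begin

abbreviation tr where "tr \<equiv> trans L \<tau>"
lemmas tr_Hom = trans_Hom[where \<tau> = \<tau>, OF \<tau>]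

lemma tr_Hom': "i \<le> p \<Longrightarrow> tr i (p - i) \<in> Hom T (L i) (L p)"
  using tr_Hom[of i "p - i"] by simp

lemma y_tr: "on_arr H (tr i n) (y (i + n)) = y i"
proof (induction n)
  case 0 then show ?case using H_ide[OF L_U y] by simp
next
  case (Suc n)
  have "on_arr H (\<tau> (i + n) \<cdot> tr i n) (y (Suc (i + n))) = on_arr H (tr i n) (on_arr H (\<tau> (i + n)) (y (Suc (i + n))))"
    using H_comp[OF L_U L_U L_U tr_Hom \<tau> y] .
  then show ?case using Suc y_\<tau> by simp
qed

lemma H_tr: "Z \<in> U \<Longrightarrow> g \<in> Hom T Z (L i) \<Longrightarrow> on_arr H (tr i n \<cdot> g) (y (i + n)) = on_arr H g (y i)"
  using H_comp[OF _ L_U L_U _ tr_Hom y] y_tr by simp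

lemma H_tr': "Z \<in> U \<Longrightarrow> g \<in> Hom T Z (L i) \<Longrightarrow> i \<le> p \<Longrightarrow> on_arr H (tr i (p - i) \<cdot> g) (y p) = on_arr H g (y i)"
  using H_tr[of Z g i "p - i"] by simp

text \<open>The shift \<open>s\<close> is kept apart from \<open>Z\<close> because the argument for
  extensions calls on the neighbouring shifts of the outer terms.\<close>

definition lifts where
  "lifts s p Z \<longleftrightarrow> (\<forall>x\<in>HH (sh s Z). \<exists>g\<in>Hom T (sh s Z) (L p). on_arr H g (y p) = x)"

definition dies where
  "dies s i n Z \<longleftrightarrow> (\<forall>g\<in>Hom T (sh s Z) (L i). on_arr H g (y i) = Hz (sh s Z) \<longrightarrow>
     tr i n \<cdot> g = zer (sh s Z) (L (i + n)))"

text \<open>The tower computes \<open>H\<close> on the shifts of the objects of \<open>\<Z>\<close>, and the number of steps needed for this is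
  uniform in \<open>\<Z>\<close>.\<close>

definition good where
  "good \<Z> \<longleftrightarrow> \<Z> \<subseteq> U \<and> (\<forall>s i. \<exists>n. \<forall>Z\<in>\<Z>. lifts s (i + n) Z \<and> dies s i n Z)"

lemma lifts_mono:
  assumes "lifts s p Z" "p \<le> q" "Z \<in> U"
  shows "lifts s q Z"
  unfolding lifts_def
proof
  fix x assume "x \<in> HH (sh s Z)"
  then obtain g where g: "g \<in> Hom T (sh s Z) (L p)" "on_arr H g (y p) = x" using assms(1) unfolding lifts_def by blast
  then show "\<exists>g\<in>Hom T (sh s Z) (L q). on_arr H g (y q) = x"
    using H_tr'[OF U_shift[OF assms(3)] g(1) assms(2)] comp_closed[OF g(1) tr_Hom'[OF assms(2)]] by auto
qed

lemma tr_die_mono: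
  assumes "tr i n \<cdot> g = zer Z (L (i + n))" "g \<in> Hom T Z (L i)" "n \<le> m"
  shows "tr i m \<cdot> g = zer Z (L (i + m))"
proof -
  have e: "tr i m = tr (i + n) (m - n) \<cdot> tr i n" using trans_add[where \<tau> = \<tau>, OF \<tau>, of i n "m - n"] assms(3) by simp
  have "tr (i + n) (m - n) \<in> Hom T (L (i + n)) (L (i + m))" using tr_Hom[of "i + n" "m - n"] assms(3) by simp
  then show ?thesis unfolding e
    using comp_assoc[OF assms(2) tr_Hom] assms(1) comp_zer_right Hom_obj[OF assms(2)] by metis
qed

lemma dies_mono:
  assumes "dies s i n Z" "n \<le> m"
  shows "dies s i m Z"
  using assms(1) tr_die_mono[OF _ _ assms(2)] unfolding dies_def by blast

lemma good_subset: "good \<Z> \<Longrightarrow> \<Z>' \<subseteq> \<Z> \<Longrightarrow> good \<Z>'"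
  unfolding good_def by (meson subset_iff)

lemma goodD:
  assumes "good \<Z>"
  obtains n where "\<And>Z. Z \<in> \<Z> \<Longrightarrow> lifts s (i + n) Z" "\<And>Z. Z \<in> \<Z> \<Longrightarrow> dies s i n Z"
  using assms unfolding good_def by metis

text \<open>Lifting and vanishing both persist at later stages, so their bounds may be found
  separately and merged by a maximum.\<close>

lemma goodI:
  assumes "\<Z> \<subseteq> U" "\<And>s i. \<exists>p n. \<forall>Z\<in>\<Z>. lifts s p Z \<and> dies s i n Z"
  shows "good \<Z>"
  unfolding good_def
proof (intro conjI allI assms(1))
  fix s i
  obtain p n where pn: "\<And>Z. Z \<in> \<Z> \<Longrightarrow> lifts s p Z" "\<And>Z. Z \<in> \<Z> \<Longrightarrow> dies s i n Z" using assms(2) by metis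
  have "lifts s (i + max n p) Z \<and> dies s i (max n p) Z" if "Z \<in> \<Z>" for Z
    using lifts_mono[OF pn(1)[OF that], of "i + max n p"] dies_mono[OF pn(2)[OF that], of "max n p"] that assms(1) by auto
  then show "\<exists>n. \<forall>Z\<in>\<Z>. lifts s (i + n) Z \<and> dies s i n Z" by blast
qed

lemma good_empty: "good {}"
  by (simp add: good_def)

lemma good_Un:
  assumes "good \<Z>" "good \<Z>'"
  shows "good (\<Z> \<union> \<Z>')"
proof (rule goodI)
  show U: "\<Z> \<union> \<Z>' \<subseteq> U" using assms by (auto simp: good_def)
  fix s i
  obtain n where n: "\<And>Z. Z \<in> \<Z> \<Longrightarrow> lifts s (i + n) Z" "\<And>Z. Z \<in> \<Z> \<Longrightarrow> dies s i n Z" using goodD[OF assms(1)] by metis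
  obtain m where m: "\<And>Z. Z \<in> \<Z>' \<Longrightarrow> lifts s (i + m) Z" "\<And>Z. Z \<in> \<Z>' \<Longrightarrow> dies s i m Z" using goodD[OF assms(2)] by metis
  have "lifts s (i + max n m) Z \<and> dies s i (max n m) Z" if "Z \<in> \<Z> \<union> \<Z>'" for Z
    using that n m lifts_mono[of s "i + n" Z "i + max n m"] lifts_mono[of s "i + m" Z "i + max n m"]
      dies_mono[of s i n Z "max n m"] dies_mono[of s i m Z "max n m"] U by auto
  then show "\<exists>p n. \<forall>Z\<in>\<Z> \<union> \<Z>'. lifts s p Z \<and> dies s i n Z" by blast
qed

lemma good_finite: "finite \<S> \<Longrightarrow> (\<And>Z. Z \<in> \<S> \<Longrightarrow> good {Z}) \<Longrightarrow> good \<S>"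
proof (induction \<S> rule: finite_induct)
  case empty then show ?case using good_empty by simp
next
  case (insert Z \<S>) then show ?case using good_Un[of "{Z}" \<S>] by simp
qed

lemma good_retract:
  assumes g: "good \<Z>" and U: "\<Z>' \<subseteq> U" and r: "\<And>Z. Z \<in> \<Z>' \<Longrightarrow> \<exists>S\<in>\<Z>. retract Z S"
  shows "good \<Z>'"
proof (rule goodI[OF U])
  fix s i
  obtain n where n: "\<And>Z. Z \<in> \<Z> \<Longrightarrow> lifts s (i + n) Z" "\<And>Z. Z \<in> \<Z> \<Longrightarrow> dies s i n Z" using goodD[OF g] by metis
  have "lifts s (i + n) Z \<and> dies s i n Z" if Z: "Z \<in> \<Z>'" for Z
  proof -
    obtain S where S: "S \<in> \<Z>" "retract Z S" using r Z by blast
    have ZU: "sh s Z \<in> U" "sh s S \<in> U" using Z U S(1) g U_shift by (auto simp: good_def)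
    obtain a b where ab: "a \<in> Hom T (sh s Z) (sh s S)" "b \<in> Hom T (sh s S) (sh s Z)" "b \<cdot> a = ide T (sh s Z)"
      using retract_shift[OF S(2), of s] unfolding retract_def by blast
    have "lifts s (i + n) Z" unfolding lifts_def
    proof
      fix x assume x: "x \<in> HH (sh s Z)"
      obtain g where g: "g \<in> Hom T (sh s S) (L (i + n))" "on_arr H g (y (i + n)) = on_arr H b x"
        using n(1)[OF S(1)] H_mem[OF ZU(2,1) ab(2) x] unfolding lifts_def by blast
      have "on_arr H (g \<cdot> a) (y (i + n)) = on_arr H a (on_arr H b x)" using H_comp[OF ZU L_U ab(1) g(1) y] g(2) by simp
      also have "\<dots> = x" using H_comp[OF ZU ZU(1) ab(1,2) x] ab(3) H_ide[OF ZU(1) x] by simp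
      finally show "\<exists>g\<in>Hom T (sh s Z) (L (i + n)). on_arr H g (y (i + n)) = x" using comp_closed[OF ab(1) g(1)] by blast
    qed
    moreover have "dies s i n Z" unfolding dies_def
    proof (intro ballI impI)
      fix g assume g: "g \<in> Hom T (sh s Z) (L i)" "on_arr H g (y i) = Hz (sh s Z)"
      have "on_arr H (g \<cdot> b) (y i) = Hz (sh s S)"
        using H_comp[OF ZU(2,1) L_U ab(2) g(1) y] g(2) H_zero[OF ZU(2,1) ab(2)] by simp
      then have 1: "tr i n \<cdot> (g \<cdot> b) = zer (sh s S) (L (i + n))"
        using n(2)[OF S(1)] comp_closed[OF ab(2) g(1)] unfolding dies_def by blast
      have "tr i n \<cdot> g = (tr i n \<cdot> (g \<cdot> b)) \<cdot> a"
        using comp_assoc[OF ab(1) comp_closed[OF ab(2) g(1)] tr_Hom] comp_assoc[OF ab(1,2) g(1)] ab(3) comp_ide[OF g(1)] by simp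
      also have "\<dots> = zer (sh s Z) (L (i + n))" unfolding 1 using comp_zer_left[OF _ ab(1)] L_U U_obj by blast
      finally show "tr i n \<cdot> g = zer (sh s Z) (L (i + n))" .
    qed
    ultimately show ?thesis by blast
  qed
  then show "\<exists>p n. \<forall>Z\<in>\<Z>'. lifts s p Z \<and> dies s i n Z" by blast
qed

lemma good_zero:
  assumes "\<Z> \<subseteq> U" "\<And>Z. Z \<in> \<Z> \<Longrightarrow> is_zero T Z"
  shows "good \<Z>"
proof (rule goodI[OF assms(1)])
  fix s i
  have "lifts s i Z \<and> dies s i 0 Z" if Z: "Z \<in> \<Z>" for Z
  proof -
    have ZU: "Z \<in> U" "sh s Z \<in> U" "Z \<in> obj T" using Z assms(1) U_shift U_obj by auto
    have z: "is_zero T (sh s Z)"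
      using assms(2)[OF Z] ZU(3) shift_ide[OF ZU(3), of s] shift_zer[OF ZU(3,3), of s] shift_obj by (simp add: is_zero_def)
    have o: "L i \<in> obj T" "sh s Z \<in> obj T" for i using L_U ZU U_obj by auto
    show ?thesis unfolding lifts_def dies_def
    proof (intro conjI ballI impI)
      fix x assume "x \<in> HH (sh s Z)"
      then have "on_arr H (zer (sh s Z) (L i)) (y i) = x" using H_zero_object[OF z ZU(2)] H_zer[OF ZU(2) L_U y] by simp
      then show "\<exists>g\<in>Hom T (sh s Z) (L i). on_arr H g (y i) = x" using zer_Hom[OF o(2,1)] by blast
    next
      fix g assume g: "g \<in> Hom T (sh s Z) (L i)"
      show "tr i 0 \<cdot> g = zer (sh s Z) (L (i + 0))"
        using hzD[OF is_zeroD(1)[OF z o(1)] comp_closed[OF g tr_Hom]] .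
    qed
  qed
  then show "\<exists>p n. \<forall>Z\<in>\<Z>. lifts s p Z \<and> dies s i n Z" by blast
qed

lemma good_direct_sum:
  assumes g: "good \<Z>" and U: "\<Z>' \<subseteq> U" and r: "\<And>S. S \<in> \<Z>' \<Longrightarrow> \<exists>X\<in>\<Z>. \<exists>Y\<in>\<Z>. is_direct_sum T X Y S"
  shows "good \<Z>'"
proof (rule goodI[OF U])
  fix s i
  obtain n where n: "\<And>Z. Z \<in> \<Z> \<Longrightarrow> lifts s (i + n) Z" "\<And>Z. Z \<in> \<Z> \<Longrightarrow> dies s i n Z" using goodD[OF g] by metis
  have "lifts s (i + n) S \<and> dies s i n S" if S: "S \<in> \<Z>'" for S
  proof -
    obtain X Y where XY: "X \<in> \<Z>" "Y \<in> \<Z>" "is_direct_sum T X Y S" using r S by blast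
    have SU: "sh s S \<in> U" "sh s X \<in> U" "sh s Y \<in> U" using S U XY g U_shift by (auto simp: good_def)
    obtain a0 b0 p0 q0 where 0: "a0 \<in> Hom T X S" "b0 \<in> Hom T Y S" "p0 \<in> Hom T S X" "q0 \<in> Hom T S Y"
      "a0 \<cdot> p0 \<boxplus> b0 \<cdot> q0 = ide T S" using XY(3) unfolding is_direct_sum_def by blast
    define a b p q where "a = sha s a0" "b = sha s b0" "p = sha s p0" "q = sha s q0"
    have a: "a \<in> Hom T (sh s X) (sh s S)" "b \<in> Hom T (sh s Y) (sh s S)"
      "p \<in> Hom T (sh s S) (sh s X)" "q \<in> Hom T (sh s S) (sh s Y)"
      unfolding a_b_p_q_def using 0 shift_Hom by blast+
    have ap: "a \<cdot> p \<boxplus> b \<cdot> q = ide T (sh s S)"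
      unfolding a_b_p_q_def using shift_comp[OF 0(3,1), of s] shift_comp[OF 0(4,2), of s]
        shift_arr_plus[OF comp_closed[OF 0(3,1)] comp_closed[OF 0(4,2)], of s] 0(5) shift_ide Hom_obj[OF 0(1)] by simp
    note apH = comp_closed[OF a(3,1)] comp_closed[OF a(4,2)]
    have "lifts s (i + n) S" unfolding lifts_def
    proof
      fix x assume x: "x \<in> HH (sh s S)"
      obtain g where g: "g \<in> Hom T (sh s X) (L (i + n))" "on_arr H g (y (i + n)) = on_arr H a x"
        using n(1)[OF XY(1)] H_mem[OF SU(2,1) a(1) x] unfolding lifts_def by blast
      obtain g' where g': "g' \<in> Hom T (sh s Y) (L (i + n))" "on_arr H g' (y (i + n)) = on_arr H b x"
        using n(1)[OF XY(2)] H_mem[OF SU(3,1) a(2) x] unfolding lifts_def by blast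
      have "on_arr H (g \<cdot> p \<boxplus> g' \<cdot> q) (y (i + n)) = on_arr H (a \<cdot> p \<boxplus> b \<cdot> q) x"
        using H_add[OF SU(1) L_U comp_closed[OF a(3) g(1)] comp_closed[OF a(4) g'(1)] y] H_add[OF SU(1,1) apH x]
          H_comp[OF SU(1,2) L_U a(3) g(1) y] H_comp[OF SU(1,3) L_U a(4) g'(1) y]
          H_comp[OF SU(1,2,1) a(3,1) x] H_comp[OF SU(1,3,1) a(4,2) x] g(2) g'(2) by simp
      also have "\<dots> = x" using ap H_ide[OF SU(1) x] by simp
      finally show "\<exists>g\<in>Hom T (sh s S) (L (i + n)). on_arr H g (y (i + n)) = x"
        using add_Hom[OF comp_closed[OF a(3) g(1)] comp_closed[OF a(4) g'(1)]] by blast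
    qed
    moreover have "dies s i n S" unfolding dies_def
    proof (intro ballI impI)
      fix g assume g: "g \<in> Hom T (sh s S) (L i)" "on_arr H g (y i) = Hz (sh s S)"
      have "on_arr H (g \<cdot> a) (y i) = Hz (sh s X)" "on_arr H (g \<cdot> b) (y i) = Hz (sh s Y)"
        using H_comp[OF SU(2,1) L_U a(1) g(1) y] H_comp[OF SU(3,1) L_U a(2) g(1) y] g(2)
          H_zero[OF SU(2,1) a(1)] H_zero[OF SU(3,1) a(2)] by simp_all
      then have 1: "tr i n \<cdot> (g \<cdot> a) = zer (sh s X) (L (i + n))" "tr i n \<cdot> (g \<cdot> b) = zer (sh s Y) (L (i + n))"
        using n(2)[OF XY(1)] n(2)[OF XY(2)] comp_closed[OF a(1) g(1)] comp_closed[OF a(2) g(1)] unfolding dies_def by blast+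
      define k where "k = tr i n \<cdot> g"
      have k: "k \<in> Hom T (sh s S) (L (i + n))" unfolding k_def using comp_closed[OF g(1) tr_Hom] .
      have ka: "k \<cdot> a = zer (sh s X) (L (i + n))" "k \<cdot> b = zer (sh s Y) (L (i + n))"
        unfolding k_def using 1 comp_assoc[OF a(1) g(1) tr_Hom] comp_assoc[OF a(2) g(1) tr_Hom] by simp_all
      have o: "L (i + n) \<in> obj T" "sh s S \<in> obj T" using L_U SU U_obj by auto
      have "k = (k \<cdot> a) \<cdot> p \<boxplus> (k \<cdot> b) \<cdot> q"
        using comp_add_right[OF apH k] ap comp_ide[OF k] comp_assoc[OF a(3,1) k] comp_assoc[OF a(4,2) k] by simp
      also have "\<dots> = zer (sh s S) (L (i + n))"
        unfolding ka using comp_zer_left[OF o(1) a(3)] comp_zer_left[OF o(1) a(4)] add_zer(1)[OF zer_Hom[OF o(2,1)]] by simp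
      finally show "tr i n \<cdot> g = zer (sh s S) (L (i + n))" unfolding k_def .
    qed
    ultimately show ?thesis by blast
  qed
  then show "\<exists>p n. \<forall>Z\<in>\<Z>'. lifts s p Z \<and> dies s i n Z" by blast
qed

text \<open>The two four lemmas, carried out with stages of the tower: every lift and every
  vanishing on an outer term costs a number of steps that is uniform over the outer class.\<close>

lemma good_extension:
  assumes g: "good \<Z>" "good \<Z>'" and U: "\<Y> \<subseteq> U" and r: "\<Y> \<subseteq> extensions T \<Z> \<Z>'"
  shows "good \<Y>"
proof (rule goodI[OF U])
  fix s i
  \<comment> \<open>All stages are fixed before \<open>Z\<close> is, which keeps the bounds uniform.
    \<open>n1\<close>, \<open>n2\<close>, \<open>n3\<close> serve the vanishing of an arrow from the
    middle term; \<open>n1\<close>, \<open>n4\<close>, \<open>n5\<close> serve the lifting of an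
    element.\<close>
  obtain n1 where n1: "\<And>Z. Z \<in> \<Z> \<Longrightarrow> lifts s (i + n1) Z" "\<And>Z. Z \<in> \<Z> \<Longrightarrow> dies s i n1 Z" using goodD[OF g(1)] by metis
  define p1 where "p1 = i + n1"
  obtain n2 where n2: "\<And>Z. Z \<in> \<Z> \<Longrightarrow> lifts (s + 1) (0 + n2) Z" using goodD[OF g(1)] by metis
  define p2 where "p2 = max p1 n2"
  obtain n3 where n3: "\<And>Z. Z \<in> \<Z>' \<Longrightarrow> dies s p2 n3 Z" using goodD[OF g(2)] by metis
  obtain n4 where n4: "\<And>Z. Z \<in> \<Z>' \<Longrightarrow> dies (s - 1) p1 n4 Z" using goodD[OF g(2)] by metis
  obtain n5 where n5: "\<And>Z. Z \<in> \<Z>' \<Longrightarrow> lifts s (0 + n5) Z" using goodD[OF g(2)] by metis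
  define P where "P = max (p1 + n4) n5"
  have "lifts s P Z \<and> dies s i (p2 - i + n3) Z" if Z: "Z \<in> \<Y>" for Z
  proof -
    obtain X Y f g' h where t: "X \<in> \<Z>" "Y \<in> \<Z>'" "triangle T X Z Y f g' h"
      using r Z unfolding extensions_def by blast
    have XU: "X \<in> U" "Y \<in> U" "Z \<in> U" using t(1,2) g Z U by (auto simp: good_def)
    note S = U_shift[OF XU(1), of s] U_shift[OF XU(2), of s] U_shift[OF XU(3), of s]
    note E = H_exact[OF t(3) XU(1,3,2), of s]
    have YE: "cohomological R T U (yoneda T (L k))" for k
      using yoneda_interpret[OF _ U_obj U_shift] L_U U_obj by blast
    \<comment> \<open>Exactness of \<open>Hom(-, L k)\<close> is taken from the same lemma as that
      of \<open>H\<close>, so that the shifted arrows \<open>f1\<close>, \<open>g1\<close>,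
      \<open>h1\<close> serve both rows without signs.\<close>
    note E' = cohomological.H_exact[OF YE t(3) XU(1,3,2), of _ s, unfolded yoneda_on_arr yoneda_simps(1) Hom_mod_simps]
    note F = triangle_Hom[OF t(3)]
    define f1 g1 h1 where "f1 = sha s f" "g1 = sha s g'" "h1 = sha s h"
    have X1: "sh (s + 1) X = sh s (susp T X)" using shift_add[of X s 1] XU(1) U_obj by auto
    have X2: "sh s X = sh (s - 1) (susp T X)" using shift_add[of X "s - 1" 1] XU(1) U_obj by auto
    have F1: "f1 \<in> Hom T (sh s X) (sh s Z)" "g1 \<in> Hom T (sh s Z) (sh s Y)" "h1 \<in> Hom T (sh s Y) (sh (s + 1) X)"
      unfolding f1_g1_h1_def X1 using F shift_Hom by blast+
    have lift1: "\<exists>v\<in>Hom T (sh s Y) (L k). v \<cdot> g1 = w" if "w \<in> Hom T (sh s Z) (L k)" "w \<cdot> f1 = zer (sh s X) (L k)" for k w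
    proof -
      have "w \<in> (\<lambda>v. v \<cdot> sha s g') ` Hom T (sh s Y) (L k)" unfolding E'(2) using that by (simp add: f1_g1_h1_def)
      then show ?thesis unfolding f1_g1_h1_def by blast
    qed
    define h2 where "h2 = sha (s - 1) h"
    have h2: "h2 \<in> Hom T (sh (s - 1) Y) (sh s X)" unfolding h2_def X2 using F shift_Hom by blast
    have lift2: "\<exists>v\<in>Hom T (sh s Z) (L k). v \<cdot> f1 = w" if "w \<in> Hom T (sh s X) (L k)" "w \<cdot> h2 = zer (sh (s - 1) Y) (L k)" for k w
    proof -
      have "w \<in> (\<lambda>v. v \<cdot> sha s f) ` Hom T (sh s Z) (L k)" unfolding E'(3) using that by (simp add: h2_def)
      then show ?thesis unfolding f1_g1_h1_def by blast
    qed
    have hg: "h1 \<cdot> g1 = zer (sh s Z) (sh (s + 1) X)"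
      unfolding f1_g1_h1_def X1 using shift_comp[OF F(2,3), of s] triangle_zero2[OF t(3)] shift_zer triangle_obj[OF t(3)] susp_obj by simp
    have ex1: "\<exists>x'\<in>HH (sh (s + 1) X). on_arr H h1 x' = x" if "x \<in> HH (sh s Y)" "on_arr H g1 x = Hz (sh s Z)" for x
    proof -
      have "x \<in> on_arr H (sha s h) ` HH (sh (s + 1) X)" unfolding E(1) using that by (simp add: f1_g1_h1_def)
      then show ?thesis unfolding f1_g1_h1_def by blast
    qed
    have ex2: "\<exists>x'\<in>HH (sh s Y). on_arr H g1 x' = x" if "x \<in> HH (sh s Z)" "on_arr H f1 x = Hz (sh s X)" for x
    proof -
      have "x \<in> on_arr H (sha s g') ` HH (sh s Y)" unfolding E(2) using that by (simp add: f1_g1_h1_def)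
      then show ?thesis unfolding f1_g1_h1_def by blast
    qed
    have ex3: "on_arr H h2 (on_arr H f1 x) = Hz (sh (s - 1) Y)" if "x \<in> HH (sh s Z)" for x
    proof -
      have "on_arr H (sha s f) x \<in> on_arr H (sha s f) ` HH (sh s Z)" using that by blast
      then show ?thesis unfolding E(3) f1_g1_h1_def h2_def by blast
    qed
    have SX: "sh (s + 1) X \<in> U" "sh (s - 1) Y \<in> U" using U_shift XU by auto
    have o: "L k \<in> obj T" "sh s Z \<in> obj T" "sh s X \<in> obj T" for k using L_U S U_obj by auto
    have "dies s i (p2 - i + n3) Z" unfolding dies_def
    proof (intro ballI impI)
      fix w assume w: "w \<in> Hom T (sh s Z) (L i)" "on_arr H w (y i) = Hz (sh s Z)"
      have ip: "i \<le> p2" unfolding p2_def p1_def by simp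
      have "on_arr H (w \<cdot> f1) (y i) = Hz (sh s X)"
        using H_comp[OF S(1,3) L_U F1(1) w(1) y] w(2) H_zero[OF S(1,3) F1(1)] by simp
      then have "tr i n1 \<cdot> (w \<cdot> f1) = zer (sh s X) (L (i + n1))"
        using n1(2)[OF t(1)] comp_closed[OF F1(1) w(1)] unfolding dies_def by blast
      then have "tr i (p2 - i) \<cdot> (w \<cdot> f1) = zer (sh s X) (L p2)"
        using tr_die_mono[OF _ comp_closed[OF F1(1) w(1)], of n1 "p2 - i"] ip unfolding p2_def p1_def by simp
      note tp = tr_Hom'[OF ip]
      define w2 where "w2 = tr i (p2 - i) \<cdot> w"
      have w2: "w2 \<in> Hom T (sh s Z) (L p2)" unfolding w2_def using comp_closed[OF w(1) tp] .
      have "w2 \<cdot> f1 = zer (sh s X) (L p2)"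
        unfolding w2_def using comp_assoc[OF F1(1) w(1) tp] \<open>tr i (p2 - i) \<cdot> (w \<cdot> f1) = _\<close> by simp
      then obtain v where v: "v \<in> Hom T (sh s Y) (L p2)" "v \<cdot> g1 = w2"
        using lift1[OF w2] by blast
      have "on_arr H w2 (y p2) = Hz (sh s Z)" unfolding w2_def using H_tr'[OF S(3) w(1) ip] w(2) by simp
      then have "on_arr H g1 (on_arr H v (y p2)) = Hz (sh s Z)" using H_comp[OF S(3,2) L_U F1(2) v(1) y] v(2) by simp
      then obtain x where x: "x \<in> HH (sh (s + 1) X)" "on_arr H h1 x = on_arr H v (y p2)"
        using ex1[OF H_mem[OF S(2) L_U v(1) y]] by blast
      \<comment> \<open>\<open>v\<close> is corrected by an arrow through \<open>h1\<close>; this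
        does not alter \<open>v \<cdot> g1\<close> and makes the value under \<open>H\<close>
        zero.\<close>
      have "lifts (s + 1) p2 X" using lifts_mono[OF n2[OF t(1)] _ XU(1), of p2] unfolding p2_def by simp
      then obtain k where k: "k \<in> Hom T (sh (s + 1) X) (L p2)" "on_arr H k (y p2) = x" using x(1) unfolding lifts_def by blast
      note kh = comp_closed[OF F1(3) k(1)]
      have "on_arr H (k \<cdot> h1) (y p2) = on_arr H v (y p2)" using H_comp[OF S(2) SX(1) L_U F1(3) k(1) y] k(2) x(2) by simp
      then have "on_arr H (v \<boxminus> k \<cdot> h1) (y p2) = Hz (sh s Y)" using H_sub_zero[OF S(2) L_U v(1) kh y] by simp
      then have 1: "tr p2 n3 \<cdot> (v \<boxminus> k \<cdot> h1) = zer (sh s Y) (L (p2 + n3))"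
        using n3[OF t(2)] sub_Hom[OF v(1) kh] unfolding dies_def by blast
      have "(k \<cdot> h1) \<cdot> g1 = zer (sh s Z) (L p2)"
        using comp_assoc[OF F1(2,3) k(1)] hg comp_zer_right[OF o(2) k(1)] by simp
      then have "(v \<boxminus> k \<cdot> h1) \<cdot> g1 = w2" using comp_sub_left[OF F1(2) v(1) kh] v(2) sub_zer[OF w2] by simp
      then have "tr p2 n3 \<cdot> w2 = zer (sh s Z) (L (p2 + n3))"
        using comp_assoc[OF F1(2) sub_Hom[OF v(1) kh] tr_Hom, of n3] 1 comp_zer_left[OF o(1) F1(2)] by simp
      moreover have "tr p2 n3 \<cdot> w2 = tr i (p2 - i + n3) \<cdot> w"
        unfolding w2_def using comp_assoc[OF w(1) tp tr_Hom, of n3, symmetric]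
          trans_add[where \<tau> = \<tau>, OF \<tau>, of i "p2 - i" n3] ip by simp
      ultimately show "tr i (p2 - i + n3) \<cdot> w = zer (sh s Z) (L (i + (p2 - i + n3)))" using ip by simp
    qed
    moreover have "lifts s P Z" unfolding lifts_def
    proof
      fix x assume x: "x \<in> HH (sh s Z)"
      note fx = H_mem[OF S(1,3) F1(1) x]
      obtain k where k: "k \<in> Hom T (sh s X) (L p1)" "on_arr H k (y p1) = on_arr H f1 x"
        using n1(1)[OF t(1)] fx unfolding lifts_def p1_def by blast
      note kh = comp_closed[OF h2 k(1)]
      have "on_arr H h2 (on_arr H f1 x) = Hz (sh (s - 1) Y)" using ex3[OF x] .
      then have "on_arr H (k \<cdot> h2) (y p1) = Hz (sh (s - 1) Y)" using H_comp[OF SX(2) S(1) L_U h2 k(1) y] k(2) by simp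
      then have "tr p1 n4 \<cdot> (k \<cdot> h2) = zer (sh (s - 1) Y) (L (p1 + n4))" using n4[OF t(2)] kh unfolding dies_def by blast
      then have "(tr p1 n4 \<cdot> k) \<cdot> h2 = zer (sh (s - 1) Y) (L (p1 + n4))" using comp_assoc[OF h2 k(1) tr_Hom] by simp
      then obtain l where l: "l \<in> Hom T (sh s Z) (L (p1 + n4))" "l \<cdot> f1 = tr p1 n4 \<cdot> k"
        using lift2[OF comp_closed[OF k(1) tr_Hom]] by blast
      interpret MZ: module R "on_obj H (sh s Z)" using H_module[OF S(3)] .
      interpret MX: module R "on_obj H (sh s X)" using H_module[OF S(1)] .
      define xl where "xl = on_arr H l (y (p1 + n4))"
      have xl: "xl \<in> HH (sh s Z)" unfolding xl_def using H_mem[OF S(3) L_U l(1) y] .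
      have "on_arr H f1 xl = on_arr H f1 x"
        unfolding xl_def using H_comp[OF S(1,3) L_U F1(1) l(1) y] l(2) H_tr[OF S(1) k(1), of n4] k(2) by simp
      \<comment> \<open>\<open>x\<close> and the value of \<open>l\<close> agree on
        \<open>X\<close>, so their difference comes from \<open>Y\<close>, where it can be
        lifted.\<close>
      then have "on_arr H f1 (x \<oplus>\<^bsub>on_obj H (sh s Z)\<^esub> \<ominus>\<^bsub>on_obj H (sh s Z)\<^esub> xl) = Hz (sh s X)"
        using H_plus[OF S(1,3) F1(1) x MZ.M.a_inv_closed[OF xl]] H_minus[OF S(1,3) F1(1) xl] MX.M.r_neg[OF fx] by simp
      then obtain x' where x': "x' \<in> HH (sh s Y)" "on_arr H g1 x' = x \<oplus>\<^bsub>on_obj H (sh s Z)\<^esub> \<ominus>\<^bsub>on_obj H (sh s Z)\<^esub> xl"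
        using ex2[OF MZ.M.a_closed[OF x MZ.M.a_inv_closed[OF xl]]] by blast
      obtain k' where k': "k' \<in> Hom T (sh s Y) (L n5)" "on_arr H k' (y n5) = x'"
        using n5[OF t(2)] x'(1) unfolding lifts_def by auto
      have le: "p1 + n4 \<le> P" "n5 \<le> P" unfolding P_def by auto
      note A = comp_closed[OF l(1) tr_Hom'[OF le(1)]] and B0 = comp_closed[OF F1(2) k'(1)]
      note B = comp_closed[OF B0 tr_Hom'[OF le(2)]]
      have "on_arr H (tr (p1 + n4) (P - (p1 + n4)) \<cdot> l \<boxplus> tr n5 (P - n5) \<cdot> (k' \<cdot> g1)) (y P)
        = xl \<oplus>\<^bsub>on_obj H (sh s Z)\<^esub> (x \<oplus>\<^bsub>on_obj H (sh s Z)\<^esub> \<ominus>\<^bsub>on_obj H (sh s Z)\<^esub> xl)"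
        using H_add[OF S(3) L_U A B y] H_tr'[OF S(3) l(1) le(1)] H_tr'[OF S(3) B0 le(2)]
          H_comp[OF S(3,2) L_U F1(2) k'(1) y] k'(2) x'(2) by (simp add: xl_def)
      also have "\<dots> = x" using x xl MZ.M.a_lcomm[of xl x "\<ominus>\<^bsub>on_obj H (sh s Z)\<^esub> xl"] MZ.M.r_neg[OF xl] by simp
      finally show "\<exists>g\<in>Hom T (sh s Z) (L P). on_arr H g (y P) = x" using add_Hom[OF A B] by blast
    qed
    ultimately show ?thesis by blast
  qed
  then show "\<exists>p n. \<forall>Z\<in>\<Y>. lifts s p Z \<and> dies s i n Z" by blast
qed

lemma good_coprod:
  assumes "\<And>X. X \<in> \<S> \<Longrightarrow> good {X}" and U: "\<And>X. X \<in> coprod T \<S> \<Longrightarrow> X \<in> U" and "X \<in> coprod T \<S>"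
  shows "good {X}"
  using assms(3)
proof induction
  case (base X) then show ?case using assms(1) by blast
next
  case (zero Z) then show ?case using U[OF coprod.zero[OF zero]] by (intro good_zero) auto
next
  case (sum X Y S)
  then show ?case using U coprod.sum[OF sum(1-3)] by (intro good_direct_sum[OF good_Un[OF sum(4,5)]]) auto
next
  case (ext A C B f g h)
  then show ?case using U coprod.ext[OF ext(1-3)] extensionsI[OF ext(3), of "{A}" "{C}"]
    by (intro good_extension[OF ext(4,5)]) auto
qed

end

section \<open>Towers of compact objects computing a finite functor\<close>

lemma (in cohomological) eval_linear:
  assumes "Z \<in> U" "K \<in> U" "w \<in> HH K"
  shows "(\<lambda>g. on_arr H g w) \<in> linear_maps R (Hom_mod T Z K) (on_obj H Z)"
  using H_mem[OF assms(1,2) _ assms(3)] H_add[OF assms(1,2) _ _ assms(3)]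
    linear_functor.scale[OF lin assms(1,2) _ _ assms(3)] by (auto simp: linear_maps_def)

lemma (in cohomological) H_sub_zero_imp:
  assumes "X \<in> U" "Y \<in> U" "f \<in> Hom T X Y" "g \<in> Hom T X Y" "x \<in> HH Y" "on_arr H (f \<boxminus> g) x = Hz X"
  shows "on_arr H f x = on_arr H g x"
proof -
  interpret M: module R "on_obj H X" using H_module assms by blast
  have "on_arr H ((f \<boxminus> g) \<boxplus> g) x = Hz X \<oplus>\<^bsub>on_obj H X\<^esub> on_arr H g x"
    using H_add[OF assms(1,2) sub_Hom[OF assms(3,4)] assms(4,5)] assms(6) by simp
  then show ?thesis using sub_add[OF assms(3,4)] H_mem[OF assms(1,2,4,5)] by simp
qed

context R_linear_triangulated_category
begin

section \<open>Finite generation of Hom between compact objects\<close>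

lemma post_linear:
  assumes "P \<in> obj T" "g \<in> Hom T K K'"
  shows "(\<lambda>x. g \<cdot> x) \<in> linear_maps R (Hom_mod T P K) (Hom_mod T P K')"
  using comp_closed[OF _ assms(2)] comp_add_right[OF _ _ assms(2)] comp_scale_right[OF _ _ assms(2)]
  by (auto simp: linear_maps_def)

lemma pre_linear:
  assumes "K \<in> obj T" "g \<in> Hom T P P'"
  shows "(\<lambda>x. x \<cdot> g) \<in> linear_maps R (Hom_mod T P' K) (Hom_mod T P K)"
  using comp_closed[OF assms(2)] comp_add_left[OF assms(2)] comp_scale_left[OF _ assms(2)]
  by (auto simp: linear_maps_def)

lemma fg_zero_module:
  assumes "hz X Y"
  shows "finitely_generated R (Hom_mod T X Y)"
proof -
  interpret M: module R "Hom_mod T X Y" using Hom_module hz_obj[OF assms] by blast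
  have "N = Hom T X Y" if "submodule N R (Hom_mod T X Y)" for N
    using M.submoduleE(1)[OF that] submodule_zero_mem[OF M.module_axioms that] assms by (auto simp: hz_def)
  then show ?thesis unfolding finitely_generated_def by (intro exI[of _ "{}"]) auto
qed

text \<open>Induction along \<open>coprod\<close> with \<open>finitely_generated_middle\<close>;
  direct sums are treated as exact sequences like the triangles.\<close>

lemma fg_cov:
  assumes R: "cring R" "noetherian_ring R" and P: "P \<in> obj T"
    and S: "\<And>X. X \<in> \<S> \<Longrightarrow> X \<in> obj T \<and> finitely_generated R (Hom_mod T P X)" and "X \<in> coprod T \<S>"
  shows "X \<in> obj T \<and> finitely_generated R (Hom_mod T P X)"
  using assms(5)
proof induction
  case (base X) then show ?case using S by blast
next
  case (zero Z)
  then show ?case using fg_zero_module is_zeroD(2)[OF zero P] by (simp add: is_zero_def)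
next
  case (sum X Y S)
  obtain i j p q where 1: "i \<in> Hom T X S" "j \<in> Hom T Y S" "p \<in> Hom T S X" "q \<in> Hom T S Y"
    "q \<cdot> i = zer X Y" "i \<cdot> p \<boxplus> j \<cdot> q = ide T S" using sum(3) unfolding is_direct_sum_def by blast
  have S: "S \<in> obj T" using Hom_obj[OF 1(1)] by blast
  have "(\<lambda>x. i \<cdot> x) ` Hom T P X = {x \<in> Hom T P S. q \<cdot> x = zer P Y}"
  proof (intro equalityI subsetI)
    fix x assume "x \<in> (\<lambda>x. i \<cdot> x) ` Hom T P X"
    then obtain x' where x': "x' \<in> Hom T P X" "x = i \<cdot> x'" by blast
    then show "x \<in> {x \<in> Hom T P S. q \<cdot> x = zer P Y}"
      using comp_closed[OF x'(1) 1(1)] comp_assoc[OF x'(1) 1(1,4)] 1(5) sum comp_zer_left[OF _ x'(1)] by simp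
  next
    fix x assume "x \<in> {x \<in> Hom T P S. q \<cdot> x = zer P Y}"
    then have x: "x \<in> Hom T P S" "q \<cdot> x = zer P Y" by auto
    have "x = i \<cdot> (p \<cdot> x) \<boxplus> j \<cdot> (q \<cdot> x)"
      using comp_add_left[OF x(1) comp_closed[OF 1(3,1)] comp_closed[OF 1(4,2)]] 1(6) comp_ide[OF x(1)]
        comp_assoc[OF x(1) 1(3,1)] comp_assoc[OF x(1) 1(4,2)] by simp
    also have "\<dots> = i \<cdot> (p \<cdot> x)"
      using x(2) comp_zer_right[OF P 1(2)] add_zer(1)[OF comp_closed[OF comp_closed[OF x(1) 1(3)] 1(1)]] by simp
    finally show "x \<in> (\<lambda>x. i \<cdot> x) ` Hom T P X" using comp_closed[OF x(1) 1(3)] by blast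
  qed
  then show ?case using finitely_generated_middle[OF R Hom_module[OF P] Hom_module[OF P] Hom_module[OF P]
      post_linear[OF P 1(1)] post_linear[OF P 1(4)]] sum S by (simp add: exact_at_def)
next
  case (ext A C B f g h)
  note F = triangle_Hom[OF ext(3)]
  have B: "B \<in> obj T" using Hom_obj[OF F(1)] by blast
  have "(\<lambda>x. f \<cdot> x) ` Hom T P A = {x \<in> Hom T P B. g \<cdot> x = zer P C}"
  proof (intro equalityI subsetI)
    fix x assume "x \<in> (\<lambda>x. f \<cdot> x) ` Hom T P A"
    then obtain x' where x': "x' \<in> Hom T P A" "x = f \<cdot> x'" by blast
    then show "x \<in> {x \<in> Hom T P B. g \<cdot> x = zer P C}"
      using comp_closed[OF x'(1) F(1)] comp_assoc[OF x'(1) F(1,2)] triangle_zero1[OF ext(3)] ext comp_zer_left[OF _ x'(1)] by simp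
  next
    fix x assume "x \<in> {x \<in> Hom T P B. g \<cdot> x = zer P C}"
    then show "x \<in> (\<lambda>x. f \<cdot> x) ` Hom T P A" using exact_cov[OF ext(3)] by blast
  qed
  then show ?case using finitely_generated_middle[OF R Hom_module[OF P] Hom_module[OF P] Hom_module[OF P]
      post_linear[OF P F(1)] post_linear[OF P F(2)]] ext B by (simp add: exact_at_def)
qed

lemma fg_contra:
  assumes R: "cring R" "noetherian_ring R" and P: "P \<in> obj T"
    and S: "\<And>X. X \<in> \<S> \<Longrightarrow> X \<in> obj T \<and> finitely_generated R (Hom_mod T X P)" and "X \<in> coprod T \<S>"
  shows "X \<in> obj T \<and> finitely_generated R (Hom_mod T X P)"
  using assms(5)
proof induction
  case (base X) then show ?case using S by blast
next
  case (zero Z)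
  then show ?case using fg_zero_module is_zeroD(1)[OF zero P] by (simp add: is_zero_def)
next
  case (sum X Y S)
  obtain i j p q where 1: "i \<in> Hom T X S" "j \<in> Hom T Y S" "p \<in> Hom T S X" "q \<in> Hom T S Y"
    "q \<cdot> i = zer X Y" "i \<cdot> p \<boxplus> j \<cdot> q = ide T S" using sum(3) unfolding is_direct_sum_def by blast
  have S: "S \<in> obj T" "X \<in> obj T" "Y \<in> obj T" using Hom_obj[OF 1(1)] Hom_obj[OF 1(4)] by auto
  have "(\<lambda>x. x \<cdot> q) ` Hom T Y P = {x \<in> Hom T S P. x \<cdot> i = zer X P}"
  proof (intro equalityI subsetI)
    fix x assume "x \<in> (\<lambda>x. x \<cdot> q) ` Hom T Y P"
    then obtain x' where x': "x' \<in> Hom T Y P" "x = x' \<cdot> q" by blast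
    then show "x \<in> {x \<in> Hom T S P. x \<cdot> i = zer X P}"
      using comp_closed[OF 1(4) x'(1)] comp_assoc[OF 1(1,4) x'(1)] 1(5) comp_zer_right[OF S(2) x'(1)] by simp
  next
    fix x assume "x \<in> {x \<in> Hom T S P. x \<cdot> i = zer X P}"
    then have x: "x \<in> Hom T S P" "x \<cdot> i = zer X P" by auto
    have "x = (x \<cdot> i) \<cdot> p \<boxplus> (x \<cdot> j) \<cdot> q"
      using comp_add_right[OF comp_closed[OF 1(3,1)] comp_closed[OF 1(4,2)] x(1)] 1(6) comp_ide[OF x(1)]
        comp_assoc[OF 1(3,1) x(1)] comp_assoc[OF 1(4,2) x(1)] by simp
    also have "\<dots> = (x \<cdot> j) \<cdot> q"
      using x(2) comp_zer_left[OF P 1(3)] add_zer(2)[OF comp_closed[OF 1(4) comp_closed[OF 1(2) x(1)]]] by simp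
    finally show "x \<in> (\<lambda>x. x \<cdot> q) ` Hom T Y P" using comp_closed[OF 1(2) x(1)] by blast
  qed
  then show ?case using finitely_generated_middle[OF R Hom_module[OF S(3) P] Hom_module[OF S(1) P] Hom_module[OF S(2) P]
      pre_linear[OF P 1(4)] pre_linear[OF P 1(1)]] sum S by (simp add: exact_at_def)
next
  case (ext A C B f g h)
  note F = triangle_Hom[OF ext(3)] and O = triangle_obj[OF ext(3)]
  have "(\<lambda>x. x \<cdot> g) ` Hom T C P = {x \<in> Hom T B P. x \<cdot> f = zer A P}"
  proof (intro equalityI subsetI)
    fix x assume "x \<in> (\<lambda>x. x \<cdot> g) ` Hom T C P"
    then obtain x' where x': "x' \<in> Hom T C P" "x = x' \<cdot> g" by blast
    then show "x \<in> {x \<in> Hom T B P. x \<cdot> f = zer A P}"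
      using comp_closed[OF F(2) x'(1)] comp_assoc[OF F(1,2) x'(1)] triangle_zero1[OF ext(3)] comp_zer_right[OF O(1) x'(1)] by simp
  next
    fix x assume "x \<in> {x \<in> Hom T B P. x \<cdot> f = zer A P}"
    then show "x \<in> (\<lambda>x. x \<cdot> g) ` Hom T C P" using exact_contra[OF ext(3)] by blast
  qed
  then show ?case using finitely_generated_middle[OF R Hom_module[OF O(3) P] Hom_module[OF O(2) P] Hom_module[OF O(1) P]
      pre_linear[OF P F(2)] pre_linear[OF P F(1)]] ext O by (simp add: exact_at_def)
qed

lemma fg_retract:
  assumes "retract X S" "P \<in> obj T"
  shows "finitely_generated R (Hom_mod T P S) \<Longrightarrow> finitely_generated R (Hom_mod T P X)"
    and "finitely_generated R (Hom_mod T S P) \<Longrightarrow> finitely_generated R (Hom_mod T X P)"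
proof -
  obtain i p where ip: "i \<in> Hom T X S" "p \<in> Hom T S X" "p \<cdot> i = ide T X"
    using assms(1) unfolding retract_def by blast
  have o: "X \<in> obj T" "S \<in> obj T" using Hom_obj[OF ip(1)] by auto
  have "(\<lambda>x. p \<cdot> x) ` Hom T P S = Hom T P X"
  proof (intro equalityI subsetI)
    fix x assume x: "x \<in> Hom T P X"
    have "x = p \<cdot> (i \<cdot> x)" using comp_assoc[OF x ip(1,2)] ip(3) comp_ide[OF x] by simp
    then show "x \<in> (\<lambda>x. p \<cdot> x) ` Hom T P S" using comp_closed[OF x ip(1)] by blast
  qed (use comp_closed[OF _ ip(2)] in blast)
  then show "finitely_generated R (Hom_mod T P S) \<Longrightarrow> finitely_generated R (Hom_mod T P X)"
    using finitely_generated_surj[OF Hom_module[OF assms(2) o(2)] Hom_module[OF assms(2) o(1)] post_linear[OF assms(2) ip(2)]] by simp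
  have "(\<lambda>x. x \<cdot> i) ` Hom T S P = Hom T X P"
  proof (intro equalityI subsetI)
    fix x assume x: "x \<in> Hom T X P"
    have "x = (x \<cdot> p) \<cdot> i" using comp_assoc[OF ip(1,2) x] ip(3) comp_ide[OF x] by simp
    then show "x \<in> (\<lambda>x. x \<cdot> i) ` Hom T S P" using comp_closed[OF ip(2) x] by blast
  qed (use comp_closed[OF ip(1)] in blast)
  then show "finitely_generated R (Hom_mod T S P) \<Longrightarrow> finitely_generated R (Hom_mod T X P)"
    using finitely_generated_surj[OF Hom_module[OF o(2) assms(2)] Hom_module[OF o(1) assms(2)] pre_linear[OF assms(2) ip(1)]] by simp
qed

end

locale generated = R_linear_triangulated_category R T
  for R :: "('r, 'a) ring_scheme" and T :: "('o, 'm, 'r, 'e) tri_category_scheme" (structure) +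
  fixes \<kappa> :: "'u rel" and \<G> :: "int \<Rightarrow> 'o set"
  assumes kappa: "regular_uncountable \<kappa>" and cring: "cring R" and noeth: "noetherian_ring R"
    and cg: "compactly_generated \<kappa> T" and gs: "generating_sequence \<kappa> T \<G>" and finG: "finite (\<G> n)"
    and fgG: "\<lbrakk>G \<in> \<G> n; G' \<in> \<G> n'\<rbrakk> \<Longrightarrow> finitely_generated R (Hom_mod T G G')"
begin

abbreviation Tc where "Tc \<equiv> compacts \<kappa> T"

lemma G_compact: "X \<in> \<G> n \<Longrightarrow> X \<in> Tc"
  using gs by (auto simp: generating_sequence_def)

lemma G_obj: "X \<in> \<G> n \<Longrightarrow> X \<in> obj T"
  using G_compact compact_obj by blast

lemma small_coproducts: "has_small_coproducts \<kappa> T"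
  using cg by (simp add: compactly_generated_def)

lemma Tc_obj: "Tc \<subseteq> obj T"
  using compact_obj by blast

lemma compact_gen: "X \<in> Tc \<Longrightarrow> \<exists>S\<in>coprod T (\<Union>n. \<G> n). retract X S"
  using gs smd_retract unfolding generating_sequence_def gen_on_def by blast

lemma coprod_compact: "\<S> \<subseteq> Tc \<Longrightarrow> X \<in> coprod T \<S> \<Longrightarrow> X \<in> Tc"
proof (rotate_tac, induction rule: coprod.induct)
  case (sum X Y S) then show ?case using compact_direct_sum by blast
next
  case (ext A C B f g h) then show ?case using compact_ext by blast
qed (use compact_zero in auto)

text \<open>One variable at a time: first from a generator to \<open>K\<close>, then from
  \<open>P\<close> to \<open>K\<close>.\<close>

lemma fg_Hom:
  assumes P: "P \<in> Tc" and K: "K \<in> Tc"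
  shows "finitely_generated R (Hom_mod T P K)"
proof -
  have 1: "finitely_generated R (Hom_mod T G K)" if G: "G \<in> \<G> n" for G n
  proof -
    obtain S where S: "S \<in> coprod T (\<Union>n. \<G> n)" "retract K S" using compact_gen[OF K] by blast
    have "finitely_generated R (Hom_mod T G S)"
      using fg_cov[OF cring noeth G_obj[OF G] _ S(1)] fgG[OF G] G_obj by blast
    then show ?thesis using fg_retract(1)[OF S(2) G_obj[OF G]] by blast
  qed
  obtain S where S: "S \<in> coprod T (\<Union>n. \<G> n)" "retract P S" using compact_gen[OF P] by blast
  have "finitely_generated R (Hom_mod T S K)"
    using fg_contra[OF cring noeth compact_obj[OF K] _ S(1)] 1 G_obj by blast
  then show ?thesis using fg_retract(2)[OF S(2) compact_obj[OF K]] by blast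
qed

end

section \<open>Building a tower in the category of elements of \<open>H\<close>\<close>

locale finite_functor = generated R T \<kappa> \<G> + cohomological R T "compacts \<kappa> T" H
  for R :: "('r, 'a) ring_scheme" and T :: "('o, 'm, 'r, 'e) tri_category_scheme" (structure)
    and \<kappa> :: "'u rel" and \<G> and H :: "('o, 'm, 'r, 'x) mod_functor" +
  assumes fgH: "K \<in> compacts \<kappa> T \<Longrightarrow> finitely_generated R (on_obj H K)"
begin

text \<open>A morphism of the category of elements of \<open>H\<close>, from \<open>(K, y)\<close>
  to \<open>(K', y')\<close>.\<close>

definition extd where
  "extd K y K' y' t \<longleftrightarrow> K \<in> Tc \<and> K' \<in> Tc \<and> y \<in> HH K \<and> y' \<in> HH K' \<and> t \<in> Hom T K K' \<and> on_arr H t y' = y"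

lemma extd_refl: "K \<in> Tc \<Longrightarrow> y \<in> HH K \<Longrightarrow> extd K y K y (ide T K)"
  using H_ide ide Tc_obj by (auto simp: extd_def)

lemma extd_trans: "extd K y K1 y1 t1 \<Longrightarrow> extd K1 y1 K2 y2 t2 \<Longrightarrow> extd K y K2 y2 (t2 \<cdot> t1)"
  unfolding extd_def using comp_closed H_comp by auto

text \<open>Meets finitely many demands one after the other; \<open>persist\<close> guards those
  already met against the later steps.\<close>

lemma extd_iterate:
  assumes "finite \<A>" "K \<in> Tc" "y \<in> HH K"
    and step: "\<And>a K1 y1 t1. a \<in> \<A> \<Longrightarrow> extd K y K1 y1 t1 \<Longrightarrow> \<exists>K2 y2 t2. extd K1 y1 K2 y2 t2 \<and> P a K2 y2 (t2 \<cdot> t1)"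
    and persist: "\<And>a K1 y1 t1 K2 y2 t2. a \<in> \<A> \<Longrightarrow> extd K y K1 y1 t1 \<Longrightarrow> P a K1 y1 t1 \<Longrightarrow> extd K1 y1 K2 y2 t2 \<Longrightarrow> P a K2 y2 (t2 \<cdot> t1)"
  shows "\<exists>K' y' t. extd K y K' y' t \<and> (\<forall>a\<in>\<A>. P a K' y' t)"
proof -
  have "\<B> \<subseteq> \<A> \<Longrightarrow> \<exists>K' y' t. extd K y K' y' t \<and> (\<forall>a\<in>\<B>. P a K' y' t)" if "finite \<B>" for \<B>
    using that
  proof (induction \<B> rule: finite_induct)
    case empty then show ?case using extd_refl[OF assms(2,3)] by blast
  next
    case (insert a \<B>)
    then obtain K1 y1 t1 where 1: "extd K y K1 y1 t1" "\<forall>a\<in>\<B>. P a K1 y1 t1" by auto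
    obtain K2 y2 t2 where 2: "extd K1 y1 K2 y2 t2" "P a K2 y2 (t2 \<cdot> t1)" using step[OF _ 1(1)] insert by blast
    have "\<forall>b\<in>\<B>. P b K2 y2 (t2 \<cdot> t1)" using persist[OF _ 1(1) _ 2(1)] 1(2) insert by blast
    then show ?case using extd_trans[OF 1(1) 2(1)] 2(2) by blast
  qed
  then show ?thesis using assms(1) by blast
qed

text \<open>The element of \<open>H(K \<oplus> Z)\<close> with components \<open>y\<close> and
  \<open>x\<close>.\<close>

lemma extd_lift1:
  assumes K: "K \<in> Tc" "y \<in> HH K" and Z: "Z \<in> Tc" "x \<in> HH Z"
  shows "\<exists>K' y' t. extd K y K' y' t \<and> (\<exists>g\<in>Hom T Z K'. on_arr H g y' = x)"
proof -
  obtain S where S: "is_direct_sum T K Z S" using direct_sums Tc_obj K Z by blast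
  have SU: "S \<in> Tc" using compact_direct_sum[OF S K(1) Z(1)] .
  obtain i j p q where 1: "i \<in> Hom T K S" "j \<in> Hom T Z S" "p \<in> Hom T S K" "q \<in> Hom T S Z"
    "p \<cdot> i = ide T K" "q \<cdot> j = ide T Z" "q \<cdot> i = zer K Z" "p \<cdot> j = zer Z K"
    using S unfolding is_direct_sum_def by blast
  define y' where "y' = on_arr H p y \<oplus>\<^bsub>on_obj H S\<^esub> on_arr H q x"
  note m = H_mem[OF SU K(1) 1(3) K(2)] H_mem[OF SU Z(1) 1(4) Z(2)]
  interpret MS: module R "on_obj H S" using H_module[OF SU] .
  interpret MK: module R "on_obj H K" using H_module[OF K(1)] .
  interpret MZ: module R "on_obj H Z" using H_module[OF Z(1)] .
  have "on_arr H i y' = y"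
    unfolding y'_def using H_plus[OF K(1) SU 1(1) m] H_comp[OF K(1) SU K(1) 1(1,3) K(2), symmetric] H_comp[OF K(1) SU Z(1) 1(1,4) Z(2), symmetric]
      1(5,7) H_ide[OF K] H_zer[OF K(1) Z] K(2) by simp
  moreover have "on_arr H j y' = x"
    unfolding y'_def using H_plus[OF Z(1) SU 1(2) m] H_comp[OF Z(1) SU K(1) 1(2,3) K(2), symmetric] H_comp[OF Z(1) SU Z(1) 1(2,4) Z(2), symmetric]
      1(6,8) H_ide[OF Z] H_zer[OF Z(1) K] Z(2) by simp
  moreover have "y' \<in> HH S" unfolding y'_def using MS.M.a_closed[OF m] .
  ultimately show ?thesis using K SU 1(1,2) unfolding extd_def by blast
qed

text \<open>\<open>y\<close> restricts to zero along \<open>g\<close>, so by exactness it comes from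
  the cone of \<open>g\<close>, and composing with the map to that cone annihilates
  \<open>g\<close>.\<close>

lemma extd_kill1:
  assumes K: "K \<in> Tc" "y \<in> HH K" and Z: "Z \<in> Tc" and g: "g \<in> Hom T Z K" "on_arr H g y = Hz Z"
  shows "\<exists>K' y' t. extd K y K' y' t \<and> t \<cdot> g = zer Z K'"
proof -
  obtain K' t h where t: "triangle T Z K K' g t h" using triangle_exists[OF g(1)] by blast
  have "susp T Z \<in> Tc" using compact_shift[OF Z, of 1] by simp
  then have K': "K' \<in> Tc" using compact_ext[OF rotate[OF t] K(1)] by blast
  have "y \<in> on_arr H (sha 0 t) ` HH (sh 0 K')" unfolding H_exact(2)[OF t Z K(1) K'] using K g by simp
  then obtain y' where "y' \<in> HH K'" "on_arr H t y' = y" by auto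
  then have "extd K y K' y' t" using K K' triangle_Hom(2)[OF t] by (simp add: extd_def)
  then show ?thesis using triangle_zero1[OF t] by blast
qed

text \<open>Only finitely many demands arise: \<open>H(Z)\<close> is finitely generated, and over a
  noetherian ring so is the kernel of the evaluation on \<open>Hom(Z, K1)\<close>.\<close>

lemma extd_object:
  assumes K: "K \<in> Tc" "y \<in> HH K" and Z: "Z \<in> Tc"
  shows "\<exists>K' y' t. extd K y K' y' t \<and> (\<forall>x\<in>HH Z. \<exists>g\<in>Hom T Z K'. on_arr H g y' = x) \<and>
    (\<forall>g\<in>Hom T Z K. on_arr H g y = Hz Z \<longrightarrow> t \<cdot> g = zer Z K')"
proof -
  have o: "Z \<in> obj T" "K \<in> obj T" using K Z Tc_obj by auto
  obtain B where B: "B \<subseteq> HH Z" "finite B" "\<And>N. submodule N R (on_obj H Z) \<Longrightarrow> B \<subseteq> N \<Longrightarrow> N = HH Z"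
    using fgH[OF Z] unfolding finitely_generated_def by blast
  have "\<exists>K' y' t. extd K y K' y' t \<and> (\<forall>x\<in>B. \<exists>g\<in>Hom T Z K'. on_arr H g y' = x)"
  proof (rule extd_iterate[OF B(2) K])
    fix x K1 y1 t1 assume x: "x \<in> B" "extd K y K1 y1 t1"
    then show "\<exists>K2 y2 t2. extd K1 y1 K2 y2 t2 \<and> (\<exists>g\<in>Hom T Z K2. on_arr H g y2 = x)"
      using extd_lift1[of K1 y1 Z x] Z B(1) by (auto simp: extd_def)
  next
    fix x K1 y1 t1 K2 y2 t2
    assume h: "\<exists>g\<in>Hom T Z K1. on_arr H g y1 = x" "extd K1 y1 K2 y2 t2"
    then obtain g where g: "g \<in> Hom T Z K1" "on_arr H g y1 = x" by blast
    have "on_arr H (t2 \<cdot> g) y2 = x" using H_comp[OF Z _ _ g(1), of K2 t2 y2] h(2) g(2) by (simp add: extd_def)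
    moreover have "t2 \<cdot> g \<in> Hom T Z K2" using comp_closed[OF g(1)] h(2) by (simp add: extd_def)
    ultimately show "\<exists>g\<in>Hom T Z K2. on_arr H g y2 = x" by blast
  qed
  then obtain K1 y1 t1 where 1: "extd K y K1 y1 t1" "\<And>x. x \<in> B \<Longrightarrow> \<exists>g\<in>Hom T Z K1. on_arr H g y1 = x" by blast
  have K1: "K1 \<in> Tc" "y1 \<in> HH K1" "t1 \<in> Hom T K K1" "on_arr H t1 y1 = y" using 1(1) by (auto simp: extd_def)
  have o1: "K1 \<in> obj T" using K1 Tc_obj by auto
  have l1: "\<exists>g\<in>Hom T Z K1. on_arr H g y1 = x" if "x \<in> HH Z" for x
  proof -
    have "submodule ((\<lambda>g. on_arr H g y1) ` Hom T Z K1) R (on_obj H Z)"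
      using image_submodule[OF Hom_module[OF o(1) o1] H_module[OF Z] eval_linear[OF Z K1(1,2)]
        module.carrier_is_submodule[OF Hom_module[OF o(1) o1]]] by simp
    then have "(\<lambda>g. on_arr H g y1) ` Hom T Z K1 = HH Z" using B(3) 1(2) by blast
    then show ?thesis using that by (metis imageE)
  qed
  \<comment> \<open>The kernel is taken at the stage reached after lifting. It contains the image of
    the kernel at \<open>K\<close>, and the lifts survive the second round.\<close>
  define N1 where "N1 = {g \<in> Hom T Z K1. on_arr H g y1 = Hz Z}"
  have "submodule N1 R (Hom_mod T Z K1)" unfolding N1_def
    using vimage_submodule[OF Hom_module[OF o(1) o1] H_module[OF Z] eval_linear[OF Z K1(1,2)] zero_submodule[OF H_module[OF Z]]]
    by simp
  then have "fg_submodule R (Hom_mod T Z K1) N1"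
    using noetherian_fg_submodule[OF cring noeth Hom_module[OF o(1) o1] fg_Hom[OF Z K1(1)]] by blast
  then obtain D where D: "D \<subseteq> N1" "finite D"
    "\<And>N. submodule N R (Hom_mod T Z K1) \<Longrightarrow> D \<subseteq> N \<Longrightarrow> N1 \<subseteq> N"
    unfolding fg_submodule_def by auto
  have "\<exists>K' y' t. extd K1 y1 K' y' t \<and> (\<forall>g\<in>D. t \<cdot> g = zer Z K')"
  proof (rule extd_iterate[OF D(2) K1(1,2)])
    fix g K2 y2 t2 assume g: "g \<in> D" "extd K1 y1 K2 y2 t2"
    have gg: "g \<in> Hom T Z K1" "on_arr H g y1 = Hz Z" using g(1) D(1) by (auto simp: N1_def)
    have K2: "K2 \<in> Tc" "y2 \<in> HH K2" "t2 \<in> Hom T K1 K2" "on_arr H t2 y2 = y1" using g(2) by (auto simp: extd_def)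
    have "on_arr H (t2 \<cdot> g) y2 = Hz Z" using H_comp[OF Z K1(1) K2(1) gg(1) K2(3,2)] K2(4) gg(2) by simp
    then obtain K3 y3 t3 where 3: "extd K2 y2 K3 y3 t3" "t3 \<cdot> (t2 \<cdot> g) = zer Z K3"
      using extd_kill1[OF K2(1,2) Z comp_closed[OF gg(1) K2(3)]] by blast
    then have "(t3 \<cdot> t2) \<cdot> g = zer Z K3" using comp_assoc[OF gg(1) K2(3)] by (auto simp: extd_def)
    then show "\<exists>K3 y3 t3. extd K2 y2 K3 y3 t3 \<and> (t3 \<cdot> t2) \<cdot> g = zer Z K3" using 3(1) by blast
  next
    fix g K2 y2 t2 K3 y3 t3
    assume h: "g \<in> D" "extd K1 y1 K2 y2 t2" "t2 \<cdot> g = zer Z K2" "extd K2 y2 K3 y3 t3"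
    have gg: "g \<in> Hom T Z K1" using h(1) D(1) by (auto simp: N1_def)
    have tt: "t2 \<in> Hom T K1 K2" "t3 \<in> Hom T K2 K3" using h by (auto simp: extd_def)
    show "(t3 \<cdot> t2) \<cdot> g = zer Z K3" using comp_assoc[OF gg tt] h(3) comp_zer_right[OF o(1) tt(2)] by simp
  qed
  then obtain K2 y2 t2 where 2: "extd K1 y1 K2 y2 t2" "\<And>g. g \<in> D \<Longrightarrow> t2 \<cdot> g = zer Z K2" by blast
  have K2: "K2 \<in> Tc" "y2 \<in> HH K2" "t2 \<in> Hom T K1 K2" "on_arr H t2 y2 = y1" using 2(1) by (auto simp: extd_def)
  have o2: "K2 \<in> obj T" using K2 Tc_obj by auto
  have "submodule {g \<in> Hom T Z K1. t2 \<cdot> g = zer Z K2} R (Hom_mod T Z K1)"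
    using vimage_submodule[OF Hom_module[OF o(1) o1] Hom_module[OF o(1) o2] post_linear[OF o(1) K2(3)] zero_submodule[OF Hom_module[OF o(1) o2]]]
    by simp
  then have "N1 \<subseteq> {g \<in> Hom T Z K1. t2 \<cdot> g = zer Z K2}"
    using D(1) 2(2) by (intro D(3)) (auto simp: N1_def)
  then have kill: "t2 \<cdot> g = zer Z K2" if "g \<in> Hom T Z K1" "on_arr H g y1 = Hz Z" for g using that unfolding N1_def by blast
  have "(t2 \<cdot> t1) \<cdot> g = zer Z K2" if g: "g \<in> Hom T Z K" "on_arr H g y = Hz Z" for g
  proof -
    have "on_arr H (t1 \<cdot> g) y1 = Hz Z" using H_comp[OF Z K(1) K1(1) g(1) K1(3,2)] K1(4) g(2) by simp
    then show ?thesis using kill[OF comp_closed[OF g(1) K1(3)]] comp_assoc[OF g(1) K1(3) K2(3)] by simp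
  qed
  moreover have "\<exists>g\<in>Hom T Z K2. on_arr H g y2 = x" if x: "x \<in> HH Z" for x
  proof -
    obtain g where g: "g \<in> Hom T Z K1" "on_arr H g y1 = x" using l1[OF x] by blast
    have "on_arr H (t2 \<cdot> g) y2 = x" using H_comp[OF Z K1(1) K2(1) g(1) K2(3,2)] K2(4) g(2) by simp
    then show ?thesis using comp_closed[OF g(1) K2(3)] by blast
  qed
  ultimately show ?thesis using extd_trans[OF 1(1) 2(1)] by blast
qed

lemma extd_finite:
  assumes S: "finite \<S>" "\<S> \<subseteq> Tc" and K: "K \<in> Tc" "y \<in> HH K"
  shows "\<exists>K' y' t. extd K y K' y' t \<and> (\<forall>Z\<in>\<S>. (\<forall>x\<in>HH Z. \<exists>g\<in>Hom T Z K'. on_arr H g y' = x) \<and>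
    (\<forall>g\<in>Hom T Z K. on_arr H g y = Hz Z \<longrightarrow> t \<cdot> g = zer Z K'))"
proof (rule extd_iterate[OF S(1) K])
  fix Z K1 y1 t1 assume h: "Z \<in> \<S>" "extd K y K1 y1 t1"
  then have Z: "Z \<in> Tc" and K1: "K1 \<in> Tc" "y1 \<in> HH K1" "t1 \<in> Hom T K K1" "on_arr H t1 y1 = y"
    using S(2) by (auto simp: extd_def)
  obtain K2 y2 t2 where 2: "extd K1 y1 K2 y2 t2" "\<forall>x\<in>HH Z. \<exists>g\<in>Hom T Z K2. on_arr H g y2 = x"
    "\<And>g. g \<in> Hom T Z K1 \<Longrightarrow> on_arr H g y1 = Hz Z \<Longrightarrow> t2 \<cdot> g = zer Z K2"
    using extd_object[OF K1(1,2) Z] by blast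
  have "(t2 \<cdot> t1) \<cdot> g = zer Z K2" if g: "g \<in> Hom T Z K" "on_arr H g y = Hz Z" for g
  proof -
    have "on_arr H (t1 \<cdot> g) y1 = Hz Z" using H_comp[OF Z K(1) K1(1) g(1) K1(3,2)] K1(4) g(2) by simp
    then show ?thesis using 2(3)[OF comp_closed[OF g(1) K1(3)]] comp_assoc[OF g(1) K1(3), of t2 K2] 2(1) by (simp add: extd_def)
  qed
  then show "\<exists>K2 y2 t2. extd K1 y1 K2 y2 t2 \<and> (\<forall>x\<in>HH Z. \<exists>g\<in>Hom T Z K2. on_arr H g y2 = x) \<and>
    (\<forall>g\<in>Hom T Z K. on_arr H g y = Hz Z \<longrightarrow> (t2 \<cdot> t1) \<cdot> g = zer Z K2)" using 2(1,2) by blast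
next
  fix Z K1 y1 t1 K2 y2 t2
  assume h: "Z \<in> \<S>" "extd K y K1 y1 t1" "(\<forall>x\<in>HH Z. \<exists>g\<in>Hom T Z K1. on_arr H g y1 = x) \<and>
    (\<forall>g\<in>Hom T Z K. on_arr H g y = Hz Z \<longrightarrow> t1 \<cdot> g = zer Z K1)" "extd K1 y1 K2 y2 t2"
  have Z: "Z \<in> Tc" and K1: "K1 \<in> Tc" "y1 \<in> HH K1" "t1 \<in> Hom T K K1" "on_arr H t1 y1 = y"
    and K2: "K2 \<in> Tc" "y2 \<in> HH K2" "t2 \<in> Hom T K1 K2" "on_arr H t2 y2 = y1"
    using h S(2) by (auto simp: extd_def)
  have "\<exists>g\<in>Hom T Z K2. on_arr H g y2 = x" if x: "x \<in> HH Z" for x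
  proof -
    obtain g where g: "g \<in> Hom T Z K1" "on_arr H g y1 = x" using h(3) x by blast
    have "on_arr H (t2 \<cdot> g) y2 = x" using H_comp[OF Z K1(1) K2(1) g(1) K2(3,2)] K2(4) g(2) by simp
    then show ?thesis using comp_closed[OF g(1) K2(3)] by blast
  qed
  moreover have "(t2 \<cdot> t1) \<cdot> g = zer Z K2" if g: "g \<in> Hom T Z K" "on_arr H g y = Hz Z" for g
    using h(3) g comp_assoc[OF g(1) K1(3) K2(3)] comp_zer_right[OF _ K2(3)] Hom_obj[OF g(1)] by simp
  ultimately show "(\<forall>x\<in>HH Z. \<exists>g\<in>Hom T Z K2. on_arr H g y2 = x) \<and>
    (\<forall>g\<in>Hom T Z K. on_arr H g y = Hz Z \<longrightarrow> (t2 \<cdot> t1) \<cdot> g = zer Z K2)" by blast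
qed

text \<open>Each window is finite, and every shift of every generator belongs to all sufficiently
  late ones.\<close>

definition window where
  "window n = (\<Union>s\<in>{- int n..int n}. \<Union>j\<in>{- int n..int n}. sh s ` \<G> j)"

lemma window: "finite (window n)" "window n \<subseteq> Tc"
  unfolding window_def using finG compact_shift[OF G_compact] by auto

lemma tower_exists:
  "\<exists>L \<tau> y. tower R T (compacts \<kappa> T) H L \<tau> y \<and>
     (\<forall>n. \<forall>Z\<in>window n. (\<forall>x\<in>HH Z. \<exists>g\<in>Hom T Z (L (Suc n)). on_arr H g (y (Suc n)) = x) \<and>
       (\<forall>g\<in>Hom T Z (L n). on_arr H g (y n) = Hz Z \<longrightarrow> \<tau> n \<cdot> g = zer Z (L (Suc n))))"
proof -
  define Q where "Q n a b t \<longleftrightarrow> extd (fst a) (snd a) (fst b) (snd b) t \<and>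
    (\<forall>Z\<in>window n. (\<forall>x\<in>HH Z. \<exists>g\<in>Hom T Z (fst b). on_arr H g (snd b) = x) \<and>
       (\<forall>g\<in>Hom T Z (fst a). on_arr H g (snd a) = Hz Z \<longrightarrow> t \<cdot> g = zer Z (fst b)))" for n a b t
  obtain O' where O': "is_zero T O'" using zero_object by blast
  have "\<exists>f. \<forall>n. (fst (f n) \<in> Tc \<and> snd (f n) \<in> HH (fst (f n))) \<and> (\<exists>t. Q n (f n) (f (Suc n)) t)"
  proof (rule dependent_nat_choice)
    \<comment> \<open>A zero object with its zero element is the starting pair.\<close>
    have m: "module R (on_obj H O')" using H_module[OF compact_zero[OF O']] .
    have "Hz O' \<in> HH O'" using submodule_zero_mem[OF m module.carrier_is_submodule[OF m]] .
    then show "\<exists>x. fst x \<in> Tc \<and> snd x \<in> HH (fst x)" using compact_zero[OF O'] by (intro exI[of _ "(O', Hz O')"]) simp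
  next
    fix a :: "'o \<times> 'x" and n assume a: "fst a \<in> Tc \<and> snd a \<in> HH (fst a)"
    obtain K' y' t where k: "extd (fst a) (snd a) K' y' t"
      "\<forall>Z\<in>window n. (\<forall>x\<in>HH Z. \<exists>g\<in>Hom T Z K'. on_arr H g y' = x) \<and>
       (\<forall>g\<in>Hom T Z (fst a). on_arr H g (snd a) = Hz Z \<longrightarrow> t \<cdot> g = zer Z K')"
      using extd_finite[OF window[of n], of "fst a" "snd a"] a by blast
    have "Q n a (K', y') t" unfolding Q_def using k by simp
    moreover have "K' \<in> Tc \<and> y' \<in> HH K'" using k(1) by (simp add: extd_def)
    ultimately show "\<exists>b. (fst b \<in> Tc \<and> snd b \<in> HH (fst b)) \<and> (\<exists>t. Q n a b t)"
      by (intro exI[of _ "(K', y')"]) auto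
  qed
  then obtain f where f: "\<And>n. fst (f n) \<in> Tc \<and> snd (f n) \<in> HH (fst (f n))" "\<And>n. \<exists>t. Q n (f n) (f (Suc n)) t" by blast
  obtain \<tau> where t: "\<And>n. Q n (f n) (f (Suc n)) (\<tau> n)" using f(2) by metis
  have "tower R T Tc H (\<lambda>n. fst (f n)) \<tau> (\<lambda>n. snd (f n))"
    using f(1) t unfolding Q_def extd_def by unfold_locales auto
  then show ?thesis using t unfolding Q_def
    by (intro exI[of _ "\<lambda>n. fst (f n)"] exI[of _ \<tau>] exI[of _ "\<lambda>n. snd (f n)"]) auto
qed

end

section \<open>The homotopy colimit represents the functor\<close>

locale finite_tower = finite_functor R T \<kappa> \<G> H + tower R T "compacts \<kappa> T" H L \<tau> y
  for R :: "('r, 'a) ring_scheme" and T :: "('o, 'm, 'r, 'e) tri_category_scheme" (structure)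
    and \<kappa> :: "'u rel" and \<G> and H :: "('o, 'm, 'r, 'x) mod_functor" and L \<tau> y +
  fixes F u
  assumes window_lift: "\<lbrakk>Z \<in> window n; x \<in> HH Z\<rbrakk> \<Longrightarrow> \<exists>g\<in>Hom T Z (L (Suc n)). on_arr H g (y (Suc n)) = x"
    and window_die: "\<lbrakk>Z \<in> window n; g \<in> Hom T Z (L n); on_arr H g (y n) = Hz Z\<rbrakk> \<Longrightarrow> \<tau> n \<cdot> g = zer Z (L (Suc n))"
    and hoc: "hocolim \<kappa> L \<tau> F u"
begin

lemma good_G:
  assumes G: "G \<in> \<G> j"
  shows "good {G}"
proof (rule goodI)
  show "{G} \<subseteq> Tc" using G_compact[OF G] by blast
  fix s i
  \<comment> \<open>The stage has to be at least \<open>i\<close>, and its window has to contain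
    both the shift \<open>s\<close> and the degree \<open>j\<close>.\<close>
  define n where "n = max i (nat (max \<bar>s\<bar> \<bar>j\<bar>))"
  have w: "sh s G \<in> window n" using G unfolding window_def n_def by (intro UN_I[of s] UN_I[of j] imageI) auto
  have sG: "sh s G \<in> Tc" using G_compact[OF G] compact_shift by blast
  have ile: "i \<le> n" unfolding n_def by simp
  have "lifts s (Suc n) G" unfolding lifts_def using window_lift[OF w] by blast
  moreover have "dies s i (Suc n - i) G" unfolding dies_def
  proof (intro ballI impI)
    fix g assume g: "g \<in> Hom T (sh s G) (L i)" "on_arr H g (y i) = Hz (sh s G)"
    note t = tr_Hom'[OF ile]
    have "\<tau> n \<cdot> (tr i (n - i) \<cdot> g) = zer (sh s G) (L (Suc n))"
      using window_die[OF w comp_closed[OF g(1) t]] H_tr'[OF sG g(1) ile] g(2) by simp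
    moreover have "tr i (Suc n - i) = \<tau> n \<cdot> tr i (n - i)" using ile by (simp add: Suc_diff_le)
    ultimately show "tr i (Suc n - i) \<cdot> g = zer (sh s G) (L (i + (Suc n - i)))"
      using comp_assoc[OF g(1) t \<tau>] ile by simp
  qed
  ultimately show "\<exists>p n. \<forall>Z\<in>{G}. lifts s p Z \<and> dies s i n Z" by blast
qed

lemma good_compact:
  assumes "P \<in> Tc"
  shows "good {P}"
proof -
  obtain S where S: "S \<in> coprod T (\<Union>n. \<G> n)" "retract P S" using compact_gen[OF assms] by blast
  have U: "(\<Union>n. \<G> n) \<subseteq> Tc" using G_compact by blast
  have "good {S}" using good_coprod[OF _ coprod_compact[OF U] S(1)] good_G by blast
  then show ?thesis using good_retract[of "{S}" "{P}"] S(2) assms by blast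
qed

lemma u: "u k \<in> Hom T (L k) F" "u (Suc k) \<cdot> \<tau> k = u k"
  using hocolim_cocone[OF hoc] by blast+

lemma F_obj: "F \<in> obj T"
  using u(1) Hom_obj by blast

lemma u_tr: "u (i + n) \<cdot> tr i n = u i"
  using cocone_trans[where \<tau> = \<tau>, OF \<tau>, OF u] .

text \<open>The map \<open>Hom(X, F) \<rightarrow> H(X)\<close> by which \<open>F\<close> represents
  \<open>H\<close>: lift an arrow to some stage and evaluate there. Independence of the lift is part
  of \<open>val_u\<close>.\<close>

definition val where
  "val X g = (THE x. \<exists>k. \<exists>g'\<in>Hom T X (L k). u k \<cdot> g' = g \<and> x = on_arr H g' (y k))"

lemma common_lift:
  assumes X: "X \<in> Tc" and "g \<in> Hom T X F" "h \<in> Hom T X F"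
  shows "\<exists>p. \<exists>a\<in>Hom T X (L p). \<exists>b\<in>Hom T X (L p). u p \<cdot> a = g \<and> u p \<cdot> b = h"
proof -
  obtain k a where a: "a \<in> Hom T X (L k)" "u k \<cdot> a = g" using hocolim_lift[OF hoc X assms(2)] by blast
  obtain m b where b: "b \<in> Hom T X (L m)" "u m \<cdot> b = h" using hocolim_lift[OF hoc X assms(3)] by blast
  define p where "p = max k m"
  have le: "k \<le> p" "m \<le> p" unfolding p_def by auto
  have "u p \<cdot> (tr k (p - k) \<cdot> a) = g" "u p \<cdot> (tr m (p - m) \<cdot> b) = h"
    using comp_assoc[OF a(1) tr_Hom'[OF le(1)] u(1)] comp_assoc[OF b(1) tr_Hom'[OF le(2)] u(1)]
      u_tr[of k "p - k"] u_tr[of m "p - m"] le a b by simp_all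
  then show ?thesis using comp_closed[OF a(1) tr_Hom'[OF le(1)]] comp_closed[OF b(1) tr_Hom'[OF le(2)]] by blast
qed

lemma u_eq_imp:
  assumes X: "X \<in> Tc" and a: "a \<in> Hom T X (L p)" and b: "b \<in> Hom T X (L p)" and e: "u p \<cdot> a = u p \<cdot> b"
  shows "on_arr H a (y p) = on_arr H b (y p)"
proof -
  have "u p \<cdot> (a \<boxminus> b) = zer X F"
    using comp_sub_right[OF a b u(1)] e sub_eq_zer_iff[OF comp_closed[OF b u(1)] comp_closed[OF b u(1)]] by simp
  then obtain n where n: "tr p n \<cdot> (a \<boxminus> b) = zer X (L (p + n))" using hocolim_die[OF hoc X sub_Hom[OF a b]] by blast
  have "on_arr H (a \<boxminus> b) (y p) = Hz X" using H_tr[OF X sub_Hom[OF a b], of n] n H_zer[OF X L_U y] by simp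
  then show ?thesis using H_sub_zero_imp[OF X L_U a b y] by blast
qed

lemma val_u:
  assumes X: "X \<in> Tc" and a: "a \<in> Hom T X (L k)"
  shows "val X (u k \<cdot> a) = on_arr H a (y k)"
  unfolding val_def
proof (rule the_equality)
  show "\<exists>k'. \<exists>g'\<in>Hom T X (L k'). u k' \<cdot> g' = u k \<cdot> a \<and> on_arr H a (y k) = on_arr H g' (y k')" using a by blast
  fix x assume "\<exists>k'. \<exists>g'\<in>Hom T X (L k'). u k' \<cdot> g' = u k \<cdot> a \<and> x = on_arr H g' (y k')"
  then obtain m b where b: "b \<in> Hom T X (L m)" "u m \<cdot> b = u k \<cdot> a" "x = on_arr H b (y m)" by blast
  define p where "p = max k m"
  have le: "k \<le> p" "m \<le> p" unfolding p_def by auto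
  have "u p \<cdot> (tr m (p - m) \<cdot> b) = u p \<cdot> (tr k (p - k) \<cdot> a)"
    using comp_assoc[OF a(1) tr_Hom'[OF le(1)] u(1)] comp_assoc[OF b(1) tr_Hom'[OF le(2)] u(1)]
      u_tr[of k "p - k"] u_tr[of m "p - m"] le b by simp
  then have "on_arr H (tr m (p - m) \<cdot> b) (y p) = on_arr H (tr k (p - k) \<cdot> a) (y p)"
    using u_eq_imp[OF X comp_closed[OF b(1) tr_Hom'[OF le(2)]] comp_closed[OF a(1) tr_Hom'[OF le(1)]]] by blast
  then show "x = on_arr H a (y k)" using H_tr'[OF X a le(1)] H_tr'[OF X b(1) le(2)] b(3) by simp
qed

lemma val_mem: "X \<in> Tc \<Longrightarrow> g \<in> Hom T X F \<Longrightarrow> val X g \<in> HH X"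
  using hocolim_lift[OF hoc] val_u H_mem[OF _ L_U _ y] by metis

text \<open>Equal values mean that \<open>H\<close> kills the difference of two lifts; goodness of
  \<open>X\<close> turns this into vanishing at a later stage of the tower.\<close>

lemma val_inj:
  assumes X: "X \<in> Tc" and "g \<in> Hom T X F" "h \<in> Hom T X F" "val X g = val X h"
  shows "g = h"
proof -
  obtain p a b where ab: "a \<in> Hom T X (L p)" "b \<in> Hom T X (L p)" "u p \<cdot> a = g" "u p \<cdot> b = h"
    using common_lift[OF assms(1-3)] by blast
  have "on_arr H a (y p) = on_arr H b (y p)" using val_u[OF X ab(1)] val_u[OF X ab(2)] ab assms(4) by simp
  then have z: "on_arr H (a \<boxminus> b) (y p) = Hz (sh 0 X)" using H_sub_zero[OF X L_U ab(1,2) y] by simp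
  obtain n where "dies 0 p n X" using goodD[OF good_compact[OF X]] by blast
  then have "tr p n \<cdot> (a \<boxminus> b) = zer X (L (p + n))" using z sub_Hom[OF ab(1,2)] unfolding dies_def by simp
  then have "u p \<cdot> (a \<boxminus> b) = zer X F"
    using comp_assoc[OF sub_Hom[OF ab(1,2)] tr_Hom u(1), of n] u_tr[of p n] comp_zer_right[OF compact_obj[OF X] u(1)] by simp
  then show ?thesis
    using comp_sub_right[OF ab(1,2) u(1)] ab(3,4) sub_eq_zer_iff[OF assms(2,3)] by simp
qed

lemma val_surj:
  assumes X: "X \<in> Tc" and x: "x \<in> HH X"
  shows "\<exists>g\<in>Hom T X F. val X g = x"
proof -
  obtain n where "lifts 0 (0 + n) X" using goodD[OF good_compact[OF X]] by blast
  then obtain g where g: "g \<in> Hom T X (L n)" "on_arr H g (y n) = x" using x unfolding lifts_def by auto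
  then show ?thesis using val_u[OF X g(1)] comp_closed[OF g(1) u(1)] by blast
qed

lemma represents: "nat_isomorphic R T Tc (yoneda T F) H"
proof -
  define \<alpha> where "\<alpha> = (\<lambda>X\<in>Tc. \<lambda>g\<in>Hom T X F. val X g)"
  have lin: "\<alpha> X \<in> linear_maps R (Hom_mod T X F) (on_obj H X)" if X: "X \<in> Tc" for X
  proof -
    have "val X (g \<boxplus> h) = val X g \<oplus>\<^bsub>on_obj H X\<^esub> val X h" if gh: "g \<in> Hom T X F" "h \<in> Hom T X F" for g h
    proof -
      obtain p a b where ab: "a \<in> Hom T X (L p)" "b \<in> Hom T X (L p)" "u p \<cdot> a = g" "u p \<cdot> b = h"
        using common_lift[OF X gh] by blast
      show ?thesis using val_u[OF X add_Hom[OF ab(1,2)]] comp_add_right[OF ab(1,2) u(1)] ab(3,4)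
        H_add[OF X L_U ab(1,2) y] val_u[OF X ab(1)] val_u[OF X ab(2)] by simp
    qed
    moreover have "val X (arr_scale T r g) = r \<odot>\<^bsub>on_obj H X\<^esub> val X g" if g: "g \<in> Hom T X F" "r \<in> carrier R" for g r
    proof -
      obtain p a where a: "a \<in> Hom T X (L p)" "u p \<cdot> a = g" using hocolim_lift[OF hoc X g(1)] by blast
      show ?thesis using val_u[OF X scale_Hom[OF a(1) g(2)]] comp_scale_right[OF g(2) a(1) u(1)] a(2)
        linear_functor.scale[OF lin X L_U g(2) a(1) y] val_u[OF X a(1)] by simp
    qed
    ultimately show ?thesis using X val_mem[OF X] add_Hom scale_Hom by (auto simp: linear_maps_def \<alpha>_def)
  qed
  have nat: "\<alpha> X (g \<cdot> f) = on_arr H f (\<alpha> Y g)" if X: "X \<in> Tc" and Y: "Y \<in> Tc" and f: "f \<in> Hom T X Y" and g: "g \<in> Hom T Y F" for X Y f g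
  proof -
    obtain p a where a: "a \<in> Hom T Y (L p)" "u p \<cdot> a = g" using hocolim_lift[OF hoc Y g] by blast
    have "val X (g \<cdot> f) = on_arr H f (val Y g)"
      using comp_assoc[OF f a(1) u(1)] a(2) val_u[OF X comp_closed[OF f a(1)]] val_u[OF Y a(1)] H_comp[OF X Y L_U f a(1) y] by simp
    then show ?thesis using X Y g comp_closed[OF f g] by (simp add: \<alpha>_def)
  qed
  have "\<alpha> \<in> nat_transformations R T Tc (yoneda T F) H"
    unfolding nat_transformations_def using lin nat by (auto simp: \<alpha>_def yoneda_on_arr)
  moreover have "bij_betw (\<alpha> X) (Hom T X F) (HH X)" if X: "X \<in> Tc" for X
    unfolding bij_betw_def using X val_inj[OF X] val_mem[OF X] val_surj[OF X]
    by (auto simp: \<alpha>_def inj_on_def image_iff) (metis)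
  ultimately show ?thesis unfolding nat_isomorphic_def by (intro bexI[of _ \<alpha>]) simp_all
qed

lemma yoneda_tower: "tower R T (obj T) (yoneda T F) L \<tau> u"
proof -
  interpret Y: cohomological R T "obj T" "yoneda T F" using yoneda_interpret[OF F_obj] shift_obj by blast
  show ?thesis using L_U Tc_obj \<tau> u by unfold_locales auto
qed

text \<open>The bounds for \<open>H\<close> carry over along \<open>val\<close>. The passage to
  \<open>Hom(-, F)\<close> on all objects is made because \<open>H\<close> has no values on infinite
  coproducts of generators.\<close>

lemma yoneda_good:
  assumes P: "P \<in> Tc"
  shows "tower.good T (obj T) (yoneda T F) L \<tau> u {P}"
proof -
  interpret Y: tower R T "obj T" "yoneda T F" L \<tau> u using yoneda_tower .
  show ?thesis
  proof (rule Y.goodI)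
    show "{P} \<subseteq> obj T" using P Tc_obj by blast
    fix s i
    obtain n where n: "lifts s (i + n) P" "dies s i n P" using goodD[OF good_compact[OF P]] by blast
    have sP: "sh s P \<in> Tc" using compact_shift[OF P] .
    have "Y.lifts s (i + n) P" unfolding Y.lifts_def
    proof
      fix x assume "x \<in> carrier (on_obj (yoneda T F) (sh s P))"
      then have x: "x \<in> Hom T (sh s P) F" by simp
      obtain g where g: "g \<in> Hom T (sh s P) (L (i + n))" "on_arr H g (y (i + n)) = val (sh s P) x"
        using n(1) val_mem[OF sP x] unfolding lifts_def by blast
      then have "u (i + n) \<cdot> g = x" using val_inj[OF sP comp_closed[OF g(1) u(1)] x] val_u[OF sP g(1)] by simp
      then show "\<exists>g\<in>Hom T (sh s P) (L (i + n)). on_arr (yoneda T F) g (u (i + n)) = x" using g(1) by auto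
    qed
    moreover have "Y.dies s i n P" unfolding Y.dies_def
    proof (intro ballI impI)
      fix g assume g: "g \<in> Hom T (sh s P) (L i)" "on_arr (yoneda T F) g (u i) = \<zero>\<^bsub>on_obj (yoneda T F) (sh s P)\<^esub>"
      have z: "zer (sh s P) (L i) \<in> Hom T (sh s P) (L i)" using zer_Hom Hom_obj[OF g(1)] by blast
      have "u i \<cdot> g = u i \<cdot> zer (sh s P) (L i)" using g(2) comp_zer_right[OF _ u(1)] Hom_obj[OF g(1)] by simp
      then have "on_arr H g (y i) = Hz (sh s P)" using u_eq_imp[OF sP g(1) z] H_zer[OF sP L_U y] by simp
      then show "tr i n \<cdot> g = zer (sh s P) (L (i + n))" using n(2) g(1) unfolding dies_def by blast
    qed
    ultimately show "\<exists>p n. \<forall>Z\<in>{P}. Y.lifts s p Z \<and> Y.dies s i n Z" by blast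
  qed
qed

end

section \<open>Orthogonality classes and metrics\<close>

context R_linear_triangulated_category
begin

lemma left_orth_retract: "retract X S \<Longrightarrow> S \<in> left_orth T V \<Longrightarrow> X \<in> left_orth T V"
  using hz_retract_left retract_obj unfolding left_orth_iff by blast

lemma left_orth_ext: "triangle T A B C f g h \<Longrightarrow> A \<in> left_orth T V \<Longrightarrow> C \<in> left_orth T V \<Longrightarrow> B \<in> left_orth T V"
  using ext_hz_contra triangle_obj(2) unfolding left_orth_iff by blast

lemma left_orth_zero: "is_zero T Z \<Longrightarrow> V \<subseteq> obj T \<Longrightarrow> Z \<in> left_orth T V"
  using is_zeroD(1) unfolding left_orth_iff is_zero_def by blast

lemma left_orth_sum:
  assumes "is_direct_sum T X Y S" "X \<in> left_orth T V" "Y \<in> left_orth T V"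
  shows "S \<in> left_orth T V"
  using assms direct_sum_hz(1)[OF assms(1)] retract_obj[OF direct_sum_retract(1)[OF assms(1)]]
  unfolding left_orth_iff by blast

lemma left_orth_coprod:
  assumes "V \<subseteq> obj T" "\<S> \<subseteq> left_orth T V" "X \<in> coprod T \<S>"
  shows "X \<in> left_orth T V"
  using assms(3)
proof induction
  case (sum X Y S) then show ?case using left_orth_sum by blast
next
  case (ext A C B f g h) then show ?case using left_orth_ext by blast
qed (use assms left_orth_zero in auto)

lemma left_orth_smd_coprod:
  assumes "V \<subseteq> obj T" "\<S> \<subseteq> left_orth T V" "X \<in> smd T (coprod T \<S>)"
  shows "X \<in> left_orth T V"
  using smd_retract[OF assms(3)] left_orth_coprod[OF assms(1,2)] left_orth_retract by blast

lemma left_orth_Coprod1: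
  fixes \<kappa> :: "'u rel"
  assumes V: "V \<subseteq> obj T" and "\<S> \<subseteq> left_orth T V" "X \<in> Coprod1 \<kappa> T \<S>"
  shows "X \<in> left_orth T V"
proof -
  obtain I :: "'u set" and Y \<iota> where Y: "\<And>i. i \<in> I \<Longrightarrow> Y i \<in> \<S>" "is_coproduct T I Y X \<iota>"
    using assms(3) unfolding Coprod1_def by blast
  have X: "X \<in> obj T" using coproduct_obj[OF Y(2)] .
  have "hz X v" if v: "v \<in> V" for v
  proof (rule hzI[OF X])
    show vo: "v \<in> obj T" using v V by blast
    fix f assume f: "f \<in> Hom T X v"
    show "f = zer X v"
    proof (rule coproduct_eq[OF Y(2) f zer_Hom[OF X vo]])
      fix i assume i: "i \<in> I"
      note ii = coproduct_Hom[OF Y(2) i]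
      have "hz (Y i) v" using subsetD[OF assms(2) Y(1)[OF i]] v by (simp add: left_orth_iff)
      then show "f \<cdot> \<iota> i = zer X v \<cdot> \<iota> i" using hzD[OF _ comp_closed[OF ii f]] comp_zer_left[OF vo ii] by simp
    qed
  qed
  then show ?thesis using X unfolding left_orth_iff by blast
qed

lemma left_orth_Coprod:
  fixes \<kappa> :: "'u rel"
  assumes "V \<subseteq> obj T" "\<S> \<subseteq> left_orth T V"
  shows "X \<in> Coprod \<kappa> T (Suc m) \<S> \<Longrightarrow> X \<in> left_orth T V"
proof (induction m arbitrary: X)
  case 0 then show ?case using left_orth_Coprod1[OF assms] by simp
next
  case (Suc m)
  then obtain A C f g h where "A \<in> Coprod1 \<kappa> T \<S>" "C \<in> Coprod \<kappa> T (Suc m) \<S>" "triangle T A X C f g h"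
    unfolding Coprod.simps extensions_def by blast
  then show ?case using left_orth_ext left_orth_Coprod1[OF assms] Suc.IH by blast
qed

text \<open>A finite family is dominated by its direct sum; this turns one choice per object into a
  single choice for all of them.\<close>

lemma coprod_common_retract:
  assumes "finite \<S>" "\<S> \<subseteq> coprod T \<U>" "\<U> \<subseteq> obj T"
  shows "\<exists>S\<in>coprod T \<U>. \<forall>X\<in>\<S>. retract X S"
  using assms(1,2)
proof (induction \<S> rule: finite_induct)
  case empty
  obtain O' where "is_zero T O'" using zero_object by blast
  then show ?case using coprod.zero[of T O' \<U>] by auto
next
  case (insert X \<S>)
  then obtain S where S: "S \<in> coprod T \<U>" "\<forall>X\<in>\<S>. retract X S" by auto
  have X: "X \<in> coprod T \<U>" using insert by blast
  have o: "Y \<in> obj T" if "Y \<in> coprod T \<U>" for Y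
    using that
  proof induction
    case (base Y) then show ?case using assms(3) by blast
  next
    case (zero Y) then show ?case by (simp add: is_zero_def)
  next
    case (sum X Y S) then show ?case using retract_obj[OF direct_sum_retract(1)[OF sum(3)]] by blast
  next
    case (ext A C B f g h) then show ?case using triangle_obj by blast
  qed
  obtain S' where S': "is_direct_sum T X S S'" using direct_sums[OF o[OF X] o[OF S(1)]] by blast
  have "retract Y S'" if "Y \<in> insert X \<S>" for Y
    using that S(2) direct_sum_retract[OF S'] retract_trans by blast
  then show ?case using coprod.sum[OF X S(1) S'] by blast
qed

end

section \<open>Vanishing against the generators\<close>

context generated
begin

text \<open>\<open>van {..- n}\<close> is the right orthogonal of \<open>gen_M T \<G> n\<close>, see
  \<open>right_orth_M\<close>. \<open>van {a..}\<close> is the vanishing in high degrees that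
  condition (2) of quasiapproximability gives for the layers of its metric.\<close>

definition van where "van J Z \<longleftrightarrow> Z \<in> obj T \<and> (\<forall>j\<in>J. \<forall>G\<in>\<G> j. hz G Z)"

lemma van_obj: "van J Z \<Longrightarrow> Z \<in> obj T"
  by (simp add: van_def)

lemma van_mono: "van J Z \<Longrightarrow> J' \<subseteq> J \<Longrightarrow> van J' Z"
  by (auto simp: van_def)

lemma van_left_orth: "van J Z \<Longrightarrow> (\<Union>j\<in>J. \<G> j) \<subseteq> left_orth T {Z}"
  using G_obj by (auto simp: van_def left_orth_iff)

lemma van_gen_on: "van J Z \<Longrightarrow> X \<in> gen_on T \<G> J \<Longrightarrow> hz X Z"
  using left_orth_smd_coprod[OF _ van_left_orth, of Z J X] van_obj[of J Z] unfolding gen_on_def left_orth_iff by blast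

lemma G_gen_on: "G \<in> \<G> j \<Longrightarrow> j \<in> J \<Longrightarrow> G \<in> gen_on T \<G> J"
  unfolding gen_on_def by (intro smd_self coprod.base UN_I) (auto intro: G_obj)

lemma gen_on_coprod: "X \<in> coprod T (\<Union>j\<in>J. \<G> j) \<Longrightarrow> X \<in> gen_on T \<G> J"
proof -
  assume X: "X \<in> coprod T (\<Union>j\<in>J. \<G> j)"
  have U: "(\<Union>j\<in>J. \<G> j) \<subseteq> Tc" using G_compact by blast
  show ?thesis unfolding gen_on_def using smd_self[OF X compact_obj[OF coprod_compact[OF U X]]] .
qed

text \<open>The shift is moved to the generator, where the axiom on neighbouring degrees of a
  generating sequence applies.\<close>

lemma van_shift:
  assumes "van J Z" "\<And>j. j \<in> J' \<Longrightarrow> {j - 1..j + 1} \<subseteq> J"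
  shows "van J' (susp T Z)" "van J' (sh (- 1) Z)"
proof -
  have Z: "Z \<in> obj T" using van_obj[OF assms(1)] .
  have g: "hz (sh (- 1) G) Z" "hz (sh 1 G) Z" if "j \<in> J'" "G \<in> \<G> j" for j G
  proof -
    have "sh (- 1) G \<in> gen_on T \<G> {j - 1..j + 1}" "sh 1 G \<in> gen_on T \<G> {j - 1..j + 1}"
      using gs that(2) unfolding generating_sequence_def by blast+
    then show "hz (sh (- 1) G) Z" "hz (sh 1 G) Z"
      using van_gen_on[OF van_mono[OF assms(1) assms(2)[OF that(1)]]] by blast+
  qed
  show "van J' (susp T Z)" "van J' (sh (- 1) Z)"
    unfolding van_def using g hz_shift_left[OF G_obj Z, of _ _ "- 1"] hz_shift_left[OF G_obj Z, of _ _ 1]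
      shift_obj[OF Z] susp_obj[OF Z] by auto
qed

lemma van_shift_up:
  assumes "van {a..} Z"
  shows "van {a + 1..} (susp T Z)" "van {a + 1..} (sh (- 1) Z)"
  by (rule van_shift[OF assms]; auto)+

lemma van_shift_down:
  assumes "van {..a} Z"
  shows "van {..a - 1} (susp T Z)" "van {..a - 1} (sh (- 1) Z)"
  by (rule van_shift[OF assms]; auto)+

lemma van_ext: "triangle T A B C f g h \<Longrightarrow> van J A \<Longrightarrow> van J C \<Longrightarrow> van J B"
  using ext_hz_cov triangle_obj(2) unfolding van_def by blast

lemma right_orth_M: "right_orth T (gen_M T \<G> n) = {Z. van {..- n} Z}"
proof (intro equalityI subsetI)
  fix Z assume "Z \<in> right_orth T (gen_M T \<G> n)"
  then show "Z \<in> {Z. van {..- n} Z}" using G_gen_on[of _ _ "{..- n}"] unfolding right_orth_iff van_def gen_M_def by auto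
next
  fix Z assume "Z \<in> {Z. van {..- n} Z}"
  then show "Z \<in> right_orth T (gen_M T \<G> n)" using van_gen_on van_obj unfolding right_orth_iff gen_M_def by blast
qed

abbreviation RR where "RR n \<equiv> gen_R T \<G> n"

lemma RR_iff: "X \<in> RR n \<longleftrightarrow> X \<in> obj T \<and> (\<forall>Z. van {..- n} Z \<longrightarrow> hz X Z)"
  unfolding gen_R_def right_orth_M left_orth_iff by blast

text \<open>A compact object is built from finitely many generators; \<open>a\<close> is a lower
  bound of their degrees.\<close>

lemma compact_van:
  assumes P: "P \<in> Tc"
  shows "\<exists>a. \<forall>Z. van {a..} Z \<longrightarrow> hz P Z"
proof -
  obtain S where S: "S \<in> coprod T (\<Union>n. \<G> n)" "retract P S" using compact_gen[OF P] by blast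
  have "\<exists>a. \<forall>Z. van {a..} Z \<longrightarrow> hz S Z" using S(1)
  proof induction
    case (base X)
    then obtain j where "X \<in> \<G> j" by blast
    then show ?case by (intro exI[of _ j]) (auto simp: van_def)
  next
    case (zero Z) then show ?case using is_zeroD(1) van_obj by blast
  next
    case (sum X Y S)
    then obtain a b where "\<forall>Z. van {a..} Z \<longrightarrow> hz X Z" "\<forall>Z. van {b..} Z \<longrightarrow> hz Y Z" by blast
    then show ?case using direct_sum_hz(1)[OF sum(3)] van_mono[of "{min a b..}" _ "{a..}"] van_mono[of "{min a b..}" _ "{b..}"]
      by (intro exI[of _ "min a b"]) (auto simp: min.coboundedI1 min.coboundedI2)
  next
    case (ext A C B f g h)
    then obtain a b where "\<forall>Z. van {a..} Z \<longrightarrow> hz A Z" "\<forall>Z. van {b..} Z \<longrightarrow> hz C Z" by blast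
    then show ?case using ext_hz_contra[OF ext(3)] van_mono[of "{min a b..}" _ "{a..}"] van_mono[of "{min a b..}" _ "{b..}"]
      by (intro exI[of _ "min a b"]) (auto simp: min.coboundedI1 min.coboundedI2)
  qed
  then show ?thesis using hz_retract_left[OF S(2)] by blast
qed

text \<open>What the closure requires of a metric in order to be triangulated, isolated because it
  serves both the metric \<open>Q\<close> of quasiapproximability and \<open>gen_R\<close>. The last
  clause makes deep layers invisible to any given compact object.\<close>

definition metric_like where
  "metric_like W \<longleftrightarrow> (\<forall>n::int. W n \<subseteq> obj T \<and> (\<forall>Z. is_zero T Z \<longrightarrow> Z \<in> W n) \<and> extensions T (W n) (W n) \<subseteq> W n \<and>
     W (n + 1) \<subseteq> W n \<and> susp T ` W (n + 1) \<subseteq> W n \<and> sh (- 1) ` W (n + 1) \<subseteq> W n) \<and>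
     (\<forall>K\<in>Tc. \<exists>m. \<forall>Y\<in>W m. hz K Y)"

lemma metric_likeD:
  assumes "metric_like W"
  shows "W n \<subseteq> obj T" "is_zero T Z \<Longrightarrow> Z \<in> W n" "extensions T (W n) (W n) \<subseteq> W n" "W (n + 1) \<subseteq> W n"
    "X \<in> W (n + 1) \<Longrightarrow> susp T X \<in> W n" "X \<in> W (n + 1) \<Longrightarrow> sh (- 1) X \<in> W n"
    "K \<in> Tc \<Longrightarrow> \<exists>m. \<forall>Y\<in>W m. hz K Y"
proof -
  note c = assms[unfolded metric_like_def, THEN conjunct1, THEN spec, of n]
    and d = assms[unfolded metric_like_def, THEN conjunct2]
  show "W n \<subseteq> obj T" "is_zero T Z \<Longrightarrow> Z \<in> W n" "extensions T (W n) (W n) \<subseteq> W n" "W (n + 1) \<subseteq> W n"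
    "X \<in> W (n + 1) \<Longrightarrow> susp T X \<in> W n" "X \<in> W (n + 1) \<Longrightarrow> sh (- 1) X \<in> W n"
    using c by (simp_all add: image_subset_iff)
  show "K \<in> Tc \<Longrightarrow> \<exists>m. \<forall>Y\<in>W m. hz K Y" using d by simp
qed

lemma metric_like_dec:
  assumes W: "metric_like W" and "i \<le> j"
  shows "W j \<subseteq> W i"
  using assms(2)
proof (induction j rule: int_ge_induct)
  case (step j) then show ?case using metric_likeD(4)[OF W, of j] by simp
qed simp

lemma metric_like_orth:
  assumes W: "metric_like W" and "K \<in> Tc"
  shows "\<exists>m\<ge>n. \<forall>Y\<in>W m. hz K Y"
proof -
  obtain m where m: "\<forall>Y\<in>W m. hz K Y" using metric_likeD(7)[OF assms] by blast
  then show ?thesis using metric_like_dec[OF W, of m "max m n"] by (intro exI[of _ "max m n"]) auto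
qed

lemma metric_like_obj: "metric_like W \<Longrightarrow> X \<in> W n \<Longrightarrow> X \<in> obj T"
  by (drule metric_likeD(1)) auto

section \<open>The closure of the compact objects is triangulated\<close>

lemma closure_iff: "X \<in> compact_closure \<kappa> T W \<longleftrightarrow> (\<forall>n. X \<in> extensions T Tc (W n))"
  by (auto simp: compact_closure_def)

lemma closure_obj: "X \<in> compact_closure \<kappa> T W \<Longrightarrow> X \<in> obj T"
  using closure_iff extensions_obj by blast

lemma closure_compact:
  assumes W: "metric_like W" and K: "K \<in> Tc"
  shows "K \<in> compact_closure \<kappa> T W"
proof -
  obtain O' where O': "is_zero T O'" using zero_object by blast
  have "K \<in> extensions T Tc (W n)" for n
    using extensionsI[OF triangle_ide[OF compact_obj[OF K] O'] K metric_likeD(2)[OF W O']] .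
  then show ?thesis unfolding closure_iff by blast
qed

text \<open>The depth \<open>m\<close> for \<open>Y\<close> is chosen after the compact part
  \<open>K1\<close> of \<open>X\<close>, so that \<open>K1 \<rightarrow> Y\<close> lifts to the
  compact part \<open>K2\<close> of \<open>Y\<close>. Two octahedra then compare the cone of
  \<open>K1 \<rightarrow> K2\<close> with \<open>Z\<close>.\<close>

lemma closure_cone:
  assumes W: "metric_like W" and t: "triangle T X Y Z f g h"
    and X: "X \<in> compact_closure \<kappa> T W" and Y: "Y \<in> compact_closure \<kappa> T W"
  shows "Z \<in> compact_closure \<kappa> T W"
  unfolding closure_iff
proof
  fix n
  \<comment> \<open>Depth \<open>n + 1\<close>, because \<open>D1\<close> enters the approximation
    of \<open>Z\<close> suspended.\<close>
  obtain K1 D1 k1 d1 e1 where 1: "K1 \<in> Tc" "D1 \<in> W (n + 1)" "triangle T K1 X D1 k1 d1 e1"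
    using X unfolding closure_iff extensions_def by blast
  obtain m where m: "m \<ge> n" "\<forall>Y\<in>W m. hz K1 Y" using metric_like_orth[OF W 1(1)] by blast
  obtain K2 D2 k2 d2 e2 where 2: "K2 \<in> Tc" "D2 \<in> W m" "triangle T K2 Y D2 k2 d2 e2"
    using Y unfolding closure_iff extensions_def by blast
  note H1 = triangle_Hom[OF 1(3)] and H2 = triangle_Hom[OF 2(3)] and H = triangle_Hom[OF t]
  note fk = comp_closed[OF H1(1) H(1)]
  have "d2 \<cdot> (f \<cdot> k1) = zer K1 D2" using hzD comp_closed[OF fk H2(2)] m(2) 2(2) by blast
  then obtain a where a: "a \<in> Hom T K1 K2" "k2 \<cdot> a = f \<cdot> k1" using exact_cov[OF 2(3) fk] by blast
  obtain V v v' where V: "triangle T K1 Y V (f \<cdot> k1) v v'" using triangle_exists[OF fk] by blast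
  obtain K3 w w' where K3: "triangle T K1 K2 K3 a w w'" using triangle_exists[OF a(1)] by blast
  have "susp T K1 \<in> Tc" using compact_shift[OF 1(1), of 1] by simp
  then have K3c: "K3 \<in> Tc" using compact_ext[OF rotate[OF K3] 2(1)] by blast
  have "triangle T K1 Y V (k2 \<cdot> a) v v'" using V a(2) by simp
  then obtain p q r where "triangle T K3 V D2 p q r" using octahedral[OF K3 2(3)] by metis
  then have V1: "V \<in> extensions T Tc (W n)"
    using extensionsI K3c metric_like_dec[OF W m(1)] 2(2) by blast
  obtain p q r where "triangle T D1 V Z p q r" using octahedral[OF 1(3) t V] by metis
  then have t3: "triangle T V Z (susp T D1) q r (neg (susp_arr T p))" using rotate by blast
  have "susp T D1 \<in> W n" using metric_likeD(5)[OF W 1(2)] .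
  then have "Z \<in> extensions T (extensions T Tc (W n)) (W n)" using extensionsI[OF t3 V1] by blast
  then have "Z \<in> extensions T Tc (extensions T (W n) (W n))" by (rule extensions_assoc1)
  then show "Z \<in> extensions T Tc (W n)" using extensions_mono[OF subset_refl metric_likeD(3)[OF W]] by blast
qed

lemma closure_shift1:
  assumes W: "metric_like W" and X: "X \<in> compact_closure \<kappa> T W"
  shows "susp T X \<in> compact_closure \<kappa> T W" "sh (- 1) X \<in> compact_closure \<kappa> T W"
proof -
  have s: "s \<in> {1, - 1} \<Longrightarrow> sh s X \<in> extensions T Tc (W n)" for n s
  proof -
    assume s: "s \<in> {1, - 1}"
    have "sh s X \<in> extensions T (sh s ` Tc) (sh s ` W (n + 1))" using extensions_shift X unfolding closure_iff by blast
    moreover have "sh s ` Tc \<subseteq> Tc" using compact_shift by blast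
    moreover have "sh s ` W (n + 1) \<subseteq> W n" using s metric_likeD(5,6)[OF W] by auto
    ultimately show "sh s X \<in> extensions T Tc (W n)" by (rule subsetD[OF extensions_mono, rotated 2])
  qed
  show "susp T X \<in> compact_closure \<kappa> T W" "sh (- 1) X \<in> compact_closure \<kappa> T W"
    unfolding closure_iff using s[of 1] s[of "- 1"] by simp_all
qed

lemma closure_shift:
  assumes W: "metric_like W" and X: "X \<in> compact_closure \<kappa> T W"
  shows "sh n X \<in> compact_closure \<kappa> T W"
proof (induction n rule: int_induct[where k = 0])
  case base then show ?case using X by simp
next
  case (step1 i) then show ?case using closure_shift1(1)[OF W] shift_succ[OF closure_obj[OF X]] by simp
next
  case (step2 i)
  have "sh (i - 1) X = sh (- 1) (sh i X)" using shift_add[OF closure_obj[OF X], of "- 1" i] by simp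
  then show ?case using closure_shift1(2)[OF W step2(2)] by simp
qed

text \<open>Up to suspension, the middle term is the cone of the arrow from \<open>Z\<close> to
  \<open>\<Sigma>X\<close>.\<close>

lemma closure_ext:
  assumes W: "metric_like W" and t: "triangle T X Y Z f g h"
    and X: "X \<in> compact_closure \<kappa> T W" and Z: "Z \<in> compact_closure \<kappa> T W"
  shows "Y \<in> compact_closure \<kappa> T W"
proof -
  have "susp T Y \<in> compact_closure \<kappa> T W"
    using closure_cone[OF W rotate[OF rotate[OF t]] Z closure_shift1(1)[OF W X]] .
  then have "sh (- 1) (susp T Y) \<in> compact_closure \<kappa> T W" using closure_shift1(2)[OF W] by blast
  then show ?thesis using shift_inverse(1)[of Y 1] triangle_obj[OF t] by simp
qed

lemma RR_retract: "retract X S \<Longrightarrow> S \<in> RR n \<Longrightarrow> X \<in> RR n"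
  unfolding gen_R_def by (rule left_orth_retract)

lemma RR_ext: "triangle T A B C f g h \<Longrightarrow> A \<in> RR n \<Longrightarrow> C \<in> RR n \<Longrightarrow> B \<in> RR n"
  unfolding gen_R_def by (rule left_orth_ext)

lemma RR_shift:
  assumes X: "X \<in> RR (n + 1)"
  shows "X \<in> RR n" "susp T X \<in> RR n" "sh (- 1) X \<in> RR n"
proof -
  have Xo: "X \<in> obj T" and h: "\<And>Z. van {..- (n + 1)} Z \<Longrightarrow> hz X Z" using X by (auto simp: RR_iff)
  show "X \<in> RR n" using Xo h van_mono[of "{..- n}" _ "{..- (n + 1)}"] by (auto simp: RR_iff)
  have "hz (sh 1 X) Z \<and> hz (sh (- 1) X) Z" if v: "van {..- n} Z" for Z
  proof -
    have "van {..- (n + 1)} (sh (- 1) Z)" "van {..- (n + 1)} (sh 1 Z)" using van_shift_down[OF v] by simp_all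
    then show ?thesis using h hz_shift_left[OF Xo van_obj[OF v], of 1] hz_shift_left[OF Xo van_obj[OF v], of "- 1"] by simp
  qed
  then show "susp T X \<in> RR n" "sh (- 1) X \<in> RR n"
    using shift_obj[OF Xo, of "- 1"] susp_obj[OF Xo] by (auto simp: RR_iff)
qed

end

section \<open>Consequences of quasiapproximability for compact objects\<close>

locale quasi = generated R T \<kappa> \<G>
  for R :: "('r, 'a) ring_scheme" and T :: "('o, 'm, 'r, 'e) tri_category_scheme" (structure)
    and \<kappa> :: "'u rel" and \<G> +
  fixes Q :: "int \<Rightarrow> 'o set" and A :: nat
  assumes om: "orthogonal_metric T Q" and A_pos: "A > 0"
    and q0: "gen_M T \<G> i \<subseteq> (\<Union>n \<in> {- int A..int A}. sh n ` gen_M T \<G> (i + 1))"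
    and q1: "gen_M T \<G> (i + int A) \<subseteq> Q i"
    and q2: "\<lbrakk>n + i \<ge> int A; X \<in> \<G> n; Y \<in> Q i\<rbrakk> \<Longrightarrow> hz X Y"
    and q3: "F \<in> Q i \<inter> compact_closure \<kappa> T Q \<Longrightarrow>
           \<exists>E D f g h. triangle T E F D f g h \<and>
             D \<in> Q (i + 1) \<inter> compact_closure \<kappa> T Q \<and>
             E \<in> gen_bar \<kappa> T \<G> A {- int A - i..int A - i}"
begin

lemma Q_obj: "X \<in> Q i \<Longrightarrow> X \<in> obj T"
  using om unfolding orthogonal_metric_def strictly_full_def by blast

lemma Q_left_orth: "Q i = left_orth T (right_orth T (Q i))"
  using om unfolding orthogonal_metric_def by blast

lemma Q_retract: "retract X S \<Longrightarrow> S \<in> Q i \<Longrightarrow> X \<in> Q i"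
  using left_orth_retract Q_left_orth by metis

lemma Q_ext: "triangle T X Y Z f g h \<Longrightarrow> X \<in> Q i \<Longrightarrow> Z \<in> Q i \<Longrightarrow> Y \<in> Q i"
  using left_orth_ext Q_left_orth by metis

lemma Q_sum: "is_direct_sum T X Y S \<Longrightarrow> X \<in> Q i \<Longrightarrow> Y \<in> Q i \<Longrightarrow> S \<in> Q i"
  using left_orth_sum Q_left_orth by metis

lemma Q_zero: "is_zero T Z \<Longrightarrow> Z \<in> Q i"
  using om unfolding orthogonal_metric_def by blast

lemma Q_van: "Y \<in> Q i \<Longrightarrow> van {int A - i..} Y"
  using q2[of _ i _ Y] Q_obj by (force simp: van_def)

lemma Q_metric: "metric_like Q"
  unfolding metric_like_def
proof (intro conjI allI ballI)
  fix n
  show "Q n \<subseteq> obj T" using Q_obj by blast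
  show "extensions T (Q n) (Q n) \<subseteq> Q n" using om unfolding orthogonal_metric_def by blast
  have "sh (- 1) ` Q (n + 1) \<union> Q (n + 1) \<union> sh 1 ` Q (n + 1) \<subseteq> Q n" using om unfolding orthogonal_metric_def by blast
  then show "Q (n + 1) \<subseteq> Q n" "susp T ` Q (n + 1) \<subseteq> Q n" "sh (- 1) ` Q (n + 1) \<subseteq> Q n" by auto
next
  fix K assume "K \<in> Tc"
  then obtain a where a: "\<forall>Z. van {a..} Z \<longrightarrow> hz K Z" using compact_van by blast
  have "hz K Y" if "Y \<in> Q (int A - a)" for Y using a Q_van[OF that] by simp
  then show "\<exists>m. \<forall>Y\<in>Q m. hz K Y" by blast
qed (use Q_zero in blast)

lemmas Q_dec = metric_like_dec[OF Q_metric]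

text \<open>Double orthogonals are monotone, and each layer of an orthogonal metric equals its own
  double orthogonal.\<close>

lemma RR_Q: "RR (i + int A) \<subseteq> Q i"
proof -
  have "right_orth T (Q i) \<subseteq> right_orth T (gen_M T \<G> (i + int A))" using subsetD[OF q1[of i]] by (auto simp: right_orth_iff)
  then show ?thesis unfolding gen_R_def using Q_left_orth[of i] unfolding left_orth_def by blast
qed

lemma RR_metric: "metric_like RR"
  unfolding metric_like_def
proof (intro conjI allI ballI impI)
  fix n
  show "RR n \<subseteq> obj T" by (auto simp: RR_iff)
  show "extensions T (RR n) (RR n) \<subseteq> RR n" using RR_ext unfolding extensions_def by blast
  show "RR (n + 1) \<subseteq> RR n" "susp T ` RR (n + 1) \<subseteq> RR n" "sh (- 1) ` RR (n + 1) \<subseteq> RR n" using RR_shift by blast+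
  fix Z assume "is_zero T Z"
  then show "Z \<in> RR n" using is_zeroD(1) van_obj unfolding RR_iff is_zero_def by blast
next
  fix K assume "K \<in> Tc"
  then obtain m where m: "\<forall>Y\<in>Q m. hz K Y" using metric_like_orth[OF Q_metric] by blast
  then show "\<exists>m. \<forall>Y\<in>RR m. hz K Y" using RR_Q[of m] by blast
qed

text \<open>Left orthogonality to \<open>Z\<close> passes from the generators to coproducts,
  extensions and summands.\<close>

lemma gen_bar_hz:
  assumes E: "E \<in> gen_bar \<kappa> T \<G> A J" and v: "van J Z"
  shows "hz E Z"
proof -
  obtain S where S: "S \<in> Coprod \<kappa> T A (\<Union>n\<in>J. \<G> n)" "retract E S"
    using smd_retract E unfolding gen_bar_def by blast
  have "S \<in> left_orth T {Z}"
    using left_orth_Coprod[OF _ van_left_orth[OF v], of S \<kappa> "A - 1"] S(1) A_pos van_obj[OF v] by simp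
  then show ?thesis using hz_retract_left[OF S(2)] by (simp add: left_orth_iff)
qed

text \<open>The decisive consequence of quasiapproximability: approximating a compact object stays inside the compact
  objects, because \<open>E\<close> has no arrows to the deep layers of the metric.\<close>

lemma compact_approximation:
  assumes X: "X \<in> Tc" "X \<in> Q l"
  shows "X \<in> extensions T (Tc \<inter> gen_bar \<kappa> T \<G> A {- int A - l..int A - l}) (Tc \<inter> Q (l + 1))"
proof -
  have XC: "X \<in> compact_closure \<kappa> T Q" using closure_compact[OF Q_metric X(1)] .
  then obtain E D f g h where t: "triangle T E X D f g h" "D \<in> Q (l + 1)" "D \<in> compact_closure \<kappa> T Q"
    "E \<in> gen_bar \<kappa> T \<G> A {- int A - l..int A - l}" using q3[of X l] X(2) by blast
  have SE: "susp T E \<in> compact_closure \<kappa> T Q" using closure_cone[OF Q_metric rotate[OF t(1)] XC t(3)] .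
  \<comment> \<open>Objects of \<open>Q (N - 1)\<close> receive no arrows from degrees at least
    \<open>int A - (N - 1)\<close>, which is \<open>- int A - l\<close>, the lower end of the
    degrees of \<open>E\<close>. The remaining layer pays for desuspending
    \<open>D'\<close>.\<close>
  define N where "N = 2 * int A + 1 + l"
  obtain K D' k g' h' where 1: "K \<in> Tc" "D' \<in> Q N" "triangle T K (susp T E) D' k g' h'"
    using SE unfolding closure_iff extensions_def by blast
  have Eo: "E \<in> obj T" using triangle_obj[OF t(1)] by blast
  have Do: "D' \<in> obj T" using Q_obj 1(2) by blast
  have "sh (- 1) D' \<in> Q (N - 1)" using metric_likeD(6)[OF Q_metric, of D' "N - 1"] 1(2) by simp
  then have "van {- int A - l..int A - l} (sh (- 1) D')" by (intro van_mono[OF Q_van]) (auto simp: N_def)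
  then have "hz E (sh (- 1) D')" using gen_bar_hz[OF t(4)] by blast
  then have "hz (susp T E) D'" using hz_shift_left[OF Eo Do, of 1] by simp
  then have "g' = zer (susp T E) D'" using hzD triangle_Hom(2)[OF 1(3)] by blast
  then have "retract (susp T E) K" using split_retract[OF 1(3)] by blast
  then have SEc: "susp T E \<in> Tc" using compact_retract[OF 1(1)] by blast
  then have "E \<in> Tc" using compact_shift[OF SEc, of "- 1"] shift_inverse(1)[OF Eo, of 1] by simp
  moreover have "D \<in> Tc" using compact_ext[OF rotate[OF t(1)] X(1) SEc] .
  ultimately show ?thesis using extensionsI[OF t(1)] t(2,4) by blast
qed

text \<open>The compact parts that can be split off from a compact object of \<open>Q l\<close> in
  \<open>k\<close> steps. The class depends on \<open>l\<close> and \<open>k\<close> only, and is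
  made from generators in a bounded range of degrees by a bounded number of coproducts, extensions
  and summands; this is why a tower can be good for all of it at once.\<close>

fun XX where
  "XX l 0 = {Z. is_zero T Z}"
| "XX l (Suc k) = extensions T (Tc \<inter> gen_bar \<kappa> T \<G> A {- int A - l..int A - l}) (XX (l + 1) k)"

lemma XX_compact: "XX l k \<subseteq> Tc"
proof (induction k arbitrary: l)
  case 0 then show ?case using compact_zero by auto
next
  case (Suc k) then show ?case using compact_ext unfolding XX.simps extensions_def by blast
qed

lemma compact_approximation_deep:
  "X \<in> Tc \<Longrightarrow> X \<in> Q l \<Longrightarrow> X \<in> extensions T (XX l k) (Tc \<inter> Q (l + int k))"
proof (induction k arbitrary: l X)
  case 0
  obtain O' where O': "is_zero T O'" using zero_object by blast
  show ?case using extensionsI[OF triangle_zero_left[OF O' compact_obj[OF 0(1)]]] O' 0 by simp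
next
  case (Suc k)
  define B where "B = Tc \<inter> gen_bar \<kappa> T \<G> A {- int A - l..int A - l}"
  have "Tc \<inter> Q (l + 1) \<subseteq> extensions T (XX (l + 1) k) (Tc \<inter> Q (l + 1 + int k))" using Suc.IH by blast
  then have "X \<in> extensions T B (extensions T (XX (l + 1) k) (Tc \<inter> Q (l + 1 + int k)))"
    using compact_approximation[OF Suc.prems] extensions_mono[OF subset_refl] unfolding B_def by blast
  then have "X \<in> extensions T (extensions T B (XX (l + 1) k)) (Tc \<inter> Q (l + 1 + int k))" by (rule extensions_assoc2)
  then show ?case by (simp add: B_def algebra_simps)
qed

text \<open>The part split off in layer \<open>l + j\<close>, for \<open>j < k\<close>, uses the
  degrees from \<open>- int A - l - j\<close> to \<open>int A - l - j\<close>; the interval contains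
  them all.\<close>

lemma XX_hz: "E \<in> XX l k \<Longrightarrow> van {- int A - l - int k + 1..int A - l} Z \<Longrightarrow> hz E Z"
proof (induction k arbitrary: l E)
  case 0 then show ?case using is_zeroD(1) van_obj by auto
next
  case (Suc k)
  then obtain B C f g h where t: "B \<in> gen_bar \<kappa> T \<G> A {- int A - l..int A - l}" "C \<in> XX (l + 1) k" "triangle T B E C f g h"
    unfolding XX.simps extensions_def by blast
  have "hz B Z" using gen_bar_hz[OF t(1) van_mono[OF Suc.prems(2)]] by auto
  moreover have "hz C Z" using Suc.IH[OF t(2) van_mono[OF Suc.prems(2)]] by auto
  ultimately show ?case using ext_hz_contra[OF t(3)] by blast
qed

text \<open>A compact object has no arrows to a deep enough remainder \<open>D\<close>, hence is a
  retract of its own approximant, which uses only degrees up to \<open>int A - l\<close>. Together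
  with \<open>RR_Q\<close> this compares the two metrics on compact objects up to a loss of
  \<open>A\<close>.\<close>

lemma compact_RR:
  assumes X: "X \<in> Tc" "X \<in> Q l"
  shows "X \<in> RR (l - int A)"
proof -
  obtain m where m: "m \<ge> l" "\<forall>Y\<in>Q m. hz X Y" using metric_like_orth[OF Q_metric X(1)] by blast
  obtain E D f g h where t: "E \<in> XX l (nat (m - l))" "D \<in> Q m" "triangle T E X D f g h"
    using compact_approximation_deep[OF X, of "nat (m - l)"] m(1) unfolding extensions_def by auto
  have "g = zer X D" using hzD triangle_Hom(2)[OF t(3)] m(2) t(2) by blast
  then have r: "retract X E" using split_retract[OF t(3)] by blast
  have "hz X Z" if v: "van {..- (l - int A)} Z" for Z
    using hz_retract_left[OF r XX_hz[OF t(1) van_mono[OF v]]] by auto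
  then show ?thesis using compact_obj[OF X(1)] unfolding RR_iff by blast
qed

lemma compact_in_Q:
  assumes P: "P \<in> Tc"
  shows "\<exists>l. P \<in> Q l"
proof -
  obtain S where S: "S \<in> coprod T (\<Union>n. \<G> n)" "retract P S" using compact_gen[OF P] by blast
  have "\<exists>l. S \<in> Q l" using S(1)
  proof induction
    case (base X)
    then obtain j where "X \<in> \<G> j" by blast
    then have "X \<in> gen_M T \<G> (- j - int A + int A)" unfolding gen_M_def using G_gen_on by auto
    then show ?case using q1 by blast
  next
    case (zero Z) then show ?case using Q_zero by blast
  next
    case (sum X Y S)
    then obtain a b where "X \<in> Q a" "Y \<in> Q b" by blast
    then show ?case using Q_sum[OF sum(3)] Q_dec[of "min a b" a] Q_dec[of "min a b" b]
      by (meson min.cobounded1 min.cobounded2 subsetD)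
  next
    case (ext A C B f g h)
    then obtain a b where "A \<in> Q a" "C \<in> Q b" by blast
    then show ?case using Q_ext[OF ext(3)] Q_dec[of "min a b" a] Q_dec[of "min a b" b]
      by (meson min.cobounded1 min.cobounded2 subsetD)
  qed
  then show ?thesis using Q_retract[OF S(2)] by blast
qed

text \<open>After \<open>m - l\<close> steps the approximant involves no degree below
  \<open>- int A - m + 1\<close>, which is \<open>a\<close> for the chosen \<open>m\<close>. So it
  has no arrows to \<open>B\<close>, and \<open>B\<close> is a retract of the remainder.\<close>

lemma van_compact_Q:
  assumes B: "B \<in> Tc" and v: "van {a..} B"
  shows "B \<in> Q (1 - int A - a)"
proof -
  define m where "m = 1 - int A - a"
  obtain l where l: "B \<in> Q l" using compact_in_Q[OF B] by blast
  show ?thesis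
  proof (cases "l \<ge> m")
    case True then show ?thesis using Q_dec[OF True] l unfolding m_def by blast
  next
    case False
    obtain E D f g h where t: "E \<in> XX l (nat (m - l))" "D \<in> Q (l + int (nat (m - l)))" "triangle T E B D f g h"
      using compact_approximation_deep[OF B l, of "nat (m - l)"] unfolding extensions_def by blast
    have "hz E B" using False by (intro XX_hz[OF t(1) van_mono[OF v]]) (auto simp: m_def)
    then have "f = zer E B" using hzD triangle_Hom(1)[OF t(3)] by blast
    then have "retract B D" using split_retract2[OF t(3)] by blast
    then show ?thesis using Q_retract t(2) False by (simp add: m_def)
  qed
qed

text \<open>The same count with \<open>F\<close> as target: the approximant of \<open>P\<close> has
  no arrows to \<open>F\<close>, so \<open>f\<close> factors through the remainder. Only
  \<open>P\<close> is approximated, never \<open>F\<close>.\<close>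

lemma factor_through_Q:
  assumes P: "P \<in> Tc" and f: "f \<in> Hom T P F" and v: "van {N..} F"
  shows "\<exists>X\<in>Tc \<inter> Q (1 - int A - N). \<exists>a\<in>Hom T P X. \<exists>b\<in>Hom T X F. b \<cdot> a = f"
proof -
  define m where "m = 1 - int A - N"
  obtain l where l: "P \<in> Q l" using compact_in_Q[OF P] by blast
  show ?thesis
  proof (cases "l \<ge> m")
    case True
    then have "P \<in> Tc \<inter> Q m" using Q_dec[OF True] l P by blast
    then show ?thesis using ide[OF compact_obj[OF P]] f comp_ide[OF f] unfolding m_def by blast
  next
    case False
    obtain E D i g h where t: "E \<in> XX l (nat (m - l))" "D \<in> Tc \<inter> Q (l + int (nat (m - l)))" "triangle T E P D i g h"
      using compact_approximation_deep[OF P l, of "nat (m - l)"] unfolding extensions_def by blast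
    have "hz E F" using False by (intro XX_hz[OF t(1) van_mono[OF v]]) (auto simp: m_def)
    then have "f \<cdot> i = zer E F" using hzD comp_closed[OF triangle_Hom(1)[OF t(3)] f] by blast
    then obtain b where "b \<in> Hom T D F" "b \<cdot> g = f" using exact_contra[OF t(3) f] by blast
    moreover have "D \<in> Tc \<inter> Q (1 - int A - N)" using t(2) False by (simp add: m_def)
    ultimately show ?thesis using triangle_Hom(2)[OF t(3)] by blast
  qed
qed

text \<open>By finite direct sums, the shift in condition (0) of quasiapproximability can be chosen uniformly.\<close>

lemma RR_shift_step: "\<exists>s. \<forall>X\<in>RR i. sh s X \<in> RR (i + 1)"
proof -
  have "\<exists>n\<in>{- int A..int A}. \<forall>j\<le>- i. \<forall>G\<in>\<G> j. \<forall>t. van {..- (i + 1)} t \<longrightarrow> hz (sh (- n) G) t"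
  proof (rule ccontr)
    assume "\<not> ?thesis"
    \<comment> \<open>One counterexample for each of the finitely many shifts. An object
      \<open>S\<close> of which all of them are retracts still lies in
      \<open>gen_M T \<G> i\<close>; condition (0) moves it by a single \<open>n\<close>, which
      contradicts the counterexample for that \<open>n\<close>.\<close>
    then have "\<forall>n\<in>{- int A..int A}. \<exists>j G t. j \<le> - i \<and> G \<in> \<G> j \<and> van {..- (i + 1)} t \<and> \<not> hz (sh (- n) G) t" by blast
    then obtain j G t where c: "\<And>n. n \<in> {- int A..int A} \<Longrightarrow>
      j n \<le> - i \<and> G n \<in> \<G> (j n) \<and> van {..- (i + 1)} (t n) \<and> \<not> hz (sh (- n) (G n)) (t n)" by metis
    have U: "(\<Union>j\<in>{..- i}. \<G> j) \<subseteq> obj T" using G_obj by blast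
    have "G n \<in> coprod T (\<Union>j\<in>{..- i}. \<G> j)" if "n \<in> {- int A..int A}" for n
      using c[OF that] by (intro coprod.base) auto
    then obtain S where S: "S \<in> coprod T (\<Union>j\<in>{..- i}. \<G> j)" "\<forall>X\<in>G ` {- int A..int A}. retract X S"
      using coprod_common_retract[of "G ` {- int A..int A}", OF _ _ U] by blast
    have "S \<in> gen_M T \<G> i" unfolding gen_M_def using gen_on_coprod[OF S(1)] .
    then obtain n M where n: "n \<in> {- int A..int A}" "M \<in> gen_M T \<G> (i + 1)" "S = sh n M" using q0 by blast
    have Mo: "M \<in> obj T" using n(2) unfolding gen_M_def gen_on_def smd_def by blast
    have "hz M (t n)" using van_gen_on[of "{..- (i + 1)}" "t n" M] c[OF n(1)] n(2) unfolding gen_M_def by blast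
    moreover have "retract (sh (- n) (G n)) M"
      using retract_shift[of "G n" S "- n"] S(2) n(1,3) shift_inverse(1)[OF Mo] by auto
    ultimately show False using hz_retract_left c[OF n(1)] by blast
  qed
  then obtain n where n: "\<And>j G t. j \<le> - i \<Longrightarrow> G \<in> \<G> j \<Longrightarrow> van {..- (i + 1)} t \<Longrightarrow> hz (sh (- n) G) t" by blast
  have "sh (- n) X \<in> RR (i + 1)" if X: "X \<in> RR i" for X
  proof -
    have Xo: "X \<in> obj T" and h: "\<And>Z. van {..- i} Z \<Longrightarrow> hz X Z" using X by (auto simp: RR_iff)
    have "hz (sh (- n) X) t" if t: "van {..- (i + 1)} t" for t
    proof -
      have "van {..- i} (sh n t)"
        unfolding van_def using n[OF _ _ t] hz_shift_left[OF G_obj van_obj[OF t], of _ _ "- n"] shift_obj[OF van_obj[OF t]] by auto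
      then show ?thesis using h hz_shift_left[OF Xo van_obj[OF t], of "- n"] by simp
    qed
    then show ?thesis using shift_obj[OF Xo] by (simp add: RR_iff)
  qed
  then show ?thesis by blast
qed

lemma RR_shift_deep: "\<exists>s. \<forall>X\<in>RR i. sh s X \<in> RR n"
proof (cases "n \<ge> i")
  case True
  then show ?thesis
  proof (induction n rule: int_ge_induct)
    case base then show ?case by (intro exI[of _ 0]) simp
  next
    case (step n)
    then obtain s where s: "\<forall>X\<in>RR i. sh s X \<in> RR n" by blast
    obtain s' where s': "\<forall>X\<in>RR n. sh s' X \<in> RR (n + 1)" using RR_shift_step by blast
    have "sh (s' + s) X \<in> RR (n + 1)" if "X \<in> RR i" for X
      using s s' that shift_add metric_like_obj[OF RR_metric that] by simp
    then show ?case by blast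
  qed
next
  case False
  then have "RR i \<subseteq> RR n" using metric_like_dec[OF RR_metric, of n i] by simp
  then show ?thesis by (intro exI[of _ 0]) auto
qed

end

section \<open>Finite hocolims lie in the closure of the compacts\<close>

context R_linear_triangulated_category
begin

text \<open>In the situation below, \<open>e\<close> is an idempotent up to identifying \<open>Hom(P, E)\<close> with \<open>Hom(P, X)\<close>, with image
  \<open>Hom(P, F)\<close>; the cone of \<open>i - e\<close> then computes \<open>F \<oplus> \<Sigma>F\<close>.\<close>

definition splits where
  "splits i e \<pi> E X F P \<longleftrightarrow>
     (\<forall>w\<in>Hom T P X. \<exists>v\<in>Hom T P E. i \<cdot> v = w) \<and>
     (\<forall>v\<in>Hom T P E. i \<cdot> v = zer P X \<longrightarrow> v = zer P E) \<and>
     (\<forall>v\<in>Hom T P E. \<pi> \<cdot> (i \<cdot> v) = zer P F \<longrightarrow> e \<cdot> v = zer P X) \<and>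
     (\<forall>x\<in>Hom T P F. \<exists>v\<in>Hom T P E. i \<cdot> v = e \<cdot> v \<and> \<pi> \<cdot> (i \<cdot> v) = x)"

text \<open>\<open>Hom(\<Sigma>P, L)\<close> has the cokernel of \<open>i - e\<close> at
  \<open>\<Sigma>P\<close> as a subgroup, read off by \<open>l\<close>, and the kernel at
  \<open>P\<close> as the quotient, read off by \<open>m\<close>. Both are copies of the
  corresponding group of arrows to \<open>F\<close> or \<open>\<Sigma>F\<close>, so the pair
  \<open>(l, m)\<close> is bijective on arrows from \<open>\<Sigma>P\<close>.\<close>

lemma cone_of_idempotent:
  assumes i: "i \<in> Hom T E X" and e: "e \<in> Hom T E X" and \<pi>: "\<pi> \<in> Hom T X F" "\<pi> \<cdot> e = \<pi> \<cdot> i"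
    and t: "triangle T E X L (i \<boxminus> e) c \<delta>"
  obtains l m where "l \<in> Hom T L F" "m \<in> Hom T L (susp T F)"
    "\<And>P x z. P \<in> obj T \<Longrightarrow> splits i e \<pi> E X F P \<Longrightarrow> splits i e \<pi> E X F (susp T P) \<Longrightarrow>
      x \<in> Hom T (susp T P) F \<Longrightarrow> z \<in> Hom T (susp T P) (susp T F) \<Longrightarrow>
      \<exists>y\<in>Hom T (susp T P) L. l \<cdot> y = x \<and> m \<cdot> y = z"
    "\<And>P y. P \<in> obj T \<Longrightarrow> splits i e \<pi> E X F P \<Longrightarrow> splits i e \<pi> E X F (susp T P) \<Longrightarrow> y \<in> Hom T (susp T P) L \<Longrightarrow>
      l \<cdot> y = zer (susp T P) F \<Longrightarrow> m \<cdot> y = zer (susp T P) (susp T F) \<Longrightarrow> y = zer (susp T P) L"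
proof -
  define a where "a = i \<boxminus> e"
  have t: "triangle T E X L a c \<delta>" using t unfolding a_def .
  note H = triangle_Hom[OF t] and o = triangle_obj[OF t]
  note \<pi>i = comp_closed[OF i \<pi>(1)]
  have F: "F \<in> obj T" using Hom_obj[OF \<pi>(1)] by blast
  have av: "a \<cdot> v = i \<cdot> v \<boxminus> e \<cdot> v" if "v \<in> Hom T P E" for P v unfolding a_def using comp_sub_left[OF that i e] .
  have "\<pi> \<cdot> a = zer E F"
    unfolding a_def using comp_sub_right[OF i e \<pi>(1)] \<pi>(2) sub_eq_zer_iff[OF \<pi>i \<pi>i] by simp
  then obtain l where l: "l \<in> Hom T L F" "l \<cdot> c = \<pi>" using exact_contra[OF t \<pi>(1)] by blast
  define m where "m = susp_arr T (\<pi> \<cdot> i) \<cdot> \<delta>"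
  note S\<pi>i = susp_Hom[OF \<pi>i]
  have m: "m \<in> Hom T L (susp T F)" unfolding m_def using comp_closed[OF H(3) S\<pi>i] .
  have mc: "m \<cdot> c = zer X (susp T F)"
    unfolding m_def using comp_assoc[OF H(2,3) S\<pi>i] triangle_zero2[OF t] comp_zer_right[OF o(2) S\<pi>i] by simp
  have 1: "\<exists>y\<in>Hom T (susp T P) L. l \<cdot> y = x \<and> m \<cdot> y = z"
    if sp: "splits i e \<pi> E X F P" "splits i e \<pi> E X F (susp T P)"
      and x: "x \<in> Hom T (susp T P) F" and z: "z \<in> Hom T (susp T P) (susp T F)" and P: "P \<in> obj T" for P x z
  proof -
    obtain z0 where z0: "z0 \<in> Hom T P F" "susp_arr T z0 = z" using desusp_Hom[OF P F z] by blast
    obtain v where v: "v \<in> Hom T P E" "i \<cdot> v = e \<cdot> v" "\<pi> \<cdot> (i \<cdot> v) = z0" using sp(1) z0(1) unfolding splits_def by blast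
    have "a \<cdot> v = zer P X" using av[OF v(1)] v(2) sub_eq_zer_iff comp_closed[OF v(1) e] by simp
    then have "susp_arr T a \<cdot> susp_arr T v = zer (susp T P) (susp T X)"
      using susp_comp[OF v(1) H(1)] susp_zer[OF P o(2)] by simp
    then obtain y0 where y0: "y0 \<in> Hom T (susp T P) L" "\<delta> \<cdot> y0 = susp_arr T v"
      using exact_cov3[OF t susp_Hom[OF v(1)]] by blast
    have my0: "m \<cdot> y0 = z"
      unfolding m_def using comp_assoc[OF y0(1) H(3) S\<pi>i] y0(2) susp_comp[OF v(1) \<pi>i] comp_assoc[OF v(1) i \<pi>(1)] v(3) z0(2) by simp
    note ly0 = comp_closed[OF y0(1) l(1)]
    obtain v' where v': "v' \<in> Hom T (susp T P) E" "\<pi> \<cdot> (i \<cdot> v') = x \<boxminus> l \<cdot> y0"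
      using sp(2) sub_Hom[OF x ly0] unfolding splits_def by blast
    note iv' = comp_closed[OF v'(1) i]
    note civ' = comp_closed[OF iv' H(2)]
    have "l \<cdot> (c \<cdot> (i \<cdot> v') \<boxplus> y0) = x"
      using comp_add_right[OF civ' y0(1) l(1)] comp_assoc[OF iv' H(2) l(1)] l(2) v'(2) sub_add[OF x ly0] by simp
    moreover have "m \<cdot> (c \<cdot> (i \<cdot> v') \<boxplus> y0) = z"
      using comp_add_right[OF civ' y0(1) m] comp_assoc[OF iv' H(2) m] mc comp_zer_left[OF susp_obj[OF F] iv'] my0 add_zer(2)[OF z] by simp
    ultimately show ?thesis using add_Hom[OF civ' y0(1)] by blast
  qed
  have 2: "y = zer (susp T P) L"
    if sp: "splits i e \<pi> E X F P" "splits i e \<pi> E X F (susp T P)" and y: "y \<in> Hom T (susp T P) L"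
      "l \<cdot> y = zer (susp T P) F" "m \<cdot> y = zer (susp T P) (susp T F)" and P: "P \<in> obj T" for P y
  proof -
    obtain v where v: "v \<in> Hom T P E" "susp_arr T v = \<delta> \<cdot> y" using desusp_Hom[OF P o(1) comp_closed[OF y(1) H(3)]] by blast
    have "susp_arr T (\<pi> \<cdot> (i \<cdot> v)) = m \<cdot> y"
      unfolding m_def using comp_assoc[OF y(1) H(3) S\<pi>i] v(2) susp_comp[OF v(1) \<pi>i] comp_assoc[OF v(1) i \<pi>(1)] by simp
    then have "\<pi> \<cdot> (i \<cdot> v) = zer P F" using y(3) susp_eq_zer[OF comp_closed[OF comp_closed[OF v(1) i] \<pi>(1)]] by simp
    then have ev: "e \<cdot> v = zer P X" using sp(1) v(1) unfolding splits_def by blast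
    have "susp_arr T (a \<cdot> v) = zer (susp T P) (susp T X)"
      using susp_comp[OF v(1) H(1)] v(2) comp_assoc[OF y(1) H(3) susp_Hom[OF H(1)]] triangle_zero3[OF t]
        comp_zer_left[OF susp_obj[OF o(2)] y(1)] by simp
    then have "a \<cdot> v = zer P X" using susp_eq_zer[OF comp_closed[OF v(1) H(1)]] by blast
    then have "i \<cdot> v = zer P X" using av[OF v(1)] ev sub_zer[OF comp_closed[OF v(1) i]] by simp
    then have "v = zer P E" using sp(1) v(1) unfolding splits_def by blast
    then have "\<delta> \<cdot> y = zer (susp T P) (susp T E)" using v(2) susp_zer[OF P o(1)] by simp
    then obtain w where w: "w \<in> Hom T (susp T P) X" "c \<cdot> w = y" using exact_cov2[OF t y(1)] by blast
    obtain v' where v': "v' \<in> Hom T (susp T P) E" "i \<cdot> v' = w" using sp(2) w(1) unfolding splits_def by blast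
    have "\<pi> \<cdot> w = zer (susp T P) F" using l(2) comp_assoc[OF w(1) H(2) l(1)] w(2) y(2) by simp
    then have "e \<cdot> v' = zer (susp T P) X" using sp(2) v' unfolding splits_def by blast
    then have "a \<cdot> v' = w" using av[OF v'(1)] v'(2) sub_zer[OF w(1)] by simp
    then have "y = (c \<cdot> a) \<cdot> v'" using w(2) comp_assoc[OF v'(1) H(1,2)] by simp
    then show ?thesis using triangle_zero1[OF t] comp_zer_left[OF o(3) v'(1)] by simp
  qed
  show ?thesis using that[OF l(1) m] 1 2 by blast
qed

end

section \<open>Approximating \<open>F \<oplus> \<Sigma>F\<close> by compact objects\<close>

locale quasi_hocolim = quasi R T \<kappa> \<G> Q A + tower R T "obj T" "yoneda T F" L \<tau> u
  for R :: "('r, 'a) ring_scheme" and T :: "('o, 'm, 'r, 'e) tri_category_scheme" (structure)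
    and \<kappa> :: "'u rel" and \<G> Q A F L \<tau> u +
  fixes N :: int
  assumes hoc: "hocolim \<kappa> L \<tau> F u" and L_compact: "L k \<in> compacts \<kappa> T"
    and good_single: "P \<in> compacts \<kappa> T \<Longrightarrow> good {P}" and van_F: "van {N..} F"
begin

lemma F_obj: "F \<in> obj T"
  using van_obj[OF van_F] .

lemma u: "u k \<in> Hom T (L k) F" "u (Suc k) \<cdot> \<tau> k = u k"
  using hocolim_cocone[OF hoc] by blast+

lemma u_tr: "u (i + n) \<cdot> tr i n = u i"
  using cocone_trans[where \<tau> = \<tau>, OF \<tau>, OF u] .

text \<open>Here uniformity is decisive: the lifts of the components all land in the same
  \<open>L (i + n)\<close>, so they assemble to one arrow from the coproduct; likewise all
  components die after the same number of steps.\<close>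

lemma good_Coprod1:
  assumes g: "good \<S>"
  shows "good (Coprod1 \<kappa> T \<S>)"
proof (rule goodI)
  show "Coprod1 \<kappa> T \<S> \<subseteq> obj T" unfolding Coprod1_def using coproduct_obj by blast
  fix s i
  obtain n where n: "\<And>Z. Z \<in> \<S> \<Longrightarrow> lifts s (i + n) Z" "\<And>Z. Z \<in> \<S> \<Longrightarrow> dies s i n Z" using goodD[OF g] by metis
  have "lifts s (i + n) S \<and> dies s i n S" if "S \<in> Coprod1 \<kappa> T \<S>" for S
  proof -
    obtain I :: "'u set" and X \<iota> where X: "\<And>i. i \<in> I \<Longrightarrow> X i \<in> \<S>" "is_coproduct T I X S \<iota>"
      using \<open>S \<in> Coprod1 \<kappa> T \<S>\<close> unfolding Coprod1_def by blast
    note cp = shift_coproduct[OF X(2), of s]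
    note \<iota> = coproduct_Hom[OF cp]
    have o: "L k \<in> obj T" for k using L_U .
    have "lifts s (i + n) S" unfolding lifts_def
    proof
      fix x assume "x \<in> HH (sh s S)"
      then have x: "x \<in> Hom T (sh s S) F" by simp
      have "\<exists>g\<in>Hom T (sh s (X j)) (L (i + n)). u (i + n) \<cdot> g = x \<cdot> sha s (\<iota> j)" if j: "j \<in> I" for j
        using n(1)[OF X(1)[OF j]] comp_closed[OF \<iota>[OF j] x] unfolding lifts_def by simp
      then obtain g where gg: "\<And>j. j \<in> I \<Longrightarrow> g j \<in> Hom T (sh s (X j)) (L (i + n)) \<and> u (i + n) \<cdot> g j = x \<cdot> sha s (\<iota> j)" by metis
      obtain h where h: "h \<in> Hom T (sh s S) (L (i + n))" "\<And>j. j \<in> I \<Longrightarrow> h \<cdot> sha s (\<iota> j) = g j"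
        using coproduct_ex[OF cp o, of g] gg by blast
      have "u (i + n) \<cdot> h = x"
      proof (rule coproduct_eq[OF cp comp_closed[OF h(1) u(1)] x])
        fix j assume j: "j \<in> I"
        show "(u (i + n) \<cdot> h) \<cdot> sha s (\<iota> j) = x \<cdot> sha s (\<iota> j)"
          using comp_assoc[OF \<iota>[OF j] h(1) u(1)] h(2)[OF j] gg[OF j] by simp
      qed
      then show "\<exists>g\<in>Hom T (sh s S) (L (i + n)). on_arr (yoneda T F) g (u (i + n)) = x" using h(1) by auto
    qed
    moreover have "dies s i n S" unfolding dies_def
    proof (intro ballI impI)
      fix g assume g: "g \<in> Hom T (sh s S) (L i)" "on_arr (yoneda T F) g (u i) = Hz (sh s S)"
      note tg = comp_closed[OF g(1) tr_Hom]
      have so: "sh s S \<in> obj T" using Hom_obj[OF g(1)] by blast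
      show "tr i n \<cdot> g = zer (sh s S) (L (i + n))"
      proof (rule coproduct_eq[OF cp tg zer_Hom[OF so o]])
        fix j assume j: "j \<in> I"
        have "u i \<cdot> (g \<cdot> sha s (\<iota> j)) = zer (sh s (X j)) F"
          using comp_assoc[OF \<iota>[OF j] g(1) u(1)] g(2) comp_zer_left[OF F_obj \<iota>[OF j]] by simp
        then have "tr i n \<cdot> (g \<cdot> sha s (\<iota> j)) = zer (sh s (X j)) (L (i + n))"
          using n(2)[OF X(1)[OF j]] comp_closed[OF \<iota>[OF j] g(1)] unfolding dies_def by simp
        then show "(tr i n \<cdot> g) \<cdot> sha s (\<iota> j) = zer (sh s S) (L (i + n)) \<cdot> sha s (\<iota> j)"
          using comp_assoc[OF \<iota>[OF j] g(1) tr_Hom] comp_zer_left[OF o \<iota>[OF j]] by simp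
      qed
    qed
    ultimately show ?thesis by blast
  qed
  then show "\<exists>p n. \<forall>Z\<in>Coprod1 \<kappa> T \<S>. lifts s p Z \<and> dies s i n Z" by blast
qed

lemma good_Coprod: "good \<S> \<Longrightarrow> good (Coprod \<kappa> T (Suc m) \<S>)"
proof (induction m)
  case 0 then show ?case using good_Coprod1 by simp
next
  case (Suc m)
  have "Coprod \<kappa> T (Suc (Suc m)) \<S> \<subseteq> obj T" using extensions_obj by auto
  then show ?case using good_extension[OF good_Coprod1 Suc.IH] Suc.prems by simp
qed

lemma good_gens: "finite J \<Longrightarrow> good (\<Union>j\<in>J. \<G> j)"
  using good_finite[of "\<Union>j\<in>J. \<G> j"] finG good_single G_compact by blast

lemma good_gen_bar:
  assumes "finite J"
  shows "good (gen_bar \<kappa> T \<G> A J)"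
proof -
  have "good (Coprod \<kappa> T A (\<Union>j\<in>J. \<G> j))" using good_Coprod[OF good_gens[OF assms], of "A - 1"] A_pos by simp
  moreover have "gen_bar \<kappa> T \<G> A J \<subseteq> obj T" unfolding gen_bar_def smd_def by blast
  ultimately show ?thesis using good_retract[of _ "gen_bar \<kappa> T \<G> A J"] smd_retract unfolding gen_bar_def by blast
qed

lemma good_XX: "good (XX l k)"
proof (induction k arbitrary: l)
  case 0
  have "XX l 0 \<subseteq> obj T" using XX_compact Tc_obj by blast
  then show ?case by (intro good_zero) auto
next
  case (Suc k)
  have "XX l (Suc k) \<subseteq> obj T" using XX_compact Tc_obj by blast
  moreover have "good (Tc \<inter> gen_bar \<kappa> T \<G> A {- int A - l..int A - l})"
    using good_subset[OF good_gen_bar[of "{- int A - l..int A - l}"]] by auto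
  ultimately show ?case using good_extension[OF _ Suc.IH[of "l + 1"]] by simp
qed

lemma van_shift_iterate:
  assumes "van {a..} Z"
  shows "van {a + \<bar>k\<bar>..} (sh k Z)"
proof (induction k rule: int_induct[where k = 0])
  case base then show ?case using assms by simp
next
  case (step1 i)
  have "a + \<bar>i + 1\<bar> = a + \<bar>i\<bar> + 1" using step1(1) by simp
  then show ?case using van_shift_up(1)[OF step1(2)] by (simp only: shift_succ[OF van_obj[OF assms]])
next
  case (step2 i)
  have "sh (i - 1) Z = sh (- 1) (sh i Z)" using shift_add[OF van_obj[OF assms], of "- 1" i] by simp
  moreover have "a + \<bar>i - 1\<bar> = a + \<bar>i\<bar> + 1" using step2(1) by simp
  ultimately show ?case using van_shift_up(2)[OF step2(2)] by (simp only:)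
qed

lemma van_hz_shift:
  assumes v: "van {a..} Z" and G: "G \<in> \<G> j" "j \<ge> a + \<bar>k\<bar>"
  shows "hz (sh (- k) G) Z"
proof -
  have "hz G (sh k Z)" using van_shift_iterate[OF v, of k] G unfolding van_def by auto
  then show ?thesis using hz_shift_left[OF G_obj[OF G(1)] van_obj[OF v], of "- k"] by simp
qed

text \<open>The layer that \<open>factor_through_Q\<close> supplies for the bound \<open>N\<close>
  of \<open>F\<close>.\<close>

definition l0 where "l0 = 1 - int A - N"

text \<open>Three consecutive shifts are provided because the cone is compared with
  \<open>F \<oplus> \<Sigma>F\<close> by injectivity at the shift \<open>- 1\<close> and
  surjectivity at the shift \<open>0\<close>, each of which also uses the shift just below. The
  layers of \<open>X\<close> and \<open>\<Sigma>E\<close> do not depend on \<open>n\<close>.\<close>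

lemma split_data:
  obtains E X i e \<pi> where "E \<in> Tc" "X \<in> Tc" "i \<in> Hom T E X" "e \<in> Hom T E X" "\<pi> \<in> Hom T X F" "\<pi> \<cdot> e = \<pi> \<cdot> i"
    "X \<in> Q l0" "susp T E \<in> Q (l0 - 1)"
    "\<And>s G j. s \<in> {- 2, - 1, 0} \<Longrightarrow> j \<ge> - n \<Longrightarrow> G \<in> \<G> j \<Longrightarrow> splits i e \<pi> E X F (sh s G)"
proof -
  \<comment> \<open>\<open>k\<close> is so large that the remainder \<open>D\<close> receives no
    arrows from degree \<open>- n\<close> on, and \<open>M\<close> so large that beyond it neither
    \<open>X\<close> nor \<open>F\<close> does; the constant \<open>2\<close> pays for the
    shifts.\<close>
  define k where "k = nat (n + int A + 2 - l0)"
  define M where "M = max (N + 2) (int A - l0 + 2)"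
  define \<Z> where "\<Z> = XX l0 k \<union> (\<Union>j\<in>{- n..M}. \<G> j)"
  have gZ: "good \<Z>" unfolding \<Z>_def using good_Un[OF good_XX good_gens] by simp
  have "\<exists>p0. \<forall>s\<in>{- 2, - 1, 0}. \<forall>Z\<in>\<Z>. lifts s p0 Z"
  proof -
    obtain n0 where 0: "\<And>Z. Z \<in> \<Z> \<Longrightarrow> lifts 0 (0 + n0) Z" using goodD[OF gZ] by metis
    obtain n1 where 1: "\<And>Z. Z \<in> \<Z> \<Longrightarrow> lifts (- 1) (0 + n1) Z" using goodD[OF gZ] by metis
    obtain n2 where 2: "\<And>Z. Z \<in> \<Z> \<Longrightarrow> lifts (- 2) (0 + n2) Z" using goodD[OF gZ] by metis
    have "Z \<in> obj T" if "Z \<in> \<Z>" for Z using that gZ unfolding good_def by blast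
    then have "lifts s (max n0 (max n1 n2)) Z" if "s \<in> {- 2, - 1, 0}" "Z \<in> \<Z>" for s Z
      using that lifts_mono[OF 0] lifts_mono[OF 1] lifts_mono[OF 2] by auto
    then show ?thesis by blast
  qed
  then obtain p where p: "\<And>s Z. s \<in> {- 2, - 1, 0} \<Longrightarrow> Z \<in> \<Z> \<Longrightarrow> lifts s p Z" by blast
  have "\<exists>m. \<forall>s\<in>{- 2, - 1, 0}. \<forall>Z\<in>\<Z>. dies s p m Z"
  proof -
    obtain n0 where 0: "\<And>Z. Z \<in> \<Z> \<Longrightarrow> dies 0 p n0 Z" using goodD[OF gZ] by metis
    obtain n1 where 1: "\<And>Z. Z \<in> \<Z> \<Longrightarrow> dies (- 1) p n1 Z" using goodD[OF gZ] by metis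
    obtain n2 where 2: "\<And>Z. Z \<in> \<Z> \<Longrightarrow> dies (- 2) p n2 Z" using goodD[OF gZ] by metis
    have "dies s p (max n0 (max n1 n2)) Z" if "s \<in> {- 2, - 1, 0}" "Z \<in> \<Z>" for s Z
      using that dies_mono[OF 0] dies_mono[OF 1] dies_mono[OF 2] by auto
    then show ?thesis by blast
  qed
  then obtain m where m: "\<And>s Z. s \<in> {- 2, - 1, 0} \<Longrightarrow> Z \<in> \<Z> \<Longrightarrow> dies s p m Z" by blast
  \<comment> \<open>Only now is \<open>X\<close> chosen, for the later stage \<open>p + m\<close>.
    The passage from \<open>p\<close> to \<open>p + m\<close> inside \<open>q\<close> annihilates
    whatever \<open>u p\<close> annihilates on the test objects.\<close>
  obtain X a \<pi> where X: "X \<in> Tc" "X \<in> Q l0" "a \<in> Hom T (L (p + m)) X" "\<pi> \<in> Hom T X F" "\<pi> \<cdot> a = u (p + m)"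
    using factor_through_Q[OF L_compact u(1) van_F] unfolding l0_def by blast
  define q where "q = a \<cdot> tr p m"
  have q: "q \<in> Hom T (L p) X" unfolding q_def using comp_closed[OF tr_Hom X(3)] .
  have \<pi>q: "\<pi> \<cdot> q = u p" unfolding q_def using comp_assoc[OF tr_Hom X(3,4)] X(5) u_tr by simp
  have lift: "\<exists>g\<in>Hom T (sh s Z) (L p). u p \<cdot> g = x"
    if "s \<in> {- 2, - 1, 0}" "Z \<in> \<Z>" "x \<in> Hom T (sh s Z) F" for s Z x
    using p[OF that(1,2)] that(3) unfolding lifts_def by simp
  have kill: "q \<cdot> g = zer (sh s Z) X"
    if "s \<in> {- 2, - 1, 0}" "Z \<in> \<Z>" "g \<in> Hom T (sh s Z) (L p)" "u p \<cdot> g = zer (sh s Z) F" for s Z g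
  proof -
    have "tr p m \<cdot> g = zer (sh s Z) (L (p + m))" using m[OF that(1,2)] that(3,4) unfolding dies_def by simp
    then show ?thesis unfolding q_def using comp_assoc[OF that(3) tr_Hom X(3)] comp_zer_right[OF _ X(3)] Hom_obj[OF that(3)] by simp
  qed
  obtain E D i h k' where E: "E \<in> XX l0 k" "D \<in> Tc" "D \<in> Q (l0 + int k)" "triangle T E X D i h k'"
    using compact_approximation_deep[OF X(1,2), of k] unfolding extensions_def by blast
  note H = triangle_Hom[OF E(4)]
  \<comment> \<open>\<open>E\<close> belongs to the class for which \<open>p\<close> was chosen, so
    \<open>\<pi> \<cdot> i\<close> lifts to that very stage.\<close>
  have EZ: "E \<in> \<Z>" unfolding \<Z>_def using E(1) by blast
  have Ec: "E \<in> Tc" using XX_compact E(1) by blast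
  note \<pi>i = comp_closed[OF H(1) X(4)]
  obtain sE where sE: "sE \<in> Hom T E (L p)" "u p \<cdot> sE = \<pi> \<cdot> i" using lift[of 0 E "\<pi> \<cdot> i"] EZ \<pi>i by auto
  \<comment> \<open>\<open>e\<close> agrees with \<open>i\<close> after \<open>\<pi>\<close>. As it
    passes through the stage \<open>p\<close>, it kills, on the generators in range, everything that
    \<open>\<pi> \<cdot> i\<close> kills.\<close>
  define e where "e = q \<cdot> sE"
  have e: "e \<in> Hom T E X" unfolding e_def using comp_closed[OF sE(1) q] .
  have \<pi>e: "\<pi> \<cdot> e = \<pi> \<cdot> i" unfolding e_def using comp_assoc[OF sE(1) q X(4)] \<pi>q sE(2) by simp
  have D_van: "van {int A - (l0 + int k)..} D" using Q_van[OF E(3)] .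
  have dk: "int A - (l0 + int k) + 2 \<le> - n" unfolding k_def by simp
  have sp: "splits i e \<pi> E X F (sh s G)" if s: "s \<in> {- 2, - 1, 0}" and j: "j \<ge> - n" and G: "G \<in> \<G> j" for s G j
  proof -
    define P where "P = sh s G"
    have P: "P \<in> obj T" unfolding P_def using shift_obj[OF G_obj[OF G]] .
    have D0: "hz P D" unfolding P_def using van_hz_shift[OF D_van G, of "- s"] s j dk by auto
    have "hz (sh (- (- (s + 1))) G) D" using s j dk by (intro van_hz_shift[OF D_van G]) auto
    then have "hz (sh (s + 1) G) D" by (simp only: minus_minus)
    then have D1: "hz (susp T P) D" unfolding P_def using shift_succ[OF G_obj[OF G], of s] by simp
    have g1: "\<exists>v\<in>Hom T P E. i \<cdot> v = w" if w: "w \<in> Hom T P X" for w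
      using exact_cov[OF E(4) w] hzD[OF D0 comp_closed[OF w H(2)]] by blast
    have g1': "v = zer P E" if v: "v \<in> Hom T P E" "i \<cdot> v = zer P X" for v
    proof -
      obtain x' where x': "x' \<in> Hom T (susp T P) D" "k' \<cdot> x' = susp_arr T v" using exact_cov0[OF E(4) v] by blast
      then have "susp_arr T v = zer (susp T P) (susp T E)"
        using hzD[OF D1 x'(1)] comp_zer_right[OF susp_obj[OF P] H(3)] by simp
      then show ?thesis using susp_eq_zer[OF v(1)] by blast
    qed
    show ?thesis
    \<comment> \<open>Generators of degree up to \<open>M\<close> are test objects of the tower;
      beyond \<open>M\<close> both \<open>Hom(P, X)\<close> and \<open>Hom(P, F)\<close>
      vanish.\<close>
    proof (cases "j \<le> M")
      case True
      then have GZ: "G \<in> \<Z>" unfolding \<Z>_def using j G by auto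
      have g2: "e \<cdot> v = zer P X" if v: "v \<in> Hom T P E" "\<pi> \<cdot> (i \<cdot> v) = zer P F" for v
      proof -
        have "u p \<cdot> (sE \<cdot> v) = zer P F" using comp_assoc[OF v(1) sE(1) u(1)] sE(2) comp_assoc[OF v(1) H(1) X(4)] v(2) by simp
        then have "q \<cdot> (sE \<cdot> v) = zer P X" using kill[OF s GZ] comp_closed[OF v(1) sE(1)] unfolding P_def by blast
        then show ?thesis unfolding e_def using comp_assoc[OF v(1) sE(1) q] by simp
      qed
      have g3: "\<exists>v\<in>Hom T P E. i \<cdot> v = e \<cdot> v \<and> \<pi> \<cdot> (i \<cdot> v) = x" if x: "x \<in> Hom T P F" for x
      proof -
        obtain g where g: "g \<in> Hom T P (L p)" "u p \<cdot> g = x" using lift[OF s GZ] x unfolding P_def by blast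
        note qg = comp_closed[OF g(1) q]
        obtain v where v: "v \<in> Hom T P E" "i \<cdot> v = q \<cdot> g" using g1[OF qg] by blast
        have \<pi>v: "\<pi> \<cdot> (i \<cdot> v) = x" using v(2) comp_assoc[OF g(1) q X(4)] \<pi>q g(2) by simp
        note sv = comp_closed[OF v(1) sE(1)]
        have "u p \<cdot> (sE \<cdot> v) = x" using comp_assoc[OF v(1) sE(1) u(1)] sE(2) comp_assoc[OF v(1) H(1) X(4)] \<pi>v by simp
        then have "u p \<cdot> (sE \<cdot> v \<boxminus> g) = zer P F" using comp_sub_right[OF sv g(1) u(1)] g(2) sub_eq_zer_iff[OF x x] by simp
        then have "q \<cdot> (sE \<cdot> v \<boxminus> g) = zer P X" using kill[OF s GZ] sub_Hom[OF sv g(1)] unfolding P_def by blast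
        then have "q \<cdot> (sE \<cdot> v) = q \<cdot> g"
          using comp_sub_right[OF sv g(1) q] sub_eq_zer_iff[OF comp_closed[OF sv q] qg] by simp
        then have "i \<cdot> v = e \<cdot> v" unfolding e_def using comp_assoc[OF v(1) sE(1) q] v(2) by simp
        then show ?thesis using v(1) \<pi>v by blast
      qed
      show ?thesis unfolding splits_def P_def[symmetric] using g1 g1' g2 g3 by blast
    next
      case False
      have X0: "hz P X" unfolding P_def using van_hz_shift[OF Q_van[OF X(2)] G, of "- s"] s False unfolding M_def by auto
      have F0: "hz P F" unfolding P_def using van_hz_shift[OF van_F G, of "- s"] s False unfolding M_def by auto
      have g2: "e \<cdot> v = zer P X" if v: "v \<in> Hom T P E" for v using hzD[OF X0 comp_closed[OF v e]] .
      have g3: "\<exists>v\<in>Hom T P E. i \<cdot> v = e \<cdot> v \<and> \<pi> \<cdot> (i \<cdot> v) = x" if x: "x \<in> Hom T P F" for x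
      proof -
        have z: "zer P E \<in> Hom T P E" using zer_Hom[OF P] Hom_obj[OF e] by blast
        have "i \<cdot> zer P E = e \<cdot> zer P E" using comp_zer_right[OF P H(1)] comp_zer_right[OF P e] by simp
        moreover have "\<pi> \<cdot> (i \<cdot> zer P E) = x" using hzD[OF F0 x] hzD[OF F0 comp_closed[OF comp_closed[OF z H(1)] X(4)]] by simp
        ultimately show ?thesis using z by blast
      qed
      show ?thesis unfolding splits_def P_def[symmetric] using g1 g1' g2 g3 by blast
    qed
  qed
  \<comment> \<open>\<open>\<Sigma>E\<close> lies between \<open>D\<close> and
    \<open>\<Sigma>X\<close> in a triangle; suspending \<open>X\<close> costs one layer.\<close>
  have "D \<in> Q (l0 - 1)" "X \<in> Q (l0 - 1 + 1)" using E(3) X(2) Q_dec[of "l0 - 1" "l0 + int k"] by auto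
  then have "susp T E \<in> Q (l0 - 1)"
    using Q_ext[OF rotate[OF rotate[OF E(4)]]] metric_likeD(5)[OF Q_metric, of X "l0 - 1"] by simp
  then show ?thesis using that[OF Ec X(1) H(1) e X(4) \<pi>e X(2)] sp by blast
qed

context
  fixes F' \<alpha> \<beta>
  assumes F': "triangle T (susp T F) F' F \<alpha> \<beta> (zer F (susp T (susp T F)))"
begin

text \<open>\<open>F'\<close> is \<open>F \<oplus> \<Sigma>F\<close>, given by a triangle with zero
  connecting arrow, whose rotations are used later. The cone of \<open>i - e\<close> maps to it by
  \<open>l\<close> and \<open>m\<close>, and the vanishing of \<open>Z\<close> in a range of degrees
  measures the quality of the approximation.\<close>

lemma compact_stage:
  "\<exists>L\<in>Tc \<inter> Q (l0 - 1). \<exists>\<psi> Z g h. triangle T L F' Z \<psi> g h \<and> van {- n..} Z"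
proof -
  obtain E X i e \<pi> where d: "E \<in> Tc" "X \<in> Tc" "i \<in> Hom T E X" "e \<in> Hom T E X" "\<pi> \<in> Hom T X F" "\<pi> \<cdot> e = \<pi> \<cdot> i"
    "X \<in> Q l0" "susp T E \<in> Q (l0 - 1)"
    "\<And>s G j. s \<in> {- 2, - 1, 0} \<Longrightarrow> j \<ge> - n \<Longrightarrow> G \<in> \<G> j \<Longrightarrow> splits i e \<pi> E X F (sh s G)"
    using split_data[of n] by metis
  obtain L c \<delta> where t: "triangle T E X L (i \<boxminus> e) c \<delta>" using triangle_exists[OF sub_Hom[OF d(3,4)]] by blast
  obtain l m where l: "l \<in> Hom T L F" "m \<in> Hom T L (susp T F)"
    "\<And>P x z. P \<in> obj T \<Longrightarrow> splits i e \<pi> E X F P \<Longrightarrow> splits i e \<pi> E X F (susp T P) \<Longrightarrow>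
      x \<in> Hom T (susp T P) F \<Longrightarrow> z \<in> Hom T (susp T P) (susp T F) \<Longrightarrow>
      \<exists>y\<in>Hom T (susp T P) L. l \<cdot> y = x \<and> m \<cdot> y = z"
    "\<And>P y. P \<in> obj T \<Longrightarrow> splits i e \<pi> E X F P \<Longrightarrow> splits i e \<pi> E X F (susp T P) \<Longrightarrow> y \<in> Hom T (susp T P) L \<Longrightarrow>
      l \<cdot> y = zer (susp T P) F \<Longrightarrow> m \<cdot> y = zer (susp T P) (susp T F) \<Longrightarrow> y = zer (susp T P) L"
    using cone_of_idempotent[OF d(3-6) t] by metis
  note H' = triangle_Hom[OF F'] and o' = triangle_obj[OF F'] and o = triangle_obj[OF t]
  have "zer F (susp T (susp T F)) \<cdot> ide T F = zer F (susp T (susp T F))" using comp_ide[OF H'(3)] by simp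
  \<comment> \<open>The zero connecting arrow splits the triangle: \<open>\<sigma>\<close> is a
    section of \<open>\<beta>\<close>, and composing with \<open>\<alpha>\<close> is
    injective.\<close>
  then obtain \<sigma> where \<sigma>: "\<sigma> \<in> Hom T F F'" "\<beta> \<cdot> \<sigma> = ide T F" using exact_cov2[OF F' ide[OF F_obj]] by blast
  have \<alpha>_inj: "z = zer P (susp T F)" if z: "z \<in> Hom T P (susp T F)" "\<alpha> \<cdot> z = zer P F'" for P z
  proof -
    have P: "P \<in> obj T" using Hom_obj[OF z(1)] by blast
    obtain x' where x': "x' \<in> Hom T (susp T P) F" "zer F (susp T (susp T F)) \<cdot> x' = susp_arr T z"
      using exact_cov0[OF F' z] by blast
    then have "susp_arr T z = zer (susp T P) (susp T (susp T F))" using comp_zer_left[OF _ x'(1)] Hom_obj[OF H'(3)] by simp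
    then show ?thesis using susp_eq_zer[OF z(1)] by blast
  qed
  have \<beta>\<alpha>: "\<beta> \<cdot> \<alpha> = zer (susp T F) F" using triangle_zero1[OF F'] .
  define \<psi> where "\<psi> = \<sigma> \<cdot> l \<boxplus> \<alpha> \<cdot> m"
  note \<sigma>l = comp_closed[OF l(1) \<sigma>(1)] and \<alpha>m = comp_closed[OF l(2) H'(1)]
  have \<psi>: "\<psi> \<in> Hom T L F'" unfolding \<psi>_def using add_Hom[OF \<sigma>l \<alpha>m] .
  have \<psi>y: "\<psi> \<cdot> y = \<sigma> \<cdot> (l \<cdot> y) \<boxplus> \<alpha> \<cdot> (m \<cdot> y)" if "y \<in> Hom T P L" for P y
    unfolding \<psi>_def using comp_add_left[OF that \<sigma>l \<alpha>m] comp_assoc[OF that l(1) \<sigma>(1)] comp_assoc[OF that l(2) H'(1)] by simp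
  have \<beta>\<psi>: "\<beta> \<cdot> (\<psi> \<cdot> y) = l \<cdot> y" if y: "y \<in> Hom T P L" for P y
  proof -
    note ly = comp_closed[OF y l(1)] and my = comp_closed[OF y l(2)]
    have "\<beta> \<cdot> (\<psi> \<cdot> y) = (\<beta> \<cdot> \<sigma>) \<cdot> (l \<cdot> y) \<boxplus> (\<beta> \<cdot> \<alpha>) \<cdot> (m \<cdot> y)"
      unfolding \<psi>y[OF y] using comp_add_right[OF comp_closed[OF ly \<sigma>(1)] comp_closed[OF my H'(1)] H'(2)]
        comp_assoc[OF ly \<sigma>(1) H'(2)] comp_assoc[OF my H'(1,2)] by simp
    then show ?thesis using \<sigma>(2) \<beta>\<alpha> comp_ide[OF ly] comp_zer_left[OF F_obj my] add_zer(1)[OF ly] by simp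
  qed
  obtain Z g h where Z: "triangle T L F' Z \<psi> g h" using triangle_exists[OF \<psi>] by blast
  note HZ = triangle_Hom[OF Z] and oZ = triangle_obj[OF Z]
  \<comment> \<open>Vanishing at \<open>G\<close> needs \<open>\<psi>\<close> to be surjective on
    arrows from \<open>G\<close> and injective on arrows from
    \<open>\<Sigma>\<^sup>-\<^sup>1G\<close>.\<close>
  have "hz G Z" if j: "j \<ge> - n" and G: "G \<in> \<G> j" for j G
  proof (rule hzI[OF G_obj[OF G] oZ(3)])
    note Go = G_obj[OF G]
    have P: "sh (- 2) G \<in> obj T" "sh (- 1) G \<in> obj T" using shift_obj[OF Go] by blast+
    have s: "susp T (sh (- 2) G) = sh (- 1) G" "susp T (sh (- 1) G) = G"
      using shift_succ[OF Go, of "- 2"] shift_succ[OF Go, of "- 1"] by simp_all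
    have sp: "splits i e \<pi> E X F (sh (- 2) G)" "splits i e \<pi> E X F (sh (- 1) G)" "splits i e \<pi> E X F G"
      using d(9)[of "- 2" j G] d(9)[of "- 1" j G] d(9)[of 0 j G] j G by auto
    have inj: "y = zer (sh (- 1) G) L" if y: "y \<in> Hom T (sh (- 1) G) L" "\<psi> \<cdot> y = zer (sh (- 1) G) F'" for y
    proof -
      have ly: "l \<cdot> y = zer (sh (- 1) G) F" using \<beta>\<psi>[OF y(1)] y(2) comp_zer_right[OF P(2) H'(2)] by simp
      then have "\<alpha> \<cdot> (m \<cdot> y) = zer (sh (- 1) G) F'"
        using \<psi>y[OF y(1)] y(2) comp_zer_right[OF P(2) \<sigma>(1)] add_zer(2)[OF comp_closed[OF comp_closed[OF y(1) l(2)] H'(1)]] by simp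
      then have "m \<cdot> y = zer (sh (- 1) G) (susp T F)" using \<alpha>_inj[OF comp_closed[OF y(1) l(2)]] by blast
      then show ?thesis using l(4)[OF P(1)] sp(1,2) y(1) ly s by simp
    qed
    have surj: "\<exists>y\<in>Hom T G L. \<psi> \<cdot> y = x" if x: "x \<in> Hom T G F'" for x
    proof -
      note bx = comp_closed[OF x H'(2)]
      note sbx = comp_closed[OF bx \<sigma>(1)]
      have "\<beta> \<cdot> (x \<boxminus> \<sigma> \<cdot> (\<beta> \<cdot> x)) = zer G F"
        using comp_sub_right[OF x sbx H'(2)] comp_assoc[OF bx \<sigma>(1) H'(2)] \<sigma>(2) comp_ide[OF bx] sub_eq_zer_iff[OF bx bx] by simp
      then obtain z where z: "z \<in> Hom T G (susp T F)" "\<alpha> \<cdot> z = x \<boxminus> \<sigma> \<cdot> (\<beta> \<cdot> x)" using exact_cov[OF F' sub_Hom[OF x sbx]] by blast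
      obtain y where y: "y \<in> Hom T G L" "l \<cdot> y = \<beta> \<cdot> x" "m \<cdot> y = z"
        using l(3)[OF P(2), of "\<beta> \<cdot> x" z] sp(2,3) bx z(1) s by auto
      have "\<psi> \<cdot> y = (x \<boxminus> \<sigma> \<cdot> (\<beta> \<cdot> x)) \<boxplus> \<sigma> \<cdot> (\<beta> \<cdot> x)"
        using \<psi>y[OF y(1)] y(2,3) z(2) add_comm[OF sbx sub_Hom[OF x sbx]] by simp
      then show ?thesis using y(1) sub_add[OF x sbx] by auto
    qed
    fix z assume z: "z \<in> Hom T G Z"
    have "h \<cdot> z \<in> Hom T (susp T (sh (- 1) G)) (susp T L)" using comp_closed[OF z HZ(3)] s by simp
    then obtain y where y: "y \<in> Hom T (sh (- 1) G) L" "susp_arr T y = h \<cdot> z" using desusp_Hom[OF P(2) oZ(1)] by blast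
    have "susp_arr T (\<psi> \<cdot> y) = zer (susp T (sh (- 1) G)) (susp T F')"
      using susp_comp[OF y(1) \<psi>] y(2) comp_assoc[OF z HZ(3) susp_Hom[OF \<psi>]] triangle_zero3[OF Z]
        comp_zer_left[OF susp_obj[OF oZ(2)] z] s by simp
    then have "\<psi> \<cdot> y = zer (sh (- 1) G) F'" using susp_eq_zer[OF comp_closed[OF y(1) \<psi>]] by blast
    then have "y = zer (sh (- 1) G) L" using inj[OF y(1)] by blast
    then have "h \<cdot> z = zer G (susp T L)" using y(2) susp_zer[OF P(2) oZ(1)] s by simp
    then obtain x where x: "x \<in> Hom T G F'" "g \<cdot> x = z" using exact_cov2[OF Z z] by blast
    obtain y where y: "y \<in> Hom T G L" "\<psi> \<cdot> y = x" using surj[OF x(1)] by blast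
    then show "z = zer G Z"
      using x(2) comp_assoc[OF y(1) \<psi> HZ(2)] triangle_zero1[OF Z] comp_zer_left[OF oZ(3) y(1)] by simp
  qed
  then have "van {- n..} Z" using oZ(3) unfolding van_def by auto
  moreover have "susp T E \<in> Tc" using compact_shift[OF d(1), of 1] by simp
  then have "L \<in> Tc" using compact_ext[OF rotate[OF t] d(2)] by blast
  moreover have "L \<in> Q (l0 - 1)" using Q_ext[OF rotate[OF t] _ d(8)] d(7) Q_dec[of "l0 - 1" l0] by auto
  ultimately show ?thesis using Z by blast
qed

text \<open>The stages become a direct system if each is chosen so late that the previous compact
  object has no arrows to its cone.\<close>

lemma compact_sequence:
  "\<exists>K \<psi> t Z g h. (\<forall>k. K k \<in> Tc \<inter> Q (l0 - 1) \<and> triangle T (K k) F' (Z k) (\<psi> k) (g k) (h k) \<and> van {- int k..} (Z k) \<and>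
     t k \<in> Hom T (K k) (K (Suc k)) \<and> \<psi> (Suc k) \<cdot> t k = \<psi> k)"
proof -
  define S where "S k a \<longleftrightarrow> fst a \<in> Tc \<inter> Q (l0 - 1) \<and> (\<exists>Z g h. triangle T (fst a) F' Z (snd a) g h \<and> van {- int k..} Z)" for k a
  have "\<exists>f. \<forall>k. S k (f k) \<and> (\<exists>t\<in>Hom T (fst (f k)) (fst (f (Suc k))). snd (f (Suc k)) \<cdot> t = snd (f k))"
  proof (rule dependent_nat_choice)
    obtain K \<psi> Z g h where "K \<in> Tc \<inter> Q (l0 - 1)" "triangle T K F' Z \<psi> g h" "van {- 0..} Z"
      using compact_stage[of 0] by blast
    then have "S 0 (K, \<psi>)" unfolding S_def by auto
    then show "\<exists>x. S 0 x" by blast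
  next
    fix a k assume "S k a"
    then have a: "fst a \<in> Tc" and "\<exists>Z g h. triangle T (fst a) F' Z (snd a) g h" unfolding S_def by auto
    then have sa: "snd a \<in> Hom T (fst a) F'" using triangle_Hom by blast
    obtain b where b: "\<And>Z. van {b..} Z \<Longrightarrow> hz (fst a) Z" using compact_van[OF a] by blast
    \<comment> \<open>Arrows from the previous object vanish on targets that vanish from degree
      \<open>b\<close> on, and \<open>- n \<le> b\<close>.\<close>
    define n where "n = max (int (Suc k)) (- b)"
    obtain K \<psi> Z g h where K: "K \<in> Tc \<inter> Q (l0 - 1)" "triangle T K F' Z \<psi> g h" "van {- n..} Z"
      using compact_stage[of n] by blast
    have "hz (fst a) Z" using b van_mono[OF K(3)] unfolding n_def by auto
    then have "g \<cdot> snd a = zer (fst a) Z" using hzD comp_closed[OF sa triangle_Hom(2)[OF K(2)]] by blast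
    then obtain t where t: "t \<in> Hom T (fst a) K" "\<psi> \<cdot> t = snd a" using exact_cov[OF K(2) sa] by blast
    have "van {- int (Suc k)..} Z" using van_mono[OF K(3)] unfolding n_def by auto
    then have "S (Suc k) (K, \<psi>)" unfolding S_def using K(1,2) by auto
    then show "\<exists>b. S (Suc k) b \<and> (\<exists>t\<in>Hom T (fst a) (fst b). snd b \<cdot> t = snd a)"
      using t by (intro exI[of _ "(K, \<psi>)"]) auto
  qed
  then obtain f where f: "\<And>k. S k (f k)" "\<And>k. \<exists>t\<in>Hom T (fst (f k)) (fst (f (Suc k))). snd (f (Suc k)) \<cdot> t = snd (f k)" by blast
  obtain t where t: "\<And>k. t k \<in> Hom T (fst (f k)) (fst (f (Suc k))) \<and> snd (f (Suc k)) \<cdot> t k = snd (f k)" using f(2) by metis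
  have "\<forall>k. \<exists>Z g h. triangle T (fst (f k)) F' Z (snd (f k)) g h \<and> van {- int k..} Z" using f(1) unfolding S_def by blast
  then obtain Z g h where "\<And>k. triangle T (fst (f k)) F' (Z k) (snd (f k)) (g k) (h k) \<and> van {- int k..} (Z k)" by metis
  then show ?thesis using t f(1) unfolding S_def
    by (intro exI[of _ "\<lambda>k. fst (f k)"] exI[of _ "\<lambda>k. snd (f k)"] exI[of _ t] exI[of _ Z] exI[of _ g] exI[of _ h]) auto
qed

end

end

section \<open>Cones of the canonical maps to a homotopy colimit\<close>

context R_linear_triangulated_category
begin

lemma sub_sub: "x \<in> Hom T X Y \<Longrightarrow> w \<in> Hom T X Y \<Longrightarrow> x \<boxminus> (x \<boxminus> w) = w"
  using add_sub[of w X Y "x \<boxminus> w"] add_comm[of w X Y "x \<boxminus> w"] sub_add[of x X Y w] sub_Hom[of x X Y w] by simp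

text \<open>\<open>D\<close> behaves like a homotopy colimit of the cones of
  \<open>K k \<rightarrow> K j\<close>, which are iterated extensions of the \<open>B j\<close>. In
  place of that colimit, \<open>f\<close> is shown to vanish on \<open>F\<close>; what remains is an
  arrow from \<open>\<Sigma>K k\<close>, and as it extends over \<open>\<Sigma>F\<close>, its
  composite with \<open>e\<close> is zero.\<close>

lemma hocolim_cone_orth:
  assumes h: "hocolim \<kappa> K t F v" and t: "\<And>j. t j \<in> Hom T (K j) (K (Suc j))"
    and B: "\<And>j. j \<ge> k \<Longrightarrow> triangle T (K j) (K (Suc j)) (B j) (t j) (b j) (c j)"
    and o: "\<And>j. j \<ge> k \<Longrightarrow> hz (B j) s" and D: "triangle T (K k) F D (v k) d e"
  shows "hz D s"
proof (rule hzI)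
  show Do: "D \<in> obj T" and so: "s \<in> obj T" using triangle_obj[OF D] o[of k] hz_obj by blast+
  note HD = triangle_Hom[OF D]
  note v = hocolim_cocone[OF h]
  note Ko = seq_obj[where \<tau> = t, OF t]
  fix f assume f: "f \<in> Hom T D s"
  define p where "p = f \<cdot> d"
  have p: "p \<in> Hom T F s" unfolding p_def using comp_closed[OF HD(2) f] .
  have pk: "p \<cdot> v k = zer (K k) s"
    unfolding p_def using comp_assoc[OF HD(1,2) f] triangle_zero1[OF D] comp_zer_right[OF Ko f] by simp
  have pv: "p \<cdot> v j = zer (K j) s" for j
  proof (cases "j \<le> k")
    case True
    have "v k \<cdot> trans K t j (k - j) = v j" using cocone_trans[where \<tau> = t, OF t, of v F, OF v, of j "k - j"] True by simp
    moreover have tj: "trans K t j (k - j) \<in> Hom T (K j) (K k)" using trans_Hom[where \<tau> = t, OF t, of j "k - j"] True by simp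
    ultimately show ?thesis using comp_assoc[OF tj v(1) p] pk comp_zer_left[OF so tj] by simp
  next
    case False
    then have "k \<le> j" by simp
    then show ?thesis
    proof (induction j rule: dec_induct)
      case base then show ?case using pk .
    next
      case (step j)
      note pj = comp_closed[OF v(1) p]
      have "(p \<cdot> v (Suc j)) \<cdot> t j = zer (K j) s" using comp_assoc[OF t v(1) p] v(2) step.IH by simp
      then obtain x' where x': "x' \<in> Hom T (B j) s" "x' \<cdot> b j = p \<cdot> v (Suc j)" using exact_contra[OF B[OF step.hyps(1)] pj] by blast
      then show ?case using hzD[OF o[OF step.hyps(1)] x'(1)] comp_zer_left[OF so triangle_Hom(2)[OF B[OF step.hyps(1)]]] by simp
    qed
  qed
  have "p = zer F s"
  proof (rule hocolim_vanish[OF h p pv])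
    fix \<phi> assume \<phi>: "\<And>j. \<phi> j \<in> Hom T (susp T (K j)) s"
    \<comment> \<open>The telescoping equations are solved upwards from \<open>k\<close>, where the
      \<open>B j\<close> allow extension, and then downwards to \<open>0\<close>, where each value
      is determined by the next one.\<close>
    define P where "P m \<longleftrightarrow> (\<exists>\<psi>. \<forall>j\<ge>m. \<psi> j \<in> Hom T (susp T (K j)) s \<and> \<phi> j = \<psi> j \<boxminus> \<psi> (Suc j) \<cdot> susp_arr T (t j))" for m
    have "\<exists>g. \<forall>i. g i \<in> Hom T (susp T (K (k + i))) s \<and> \<phi> (k + i) = g i \<boxminus> g (Suc i) \<cdot> susp_arr T (t (k + i))"
    proof (rule dependent_nat_choice)
      show "\<exists>x. x \<in> Hom T (susp T (K (k + 0))) s" using zer_Hom[OF susp_obj[OF Ko] so] by blast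
    next
      fix x i assume x: "x \<in> Hom T (susp T (K (k + i))) s"
      note w = sub_Hom[OF x \<phi>]
      have ki: "k + i \<ge> k" by simp
      have "(x \<boxminus> \<phi> (k + i)) \<cdot> c (k + i) = zer (B (k + i)) s"
        using hzD[OF o[OF ki] comp_closed[OF triangle_Hom(3)[OF B[OF ki]] w]] .
      then obtain x' where x': "x' \<in> Hom T (susp T (K (Suc (k + i)))) s" "x' \<cdot> susp_arr T (t (k + i)) = x \<boxminus> \<phi> (k + i)"
        using exact_contra3[OF B[OF ki] w] by blast
      then show "\<exists>y. y \<in> Hom T (susp T (K (k + Suc i))) s \<and> \<phi> (k + i) = x \<boxminus> y \<cdot> susp_arr T (t (k + i))"
        using sub_sub[OF x \<phi>] by auto
    qed
    then obtain g where g: "\<And>i. g i \<in> Hom T (susp T (K (k + i))) s \<and> \<phi> (k + i) = g i \<boxminus> g (Suc i) \<cdot> susp_arr T (t (k + i))" by blast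
    have "\<forall>j\<ge>k. g (j - k) \<in> Hom T (susp T (K j)) s \<and> \<phi> j = g (j - k) \<boxminus> g (Suc j - k) \<cdot> susp_arr T (t j)"
    proof (intro allI impI)
      fix j assume j: "k \<le> j"
      show "g (j - k) \<in> Hom T (susp T (K j)) s \<and> \<phi> j = g (j - k) \<boxminus> g (Suc j - k) \<cdot> susp_arr T (t j)"
        using g[of "j - k"] unfolding Suc_diff_le[OF j] le_add_diff_inverse[OF j] .
    qed
    then have "P k" unfolding P_def by (rule exI[of _ "\<lambda>j. g (j - k)"])
    have "P 0"
    proof (rule inc_induct[of 0 k P, OF _ \<open>P k\<close>])
      fix m assume "P (Suc m)"
      then obtain \<psi> where \<psi>: "\<And>j. j \<ge> Suc m \<Longrightarrow> \<psi> j \<in> Hom T (susp T (K j)) s \<and> \<phi> j = \<psi> j \<boxminus> \<psi> (Suc j) \<cdot> susp_arr T (t j)"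
        unfolding P_def by blast
      define w where "w = \<psi> (Suc m) \<cdot> susp_arr T (t m)"
      have w: "w \<in> Hom T (susp T (K m)) s" unfolding w_def using comp_closed[OF susp_Hom[OF t]] \<psi>[of "Suc m"] by blast
      have "(\<psi>(m := \<phi> m \<boxplus> w)) j \<in> Hom T (susp T (K j)) s \<and>
        \<phi> j = (\<psi>(m := \<phi> m \<boxplus> w)) j \<boxminus> (\<psi>(m := \<phi> m \<boxplus> w)) (Suc j) \<cdot> susp_arr T (t j)" if "j \<ge> m" for j
        using that \<psi>[of j] add_Hom[OF \<phi> w] add_sub[OF \<phi> w] by (cases "j = m") (auto simp: w_def)
      then show "P m" unfolding P_def by blast
    qed simp
    then show "\<exists>\<psi>. \<forall>k. \<psi> k \<in> Hom T (susp T (K k)) s \<and> \<phi> k = \<psi> k \<boxminus> \<psi> (Suc k) \<cdot> susp_arr T (t k)"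
      unfolding P_def by simp
  qed
  then obtain f' where f': "f' \<in> Hom T (susp T (K k)) s" "f' \<cdot> e = f"
    using exact_contra2[OF D f] unfolding p_def by blast
  obtain s0 where s0: "s0 \<in> obj T" "susp T s0 = s" using desusp_obj[OF so] by blast
  obtain f0 where f0: "f0 \<in> Hom T (K k) s0" "susp_arr T f0 = f'" using desusp_Hom[OF Ko s0(1)] f'(1) s0(2) by metis
  \<comment> \<open>Extension of \<open>f0\<close> along the tower; each obstruction is an arrow
    from some \<open>B (k + i)\<close> to \<open>s\<close>. Below \<open>k\<close> the cocone is
    completed by composing with the transition maps.\<close>
  have "\<exists>g. \<forall>i. (g i \<in> Hom T (K (k + i)) s0 \<and> (i = 0 \<longrightarrow> g i = f0)) \<and> g (Suc i) \<cdot> t (k + i) = g i"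
  proof (rule dependent_nat_choice)
    show "\<exists>x. x \<in> Hom T (K (k + 0)) s0 \<and> (0 = 0 \<longrightarrow> x = f0)" using f0(1) by simp
  next
    fix x and i :: nat assume x: "x \<in> Hom T (K (k + i)) s0 \<and> (i = 0 \<longrightarrow> x = f0)"
    have ki: "k + i \<ge> k" by simp
    have "susp_arr T x \<cdot> c (k + i) = zer (B (k + i)) (susp T s0)"
      using hzD[OF o[OF ki]] comp_closed[OF triangle_Hom(3)[OF B[OF ki]] susp_Hom] x s0(2) by blast
    then obtain y where "y \<in> Hom T (K (Suc (k + i))) s0" "y \<cdot> t (k + i) = x" using exact_contra0[OF B[OF ki]] x by blast
    then show "\<exists>y. (y \<in> Hom T (K (k + Suc i)) s0 \<and> (Suc i = 0 \<longrightarrow> y = f0)) \<and> y \<cdot> t (k + i) = x" by auto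
  qed
  then obtain g where g: "\<And>i. g i \<in> Hom T (K (k + i)) s0" "g 0 = f0" "\<And>i. g (Suc i) \<cdot> t (k + i) = g i" by blast
  define q where "q j = (if k \<le> j then g (j - k) else f0 \<cdot> trans K t j (k - j))" for j
  have tj: "trans K t j (k - j) \<in> Hom T (K j) (K k)" if "j \<le> k" for j using trans_Hom[where \<tau> = t, OF t, of j "k - j"] that by simp
  have q1: "q j \<in> Hom T (K j) s0" for j
    using g(1)[of "j - k"] comp_closed[OF tj f0(1)] unfolding q_def by auto
  have q2: "q (Suc j) \<cdot> t j = q j" for j
  proof -
    consider "k \<le> j" | "Suc j < k" | "Suc j = k" by linarith
    then show ?thesis
    proof cases
      case 1
      then show ?thesis using g(3)[of "j - k"] unfolding q_def by (simp add: Suc_diff_le)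
    next
      case 2
      have "trans K t (Suc j) (k - Suc j) \<cdot> t j = trans K t j (k - j)"
        using trans_Suc_left[where \<tau> = t, OF t, of j "k - Suc j"] 2 by (simp add: Suc_diff_Suc)
      then show ?thesis using comp_assoc[OF t tj f0(1), of j] 2 unfolding q_def by simp
    next
      case 3
      then show ?thesis using g(2) comp_ide[OF t, of j] unfolding q_def by auto
    qed
  qed
  obtain h' where h': "h' \<in> Hom T F s0" "\<And>j. h' \<cdot> v j = q j" using hocolim_weak[OF h q1 q2] by blast
  have "h' \<cdot> v k = f0" using h'(2)[of k] g(2) unfolding q_def by simp
  then have "f' = susp_arr T h' \<cdot> susp_arr T (v k)" using f0(2) susp_comp[OF HD(1) h'(1)] by simp
  then have "f = susp_arr T h' \<cdot> (susp_arr T (v k) \<cdot> e)"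
    using f'(2) comp_assoc[OF HD(3) susp_Hom[OF HD(1)] susp_Hom[OF h'(1)]] by simp
  then show "f = zer D s" using triangle_zero3[OF D] comp_zer_right[OF Do susp_Hom[OF h'(1)]] s0(2) by simp
qed

end

section \<open>From the compact stages to the closure\<close>

context quasi_hocolim
begin

context
  fixes F' \<alpha> \<beta>
  assumes F': "triangle T (susp T F) F' F \<alpha> \<beta> (zer F (susp T (susp T F)))"
begin

text \<open>The homotopy colimit \<open>F2\<close> of the compact stages agrees with
  \<open>F'\<close>, since a given compact object has no arrows to the cones \<open>Z k\<close> for
  large \<open>k\<close>. The cones of its transition maps are compact, and on compact objects
  vanishing in high degrees means depth in the metric.\<close>

lemma zero_cone_closure: "F' \<in> compact_closure \<kappa> T RR \<and> (\<exists>l. F' \<in> RR l)"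
proof -
  obtain K \<psi> t Z g h where s: "\<And>k. K k \<in> Tc" "\<And>k. K k \<in> Q (l0 - 1)" "\<And>k. triangle T (K k) F' (Z k) (\<psi> k) (g k) (h k)"
    "\<And>k. van {- int k..} (Z k)" "\<And>k. t k \<in> Hom T (K k) (K (Suc k))" "\<And>k. \<psi> (Suc k) \<cdot> t k = \<psi> k"
    using compact_sequence[OF F'] by blast
  note \<psi> = triangle_Hom(1)[OF s(3)]
  obtain F2 v where hc: "hocolim \<kappa> K t F2 v" using hocolim_exists[where \<tau> = t, OF kappa small_coproducts s(5)] by blast
  note v = hocolim_cocone[OF hc]
  note tr2 = trans_Hom[where \<tau> = t, OF s(5)] and vt = cocone_trans[where \<tau> = t, OF s(5), of v F2, OF v]
  obtain \<Psi> where \<Psi>: "\<Psi> \<in> Hom T F2 F'" "\<And>k. \<Psi> \<cdot> v k = \<psi> k" using hocolim_weak[OF hc \<psi> s(6)] by blast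
  obtain C p q where C: "triangle T F2 F' C \<Psi> p q" using triangle_exists[OF \<Psi>(1)] by blast
  note HC = triangle_Hom[OF C] and oC = triangle_obj[OF C]
  have late: "\<exists>k0. \<forall>k\<ge>k0. hz P (Z k)" if P: "P \<in> Tc" for P
  proof -
    obtain a where a: "\<And>Z. van {a..} Z \<Longrightarrow> hz P Z" using compact_van[OF P] by blast
    have "hz P (Z k)" if "k \<ge> nat (- a)" for k using that by (intro a van_mono[OF s(4)]) auto
    then show ?thesis by blast
  qed
  have C0: "hz P C" if P: "P \<in> Tc" for P
  proof (rule hzI[OF compact_obj[OF P] oC(3)])
    note Po = compact_obj[OF P]
    have P': "sh (- 1) P \<in> Tc" "sh (- 1) P \<in> obj T" "susp T (sh (- 1) P) = P"
      using compact_shift[OF P] shift_obj[OF Po] shift_succ[OF Po, of "- 1"] by simp_all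
    obtain k0 where k0: "\<And>k. k \<ge> k0 \<Longrightarrow> hz P (Z k)" using late[OF P] by blast
    fix z assume z: "z \<in> Hom T P C"
    have "q \<cdot> z \<in> Hom T (susp T (sh (- 1) P)) (susp T F2)" using comp_closed[OF z HC(3)] P'(3) by simp
    then obtain y where y: "y \<in> Hom T (sh (- 1) P) F2" "susp_arr T y = q \<cdot> z" using desusp_Hom[OF P'(2) oC(1)] by blast
    have "susp_arr T (\<Psi> \<cdot> y) = zer (susp T (sh (- 1) P)) (susp T F')"
      using susp_comp[OF y(1) \<Psi>(1)] y(2) comp_assoc[OF z HC(3) susp_Hom[OF \<Psi>(1)]] triangle_zero3[OF C]
        comp_zer_left[OF susp_obj[OF oC(2)] z] P'(3) by simp
    then have \<Psi>y: "\<Psi> \<cdot> y = zer (sh (- 1) P) F'" using susp_eq_zer[OF comp_closed[OF y(1) \<Psi>(1)]] by blast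
    obtain k w where w: "w \<in> Hom T (sh (- 1) P) (K k)" "v k \<cdot> w = y" using hocolim_lift[OF hc P'(1) y(1)] by blast
    \<comment> \<open>Injectivity of \<open>\<psi>\<close> on these arrows holds only at late
      stages, so the lift is first moved up by \<open>k0\<close> steps.\<close>
    define w' where "w' = trans K t k k0 \<cdot> w"
    have w': "w' \<in> Hom T (sh (- 1) P) (K (k + k0))" unfolding w'_def using comp_closed[OF w(1) tr2] .
    have vw': "v (k + k0) \<cdot> w' = y" unfolding w'_def using comp_assoc[OF w(1) tr2 v(1)] vt w(2) by simp
    have "\<psi> (k + k0) \<cdot> w' = zer (sh (- 1) P) F'" using \<Psi>(2)[of "k + k0"] comp_assoc[OF w' v(1) \<Psi>(1)] vw' \<Psi>y by simp
    then obtain x' where x': "x' \<in> Hom T (susp T (sh (- 1) P)) (Z (k + k0))" "h (k + k0) \<cdot> x' = susp_arr T w'"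
      using exact_cov0[OF s(3) w'] by blast
    have "x' = zer P (Z (k + k0))" using hzD[OF k0[of "k + k0"]] x'(1) P'(3) by simp
    then have "susp_arr T w' = zer (susp T (sh (- 1) P)) (susp T (K (k + k0)))"
      using x'(2) comp_zer_right[OF Po triangle_Hom(3)[OF s(3)]] P'(3) by simp
    then have "w' = zer (sh (- 1) P) (K (k + k0))" using susp_eq_zer[OF w'] by blast
    then have "y = zer (sh (- 1) P) F2" using vw' comp_zer_right[OF P'(2) v(1)] by simp
    then have "q \<cdot> z = zer P (susp T F2)" using y(2) susp_zer[OF P'(2) oC(1)] P'(3) by simp
    then obtain x where x: "x \<in> Hom T P F'" "p \<cdot> x = z" using exact_cov2[OF C z] by blast
    have "g k0 \<cdot> x = zer P (Z k0)" using hzD[OF k0 comp_closed[OF x(1) triangle_Hom(2)[OF s(3)]]] by simp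
    then obtain y' where y': "y' \<in> Hom T P (K k0)" "\<psi> k0 \<cdot> y' = x" using exact_cov[OF s(3) x(1)] by blast
    have "x = \<Psi> \<cdot> (v k0 \<cdot> y')" using y'(2) \<Psi>(2)[of k0] comp_assoc[OF y'(1) v(1) \<Psi>(1)] by simp
    then have "z = (p \<cdot> \<Psi>) \<cdot> (v k0 \<cdot> y')" using x(2) comp_assoc[OF comp_closed[OF y'(1) v(1)] \<Psi>(1) HC(2)] by simp
    then show "z = zer P C" using triangle_zero1[OF C] comp_zer_left[OF oC(3) comp_closed[OF y'(1) v(1)]] by simp
  qed
  \<comment> \<open>Compact generation: \<open>C\<close> receives no arrows from any shift of a
    compact object.\<close>
  have Cz: "is_zero T C"
  proof -
    obtain S where S: "S \<subseteq> Tc" "(\<forall>s\<in>S. \<forall>n. Hom T (sh n s) C = {zer (sh n s) C}) \<longrightarrow> is_zero T C"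
      using cg oC(3) unfolding compactly_generated_def by blast
    then show ?thesis using C0[OF compact_shift] unfolding hz_def by blast
  qed
  have "\<forall>j. \<exists>B b c. triangle T (K j) (K (Suc j)) B (t j) b c" using triangle_exists[OF s(5)] by blast
  then obtain B b c where B: "\<And>j. triangle T (K j) (K (Suc j)) (B j) (t j) (b j) (c j)" by metis
  \<comment> \<open>By the octahedral axiom \<open>B j\<close> is a desuspended cone of
    \<open>Z j \<rightarrow> Z (Suc j)\<close>. The bound \<open>- j\<close> becomes
    \<open>- j + 1\<close> for the suspension of \<open>Z j\<close> and \<open>- j + 2\<close> after
    desuspending; \<open>van_compact_Q\<close> and \<open>compact_RR\<close> then cost
    \<open>int A\<close> each.\<close>
  have BR: "B j \<in> RR (int j - 1 - 2 * int A)" for j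
  proof -
    have "triangle T (K j) F' (Z j) (\<psi> (Suc j) \<cdot> t j) (g j) (h j)" using s(3)[of j] s(6) by simp
    then obtain x y where "triangle T (B j) (Z j) (Z (Suc j)) x y (susp_arr T (b j) \<cdot> h (Suc j))"
      using octahedral[OF B[of j] s(3)[of "Suc j"]] by blast
    note r = rotate[OF rotate[OF this]]
    have "van {- int j + 1..} (susp T (Z j))" using van_shift_up(1)[OF s(4)] .
    moreover have "van {- int j + 1..} (Z (Suc j))" by (intro van_mono[OF s(4)]) auto
    ultimately have "van {- int j + 1..} (susp T (B j))" using van_ext[OF r] by blast
    then have "van {- int j + 2..} (sh (- 1) (susp T (B j)))" using van_shift_up(2) by fastforce
    then have v: "van {- int j + 2..} (B j)" using shift_inverse(1)[of "B j" 1] triangle_obj[OF B[of j]] by simp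
    have "susp T (K j) \<in> Tc" using compact_shift[OF s(1), of 1] by simp
    then have Bc: "B j \<in> Tc" using compact_ext[OF rotate[OF B] s(1)] by blast
    have "1 - int A - (- int j + 2) - int A = int j - 1 - 2 * int A" by simp
    then show ?thesis using compact_RR[OF Bc van_compact_Q[OF Bc v]] by (simp only:)
  qed
  have F2C: "F2 \<in> compact_closure \<kappa> T RR"
    unfolding closure_iff
  proof
    fix n
    \<comment> \<open>From this stage on all cones \<open>B j\<close> lie in
      \<open>RR n\<close>.\<close>
    define k where "k = nat (n + 1 + 2 * int A)"
    obtain D d e where D: "triangle T (K k) F2 D (v k) d e" using triangle_exists[OF v(1)] by blast
    have "hz D w" if w: "van {..- n} w" for w
    proof (rule hocolim_cone_orth[OF hc s(5) B _ D])
      fix j assume "j \<ge> k"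
      then have "n \<le> int j - 1 - 2 * int A" unfolding k_def by linarith
      then have "B j \<in> RR n" using subsetD[OF metric_like_dec[OF RR_metric] BR] by blast
      then show "hz (B j) w" using w by (simp add: RR_iff)
    qed
    then have "D \<in> RR n" using triangle_obj[OF D] by (simp add: RR_iff)
    then show "F2 \<in> extensions T Tc (RR n)" using extensionsI[OF D s(1)] by blast
  qed
  have "F' \<in> compact_closure \<kappa> T RR"
    using closure_ext[OF RR_metric C F2C closure_compact[OF RR_metric compact_zero[OF Cz]]] .
  \<comment> \<open>All \<open>K k\<close> lie in the layer \<open>l0 - 1 - int A\<close>; one more
    layer is lost on their suspensions, which enter through the derived limit.\<close>
  moreover have "F2 \<in> RR (l0 - 1 - int A - 1)"
  proof -
    have "hz F2 w" if w: "van {..- (l0 - 1 - int A - 1)} w" for w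
    proof (rule hocolim_orth[OF hc oC(1)])
      fix k
      have "K k \<in> RR (l0 - 1 - int A - 1 + 1)" using compact_RR[OF s(1,2), of k] by (simp add: algebra_simps)
      then show "hz (K k) w" "hz (susp T (K k)) w" using RR_shift[of "K k" "l0 - 1 - int A - 1"] w by (simp_all add: RR_iff)
    qed (rule s(5))
    then show ?thesis using oC(1) by (simp add: RR_iff)
  qed
  then have "F' \<in> RR (l0 - 1 - int A - 1)" using RR_ext[OF C] metric_likeD(2)[OF RR_metric Cz] by blast
  ultimately show ?thesis by blast
qed

end

text \<open>\<open>F \<oplus> \<Sigma>F\<close> lies in the closure, that is, the zero arrow from \<open>F\<close> to \<open>\<Sigma>\<^sup>2F\<close> has a cone in the closure. The
  octahedral axiom replaces \<open>\<Sigma>\<^sup>2F\<close> by any even shift of \<open>F\<close>, and by condition (0) of quasiapproximability one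
  of these lies arbitrarily deep in the metric.\<close>

definition zero_cone where
  "zero_cone X Y \<longleftrightarrow> (\<exists>B\<in>compact_closure \<kappa> T RR. \<exists>b c. triangle T X Y B (zer X Y) b c)"

text \<open>A composite of zero arrows is zero, and the octahedral axiom makes its cone an extension
  of the two given cones.\<close>

lemma zero_cone_trans:
  assumes "zero_cone X Y" "zero_cone Y Z"
  shows "zero_cone X Z"
proof -
  obtain B b c where B: "B \<in> compact_closure \<kappa> T RR" "triangle T X Y B (zer X Y) b c" using assms(1) unfolding zero_cone_def by blast
  obtain B' b' c' where B': "B' \<in> compact_closure \<kappa> T RR" "triangle T Y Z B' (zer Y Z) b' c'" using assms(2) unfolding zero_cone_def by blast
  have e: "zer Y Z \<cdot> zer X Y = zer X Z" using comp_zer_left[OF triangle_obj(2)[OF B'(2)] triangle_Hom(1)[OF B(2)]] .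
  obtain W w w' where W: "triangle T X Z W (zer Y Z \<cdot> zer X Y) w w'"
    using triangle_exists[OF comp_closed[OF triangle_Hom(1)[OF B(2)] triangle_Hom(1)[OF B'(2)]]] by blast
  obtain x y where "triangle T B W B' x y (susp_arr T b \<cdot> c')" using octahedral[OF B(2) B'(2) W] by blast
  then have "W \<in> compact_closure \<kappa> T RR" using closure_ext[OF RR_metric _ B(1) B'(1)] by blast
  then show ?thesis using W e unfolding zero_cone_def by auto
qed

lemma zero_cone_shift:
  assumes "zero_cone X Y"
  shows "zero_cone (sh n X) (sh n Y)"
proof -
  obtain B b c where B: "B \<in> compact_closure \<kappa> T RR" "triangle T X Y B (zer X Y) b c" using assms unfolding zero_cone_def by blast
  obtain c' where "triangle T (sh n X) (sh n Y) (sh n B) (sha n (zer X Y)) (sha n b) c'" using triangle_shift[OF B(2)] by blast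
  then show ?thesis using closure_shift[OF RR_metric B(1)] shift_zer[OF triangle_obj(1,2)[OF B(2)]] unfolding zero_cone_def by auto
qed

lemma F_closure: "F \<in> compact_closure \<kappa> T RR"
proof -
  have P: "sh (- 1) F \<in> obj T" "susp T (sh (- 1) F) = F" using shift_obj[OF F_obj] shift_succ[OF F_obj, of "- 1"] by simp_all
  note z0 = zer_Hom[OF P(1) susp_obj[OF F_obj]]
  \<comment> \<open>A cone of the zero arrow from \<open>\<Sigma>\<^sup>-\<^sup>1F\<close> to
    \<open>\<Sigma>F\<close>; after one rotation it is \<open>F'\<close> with zero connecting
    arrow.\<close>
  obtain F' \<alpha> \<beta> where t: "triangle T (sh (- 1) F) (susp T F) F' (zer (sh (- 1) F) (susp T F)) \<alpha> \<beta>"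
    using triangle_exists[OF z0] by blast
  have "neg (susp_arr T (zer (sh (- 1) F) (susp T F))) = zer F (susp T (susp T F))"
    using susp_zer[OF P(1) susp_obj[OF F_obj]] P(2) neg_zer[OF F_obj susp_obj[OF susp_obj[OF F_obj]]] by simp
  then have F': "triangle T (susp T F) F' F \<alpha> \<beta> (zer F (susp T (susp T F)))" using rotate[OF t] P(2) by simp
  note HF = triangle_Hom[OF F'] and oF = triangle_obj[OF F']
  obtain l where l: "F' \<in> RR l" and F'C: "F' \<in> compact_closure \<kappa> T RR" using zero_cone_closure[OF F'] by blast
  have "zer F (susp T (susp T F)) \<cdot> ide T F = zer F (susp T (susp T F))" using comp_ide[OF HF(3)] by simp
  then obtain \<sigma> where "\<sigma> \<in> Hom T F F'" "\<beta> \<cdot> \<sigma> = ide T F" using exact_cov2[OF F' ide[OF F_obj]] by blast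
  then have "retract F F'" using HF(2) unfolding retract_def by blast
  then have Fl: "F \<in> RR l" using RR_retract l by blast
  have s2: "sh 2 F = susp T (susp T F)" using shift_succ[OF F_obj, of 1] by simp
  \<comment> \<open>Two more rotations exhibit \<open>\<Sigma>F'\<close> as the cone of the zero
    arrow from \<open>F\<close> to \<open>\<Sigma>\<^sup>2F\<close>.\<close>
  have z2: "zero_cone F (sh 2 F)"
    unfolding zero_cone_def s2 using rotate[OF rotate[OF F']] closure_shift1(1)[OF RR_metric F'C] by blast
  have step: "zero_cone (sh a F) (sh (a + 2) F)" for a
    using zero_cone_shift[OF z2, of a] shift_add[OF F_obj, of a 2] by simp
  have zc: "zero_cone (sh a F) (sh (a + 2 * (1 + int r)) F)" for a r
  proof (induction r)
    case 0 then show ?case using step[of a] by simp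
  next
    case (Suc r)
    have "a + 2 * (1 + int r) + 2 = a + 2 * (1 + int (Suc r))" by simp
    then show ?case using zero_cone_trans[OF Suc step] by (simp only:)
  qed
  have comp: "X \<in> extensions T Tc (RR n)" if "triangle T B X D f g h" "B \<in> compact_closure \<kappa> T RR" "D \<in> RR n" for B X D f g h n
  proof -
    have "B \<in> extensions T Tc (RR n)" using that(2) unfolding closure_iff by blast
    then have "X \<in> extensions T (extensions T Tc (RR n)) (RR n)" using extensionsI[OF that(1)] that(3) by blast
    then have "X \<in> extensions T Tc (extensions T (RR n) (RR n))" by (rule extensions_assoc1)
    then show ?thesis using extensions_mono[OF subset_refl metric_likeD(3)[OF RR_metric]] by blast
  qed
  show ?thesis unfolding closure_iff
  proof
    fix n
    \<comment> \<open>One of the four extra layers is spent on making the shift even; the others are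
      a reserve for the suspensions and desuspensions below.\<close>
    obtain s where s: "sh s F \<in> RR (n + 4)" using RR_shift_deep[of l "n + 4"] Fl by blast
    define e where "e = (if even s then s else s + 1)"
    have e: "even e" unfolding e_def by simp
    have eR: "sh e F \<in> RR (n + 3)"
      using RR_shift(1,2)[of "sh s F" "n + 3"] s shift_succ[OF F_obj, of s] unfolding e_def by (auto simp: add.commute)
    consider "e = 0" | "e > 0" | "e < 0" by linarith
    then show "F \<in> extensions T Tc (RR n)"
    proof cases
      case 1
      obtain O' where O': "is_zero T O'" using zero_object by blast
      have "F \<in> RR n" using eR metric_like_dec[OF RR_metric, of n "n + 3"] 1 by auto
      then show ?thesis using extensionsI[OF triangle_zero_left[OF O' F_obj] compact_zero[OF O']] by blast
    next
      case 2
      \<comment> \<open>\<open>\<Sigma>F\<close> sits in a triangle between the cone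
        \<open>B\<close> and the deep object \<open>\<Sigma>\<^sup>e\<^sup>+\<^sup>1F\<close>; the
        approximation so obtained is desuspended at the end.\<close>
      define r where "r = nat (e div 2 - 1)"
      have "0 + 2 * (1 + int r) = e" using e 2 unfolding r_def by (auto elim!: evenE)
      then have "zero_cone F (sh e F)" using zc[of 0 r] by simp
      then obtain B b c where B: "B \<in> compact_closure \<kappa> T RR" "triangle T F (sh e F) B (zer F (sh e F)) b c" unfolding zero_cone_def by blast
      have "susp T (sh e F) \<in> RR (n + 1)" using RR_shift(2)[of "sh e F" "n + 2"] eR RR_shift(1)[of "susp T (sh e F)" "n + 1"] by (simp add: add.assoc)
      then have "susp T F \<in> extensions T Tc (RR (n + 1))" using comp[OF rotate[OF rotate[OF B(2)]] B(1)] by blast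
      then have "sh (- 1) (susp T F) \<in> extensions T (sh (- 1) ` Tc) (sh (- 1) ` RR (n + 1))" by (rule extensions_shift)
      moreover have "sh (- 1) ` Tc \<subseteq> Tc" "sh (- 1) ` RR (n + 1) \<subseteq> RR n" using compact_shift RR_shift(3) by blast+
      ultimately have "sh (- 1) (susp T F) \<in> extensions T Tc (RR n)" by (rule subsetD[OF extensions_mono, rotated 2])
      then show ?thesis using shift_inverse(1)[OF F_obj, of 1] by simp
    next
      case 3
      define r where "r = nat (- e div 2 - 1)"
      have "e + 2 * (1 + int r) = 0" using e 3 unfolding r_def by (auto elim!: evenE)
      then have "zero_cone (sh e F) F" using zc[of e r] by simp
      then obtain B b c where B: "B \<in> compact_closure \<kappa> T RR" "triangle T (sh e F) F B (zer (sh e F) F) b c" unfolding zero_cone_def by blast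
      have eo: "sh e F \<in> obj T" using shift_obj[OF F_obj] .
      have "ide T F \<cdot> zer (sh e F) F = zer (sh e F) F" using comp_ide[OF triangle_Hom(1)[OF B(2)]] by simp
      then obtain p where p: "p \<in> Hom T B F" "p \<cdot> b = ide T F" using exact_contra[OF B(2) ide[OF F_obj]] by blast
      \<comment> \<open>Here \<open>F\<close> is a retract of \<open>B\<close>. The octahedral axiom
        for \<open>p \<cdot> b = 1\<close> identifies the other part: up to isomorphism
        \<open>\<Sigma>W\<close> is \<open>\<Sigma>\<^sup>e\<^sup>+\<^sup>2F\<close>, which is
        deep.\<close>
      obtain W w w' where W: "triangle T W B F w p w'" using triangle_fiber[OF p(1)] by blast
      obtain O' where O': "is_zero T O'" using zero_object by blast
      have "triangle T F F O' (p \<cdot> b) (zer F O') (zer O' (susp T F))" using triangle_ide[OF F_obj O'] p(2) by simp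
      then obtain x y z where xyz: "triangle T (susp T (sh e F)) O' (susp T W) x y z"
        using octahedral[OF rotate[OF B(2)] rotate[OF W]] by blast
      have "susp T (susp T (sh e F)) \<in> RR (n + 1)"
        using RR_shift(2)[of "sh e F" "n + 2"] eR RR_shift(2)[of "susp T (sh e F)" "n + 1"] by (simp add: add.assoc)
      then have "susp T (susp T (sh e F)) \<in> RR n" using RR_shift(1) by blast
      then have "susp T W \<in> RR n" using RR_ext[OF rotate[OF xyz]] metric_likeD(2)[OF RR_metric O'] by blast
      then show ?thesis using comp[OF rotate[OF W] B(1)] by blast
    qed
  qed
qed

end

section \<open>The restricted Yoneda functor\<close>

lemma exact_at_transfer:
  assumes e: "exact_at K f L g M" and f: "f \<in> carrier K \<rightarrow> carrier L" and g: "g \<in> carrier L \<rightarrow> carrier M"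
    and z: "\<zero>\<^bsub>M\<^esub> \<in> carrier M" "c \<zero>\<^bsub>M\<^esub> = \<zero>\<^bsub>M'\<^esub>"
    and a: "bij_betw a (carrier K) (carrier K')" and b: "bij_betw b (carrier L) (carrier L')"
    and c: "bij_betw c (carrier M) (carrier M')"
    and bf: "\<And>x. x \<in> carrier K \<Longrightarrow> b (f x) = f' (a x)" and cg: "\<And>x. x \<in> carrier L \<Longrightarrow> c (g x) = g' (b x)"
  shows "exact_at K' f' L' g' M'"
proof -
  have 1: "g' (b x) = \<zero>\<^bsub>M'\<^esub> \<longleftrightarrow> g x = \<zero>\<^bsub>M\<^esub>" if "x \<in> carrier L" for x
    using cg[OF that] z inj_on_eq_iff[OF bij_betw_imp_inj_on[OF c]] funcset_mem[OF g that] by metis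
  have "f' ` carrier K' = f' ` a ` carrier K" using a by (simp add: bij_betw_def)
  also have "\<dots> = b ` f ` carrier K" using bf by (force simp: image_iff)
  also have "\<dots> = b ` {x \<in> carrier L. g x = \<zero>\<^bsub>M\<^esub>}" using e by (simp add: exact_at_def)
  also have "\<dots> = {x \<in> b ` carrier L. g' x = \<zero>\<^bsub>M'\<^esub>}" using 1 by auto
  finally show ?thesis using b by (simp add: exact_at_def bij_betw_def)
qed

lemma (in cohomological) nat_isomorphic_cohomological:
  assumes K: "linear_functor R T U K" and iso: "nat_isomorphic R T U H K"
  shows "cohomological_functor R T U K"
  unfolding cohomological_functor_def
proof (intro conjI ballI allI impI)
  obtain \<alpha> where \<alpha>: "\<alpha> \<in> nat_transformations R T U H K"
    and bij: "\<And>X. X \<in> U \<Longrightarrow> bij_betw (\<alpha> X) (HH X) (carrier (on_obj K X))"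
    using iso unfolding nat_isomorphic_def by blast
  have lin: "\<alpha> X \<in> linear_maps R (on_obj H X) (on_obj K X)" if "X \<in> U" for X
    using \<alpha> that by (auto simp: nat_transformations_def)
  have nat: "\<alpha> X (on_arr H f y) = on_arr K f (\<alpha> Y y)" if "X \<in> U" "Y \<in> U" "f \<in> Hom T X Y" "y \<in> HH Y" for X Y f y
    using \<alpha> that by (auto simp: nat_transformations_def)
  have z: "Hz X \<in> HH X" if "X \<in> U" for X
  proof -
    interpret M: module R "on_obj H X" using H_module that .
    show ?thesis by simp
  qed
  have ex: "exact_at (on_obj K C) (on_arr K q) (on_obj K B) (on_arr K p) (on_obj K A)"
    if "exact_at (on_obj H C) (on_arr H q) (on_obj H B) (on_arr H p) (on_obj H A)"
      and o: "A \<in> U" "B \<in> U" "C \<in> U" and pq: "p \<in> Hom T A B" "q \<in> Hom T B C" for A B C p q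
  proof (rule exact_at_transfer[OF that(1) _ _ z[OF o(1)] _ bij[OF o(3)] bij[OF o(2)] bij[OF o(1)]])
    show "on_arr H q \<in> HH C \<rightarrow> HH B" "on_arr H p \<in> HH B \<rightarrow> HH A" using H_mem o pq by blast+
    show "\<alpha> A (Hz A) = \<zero>\<^bsub>on_obj K A\<^esub>"
      using linear_maps_zero[OF H_module linear_functor.obj_module[OF K] lin] o(1) by blast
  qed (use nat o pq in auto)
  show "linear_functor R T U K" by (rule K)
  fix X Y Z f g h n assume XYZ: "X \<in> U" "Y \<in> U" "Z \<in> U" and t: "triangle T X Y Z f g h"
  note F = triangle_Hom[OF t] and E = coh[unfolded cohomological_functor_def, THEN conjunct2, THEN bspec, OF XYZ(1),
      THEN bspec, OF XYZ(2), THEN bspec, OF XYZ(3), THEN spec, THEN spec, THEN spec, THEN mp, OF t, THEN spec, of n]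
  have X: "X \<in> obj T" using XYZ U_obj by blast
  have "sha n h \<in> Hom T (sh n Z) (sh (n + 1) X)" using shift_Hom[OF F(3), of n] shift_add[OF X, of n 1] by simp
  then show "exact_at (on_obj K (sh (n + 1) X)) (on_arr K (sha n h)) (on_obj K (sh n Z)) (on_arr K (sha n g)) (on_obj K (sh n Y))"
    by (rule ex[OF E[THEN conjunct1] U_shift[OF XYZ(2)] U_shift[OF XYZ(3)] U_shift[OF XYZ(1)] shift_Hom[OF F(2)]])
  show "exact_at (on_obj K (sh n Z)) (on_arr K (sha n g)) (on_obj K (sh n Y)) (on_arr K (sha n f)) (on_obj K (sh n X))"
    by (rule ex[OF E[THEN conjunct2, THEN conjunct1] U_shift[OF XYZ(1)] U_shift[OF XYZ(2)] U_shift[OF XYZ(3)]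
        shift_Hom[OF F(1)] shift_Hom[OF F(2)]])
  have "sha (n - 1) h \<in> Hom T (sh (n - 1) Z) (sh n X)" using shift_Hom[OF F(3), of "n - 1"] shift_add[OF X, of "n - 1" 1] by simp
  then show "exact_at (on_obj K (sh n Y)) (on_arr K (sha n f)) (on_obj K (sh n X)) (on_arr K (sha (n - 1) h)) (on_obj K (sh (n - 1) Z))"
    by (rule ex[OF E[THEN conjunct2, THEN conjunct2] U_shift[OF XYZ(3)] U_shift[OF XYZ(1)] U_shift[OF XYZ(2)] _ shift_Hom[OF F(1)]])
qed

lemma nat_isomorphic_G_finite:
  assumes H: "linear_functor R T (compacts \<kappa> T) H" and K: "linear_functor R T (compacts \<kappa> T) K"
    and iso: "nat_isomorphic R T (compacts \<kappa> T) H K"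
    and G: "\<And>n. \<G> n \<subseteq> compacts \<kappa> T" and fin: "G_finite R \<kappa> T \<G> H"
  shows "G_finite R \<kappa> T \<G> K"
proof -
  obtain \<alpha> where \<alpha>: "\<alpha> \<in> nat_transformations R T (compacts \<kappa> T) H K"
    and bij: "\<And>X. X \<in> compacts \<kappa> T \<Longrightarrow> \<alpha> X ` carrier (on_obj H X) = carrier (on_obj K X)"
    using iso unfolding nat_isomorphic_def bij_betw_def by blast
  have lin: "\<alpha> X \<in> linear_maps R (on_obj H X) (on_obj K X)" if "X \<in> compacts \<kappa> T" for X
    using \<alpha> that by (auto simp: nat_transformations_def)
  obtain N where N: "\<And>i X. \<bar>i\<bar> \<ge> N \<Longrightarrow> X \<in> \<G> i \<Longrightarrow> carrier (on_obj H X) = {\<zero>\<^bsub>on_obj H X\<^esub>}"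
    using fin unfolding G_finite_def by blast
  have "carrier (on_obj K X) = {\<zero>\<^bsub>on_obj K X\<^esub>}" if i: "\<bar>i\<bar> \<ge> N" "X \<in> \<G> i" for i X
  proof -
    have X: "X \<in> compacts \<kappa> T" using i(2) G by blast
    have "\<alpha> X \<zero>\<^bsub>on_obj H X\<^esub> = \<zero>\<^bsub>on_obj K X\<^esub>"
      by (rule linear_maps_zero[OF linear_functor.obj_module[OF H X] linear_functor.obj_module[OF K X] lin[OF X]])
    then show ?thesis using bij[OF X] N[OF i] by simp
  qed
  moreover have "finitely_generated R (on_obj K X)" if X: "X \<in> compacts \<kappa> T" for X
    using finitely_generated_surj[OF linear_functor.obj_module[OF H X] linear_functor.obj_module[OF K X] lin[OF X] bij[OF X]]
      fin X unfolding G_finite_def by blast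
  ultimately show ?thesis unfolding G_finite_def by blast
qed

context generated
begin

lemma bounded_iff: "F \<in> bounded_closure \<kappa> T \<G> \<longleftrightarrow> F \<in> compact_closure \<kappa> T RR \<and> (\<exists>n. van {..- n} F)"
  unfolding bounded_closure_def right_orth_M by blast

lemma closure_triangle:
  assumes "F \<in> compact_closure \<kappa> T W"
  obtains K D f g h where "triangle T K F D f g h" "K \<in> Tc" "D \<in> W n"
  using assms unfolding closure_iff extensions_def by blast

lemma bounded_obj: "F \<in> bounded_closure \<kappa> T \<G> \<Longrightarrow> F \<in> obj T"
  using bounded_iff van_obj by blast

text \<open>The difference of the two arrows factors through \<open>D\<close>, which has no arrows
  to \<open>F'\<close>.\<close>

lemma agree_on_compact:
  assumes t: "triangle T K F D k g h" and D: "D \<in> RR n" and v: "van {..- n} F'"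
    and f: "f \<in> Hom T F F'" "f' \<in> Hom T F F'" "f \<cdot> k = f' \<cdot> k"
  shows "f = f'"
proof -
  note H = triangle_Hom[OF t]
  have fk: "f \<cdot> k \<in> Hom T K F'" using comp_closed[OF H(1) f(1)] .
  have "(f \<boxminus> f') \<cdot> k = f \<cdot> k \<boxminus> f' \<cdot> k" using comp_sub_left H(1) f(1,2) by blast
  also have "\<dots> = zer K F'" using sub_eq_zer_iff[OF fk fk] f(3) by simp
  finally obtain x where x: "x \<in> Hom T D F'" "x \<cdot> g = f \<boxminus> f'" using exact_contra[OF t sub_Hom[OF f(1,2)]] by blast
  have "hz D F'" using D v by (simp add: RR_iff)
  then have "x = zer D F'" using hzD x(1) by blast
  then have "f \<boxminus> f' = zer F F'" using x(2) comp_zer_left[OF van_obj[OF v] H(2)] by simp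
  then show ?thesis using sub_eq_zer_iff[OF f(1,2)] by simp
qed

end

section \<open>Finiteness, full faithfulness and the essential image\<close>

context quasi
begin

text \<open>Arrows from \<open>P\<close> lift to a compact approximation of \<open>F\<close> whose
  remainder is invisible to \<open>P\<close>. In low degrees the vanishing is boundedness; in high
  degrees it holds for the compact part and for the remainder, since both lie in layers of
  \<open>Q\<close>.\<close>

lemma bounded_G_finite:
  assumes F: "F \<in> bounded_closure \<kappa> T \<G>"
  shows "G_finite R \<kappa> T \<G> (yoneda T F)"
proof -
  obtain n where n: "van {..- n} F" and Fc: "F \<in> compact_closure \<kappa> T RR" using F bounded_iff by blast
  have Fo: "F \<in> obj T" using bounded_obj[OF F] .
  have "finitely_generated R (Hom_mod T P F)" if P: "P \<in> Tc" for P
  proof -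
    have Po: "P \<in> obj T" using compact_obj[OF P] .
    obtain m where m: "\<And>Y. Y \<in> RR m \<Longrightarrow> hz P Y" using metric_likeD(7)[OF RR_metric P] by blast
    obtain K D f g h where t: "triangle T K F D f g h" "K \<in> Tc" "D \<in> RR m" using closure_triangle[OF Fc] by blast
    note H = triangle_Hom[OF t(1)]
    have "(\<lambda>x. f \<cdot> x) ` Hom T P K = Hom T P F"
    proof (intro equalityI subsetI)
      fix x assume x: "x \<in> Hom T P F"
      have "g \<cdot> x = zer P D" using hzD[OF m[OF t(3)] comp_closed[OF x H(2)]] .
      then show "x \<in> (\<lambda>x. f \<cdot> x) ` Hom T P K" using exact_cov[OF t(1) x] by blast
    qed (use comp_closed[OF _ H(1)] in blast)
    then show ?thesis
      using finitely_generated_surj[OF Hom_module[OF Po] Hom_module[OF Po Fo] post_linear[OF Po H(1)]]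
        compact_obj[OF t(2)] fg_Hom[OF P t(2)] by simp
  qed
  moreover have "\<exists>N. \<forall>i. \<bar>i\<bar> \<ge> N \<longrightarrow> (\<forall>X\<in>\<G> i. hz X F)"
  proof -
    obtain K D f g h where t: "triangle T K F D f g h" "K \<in> Tc" "D \<in> RR (0 + int A)" using closure_triangle[OF Fc] by blast
    have D: "D \<in> Q 0" using RR_Q t(3) by blast
    obtain l where l: "K \<in> Q l" using compact_in_Q[OF t(2)] by blast
    define N where "N = \<bar>n\<bar> + \<bar>l\<bar> + int A"
    have "van {N..} D" "van {N..} K" using van_mono[OF Q_van[OF D]] van_mono[OF Q_van[OF l]] unfolding N_def by simp_all
    then have v: "van {N..} F" using van_ext[OF t(1)] by blast
    have "hz X F" if "\<bar>i\<bar> \<ge> N" "X \<in> \<G> i" for i X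
    proof (cases "i \<ge> 0")
      case True
      then show ?thesis using v that unfolding van_def by auto
    next
      case False
      then have "i \<le> - n" using that(1) unfolding N_def by linarith
      then show ?thesis using n that(2) unfolding van_def by auto
    qed
    then show ?thesis by blast
  qed
  ultimately show ?thesis unfolding G_finite_def by (simp add: hz_def)
qed

lemma yoneda_arr_nat:
  assumes f: "f \<in> Hom T F F'"
  shows "yoneda_arr T Tc f \<in> nat_transformations R T Tc (yoneda T F) (yoneda T F')"
proof -
  have s: "src T f = F" using f by (simp add: Hom_def)
  have "(\<lambda>g\<in>Hom T X F. f \<cdot> g) \<in> linear_maps R (Hom_mod T X F) (Hom_mod T X F')" if X: "X \<in> Tc" for X
  proof -
    have Xo: "X \<in> obj T" using compact_obj[OF X] .
    interpret M: module R "Hom_mod T X F" using Hom_module[OF Xo] Hom_obj[OF f] by blast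
    show ?thesis using post_linear[OF Xo f] M.add.m_closed M.smult_closed by (auto simp: linear_maps_def)
  qed
  moreover have "g \<cdot> p \<in> Hom T X F \<and> f \<cdot> (g \<cdot> p) = (f \<cdot> g) \<cdot> p" if "p \<in> Hom T X Y" "g \<in> Hom T Y F" for X Y p g
    using comp_closed[OF that] comp_assoc[OF that f] by simp
  ultimately show ?thesis unfolding nat_transformations_def yoneda_arr_def s by (auto simp: PiE_def)
qed

lemma fully_faithful: "yoneda_fully_faithful R T Tc (bounded_closure \<kappa> T \<G>)"
  unfolding yoneda_fully_faithful_def
proof (intro ballI)
  fix F F' assume F: "F \<in> bounded_closure \<kappa> T \<G>" and F': "F' \<in> bounded_closure \<kappa> T \<G>"
  obtain n where n: "van {..- n} F'" using F' bounded_iff by blast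
  have Fc: "F \<in> compact_closure \<kappa> T RR" using F bounded_iff by blast
  show "bij_betw (yoneda_arr T Tc) (Hom T F F') (nat_transformations R T Tc (yoneda T F) (yoneda T F'))"
    unfolding bij_betw_def
  proof (intro conjI inj_onI equalityI subsetI)
    fix f f' assume f: "f \<in> Hom T F F'" "f' \<in> Hom T F F'" and e: "yoneda_arr T Tc f = yoneda_arr T Tc f'"
    obtain K D k g h where t: "triangle T K F D k g h" "K \<in> Tc" "D \<in> RR n" using closure_triangle[OF Fc] by blast
    have s: "src T f = F" "src T f' = F" using f by (simp_all add: Hom_def)
    have "yoneda_arr T Tc f K k = yoneda_arr T Tc f' K k" by (simp only: e)
    then have "f \<cdot> k = f' \<cdot> k" using s t(2) triangle_Hom(1)[OF t(1)] by (simp add: yoneda_arr_def)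
    then show "f = f'" by (rule agree_on_compact[OF t(1,3) n f])
  next
    fix \<phi> assume "\<phi> \<in> yoneda_arr T Tc ` Hom T F F'"
    then show "\<phi> \<in> nat_transformations R T Tc (yoneda T F) (yoneda T F')" using yoneda_arr_nat by blast
  next
    fix \<phi> assume \<phi>: "\<phi> \<in> nat_transformations R T Tc (yoneda T F) (yoneda T F')"
    have \<phi>P: "\<phi> \<in> extensional Tc" using \<phi> by (auto simp: nat_transformations_def PiE_def)
    have \<phi>m: "\<phi> X \<in> linear_maps R (Hom_mod T X F) (Hom_mod T X F') \<inter> extensional (Hom T X F)" if "X \<in> Tc" for X
      using \<phi> that by (auto simp: nat_transformations_def)
    have \<phi>1: "\<phi> X x \<in> Hom T X F'" if "X \<in> Tc" "x \<in> Hom T X F" for X x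
      using \<phi>m[OF that(1)] that(2) by (auto simp: linear_maps_def)
    have \<phi>2: "\<phi> X (y \<cdot> f) = \<phi> Y y \<cdot> f" if "X \<in> Tc" "Y \<in> Tc" "f \<in> Hom T X Y" "y \<in> Hom T Y F" for X Y f y
      using \<phi> that by (auto simp: nat_transformations_def)
    \<comment> \<open>The layer is \<open>n + 1\<close> because the obstruction lies in
      \<open>Hom(D, \<Sigma>F')\<close>, and suspension moves the bound of \<open>F'\<close> by
      one.\<close>
    have extend: "\<exists>f\<in>Hom T F F'. f \<cdot> k = \<phi> K k" if t: "triangle T K F D k g h" "K \<in> Tc" "D \<in> RR (n + 1)" for K D k g h
    proof -
      note H = triangle_Hom[OF t(1)]
      note x = \<phi>1[OF t(2) H(1)]
      have "van {..- (n + 1)} (susp T F')" by (rule van_mono[OF van_shift_down(1)[OF n]]) simp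
      then have "hz D (susp T F')" using t(3) by (simp add: RR_iff)
      then have "susp_arr T (\<phi> K k) \<cdot> h = zer D (susp T F')" by (rule hzD[OF _ comp_closed[OF H(3) susp_Hom[OF x]]])
      then show ?thesis by (rule exact_contra0[OF t(1) x])
    qed
    obtain K D k g h where t: "triangle T K F D k g h" "K \<in> Tc" "D \<in> RR (n + 1)" using closure_triangle[OF Fc] by blast
    note k = triangle_Hom(1)[OF t(1)]
    obtain f where f: "f \<in> Hom T F F'" "f \<cdot> k = \<phi> K k" using extend[OF t] by blast
    have Dn: "D \<in> RR n" using RR_shift(1)[OF t(3)] .
    have val: "f \<cdot> p = \<phi> P p" if P: "P \<in> Tc" and p: "p \<in> Hom T P F" for P p
    proof -
      \<comment> \<open>A finer approximation \<open>K'\<close> is taken, through which both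
        \<open>p\<close> and \<open>k\<close> factor. The arrow that extends
        \<open>\<phi> K' k'\<close> agrees with \<open>f\<close> on \<open>K\<close>, hence equals
        \<open>f\<close>.\<close>
      obtain m1 where m1: "\<And>Y. Y \<in> RR m1 \<Longrightarrow> hz P Y" using metric_likeD(7)[OF RR_metric P] by blast
      obtain m2 where m2: "m2 \<ge> n + 1" "\<And>Y. Y \<in> RR m2 \<Longrightarrow> hz K Y" using metric_like_orth[OF RR_metric t(2)] by blast
      define m where "m = max m1 m2"
      obtain K' D' k' g' h' where t': "triangle T K' F D' k' g' h'" "K' \<in> Tc" "D' \<in> RR m" using closure_triangle[OF Fc] by blast
      have D': "D' \<in> RR m1" "D' \<in> RR m2" "D' \<in> RR (n + 1)"
        using subsetD[OF metric_like_dec[OF RR_metric] t'(3)] m2(1) unfolding m_def by simp_all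
      note H' = triangle_Hom[OF t'(1)]
      have "g' \<cdot> p = zer P D'" using hzD[OF m1[OF D'(1)] comp_closed[OF p H'(2)]] .
      then obtain p' where p': "p' \<in> Hom T P K'" "k' \<cdot> p' = p" using exact_cov[OF t'(1) p] by blast
      have "g' \<cdot> k = zer K D'" using hzD[OF m2(2)[OF D'(2)] comp_closed[OF k H'(2)]] .
      then obtain c where c: "c \<in> Hom T K K'" "k' \<cdot> c = k" using exact_cov[OF t'(1) k] by blast
      obtain f' where f': "f' \<in> Hom T F F'" "f' \<cdot> k' = \<phi> K' k'" using extend[OF t'(1,2) D'(3)] by blast
      have "f' \<cdot> k = \<phi> K k" using comp_assoc[OF c(1) H'(1) f'(1)] c(2) f'(2) \<phi>2[OF t(2) t'(2) c(1) H'(1)] by simp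
      then have "f' = f" using agree_on_compact[OF t(1) Dn n f'(1) f(1)] f(2) by simp
      then show ?thesis using comp_assoc[OF p'(1) H'(1) f'(1)] p'(2) f'(2) \<phi>2[OF P t'(2) p'(1) H'(1)] by simp
    qed
    have s: "src T f = F" using f(1) by (simp add: Hom_def)
    have "\<phi> = yoneda_arr T Tc f"
    proof (rule extensionalityI[OF \<phi>P])
      show "yoneda_arr T Tc f \<in> extensional Tc" by (simp add: yoneda_arr_def)
      fix P assume P: "P \<in> Tc"
      have "\<phi> P = (\<lambda>g\<in>Hom T P F. f \<cdot> g)"
        by (rule extensionalityI[of _ "Hom T P F"]) (use \<phi>m[OF P] val[OF P] in auto)
      then show "\<phi> P = yoneda_arr T Tc f P" using P s by (simp add: yoneda_arr_def)
    qed
    then show "\<phi> \<in> yoneda_arr T Tc ` Hom T F F'" using f(1) by blast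
  qed
qed

lemma finite_represented:
  fixes H :: "('o, 'm, 'r, 'x) mod_functor"
  assumes coh: "cohomological_functor R T Tc H" and fin: "G_finite R \<kappa> T \<G> H"
  shows "\<exists>F\<in>bounded_closure \<kappa> T \<G>. nat_isomorphic R T Tc (yoneda T F) H"
proof -
  interpret FF: finite_functor R T \<kappa> \<G> H
    using coh fin Tc_obj compact_shift by unfold_locales (auto simp: G_finite_def)
  obtain L \<tau> y where tw: "tower R T Tc H L \<tau> y"
    and w1: "\<And>n Z x. Z \<in> FF.window n \<Longrightarrow> x \<in> FF.HH Z \<Longrightarrow> \<exists>g\<in>Hom T Z (L (Suc n)). on_arr H g (y (Suc n)) = x"
    and w2: "\<And>n Z g. Z \<in> FF.window n \<Longrightarrow> g \<in> Hom T Z (L n) \<Longrightarrow> on_arr H g (y n) = FF.Hz Z \<Longrightarrow> \<tau> n \<cdot> g = zer Z (L (Suc n))"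
    using FF.tower_exists by metis
  interpret TW: tower R T Tc H L \<tau> y by (rule tw)
  obtain F u where hoc: "hocolim \<kappa> L \<tau> F u" using hocolim_exists[where \<tau> = \<tau>, OF kappa small_coproducts TW.\<tau>] by blast
  interpret FT: finite_tower R T \<kappa> \<G> H L \<tau> y F u
    by (intro finite_tower.intro finite_tower_axioms.intro FF.finite_functor_axioms tw w1 w2 hoc)
  obtain N where N: "\<And>i X. \<bar>i\<bar> \<ge> N \<Longrightarrow> X \<in> \<G> i \<Longrightarrow> FF.HH X = {FF.Hz X}"
    using fin unfolding G_finite_def by blast
  have V: "hz X F" if i: "\<bar>i\<bar> \<ge> N" "X \<in> \<G> i" for i X
  proof (rule hzI[OF G_obj[OF i(2)] FT.F_obj])
    note X = G_compact[OF i(2)] and z = zer_Hom[OF G_obj[OF i(2)] FT.F_obj]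
    fix f assume f: "f \<in> Hom T X F"
    \<comment> \<open>Both values lie in the zero module \<open>H(X)\<close>.\<close>
    have "FT.val X f = FT.val X (zer X F)" using FT.val_mem[OF X f] FT.val_mem[OF X z] N[OF i] by simp
    then show "f = zer X F" by (rule FT.val_inj[OF X f z])
  qed
  have vanF: "van J F" if "\<And>j. j \<in> J \<Longrightarrow> \<bar>j\<bar> \<ge> N" for J
    using V that FT.F_obj by (auto simp: van_def)
  \<comment> \<open>The same tower, read over \<open>Hom(-, F)\<close> on all objects with the
    cocone \<open>u\<close> as its elements.\<close>
  interpret Y: tower R T "obj T" "yoneda T F" L \<tau> u by (rule FT.yoneda_tower)
  interpret QH: quasi_hocolim R T \<kappa> \<G> Q A F L \<tau> u "\<bar>N\<bar>"
  proof unfold_locales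
    show "hocolim \<kappa> L \<tau> F u" by (rule hoc)
    show "L k \<in> Tc" for k by (rule TW.L_U)
    show "Y.good {P}" if "P \<in> Tc" for P using FT.yoneda_good[OF that] .
    show "van {\<bar>N\<bar>..} F" by (rule vanF) simp
  qed
  have "van {..- \<bar>N\<bar>} F" by (rule vanF) simp
  then have "F \<in> bounded_closure \<kappa> T \<G>" using QH.F_closure bounded_iff by blast
  then show ?thesis using FT.represents by blast
qed

lemma essential_image:
  "(yoneda_essential_image R T Tc (bounded_closure \<kappa> T \<G>) :: ('o, 'm, 'r, 'x) mod_functor set)
    = {H. cohomological_functor R T Tc H \<and> G_finite R \<kappa> T \<G> H}"
proof (intro equalityI subsetI)
  fix H :: "('o, 'm, 'r, 'x) mod_functor"
  assume "H \<in> yoneda_essential_image R T Tc (bounded_closure \<kappa> T \<G>)"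
  then obtain F where F: "F \<in> bounded_closure \<kappa> T \<G>" and i: "nat_isomorphic R T Tc (yoneda T F) H"
    and H: "linear_functor R T Tc H" unfolding yoneda_essential_image_def by blast
  interpret Y: cohomological R T Tc "yoneda T F"
    using yoneda_interpret[OF bounded_obj[OF F] Tc_obj compact_shift] .
  show "H \<in> {H. cohomological_functor R T Tc H \<and> G_finite R \<kappa> T \<G> H}"
    using Y.nat_isomorphic_cohomological[OF H i] nat_isomorphic_G_finite[OF Y.lin H i _ bounded_G_finite[OF F]] G_compact by blast
next
  fix H :: "('o, 'm, 'r, 'x) mod_functor"
  assume H: "H \<in> {H. cohomological_functor R T Tc H \<and> G_finite R \<kappa> T \<G> H}"
  then have "linear_functor R T Tc H" by (simp add: cohomological_functor_def)
  then show "H \<in> yoneda_essential_image R T Tc (bounded_closure \<kappa> T \<G>)"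
    using finite_represented[of H] H unfolding yoneda_essential_image_def by blast
qed

end

theorem theorem6p24:
  fixes \<kappa> :: "'u rel"
    and R :: "('r, 'a) ring_scheme"
    and T :: "('o, 'm, 'r, 'e) tri_category_scheme"
    and \<G> :: "int \<Rightarrow> 'o set"
  assumes "regular_uncountable \<kappa>"
    and "cring R" and "noetherian_ring R"
    and "R_linear_triangulated_category R T"
    and "compactly_generated \<kappa> T"
    and "generating_sequence \<kappa> T \<G>" and "\<forall>n. finite (\<G> n)"
    and "quasiapproximable \<kappa> T \<G>"
    and "\<forall>G \<in> (\<Union>n. \<G> n). \<forall>G' \<in> (\<Union>n. \<G> n). finitely_generated R (Hom_mod T G G')"
  shows "(yoneda_essential_image R T (compacts \<kappa> T) (bounded_closure \<kappa> T \<G>)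
            :: ('o, 'm, 'r, 'x) mod_functor set)
         = {H. cohomological_functor R T (compacts \<kappa> T) H \<and> G_finite R \<kappa> T \<G> H}
       \<and> yoneda_fully_faithful R T (compacts \<kappa> T) (bounded_closure \<kappa> T \<G>)"
proof -
  obtain Q A where QA: "orthogonal_metric T Q \<and> A > 0 \<and>
        (\<forall>i. gen_M T \<G> i \<subseteq> (\<Union>n \<in> {- int A..int A}. shift T n ` gen_M T \<G> (i + 1))) \<and>
        (\<forall>i. gen_M T \<G> (i + int A) \<subseteq> Q i) \<and>
        (\<forall>n i. n + i \<ge> int A \<longrightarrow> (\<forall>X \<in> \<G> n. \<forall>Y \<in> Q i. Hom T X Y = {arr_zero T X Y})) \<and>
        (\<forall>i. \<forall>F \<in> Q i \<inter> compact_closure \<kappa> T Q.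
           \<exists>E D f g h. triangle T E F D f g h \<and>
             D \<in> Q (i + 1) \<inter> compact_closure \<kappa> T Q \<and>
             E \<in> gen_bar \<kappa> T \<G> A {- int A - i..int A - i})"
    using assms(8) unfolding quasiapproximable_def by (elim exE)
  interpret R_linear_triangulated_category R T by (rule assms(4))
  interpret quasi R T \<kappa> \<G> Q A
  proof (intro quasi.intro generated.intro generated_axioms.intro quasi_axioms.intro)
    fix G G' n n' assume "G \<in> \<G> n" "G' \<in> \<G> n'"
    then show "finitely_generated R (Hom_mod T G G')" using assms(9) by blast
  next
    fix n i X Y assume "n + i \<ge> int A" "X \<in> \<G> n" "Y \<in> Q i"
    then show "hz X Y" using QA by (simp add: hz_def)
  next
    fix F i assume "F \<in> Q i \<inter> compact_closure \<kappa> T Q"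
    then show "\<exists>E D f g h. triangle T E F D f g h \<and> D \<in> Q (i + 1) \<inter> compact_closure \<kappa> T Q \<and>
        E \<in> gen_bar \<kappa> T \<G> A {- int A - i..int A - i}"
      using QA[THEN conjunct2, THEN conjunct2, THEN conjunct2, THEN conjunct2, THEN conjunct2, THEN spec, THEN bspec]
      by blast
  qed (use assms(7) in \<open>simp_all add: assms(1-6) QA\<close>)
  show ?thesis using essential_image fully_faithful by blast
qed

end
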